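(* Let $A$ be the preprojective algebra of type $\mathrm{D}_n$ ($n\geq4$) over a field $\mathbb{F}$; put $m=\lfloor\frac{n-2}{2}\rfloor$ and $u=n-m-2$. Up to graded commutativity, the non zero Koszul cup products of elements of the basis of $\mathrm{HK}^\bullet(A)$ described in the context are: - $z_0\smile\overline{f}=\overline{f}$ for all $\overline{f}\in\mathrm{HK}^\bullet(A)$; - $z_{\ell_1}\smile z_{\ell_2}=z_{\ell_1+\ell_2}$ if $\ell_1+\ell_2\leq u-1$, and $z_{\ell_1}\smile z_{\ell_2}=-\pi_0+\pi_1$ if $n$ is even and $\ell_1+\ell_2=m$; - $z_{\ell_1}\smile\overline{\zeta}_{\ell_2}=\overline{\zeta}_{\ell_1+\ell_2}$ if $\ell_1+\ell_2\leq u-1$; - $z_{\ell_1}\smile\overline{\rho}_{\ell_2}=\overline{\rho}_{\ell_1+\ell_2}$ if $\mathrm{char}(\mathbb{F})=2$ and $\ell_1+\ell_2\leq m-1$; - $z_\ell\smile\overline{h}_i=\overline{\gamma}_\ell$ if $\ell\geq1$, $\mathrm{char}(\mathbb{F})=2$ and $i\in\{0,1\}$, and $z_0\smile\overline{h}_i=\overline{h}_i$; - $z_{\ell_1}\smile\overline{\gamma}_{\ell_2}=\overline{\gamma}_{\ell_1+\ell_2}$ if $\mathrm{char}(\mathbb{F})=2$ and $\ell_1+\ell_2\leq m$; - $\pi_i\smile\overline{h}_j=\overline{\gamma}_m$ if $i=j$, $n$ is even and $\mathrm{char}(\mathbb{F})=2$.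
   Context: The algebra. $\overline{Q}$ is the quiver with vertices $0,\ldots,n-1$ and arrows $a_0:0\to2$, $a_1:1\to2$, $a_i:i\to i+1$ for $2\leq i\leq n-2$, together with reversed arrows $a_i^*$; paths are written from right to left. $k=\bigoplus_i\mathbb{F}e_i$, $V=\mathbb{F}\overline{Q}_1$, $k^e=k\otimes_{\mathbb{F}}k$, $A=\mathbb{F}\overline{Q}/(R)$ with $R\subseteq V\otimes_kV$ spanned by $\sigma_0=-a_0^*a_0$, $\sigma_1=-a_1^*a_1$, $\sigma_2=a_0a_0^*+a_1a_1^*-a_2^*a_2$, $\sigma_i=a_{i-1}a_{i-1}^*-a_i^*a_i$ ($3\leq i\leq n-2$), $\sigma_{n-1}=a_{n-2}a_{n-2}^*$. Koszul cohomology. $W_0=k$, $W_1=V$, $W_p=\bigcap_{i+2+j=p}V^{\otimes_k i}\otimes_kR\otimes_kV^{\otimes_k j}$ for $p\geq2$ (so $W_2=R$); elements of $W_p$ are written $x_1\ldots x_p$ (a sum is understood). $\mathrm{HK}^\bullet(A)=H^\bullet(\mathrm{Hom}_{k^e}(W_\bullet,A),b_K)$ with $b_K(f)(x_1\ldots x_{p+1})=f(x_1\ldots x_p)x_{p+1}-(-1)^px_1f(x_2\ldots x_{p+1})$ for $f:W_p\to A$. The Koszul cup product is induced by $(f\smile g)(x_1\ldots x_{p+q})=(-1)^{pq}f(x_1\ldots x_p)g(x_{p+1}\ldots x_{p+q})$. $\mathrm{HK}^0(A)$ is identified with the centre of $A$. $\overline{f}$ denotes the class of a cocycle $f$; a cochain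 takes the value $0$ on arrows or relations where no value is specified. Basis. $\pi_0=-a_0^*a_2^*a_3^*\cdots a_{n-2}^*a_{n-2}\cdots a_3a_2a_0$, $\pi_1=a_1^*a_2^*a_3^*\cdots a_{n-2}^*a_{n-2}\cdots a_3a_2a_1$, $\pi_i=(a_i^*a_i)^{n-i-1}a_{i-1}\cdots a_2a_1a_1^*a_2^*\cdots a_{i-1}^*$ for $2\leq i\leq n-2$, $\pi_{n-1}=a_{n-2}a_{n-3}\cdots a_2a_1a_1^*a_2^*\cdots a_{n-2}^*$. $z_0=1$ and $z_\ell=(a_0^*a_1a_1^*a_0)^\ell+(a_1^*a_0a_0^*a_1)^\ell+\sum_{i=2}^{n-2}(a_i^*a_i)^{2\ell}$ for $\ell>0$. $\zeta_\ell(a_i)=a_iz_\ell$ for all $i$; $\rho_\ell(a_i)=(a_2^*a_2)^{2\ell+1}a_i$ and $\rho_\ell(a_i^* )=a_i^*(a_2^*a_2)^{2\ell+1}$ for $i=0,1$; $h_j(\sigma_i)=\delta_{ij}e_j$; $\gamma_\ell(\sigma_0)=(a_0^*a_1a_1^*a_0)^\ell$. The basis of $\mathrm{HK}^\bullet(A)$ consists of: in degree $0$, $z_\ell$ ($0\leq\ell\leq u-1$) and $\pi_i$ (all $0\leq i\leq n-1$ if $n$ is even, $2\leq i\leq n-1$ if $n$ is odd); in degree $1$, $\overline{\zeta}_\ell$ ($0\leq\ell\leq u-1$) and, only if $\mathrm{char}(\mathbb{F})=2$, $\overline{\rho}_\ell$ ($0\leq\ell\leq m-1$); in degree $2$, $\overline{h}_j$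 ($0\leq j\leq n-1$) and, only if $\mathrm{char}(\mathbb{F})=2$, $\overline{\gamma}_\ell$ ($1\leq\ell\leq m$). "Up to graded commutativity, the non zero cup products are" means that the cup product is graded commutative and that every cup product of two basis elements which is not listed, possibly after exchanging the factors, is zero. *)

theory Defs
  imports "HOL-Algebra.QuotRing"
begin

section \<open>The double quiver of type D\<close>

text \<open>\<open>Arr i\<close> is the arrow $a_i$ and \<open>Star i\<close> is the reversed arrow $a_i^*$.\<close>

datatype arrow = Arr nat | Star nat

fun arrow_source :: "arrow \<Rightarrow> nat" where
  "arrow_source (Arr i) = i"
| "arrow_source (Star i) = (if i < 2 then 2 else i + 1)"

fun arrow_target :: "arrow \<Rightarrow> nat" where
  "arrow_target (Arr i) = (if i < 2 then 2 else i + 1)"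
| "arrow_target (Star i) = i"

definition arrows :: "nat \<Rightarrow> arrow set" where
  "arrows n = Arr ` {0..n - 2} \<union> Star ` {0..n - 2}"

text \<open>The pair \<open>([x\<^sub>1, \<dots>, x\<^sub>p], s)\<close> stands for the path \<open>x\<^sub>1 \<dots> x\<^sub>p\<close> with source \<open>s\<close>, written from right
  to left (so \<open>s\<close> is the source of \<open>x\<^sub>p\<close>). The source has to be recorded for the trivial paths
  \<open>e\<^sub>s = ([], s)\<close>.\<close>

type_synonym path = "arrow list \<times> nat"

fun path_target :: "path \<Rightarrow> nat" where
  "path_target ([], s) = s"
| "path_target (x # xs, s) = arrow_target x"

fun is_path :: "nat \<Rightarrow> path \<Rightarrow> bool" where
  "is_path n ([], s) \<longleftrightarrow> s < n"
| "is_path n (x # xs, s) \<longleftrightarrow>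
     x \<in> arrows n \<and> is_path n (xs, s) \<and> arrow_source x = path_target (xs, s)"


section \<open>The path algebra and the preprojective algebra\<close>

text \<open>An element of the path algebra is the finitely supported function of its coefficients; the
  coefficient of a product at a path sums over all ways of cutting that path in two.\<close>

definition path_algebra :: "nat \<Rightarrow> (path \<Rightarrow> 'a::field) ring" where
  "path_algebra n = \<lparr>
     carrier = {f. finite {q. f q \<noteq> 0} \<and> (\<forall>q. f q \<noteq> 0 \<longrightarrow> is_path n q)},
     monoid.mult = (\<lambda>f g (xs, s).
        \<Sum>i\<le>length xs. f (take i xs, path_target (drop i xs, s)) * g (drop i xs, s)),
     one = (\<lambda>(xs, s). of_bool (xs = [] \<and> s < n)),
     zero = (\<lambda>q. 0),
     add = (\<lambda>f g q. f q + g q)\<rparr>"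

definition vertex_elt :: "nat \<Rightarrow> path \<Rightarrow> 'a::field" where
  "vertex_elt i = (\<lambda>q. of_bool (q = ([], i)))"

definition arrow_elt :: "arrow \<Rightarrow> path \<Rightarrow> 'a::field" where
  "arrow_elt x = (\<lambda>q. of_bool (q = ([x], arrow_source x)))"

text \<open>The path algebra is the tensor algebra of \<open>V\<close> over \<open>k\<close>, and its subspace spanned by the paths
  of length \<open>d\<close> is the \<open>d\<close>-fold tensor power of \<open>V\<close> over \<open>k\<close>; in particular it is \<open>k\<close> for \<open>d = 0\<close>
  and \<open>V\<close> for \<open>d = 1\<close>.\<close>

definition tensor_power :: "nat \<Rightarrow> nat \<Rightarrow> (path \<Rightarrow> 'a::field) set" where
  "tensor_power n d = {f \<in> carrier (path_algebra n). \<forall>q. f q \<noteq> 0 \<longrightarrow> length (fst q) = d}"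

definition sigma :: "nat \<Rightarrow> nat \<Rightarrow> path \<Rightarrow> 'a::field" where
  "sigma n i =
    (let P = path_algebra n; a = (\<lambda>j. arrow_elt (Arr j)); b = (\<lambda>j. arrow_elt (Star j)) in
      if i < 2 then \<ominus>\<^bsub>P\<^esub> (b i \<otimes>\<^bsub>P\<^esub> a i)
      else if i = 2 then
        (a 0 \<otimes>\<^bsub>P\<^esub> b 0 \<oplus>\<^bsub>P\<^esub> a 1 \<otimes>\<^bsub>P\<^esub> b 1) \<ominus>\<^bsub>P\<^esub> (b 2 \<otimes>\<^bsub>P\<^esub> a 2)
      else if i = n - 1 then a (n - 2) \<otimes>\<^bsub>P\<^esub> b (n - 2)
      else (a (i - 1) \<otimes>\<^bsub>P\<^esub> b (i - 1)) \<ominus>\<^bsub>P\<^esub> (b i \<otimes>\<^bsub>P\<^esub> a i))"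

definition relations :: "nat \<Rightarrow> (path \<Rightarrow> 'a::field) set" where
  "relations n = {(\<lambda>q. \<Sum>i<n. c i * sigma n i q) | c. True}"

definition relation_ideal :: "nat \<Rightarrow> (path \<Rightarrow> 'a::field) set" where
  "relation_ideal n = Idl\<^bsub>path_algebra n\<^esub> (relations n)"

definition preproj :: "nat \<Rightarrow> (path \<Rightarrow> 'a::field) set ring" where
  "preproj n = path_algebra n Quot relation_ideal n"

definition proj :: "nat \<Rightarrow> (path \<Rightarrow> 'a::field) \<Rightarrow> (path \<Rightarrow> 'a) set" where
  "proj n x = relation_ideal n +>\<^bsub>path_algebra n\<^esub> x"


section \<open>Koszul cohomology\<close>

text \<open>For sub-bimodules \<open>S\<close> and \<open>T\<close> of tensor powers of \<open>V\<close>, this is the image of the tensor product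
  of \<open>S\<close> and \<open>T\<close> over \<open>k\<close> in a tensor power of \<open>V\<close>.\<close>

definition tensor :: "nat \<Rightarrow> (path \<Rightarrow> 'a::field) set \<Rightarrow> (path \<Rightarrow> 'a) set \<Rightarrow> (path \<Rightarrow> 'a) set" where
  "tensor n S T = {\<Oplus>\<^bsub>path_algebra n\<^esub>j\<in>{..<N}. u j \<otimes>\<^bsub>path_algebra n\<^esub> v j | (N::nat) u v.
     \<forall>j<N. u j \<in> S \<and> v j \<in> T}"

definition W :: "nat \<Rightarrow> nat \<Rightarrow> (path \<Rightarrow> 'a::field) set" where
  "W n p = (if p < 2 then tensor_power n p
     else \<Inter>{tensor n (tensor n (tensor_power n i) (relations n)) (tensor_power n j) | i j.
              i + 2 + j = p})"

type_synonym 'a cochain = "(path \<Rightarrow> 'a) \<Rightarrow> (path \<Rightarrow> 'a) set"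

text \<open>Bilinearity over \<open>k\<close> includes linearity over the ground field, which embeds in \<open>k\<close>.
  Cochains are \<^const>\<open>undefined\<close> outside \<open>W n p\<close>.\<close>

definition cochains :: "nat \<Rightarrow> nat \<Rightarrow> 'a::field cochain set" where
  "cochains n p = {f \<in> W n p \<rightarrow>\<^sub>E carrier (preproj n).
     (\<forall>w\<in>W n p. \<forall>w'\<in>W n p. f (w \<oplus>\<^bsub>path_algebra n\<^esub> w') = f w \<oplus>\<^bsub>preproj n\<^esub> f w') \<and>
     (\<forall>c\<in>tensor_power n 0. \<forall>d\<in>tensor_power n 0. \<forall>w\<in>W n p.
        f (c \<otimes>\<^bsub>path_algebra n\<^esub> w \<otimes>\<^bsub>path_algebra n\<^esub> d) =
          proj n c \<otimes>\<^bsub>preproj n\<^esub> f w \<otimes>\<^bsub>preproj n\<^esub> proj n d)}"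

text \<open>The additive group of cochains. It is written multiplicatively, as are its quotients below, in
  order to use the factor groups of the library: \<open>\<one>\<close> is the zero cochain, and \<open>f [^] k\<close> is \<open>k\<close> times
  \<open>f\<close>.\<close>

definition cochain_group :: "nat \<Rightarrow> nat \<Rightarrow> 'a::field cochain monoid" where
  "cochain_group n p = \<lparr>
     carrier = cochains n p,
     monoid.mult = (\<lambda>f g. \<lambda>w\<in>W n p. f w \<oplus>\<^bsub>preproj n\<^esub> g w),
     one = (\<lambda>w\<in>W n p. \<zero>\<^bsub>preproj n\<^esub>)\<rparr>"

text \<open>The value \<open>f(x\<^sub>1 \<dots> x\<^sub>p) g(x\<^sub>p\<^sub>+\<^sub>1 \<dots> x\<^sub>p\<^sub>+\<^sub>q)\<close> (a sum is understood) at \<open>w = x\<^sub>1 \<dots> x\<^sub>p\<^sub>+\<^sub>q\<close>: an element \<open>w\<close> of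
  \<open>W n (p + q)\<close> is a sum of products \<open>u v\<close> with \<open>u\<close> in \<open>W n p\<close> and \<open>v\<close> in \<open>W n q\<close>, and the sum of the
  corresponding \<open>f u g v\<close> does not depend on the decomposition when \<open>f\<close> and \<open>g\<close> are bimodule maps.\<close>

definition convolution ::
    "nat \<Rightarrow> nat \<Rightarrow> nat \<Rightarrow> 'a::field cochain \<Rightarrow> 'a cochain \<Rightarrow> 'a cochain" where
  "convolution n p q f g w = (THE y. \<exists>(N::nat) u v.
     (\<forall>j<N. u j \<in> W n p \<and> v j \<in> W n q) \<and>
     w = (\<Oplus>\<^bsub>path_algebra n\<^esub>j\<in>{..<N}. u j \<otimes>\<^bsub>path_algebra n\<^esub> v j) \<and>
     y = (\<Oplus>\<^bsub>preproj n\<^esub>j\<in>{..<N}. f (u j) \<otimes>\<^bsub>preproj n\<^esub> g (v j)))"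

definition koszul_diff :: "nat \<Rightarrow> nat \<Rightarrow> 'a::field cochain \<Rightarrow> 'a cochain" where
  "koszul_diff n p f = (\<lambda>w\<in>W n (p + 1).
     convolution n p 1 f (proj n) w \<ominus>\<^bsub>preproj n\<^esub>
       [((- 1 :: int) ^ p)] \<cdot>\<^bsub>preproj n\<^esub> convolution n 1 p (proj n) f w)"

definition cocycles :: "nat \<Rightarrow> nat \<Rightarrow> 'a::field cochain set" where
  "cocycles n p = kernel (cochain_group n p) (cochain_group n (p + 1)) (koszul_diff n p)"

fun coboundaries :: "nat \<Rightarrow> nat \<Rightarrow> 'a::field cochain set" where
  "coboundaries n 0 = {\<one>\<^bsub>cochain_group n 0\<^esub>}"
| "coboundaries n (Suc p) = koszul_diff n p ` cochains n p"

definition HK :: "nat \<Rightarrow> nat \<Rightarrow> 'a::field cochain set monoid" where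
  "HK n p = (cochain_group n p)\<lparr>carrier := cocycles n p\<rparr> Mod coboundaries n p"

definition hk_class :: "nat \<Rightarrow> nat \<Rightarrow> 'a::field cochain \<Rightarrow> 'a cochain set" where
  "hk_class n p f = coboundaries n p #>\<^bsub>cochain_group n p\<^esub> f"

definition cup_cochain ::
    "nat \<Rightarrow> nat \<Rightarrow> nat \<Rightarrow> 'a::field cochain \<Rightarrow> 'a cochain \<Rightarrow> 'a cochain" where
  "cup_cochain n p q f g = (\<lambda>w\<in>W n (p + q).
     [((- 1 :: int) ^ (p * q))] \<cdot>\<^bsub>preproj n\<^esub> convolution n p q f g w)"

text \<open>The product of two classes. All the classes in the union coincide when \<open>X\<close> and \<open>Y\<close> are
  cohomology classes.\<close>

definition cup ::
    "nat \<Rightarrow> nat \<Rightarrow> nat \<Rightarrow> 'a::field cochain set \<Rightarrow> 'a cochain set \<Rightarrow> 'a cochain set" where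
  "cup n p q X Y = (\<Union>f\<in>X. \<Union>g\<in>Y. hk_class n (p + q) (cup_cochain n p q f g))"


section \<open>The distinguished cohomology classes\<close>

text \<open>The product in the preprojective algebra of the letters of a word.\<close>

definition word :: "nat \<Rightarrow> arrow list \<Rightarrow> (path \<Rightarrow> 'a::field) set" where
  "word n xs = foldr (\<lambda>x y. proj n (arrow_elt x) \<otimes>\<^bsub>preproj n\<^esub> y) xs \<one>\<^bsub>preproj n\<^esub>"

definition pi_elt :: "nat \<Rightarrow> nat \<Rightarrow> (path \<Rightarrow> 'a::field) set" where
  "pi_elt n i =
    (if i < 2 then
       (let y = word n ([Star i] @ map Star [2..<n - 1] @ map Arr (rev [2..<n - 1]) @ [Arr i])
        in if i = 0 then \<ominus>\<^bsub>preproj n\<^esub> y else y)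
     else if i < n - 1 then
       (word n [Star i, Arr i] [^]\<^bsub>preproj n\<^esub> (n - i - 1)) \<otimes>\<^bsub>preproj n\<^esub>
         word n (map Arr (rev [1..<i]) @ map Star [1..<i])
     else word n (map Arr (rev [1..<n - 1]) @ map Star [1..<n - 1]))"

definition z_elt :: "nat \<Rightarrow> nat \<Rightarrow> (path \<Rightarrow> 'a::field) set" where
  "z_elt n l =
    (if l = 0 then \<one>\<^bsub>preproj n\<^esub>
     else (word n [Star 0, Arr 1, Star 1, Arr 0] [^]\<^bsub>preproj n\<^esub> l) \<oplus>\<^bsub>preproj n\<^esub>
          (word n [Star 1, Arr 0, Star 0, Arr 1] [^]\<^bsub>preproj n\<^esub> l) \<oplus>\<^bsub>preproj n\<^esub>
          (\<Oplus>\<^bsub>preproj n\<^esub>i\<in>{2..n - 2}. word n [Star i, Arr i] [^]\<^bsub>preproj n\<^esub> (2 * l)))"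

text \<open>A \<open>0\<close>-cochain corresponds to its value at \<open>1\<close>, which for a \<open>0\<close>-cocycle is a central element.
  A \<open>1\<close>-cochain is determined by its values on the arrows, and a \<open>2\<close>-cochain by its values on the
  relations \<open>sigma n i\<close>.\<close>

definition cochain0 :: "nat \<Rightarrow> (path \<Rightarrow> 'a::field) set \<Rightarrow> 'a cochain" where
  "cochain0 n z = (\<lambda>c\<in>W n 0. proj n c \<otimes>\<^bsub>preproj n\<^esub> z)"

definition cochain1 :: "nat \<Rightarrow> (arrow \<Rightarrow> (path \<Rightarrow> 'a::field) set) \<Rightarrow> 'a cochain" where
  "cochain1 n val = (THE f. f \<in> cochains n 1 \<and> (\<forall>x\<in>arrows n. f (arrow_elt x) = val x))"

definition cochain2 :: "nat \<Rightarrow> (nat \<Rightarrow> (path \<Rightarrow> 'a::field) set) \<Rightarrow> 'a cochain" where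
  "cochain2 n val = (THE f. f \<in> cochains n 2 \<and> (\<forall>i<n. f (sigma n i) = val i))"

definition zeta :: "nat \<Rightarrow> nat \<Rightarrow> 'a::field cochain" where
  "zeta n l = cochain1 n (\<lambda>x. case x of
       Arr i \<Rightarrow> word n [Arr i] \<otimes>\<^bsub>preproj n\<^esub> z_elt n l
     | Star i \<Rightarrow> \<zero>\<^bsub>preproj n\<^esub>)"

definition rho :: "nat \<Rightarrow> nat \<Rightarrow> 'a::field cochain" where
  "rho n l = cochain1 n (\<lambda>x. let y = word n [Star 2, Arr 2] [^]\<^bsub>preproj n\<^esub> (2 * l + 1) in
     case x of
       Arr i \<Rightarrow> if i < 2 then y \<otimes>\<^bsub>preproj n\<^esub> word n [Arr i] else \<zero>\<^bsub>preproj n\<^esub>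
     | Star i \<Rightarrow> if i < 2 then word n [Star i] \<otimes>\<^bsub>preproj n\<^esub> y else \<zero>\<^bsub>preproj n\<^esub>)"

definition eta :: "nat \<Rightarrow> nat \<Rightarrow> 'a::field cochain" where
  "eta n j = cochain2 n (\<lambda>i. if i = j then proj n (vertex_elt j) else \<zero>\<^bsub>preproj n\<^esub>)"

definition gamma :: "nat \<Rightarrow> nat \<Rightarrow> 'a::field cochain" where
  "gamma n l = cochain2 n (\<lambda>i.
     if i = 0 then word n [Star 0, Arr 1, Star 1, Arr 0] [^]\<^bsub>preproj n\<^esub> l else \<zero>\<^bsub>preproj n\<^esub>)"

text \<open>Names for the classes $z_\ell$, $\pi_i$, $\overline\zeta_\ell$, $\overline\rho_\ell$,
  $\overline h_j$ and $\overline\gamma_\ell$, in this order, together with their degrees and values.\<close>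

datatype hk_gen = Z nat | Pi nat | Zeta nat | Rho nat | H nat | Gamma nat

fun hk_deg :: "hk_gen \<Rightarrow> nat" where
  "hk_deg (Z l) = 0"
| "hk_deg (Pi i) = 0"
| "hk_deg (Zeta l) = 1"
| "hk_deg (Rho l) = 1"
| "hk_deg (H j) = 2"
| "hk_deg (Gamma l) = 2"

fun hk_elt :: "nat \<Rightarrow> hk_gen \<Rightarrow> 'a::field cochain set" where
  "hk_elt n (Z l) = hk_class n 0 (cochain0 n (z_elt n l))"
| "hk_elt n (Pi i) = hk_class n 0 (cochain0 n (pi_elt n i))"
| "hk_elt n (Zeta l) = hk_class n 1 (zeta n l)"
| "hk_elt n (Rho l) = hk_class n 1 (rho n l)"
| "hk_elt n (H j) = hk_class n 2 (eta n j)"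
| "hk_elt n (Gamma l) = hk_class n 2 (gamma n l)"

definition m_D :: "nat \<Rightarrow> nat" where
  "m_D n = (n - 2) div 2"

definition u_D :: "nat \<Rightarrow> nat" where
  "u_D n = n - m_D n - 2"

text \<open>The second argument is the characteristic of the ground field. Linear independence of the
  listed classes is not part of this definition: in characteristic \<open>2\<close> the cochains \<^const>\<open>rho\<close> are
  coboundaries.\<close>

definition hk_basis :: "nat \<Rightarrow> nat \<Rightarrow> hk_gen set" where
  "hk_basis n ch =
     Z ` {0..u_D n - 1} \<union>
     Pi ` (if even n then {0..n - 1} else {2..n - 1}) \<union>
     Zeta ` {0..u_D n - 1} \<union>
     (if ch = 2 then Rho ` {0..m_D n - 1} else {}) \<union>
     H ` {0..n - 1} \<union>
     (if ch = 2 then Gamma ` {1..m_D n} else {})"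

definition hk_cup :: "nat \<Rightarrow> hk_gen \<Rightarrow> hk_gen \<Rightarrow> 'a::field cochain set" where
  "hk_cup n x y = cup n (hk_deg x) (hk_deg y) (hk_elt n x) (hk_elt n y)"

text \<open>\<open>listed_product n x y v\<close> means that the product of \<open>x\<close> and \<open>y\<close>, in this order, is in the table
  of products, with value \<open>v\<close>.\<close>

inductive listed_product :: "nat \<Rightarrow> hk_gen \<Rightarrow> hk_gen \<Rightarrow> 'a::field cochain set \<Rightarrow> bool"
  for n :: nat where
  unit: "listed_product n (Z 0) y (hk_elt n y)"
| Z_Z: "listed_product n (Z l1) (Z l2) (hk_elt n (Z (l1 + l2)))"
    if "l1 + l2 \<le> u_D n - 1"
| Z_Z_even: "listed_product n (Z l1) (Z l2)
      (hk_class n 0 (cochain0 n (\<ominus>\<^bsub>preproj n\<^esub> pi_elt n 0 \<oplus>\<^bsub>preproj n\<^esub> pi_elt n 1)))"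
    if "even n" "l1 + l2 = m_D n"
| Z_Zeta: "listed_product n (Z l1) (Zeta l2) (hk_elt n (Zeta (l1 + l2)))"
    if "l1 + l2 \<le> u_D n - 1"
| Z_Rho: "listed_product n (Z l1) (Rho l2) (hk_elt n (Rho (l1 + l2)))"
    if "CHAR('a) = 2" "l1 + l2 \<le> m_D n - 1"
| Z_H: "listed_product n (Z l) (H i) (hk_elt n (Gamma l))"
    if "l \<ge> 1" "CHAR('a) = 2" "i \<in> {0, 1}"
| Z_Gamma: "listed_product n (Z l1) (Gamma l2) (hk_elt n (Gamma (l1 + l2)))"
    if "CHAR('a) = 2" "l1 + l2 \<le> m_D n"
| Pi_H: "listed_product n (Pi i) (H j) (hk_elt n (Gamma (m_D n)))"
    if "i = j" "even n" "CHAR('a) = 2"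

end

theory Submission
  imports Defs
begin

text \<open>
  A class of degree $0$ is a central element, a class of degree $1$ is given by its values on the
  arrows, and a class of degree $2$ by its values on the relations; multiplying by a central element
  multiplies these values. An element of $R$ is a combination of paths $x x^*$ whose coefficients
  agree up to sign for all arrows $x$ with the same target. As every edge shares an end with another
  edge, this forces $(V \otimes R) \cap (R \otimes V) = 0$, so $W_p = 0$ for $p \geq 3$ and products of
  total degree at least $3$ vanish. For two $1$-cocycles $f$ and $g$, the
  cocycle $f$ extends to a derivation $D$ of $A$, and the differential of $D \circ g$ is the sum of the
  two cup products of $f$ and $g$ up to sign, which gives graded commutativity.

  What is left are products with values on the relations, modulo coboundaries. Put
  $g_i = a_i^* a_{1-i} a_{1-i}^* a_i$ for $i = 0, 1$. Explicit $1$-cochains show that the positive powers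
  of $a_i^* a_i$ at a vertex $i \geq 2$ are coboundaries, that $g_0^\ell$ and $g_1^\ell$ are
  cohomologous, that $2 g_0^\ell$ is a coboundary, and that all the socle elements $\pi_i$, $i \geq 1$, are
  cohomologous; and $\pi_1 = g_1^m$ if $n$ is even. In characteristic $2$ the cochains $\rho_\ell$ are
  themselves coboundaries.
\<close>

section \<open>The path algebra is a ring\<close>

text \<open>Listed values and vanishing alike come from explicit cochains, and the algebra A enters
  through its defining relations alone. The calculations rest on one observation at the branching
  vertex 2. Put y = a_2^* a_2 and p_i = a_i a_i^* for i = 0, 1. Then y = p_0 + p_1 and p_i^2 = 0, so
  y p_i = p_{1-i} y: passing y across exchanges the two short branches. Hence y^2 a_i = a_i g_i;
  between a_i^* and a_i, odd powers of y give the powers of g_i and even powers give 0, which is how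
  the parity of n enters. As y^{n-2} = 0, the components of z_l at the vertices i \<ge> 2 vanish
  when 2l \<ge> n-2, while g_i^l is forced to vanish only when 2l > n-2. For even n the borderline
  exponent l = m is the source of the product -pi_0 + pi_1. A second obstacle is that differentials
  and cup products are given by an unspecified decomposition of an element of W_{p+q}; that the
  value does not depend on it is shown with coordinates on W_p.\<close>

lemma path_algebra_mult:
  "(f \<otimes>\<^bsub>path_algebra n\<^esub> g) (xs, s) =
    (\<Sum>i\<le>length xs. f (take i xs, path_target (drop i xs, s)) * g (drop i xs, s))"
  by (simp add: path_algebra_def)

lemma path_algebra_add: "f \<oplus>\<^bsub>path_algebra n\<^esub> g = (\<lambda>q. f q + g q)"
  by (simp add: path_algebra_def)

lemma path_algebra_zero: "\<zero>\<^bsub>path_algebra n\<^esub> = (\<lambda>q. 0)"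
  by (simp add: path_algebra_def)

lemma path_algebra_one: "\<one>\<^bsub>path_algebra n\<^esub> (xs, s) = of_bool (xs = [] \<and> s < n)"
  by (simp add: path_algebra_def)

lemma path_algebra_carrier:
  "f \<in> carrier (path_algebra n) \<longleftrightarrow> finite {q. f q \<noteq> 0} \<and> (\<forall>q. f q \<noteq> 0 \<longrightarrow> is_path n q)"
  by (simp add: path_algebra_def)

lemma path_target_append: "path_target (xs, path_target (ys, s)) = path_target (xs @ ys, s)"
  by (cases xs) auto

text \<open>Both bracketings sum over all ways of cutting the path into three pieces; a triangular
  reindexing passes from one order of cutting to the other.\<close>

lemma path_algebra_mult_assoc:
  "(f \<otimes>\<^bsub>path_algebra n\<^esub> g) \<otimes>\<^bsub>path_algebra n\<^esub> h =
    f \<otimes>\<^bsub>path_algebra n\<^esub> (g \<otimes>\<^bsub>path_algebra n\<^esub> h)" (is "?l = ?r")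
proof (rule ext, rule prod.induct)
  fix xs :: "arrow list" and s :: nat
  \<comment> \<open>\<open>j\<close> and \<open>k\<close> are the lengths of the first two pieces,
    and \<open>t j k\<close> is the product of the three coefficients.\<close>
  define t where "t = (\<lambda>j k. f (take j xs, path_target (drop j xs, s)) *
      (g (take k (drop j xs), path_target (drop (j + k) xs, s)) * h (drop (j + k) xs, s)))"
  have split: "path_target (take (i - j) (drop j xs), path_target (drop i xs, s)) = path_target (drop j xs, s)"
      "drop j (take i xs) = take (i - j) (drop j xs)" if "j \<le> i" for i j
    using append_take_drop_id[of "i - j" "drop j xs"] that
    by (auto simp: path_target_append drop_take)
  have "?l (xs, s) = (\<Sum>i\<le>length xs. \<Sum>j\<le>i. t j (i - j))"
    unfolding path_algebra_mult sum_distrib_right t_def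
    by (intro sum.cong refl) (auto simp: split mult.assoc min_def)
  also have "\<dots> = (\<Sum>(j, k)\<in>{(j, k). j + k \<le> length xs}. t j k)"
    by (rule sum.triangle_reindex_eq[symmetric])
  also have "{(j, k). j + k \<le> length xs} = (SIGMA j:{..length xs}. {..length xs - j})"
    by auto
  also have "(\<Sum>(j, k)\<in>\<dots>. t j k) = (\<Sum>j\<le>length xs. \<Sum>k\<le>length xs - j. t j k)"
    by (rule sum.Sigma[symmetric]) auto
  also have "\<dots> = ?r (xs, s)"
    unfolding path_algebra_mult sum_distrib_left t_def
    by (intro sum.cong refl) (auto simp: add.commute)
  finally show "?l (xs, s) = ?r (xs, s)" .
qed

text \<open>The type argument \<open>F\<close> brings the coefficient field into the locale, so that
  \<open>P\<close> and \<open>A\<close> have a determined type.\<close>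

locale type_D =
  fixes n :: nat and F :: "'a::field itself"
  assumes n_ge_4: "n \<ge> 4"
begin

abbreviation P :: "(path \<Rightarrow> 'a) ring" where "P \<equiv> path_algebra n"
abbreviation A :: "(path \<Rightarrow> 'a) set ring" where "A \<equiv> preproj n"

lemma arrow_target_less: "x \<in> arrows n \<Longrightarrow> arrow_target x < n"
  and arrow_source_less: "x \<in> arrows n \<Longrightarrow> arrow_source x < n"
  using n_ge_4 by (auto simp: arrows_def)

lemma path_target_less: "is_path n q \<Longrightarrow> path_target q < n"
  by (cases q rule: path_target.cases) (auto simp: arrow_target_less)

lemma is_path_append:
  "is_path n (xs @ ys, s) \<longleftrightarrow> is_path n (ys, s) \<and> is_path n (xs, path_target (ys, s))"
  by (induction xs) (auto simp: path_target_append path_target_less)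

text \<open>A path in the support of the product is a concatenation of one path from each support.
  This bounds the support and shows that it consists of composable words.\<close>

lemma mult_closed:
  assumes "f \<in> carrier P" "g \<in> carrier P"
  shows "f \<otimes>\<^bsub>P\<^esub> g \<in> carrier P"
proof -
  have split: "\<exists>us vs. q = (us @ vs, snd q) \<and> f (us, path_target (vs, snd q)) \<noteq> 0 \<and> g (vs, snd q) \<noteq> 0"
    if nz: "(f \<otimes>\<^bsub>P\<^esub> g) q \<noteq> 0" for q
  proof -
    obtain xs s where q: "q = (xs, s)" by fastforce
    obtain i where "f (take i xs, path_target (drop i xs, s)) * g (drop i xs, s) \<noteq> 0"
      using nz unfolding q path_algebra_mult by (meson sum.neutral)
    then show ?thesis
      by (intro exI[of _ "take i xs"] exI[of _ "drop i xs"]) (simp add: q)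
  qed
  have "{q. (f \<otimes>\<^bsub>P\<^esub> g) q \<noteq> 0} \<subseteq>
      (\<lambda>((us, t), (vs, s)). (us @ vs, s)) ` ({q. f q \<noteq> 0} \<times> {q. g q \<noteq> 0})"
    using split by force
  moreover have "finite ({q. f q \<noteq> 0} \<times> {q. g q \<noteq> 0})"
    using assms by (simp add: path_algebra_carrier)
  moreover have "is_path n q" if "(f \<otimes>\<^bsub>P\<^esub> g) q \<noteq> 0" for q
    using split[OF that] assms is_path_append unfolding path_algebra_carrier by metis
  ultimately show ?thesis
    unfolding path_algebra_carrier by (meson finite_imageI finite_subset)
qed

lemma add_closed:
  assumes "f \<in> carrier P" "g \<in> carrier P"
  shows "f \<oplus>\<^bsub>P\<^esub> g \<in> carrier P"
proof -
  have "{q. f q + g q \<noteq> 0} \<subseteq> {q. f q \<noteq> 0} \<union> {q. g q \<noteq> 0}" by auto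
  then have "finite {q. f q + g q \<noteq> 0}"
    by (rule finite_subset) (use assms in \<open>auto simp: path_algebra_carrier\<close>)
  then show ?thesis
    using assms by (auto simp: path_algebra_carrier path_algebra_add) (metis add.right_neutral)
qed

text \<open>Only the empty left piece meets the unit. The remaining factor asks the end vertex to be
  less than \<open>n\<close>, which holds wherever \<open>f\<close> is nonzero.\<close>

lemma one_mult:
  assumes "f \<in> carrier P" shows "\<one>\<^bsub>P\<^esub> \<otimes>\<^bsub>P\<^esub> f = f"
proof (rule ext, rule prod.induct)
  fix xs :: "arrow list" and s :: nat
  have "(\<one>\<^bsub>P\<^esub> \<otimes>\<^bsub>P\<^esub> f) (xs, s) = (\<Sum>i\<in>{0::nat}. of_bool (path_target (xs, s) < n) * f (xs, s))"
    unfolding path_algebra_mult path_algebra_one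
    by (rule sum.mono_neutral_cong_right) auto
  also have "\<dots> = f (xs, s)"
    using assms path_target_less by (auto simp: path_algebra_carrier)
  finally show "(\<one>\<^bsub>P\<^esub> \<otimes>\<^bsub>P\<^esub> f) (xs, s) = f (xs, s)" .
qed

lemma mult_one:
  assumes "f \<in> carrier P" shows "f \<otimes>\<^bsub>P\<^esub> \<one>\<^bsub>P\<^esub> = f"
proof (rule ext, rule prod.induct)
  fix xs :: "arrow list" and s :: nat
  have path: "is_path n (ys, s) \<Longrightarrow> s < n" for ys
    by (induction ys) auto
  have "(f \<otimes>\<^bsub>P\<^esub> \<one>\<^bsub>P\<^esub>) (xs, s) = (\<Sum>i\<in>{length xs}. f (xs, s) * of_bool (s < n))"
    unfolding path_algebra_mult path_algebra_one
    by (rule sum.mono_neutral_cong_right) auto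
  also have "\<dots> = f (xs, s)"
    using assms path by (auto simp: path_algebra_carrier)
  finally show "(f \<otimes>\<^bsub>P\<^esub> \<one>\<^bsub>P\<^esub>) (xs, s) = f (xs, s)" .
qed

lemma scaled_closed: "f \<in> carrier P \<Longrightarrow> (\<lambda>q. c * f q) \<in> carrier P"
  by (auto simp: path_algebra_carrier elim!: finite_subset[rotated])

lemma path_algebra_ring: "ring P"
proof (rule ringI)
  show "abelian_group P"
  proof (rule abelian_groupI)
    fix f assume "f \<in> carrier P"
    then show "\<exists>g\<in>carrier P. g \<oplus>\<^bsub>P\<^esub> f = \<zero>\<^bsub>P\<^esub>"
      by (intro bexI[of _ "\<lambda>q. (- 1) * f q"] scaled_closed)
        (auto simp: path_algebra_add path_algebra_zero)
  next
    fix f g assume "f \<in> carrier P" "g \<in> carrier P"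
    then show "f \<oplus>\<^bsub>P\<^esub> g \<in> carrier P" by (rule add_closed)
  qed (auto simp: path_algebra_add path_algebra_zero path_algebra_carrier add.assoc add.commute)
  have "\<one>\<^bsub>P\<^esub> \<in> carrier P"
  proof -
    have "{q. \<one>\<^bsub>P\<^esub> q \<noteq> 0} \<subseteq> Pair [] ` {..<n}"
      by (auto simp: path_algebra_one)
    then have "finite {q. \<one>\<^bsub>P\<^esub> q \<noteq> 0}"
      by (rule finite_subset) simp
    then show ?thesis
      by (auto simp: path_algebra_carrier path_algebra_one)
  qed
  then show "monoid P"
    by (intro monoidI) (auto intro: mult_closed path_algebra_mult_assoc simp: one_mult mult_one)
qed (auto simp: path_algebra_add path_algebra_mult algebra_simps sum.distrib)

end

sublocale type_D \<subseteq> P: ring "path_algebra n :: (path \<Rightarrow> 'a) ring"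
  by (rule path_algebra_ring)

section \<open>Paths and generators\<close>

definition path_elt :: "path \<Rightarrow> path \<Rightarrow> 'a::field" where
  "path_elt q = (\<lambda>q'. of_bool (q' = q))"

abbreviation (input) scaled :: "'a::field \<Rightarrow> (path \<Rightarrow> 'a) \<Rightarrow> path \<Rightarrow> 'a" where
  "scaled c f \<equiv> (\<lambda>q. c * f q)"

lemma vertex_elt_path: "vertex_elt i = path_elt ([], i)"
  and arrow_elt_path: "arrow_elt x = path_elt ([x], arrow_source x)"
  by (simp_all add: vertex_elt_def arrow_elt_def path_elt_def)

text \<open>When the length of the left piece is prescribed, a single cut of the path contributes to
  the sum.\<close>

lemma mult_homogeneous_left:
  assumes "\<And>q. f q \<noteq> 0 \<Longrightarrow> length (fst q) = d"
  shows "(f \<otimes>\<^bsub>path_algebra n\<^esub> g) (xs, s) =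
    (if d \<le> length xs then f (take d xs, path_target (drop d xs, s)) * g (drop d xs, s) else 0)"
proof -
  have z: "f (take i xs, t) = 0" if "i \<le> length xs" "i \<noteq> d" for i t
    using assms[of "(take i xs, t)"] that by auto
  show ?thesis
  proof (cases "d \<le> length xs")
    case True
    have "(f \<otimes>\<^bsub>path_algebra n\<^esub> g) (xs, s) =
        (\<Sum>i\<in>{d}. f (take i xs, path_target (drop i xs, s)) * g (drop i xs, s))"
      unfolding path_algebra_mult using True z by (intro sum.mono_neutral_right) auto
    with True show ?thesis by simp
  next
    case False
    then show ?thesis unfolding path_algebra_mult using z by (auto intro!: sum.neutral)
  qed
qed

lemma mult_homogeneous_right:
  assumes "\<And>q. g q \<noteq> 0 \<Longrightarrow> length (fst q) = d" and "length ys = d"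
  shows "(f \<otimes>\<^bsub>path_algebra n\<^esub> g) (xs @ ys, s) = f (xs, path_target (ys, s)) * g (ys, s)"
proof -
  have z: "g (drop i (xs @ ys), s) = 0" if "i \<le> length (xs @ ys)" "i \<noteq> length xs" for i
    using assms(1)[of "(drop i (xs @ ys), s)"] that assms(2) by fastforce
  have "(f \<otimes>\<^bsub>path_algebra n\<^esub> g) (xs @ ys, s) =
      (\<Sum>i\<in>{length xs}. f (take i (xs @ ys), path_target (drop i (xs @ ys), s)) * g (drop i (xs @ ys), s))"
    unfolding path_algebra_mult using z by (intro sum.mono_neutral_right) auto
  then show ?thesis by simp
qed

lemma path_elt_mult:
  "path_elt (xs, t) \<otimes>\<^bsub>path_algebra n\<^esub> path_elt (ys, s) =
    (if t = path_target (ys, s) then path_elt (xs @ ys, s) else \<zero>\<^bsub>path_algebra n\<^esub> :: path \<Rightarrow> 'a::field)"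
proof (rule ext, rule prod.induct)
  fix zs and r
  have *: "(path_elt (xs, t) \<otimes>\<^bsub>path_algebra n\<^esub> path_elt (ys, s)) (zs, r) =
    (if length xs \<le> length zs then path_elt (xs, t) (take (length xs) zs, path_target (drop (length xs) zs, r)) *
      path_elt (ys, s) (drop (length xs) zs, r) else (0 :: 'a))"
    by (rule mult_homogeneous_left) (auto simp: path_elt_def)
  show "((path_elt (xs, t) \<otimes>\<^bsub>path_algebra n\<^esub> path_elt (ys, s)) (zs, r) :: 'a) =
    (if t = path_target (ys, s) then path_elt (xs @ ys, s) else \<zero>\<^bsub>path_algebra n\<^esub>) (zs, r)"
  proof (cases "length xs \<le> length zs")
    case True
    then obtain us vs where "zs = us @ vs" "length us = length xs"
      by (metis append_take_drop_id length_take min.absorb2)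
    then show ?thesis unfolding * by (auto simp: path_elt_def path_algebra_zero)
  next
    case False
    then show ?thesis unfolding * by (auto simp: path_elt_def path_algebra_zero)
  qed
qed

lemma scaled_mult: "scaled c f \<otimes>\<^bsub>path_algebra n\<^esub> g = scaled c (f \<otimes>\<^bsub>path_algebra n\<^esub> g)"
  and mult_scaled: "f \<otimes>\<^bsub>path_algebra n\<^esub> scaled c g = scaled c (f \<otimes>\<^bsub>path_algebra n\<^esub> g)"
  by (auto simp: path_algebra_mult sum_distrib_left mult_ac)

section \<open>Paths span the path algebra, and idempotents and arrows generate it\<close>

context type_D begin

lemma path_elt_closed [simp]: "is_path n q \<Longrightarrow> path_elt q \<in> carrier P"
  by (auto simp: path_algebra_carrier path_elt_def)

lemma vertex_elt_closed [simp]: "i < n \<Longrightarrow> vertex_elt i \<in> carrier P"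
  by (simp add: vertex_elt_path)

lemma arrow_elt_closed [simp]: "x \<in> arrows n \<Longrightarrow> arrow_elt x \<in> carrier P"
  by (simp add: arrow_elt_path arrow_source_less)

text \<open>A scalar acts as an element of k. This is how linearity over the ground field is drawn
  from bilinearity over k.\<close>

lemma scaled_one: "f \<in> carrier P \<Longrightarrow> scaled c f = scaled c \<one>\<^bsub>P\<^esub> \<otimes>\<^bsub>P\<^esub> f"
  by (simp add: scaled_mult)

text \<open>Induction over a finite set containing the support. The paths carry their coefficients,
  so that zero and scalar multiples need no cases of their own.\<close>

lemma path_span_induct [consumes 1, case_names path add]:
  assumes f: "f \<in> carrier P"
    and path: "\<And>c q. is_path n q \<Longrightarrow> Q (scaled c (path_elt q))"
    and add: "\<And>f g. f \<in> carrier P \<Longrightarrow> g \<in> carrier P \<Longrightarrow> Q f \<Longrightarrow> Q g \<Longrightarrow> Q (f \<oplus>\<^bsub>P\<^esub> g)"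
  shows "Q f"
proof -
  have zero: "Q \<zero>\<^bsub>P\<^esub>"
    using path[of "([], 0)" 0] n_ge_4 by (simp add: path_algebra_zero)
  have "Q f" if "finite S" "{q. f q \<noteq> 0} \<subseteq> S" "f \<in> carrier P" for S f
    using that
  proof (induction S arbitrary: f rule: finite_induct)
    case empty
    then have "f = \<zero>\<^bsub>P\<^esub>" by (auto simp: path_algebra_zero)
    then show ?case using zero by simp
  next
    case (insert q S)
    let ?g = "f(q := 0)"
    have "finite {r. ?g r \<noteq> 0}"
      using insert.prems by (auto simp: path_algebra_carrier elim!: rev_finite_subset)
    then have g: "?g \<in> carrier P"
      using insert.prems by (auto simp: path_algebra_carrier)
    have "{r. ?g r \<noteq> 0} \<subseteq> S"
      using insert.prems by auto
    then have Qg: "Q ?g"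
      using g by (rule insert.IH)
    show ?case
    proof (cases "f q = 0")
      case True
      then show ?thesis using Qg by (simp add: fun_upd_idem)
    next
      case False
      then have q: "is_path n q" using insert.prems unfolding path_algebra_carrier by blast
      have "f = scaled (f q) (path_elt q) \<oplus>\<^bsub>P\<^esub> ?g"
        by (auto simp: path_algebra_add path_elt_def)
      moreover have "Q (scaled (f q) (path_elt q) \<oplus>\<^bsub>P\<^esub> ?g)"
        using path q g Qg by (intro add scaled_closed) auto
      ultimately show ?thesis by simp
    qed
  qed
  then show ?thesis using f by (auto simp: path_algebra_carrier)
qed

text \<open>A scalar multiple of a path is a product of arrows ending in a scaled trivial path, so
  coefficients have to be treated at the vertices only.\<close>

lemma path_algebra_induct [consumes 1, case_names vertex arrow add mult]:
  assumes f: "f \<in> carrier P"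
    and vertex: "\<And>c i. i < n \<Longrightarrow> Q (scaled c (vertex_elt i))"
    and arrow: "\<And>x. x \<in> arrows n \<Longrightarrow> Q (arrow_elt x)"
    and add: "\<And>f g. f \<in> carrier P \<Longrightarrow> g \<in> carrier P \<Longrightarrow> Q f \<Longrightarrow> Q g \<Longrightarrow> Q (f \<oplus>\<^bsub>P\<^esub> g)"
    and mult: "\<And>f g. f \<in> carrier P \<Longrightarrow> g \<in> carrier P \<Longrightarrow> Q f \<Longrightarrow> Q g \<Longrightarrow> Q (f \<otimes>\<^bsub>P\<^esub> g)"
  shows "Q f"
proof -
  have path: "Q (scaled c (path_elt (xs, s)))" if "is_path n (xs, s)" for c xs s
    using that
  proof (induction xs)
    case Nil
    then show ?case using vertex by (simp add: vertex_elt_path)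
  next
    case (Cons x xs)
    then have "arrow_elt x \<otimes>\<^bsub>P\<^esub> scaled c (path_elt (xs, s)) = scaled c (path_elt (x # xs, s))"
      by (simp add: mult_scaled arrow_elt_path path_elt_mult)
    moreover have "Q (arrow_elt x \<otimes>\<^bsub>P\<^esub> scaled c (path_elt (xs, s)))"
      using Cons by (intro mult arrow scaled_closed) auto
    ultimately show ?case by simp
  qed
  show ?thesis
    using f by (induction rule: path_span_induct) (use path add in auto)
qed

lemma finsum_apply:
  assumes "u \<in> S \<rightarrow> carrier P"
  shows "(\<Oplus>\<^bsub>P\<^esub>j\<in>S. u j) q = (\<Sum>j\<in>S. u j q)"
proof (cases "finite S")
  case True
  then show ?thesis using assms
    by (induction S rule: finite_induct) (auto simp: path_algebra_zero path_algebra_add Pi_def)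
qed (simp add: path_algebra_zero)

end

section \<open>The relations\<close>

fun bar :: "arrow \<Rightarrow> arrow" where
  "bar (Arr i) = Star i"
| "bar (Star i) = Arr i"

text \<open>The sign of x bar(x) in a relation: plus for a a^* and minus for a^* a. With it one
  formula, a signed sum over the arrows ending at a vertex, covers the four shapes of
  \<open>sigma\<close>.\<close>

fun arrow_sign :: "arrow \<Rightarrow> 'a::field" where
  "arrow_sign (Arr i) = 1"
| "arrow_sign (Star i) = - 1"

lemma bar_bar [simp]: "bar (bar x) = x"
  and bar_arrows [simp]: "bar x \<in> arrows n \<longleftrightarrow> x \<in> arrows n"
  and source_bar [simp]: "arrow_source (bar x) = arrow_target x"
  and target_bar [simp]: "arrow_target (bar x) = arrow_source x"
  and arrow_sign_nonzero [simp]: "arrow_sign x \<noteq> 0"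
  by (cases x; auto simp: arrows_def)+

definition arrows_into :: "nat \<Rightarrow> nat \<Rightarrow> arrow set" where
  "arrows_into n i = {x \<in> arrows n. arrow_target x = i}"

context type_D begin

lemma arrows_into_cases:
  assumes "i < n"
  shows "arrows_into n i =
    (if i < 2 then {Star i} else if i = 2 then {Arr 0, Arr 1, Star 2}
     else if i = n - 1 then {Arr (n - 2)} else {Arr (i - 1), Star i})"
  using assms n_ge_4 by (auto simp: arrows_into_def arrows_def image_iff split: if_splits)

lemma a_inv_apply: "f \<in> carrier P \<Longrightarrow> \<ominus>\<^bsub>P\<^esub> f = (\<lambda>q. - f q)"
  using scaled_closed[of f "- 1"]
  by (intro P.minus_equality) (auto simp: path_algebra_add path_algebra_zero)

lemma a_minus_apply: "g \<in> carrier P \<Longrightarrow> f \<ominus>\<^bsub>P\<^esub> g = (\<lambda>q. f q - g q)"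
  by (simp add: a_minus_def a_inv_apply path_algebra_add)

lemma sigma_eq:
  assumes "i < n"
  shows "sigma n i = (\<lambda>q. \<Sum>x\<in>arrows_into n i. arrow_sign x * path_elt ([x, bar x], i) q :: 'a)"
proof -
  have mem: "j \<le> n - 2 \<Longrightarrow> Arr j \<in> arrows n" "j \<le> n - 2 \<Longrightarrow> Star j \<in> arrows n" for j
    by (auto simp: arrows_def)
  note n_ge_4 [simp]
  have prods: "arrow_elt (Arr j) \<otimes>\<^bsub>P\<^esub> arrow_elt (Star j) = path_elt ([Arr j, Star j], arrow_target (Arr j))"
    "arrow_elt (Star j) \<otimes>\<^bsub>P\<^esub> arrow_elt (Arr j) = path_elt ([Star j, Arr j], j)" for j
    by (simp_all add: arrow_elt_path path_elt_mult)
  have closed: "path_elt ([Arr j, Star j], arrow_target (Arr j)) \<in> carrier P"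
    "path_elt ([Star j, Arr j], j) \<in> carrier P" if "j \<le> n - 2" for j
    using mem[OF that] arrow_target_less[OF mem(1)[OF that]] arrow_target_less[OF mem(2)[OF that]] by auto
  consider "i < 2" | "i = 2" | "i = n - 1" "i > 2" | "2 < i" "i < n - 1"
    using assms by linarith
  then show ?thesis
  proof cases
    case 1
    then have "i \<le> n - 2" using n_ge_4 by linarith
    with 1 assms closed(2)[of i] show ?thesis
      by (simp add: sigma_def Let_def prods arrows_into_cases a_inv_apply)
  next
    case 2
    have "2 \<le> n - 2" "0 \<le> n - 2" "1 \<le> n - 2" using n_ge_4 by linarith+
    with 2 closed(2)[of 2] show ?thesis
      by (simp add: sigma_def Let_def prods arrows_into_cases a_minus_apply path_algebra_add algebra_simps)
  next
    case 3
    have "\<not> n - 2 < 2" "Suc (n - 2) = i" "\<not> i < 2" "i \<noteq> 2" using 3 n_ge_4 by linarith+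
    with 3(1) assms show ?thesis
      by (simp add: sigma_def Let_def prods arrows_into_cases)
  next
    case 4
    have "i \<le> n - 2" "\<not> i - 1 < 2" "Suc (i - 1) = i" "i \<noteq> n - 1" "\<not> i < 2" "i \<noteq> 2" using 4 by linarith+
    with assms closed(2)[of i] show ?thesis
      by (simp add: sigma_def Let_def prods arrows_into_cases a_minus_apply)
  qed
qed

lemma arrows_finite [simp]: "finite (arrows n)" "finite (arrows_into n i)"
  by (auto simp: arrows_def arrows_into_def)

lemma sigma_apply:
  assumes "i < n"
  shows "sigma n i (xs, s) =
    (case xs of [x, y] \<Rightarrow> (if x \<in> arrows n \<and> arrow_target x = i \<and> y = bar x \<and> s = i then arrow_sign x else 0)
      | _ \<Rightarrow> (0 :: 'a))"
proof -
  have "sigma n i (xs, s) =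
      (\<Sum>x\<in>arrows_into n i. if xs = [x, bar x] \<and> s = i then arrow_sign x else (0 :: 'a))"
    unfolding sigma_eq[OF assms] by (intro sum.cong) (auto simp: path_elt_def)
  \<comment> \<open>The word determines its first letter, so at most one summand survives; the sum
    is rewritten as a delta sum at \<open>hd xs\<close>.\<close>
  also have "\<dots> = (\<Sum>x\<in>arrows_into n i. if x = hd xs then (if xs = [x, bar x] \<and> s = i then arrow_sign x else 0) else 0)"
    by (intro sum.cong) auto
  also have "\<dots> = (case xs of [x, y] \<Rightarrow> (if x \<in> arrows n \<and> arrow_target x = i \<and> y = bar x \<and> s = i then arrow_sign x else 0)
      | _ \<Rightarrow> (0 :: 'a))"
    by (auto simp: arrows_into_def split: list.splits)
  finally show ?thesis .
qed

lemma sigma_closed [simp]: "i < n \<Longrightarrow> sigma n i \<in> carrier P"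
proof -
  assume i: "i < n"
  have "finite {q. sigma n i q \<noteq> (0::'a)}"
    by (rule finite_subset[of _ "(\<lambda>x. ([x, bar x], i)) ` arrows n"])
      (auto simp: sigma_apply[OF i] split: list.splits if_splits)
  then show ?thesis
    using i by (auto simp: path_algebra_carrier sigma_apply[OF i] split: list.splits if_splits)
qed

text \<open>The combination of the sigma_i with coefficients \<open>c i\<close>, given by its values
  at paths. A path x bar(x) is a loop, and its base point tells which sigma_i contributes.\<close>

definition relation_fun :: "(nat \<Rightarrow> 'a) \<Rightarrow> path \<Rightarrow> 'a" where
  "relation_fun c = (\<lambda>(xs, s). case xs of
      [x, y] \<Rightarrow> (if x \<in> arrows n \<and> y = bar x \<and> s = arrow_target x then c s * arrow_sign x else 0)
    | _ \<Rightarrow> 0)"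

lemma relation_fun_eq: "(\<lambda>q. \<Sum>i<n. c i * sigma n i q) = relation_fun c"
proof (rule ext, rule prod.induct)
  fix xs and s :: nat
  have "(\<Sum>i<n. c i * sigma n i (xs, s)) =
      (\<Sum>i<n. if i = s then c i * sigma n i (xs, s) else 0)"
    by (intro sum.cong) (auto simp: sigma_apply split: list.splits)
  also have "\<dots> = (if s < n then c s * sigma n s (xs, s) else 0)"
    by auto
  also have "\<dots> = relation_fun c (xs, s)"
    by (auto simp: relation_fun_def sigma_apply arrow_target_less split: list.splits)
  finally show "(\<Sum>i<n. c i * sigma n i (xs, s)) = relation_fun c (xs, s)" .
qed

lemma relations_eq: "relations n = range relation_fun"
  by (auto simp: relations_def relation_fun_eq)

lemma relation_fun_cong: "(\<And>i. i < n \<Longrightarrow> c i = d i) \<Longrightarrow> relation_fun c = relation_fun d"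
  unfolding relation_fun_eq[symmetric] by simp

lemma sigma_relation_fun: "j < n \<Longrightarrow> sigma n j = relation_fun (\<lambda>i. of_bool (i = j))"
  by (auto simp: fun_eq_iff relation_fun_def sigma_apply split: list.splits)

lemma relation_fun_closed [simp]: "relation_fun c \<in> carrier P"
proof -
  have "finite {q. relation_fun c q \<noteq> 0}"
    by (rule finite_subset[of _ "(\<lambda>x. ([x, bar x], arrow_target x)) ` arrows n"])
      (auto simp: relation_fun_def split: list.splits if_splits)
  then show ?thesis
    by (auto simp: path_algebra_carrier relation_fun_def arrow_target_less split: list.splits if_splits)
qed

section \<open>The quotient of the path algebra by the relations\<close>

lemma relations_closed: "relations n \<subseteq> carrier P"
  by (auto simp: relations_eq)

sublocale rel: ideal "relation_ideal n" P
  unfolding relation_ideal_def by (rule P.genideal_ideal[OF relations_closed])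

sublocale A: ring "preproj n :: (path \<Rightarrow> 'a) set ring"
  unfolding preproj_def by (rule rel.quotient_is_ring)

lemma proj_ring_hom: "proj n \<in> ring_hom P A"
  using rel.rcos_ring_hom unfolding proj_def preproj_def by simp

sublocale proj: ring_hom_ring P A "proj n"
  by (intro ring_hom_ringI2 P.ring_axioms A.ring_axioms proj_ring_hom)

lemma proj_eq_iff: "f \<in> carrier P \<Longrightarrow> g \<in> carrier P \<Longrightarrow> proj n f = proj n g \<longleftrightarrow> f \<ominus>\<^bsub>P\<^esub> g \<in> relation_ideal n"
  unfolding proj_def by (rule P.quotient_eq_iff_same_a_r_cos[OF rel.ideal_axioms, symmetric])

lemma proj_surj: "carrier A = proj n ` carrier P"
  unfolding preproj_def proj_def FactRing_def A_RCOSETS_def' by auto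

lemma proj_relation: "r \<in> relations n \<Longrightarrow> proj n r = \<zero>\<^bsub>A\<^esub>"
proof -
  assume "r \<in> relations n"
  then have "r \<in> relation_ideal n" and "r \<in> carrier P"
    unfolding relation_ideal_def using P.genideal_self[OF relations_closed] relations_closed by auto
  then have "proj n r = proj n \<zero>\<^bsub>P\<^esub>"
    by (subst proj_eq_iff) (auto simp: a_minus_def)
  then show ?thesis by simp
qed

end

section \<open>The spaces of Koszul chains\<close>

context type_D begin

definition homogeneous :: "nat \<Rightarrow> (path \<Rightarrow> 'a) \<Rightarrow> bool" where
  "homogeneous d f \<longleftrightarrow> (\<forall>q. f q \<noteq> 0 \<longrightarrow> length (fst q) = d)"

lemma homogeneousD: "homogeneous d f \<Longrightarrow> f q \<noteq> 0 \<Longrightarrow> length (fst q) = d"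
  unfolding homogeneous_def by blast

lemma tensor_power_iff: "f \<in> tensor_power n d \<longleftrightarrow> f \<in> carrier P \<and> homogeneous d f"
  by (simp add: tensor_power_def homogeneous_def)

lemma homogeneous_mult_left:
  "homogeneous d f \<Longrightarrow> (f \<otimes>\<^bsub>P\<^esub> g) (xs, s) =
    (if d \<le> length xs then f (take d xs, path_target (drop d xs, s)) * g (drop d xs, s) else 0)"
  by (rule mult_homogeneous_left) (rule homogeneousD)

lemma homogeneous_mult_right:
  "homogeneous d g \<Longrightarrow> length ys = d \<Longrightarrow>
    (f \<otimes>\<^bsub>P\<^esub> g) (xs @ ys, s) = f (xs, path_target (ys, s)) * g (ys, s)"
  by (rule mult_homogeneous_right) (rule homogeneousD)

lemma homogeneous_mult:
  assumes "homogeneous d f" "homogeneous e g"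
  shows "homogeneous (d + e) (f \<otimes>\<^bsub>P\<^esub> g)"
  unfolding homogeneous_def
proof (intro allI impI)
  fix q assume nz: "(f \<otimes>\<^bsub>P\<^esub> g) q \<noteq> 0"
  obtain xs s where q: "q = (xs, s)" by fastforce
  have "d \<le> length xs \<and> g (drop d xs, s) \<noteq> 0"
    using nz unfolding q homogeneous_mult_left[OF assms(1)] by (auto split: if_splits)
  then show "length (fst q) = d + e"
    using homogeneousD[OF assms(2)] by (fastforce simp: q)
qed

lemma zero_apply: "\<zero>\<^bsub>P\<^esub> q = 0"
  by (simp add: path_algebra_zero)

lemma homogeneous_zero [simp]: "homogeneous d \<zero>\<^bsub>P\<^esub>"
  by (simp add: homogeneous_def zero_apply)

lemma homogeneous_add: "homogeneous d f \<Longrightarrow> homogeneous d g \<Longrightarrow> homogeneous d (f \<oplus>\<^bsub>P\<^esub> g)"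
  unfolding homogeneous_def path_algebra_add by (metis add.right_neutral)

lemma homogeneous_scaled: "homogeneous d f \<Longrightarrow> homogeneous d (scaled c f)"
  by (simp add: homogeneous_def)

lemma homogeneous_relation_fun: "homogeneous 2 (relation_fun c)"
  by (auto simp: homogeneous_def relation_fun_def split: list.split_asm)

lemma tensor_power0_mult:
  assumes "homogeneous 0 c"
  shows "(c \<otimes>\<^bsub>P\<^esub> f) (xs, s) = c ([], path_target (xs, s)) * f (xs, s)"
  by (simp add: homogeneous_mult_left[OF assms])

lemma mult_tensor_power0:
  assumes "homogeneous 0 c"
  shows "(f \<otimes>\<^bsub>P\<^esub> c) (xs, s) = f (xs, s) * c ([], s)"
  using homogeneous_mult_right[OF assms, of "[]" f xs s] by simp

lemma one_tensor_power [simp]: "\<one>\<^bsub>P\<^esub> \<in> tensor_power n 0"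
  unfolding tensor_power_iff homogeneous_def by (auto simp: path_algebra_one)

lemma scaled_tensor_power: "f \<in> tensor_power n d \<Longrightarrow> scaled (c :: 'a) f \<in> tensor_power n d"
  by (simp add: tensor_power_iff homogeneous_scaled scaled_closed)

lemma vertex_tensor_power [simp]: "i < n \<Longrightarrow> vertex_elt i \<in> (tensor_power n 0 :: (path \<Rightarrow> 'a) set)"
  by (simp add: tensor_power_iff homogeneous_def) (simp add: vertex_elt_path path_elt_def)

lemma arrow_tensor_power [simp]: "x \<in> arrows n \<Longrightarrow> arrow_elt x \<in> (tensor_power n (Suc 0) :: (path \<Rightarrow> 'a) set)"
  by (simp add: tensor_power_iff homogeneous_def) (simp add: arrow_elt_path path_elt_def)

text \<open>Induction on the number of summands: to bound a tensor product from above it is enough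
  to look at products and at sums of two elements.\<close>

lemma tensor_subset:
  assumes closed: "S \<subseteq> carrier P" "T \<subseteq> carrier P" and zero: "\<zero>\<^bsub>P\<^esub> \<in> X"
    and add: "\<And>f g. f \<in> X \<Longrightarrow> g \<in> X \<Longrightarrow> f \<oplus>\<^bsub>P\<^esub> g \<in> X"
    and mult: "\<And>f g. f \<in> S \<Longrightarrow> g \<in> T \<Longrightarrow> f \<otimes>\<^bsub>P\<^esub> g \<in> X"
  shows "tensor n S T \<subseteq> X"
proof
  fix w assume "w \<in> tensor n S T"
  then obtain N :: nat and u v where w: "w = (\<Oplus>\<^bsub>P\<^esub>j\<in>{..<N}. u j \<otimes>\<^bsub>P\<^esub> v j)"
    and uv: "\<forall>j<N. u j \<in> S \<and> v j \<in> T"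
    unfolding tensor_def by auto
  have "(\<Oplus>\<^bsub>P\<^esub>j\<in>{..<M}. u j \<otimes>\<^bsub>P\<^esub> v j) \<in> X" if "M \<le> N" for M
    using that
  proof (induction M)
    case 0
    then show ?case using zero by simp
  next
    case (Suc M)
    have "u j \<otimes>\<^bsub>P\<^esub> v j \<in> carrier P" if "j \<le> M" for j
      using that Suc.prems uv closed by (intro P.m_closed) auto
    then have "(\<Oplus>\<^bsub>P\<^esub>j\<in>{..<Suc M}. u j \<otimes>\<^bsub>P\<^esub> v j) =
        (u M \<otimes>\<^bsub>P\<^esub> v M) \<oplus>\<^bsub>P\<^esub> (\<Oplus>\<^bsub>P\<^esub>j\<in>{..<M}. u j \<otimes>\<^bsub>P\<^esub> v j)"
      unfolding lessThan_Suc by (intro P.finsum_insert) auto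
    then show ?case
      using Suc uv by (simp add: add mult)
  qed
  then show "w \<in> X" by (simp add: w)
qed

lemma tensor_mult:
  assumes "f \<in> S" "g \<in> T" "S \<subseteq> carrier P" "T \<subseteq> carrier P"
  shows "f \<otimes>\<^bsub>P\<^esub> g \<in> tensor n S T"
proof -
  have "f \<otimes>\<^bsub>P\<^esub> g = (\<Oplus>\<^bsub>P\<^esub>j\<in>{..<1::nat}. f \<otimes>\<^bsub>P\<^esub> g)"
    using assms by (simp add: lessThan_Suc subset_iff)
  then show ?thesis
    unfolding tensor_def using assms(1,2)
    by (intro CollectI exI[of _ "1::nat"] exI[of _ "\<lambda>_. f"] exI[of _ "\<lambda>_. g"]) auto
qed

lemma tensor_zero: "\<zero>\<^bsub>P\<^esub> \<in> tensor n S T"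
  unfolding tensor_def by (intro CollectI exI[of _ "0::nat"]) auto

section \<open>The space of relations as a bimodule over k\<close>

lemma relation_fun_left:
  assumes "homogeneous 0 c"
  shows "c \<otimes>\<^bsub>P\<^esub> relation_fun d = relation_fun (\<lambda>i. c ([], i) * d i)"
proof (rule ext, rule prod.induct)
  fix xs s show "(c \<otimes>\<^bsub>P\<^esub> relation_fun d) (xs, s) = relation_fun (\<lambda>i. c ([], i) * d i) (xs, s)"
    unfolding tensor_power0_mult[OF assms] by (auto simp: relation_fun_def split: list.splits)
qed

lemma relation_fun_right:
  assumes "homogeneous 0 c"
  shows "relation_fun d \<otimes>\<^bsub>P\<^esub> c = relation_fun (\<lambda>i. d i * c ([], i))"
proof (rule ext, rule prod.induct)
  fix xs s show "(relation_fun d \<otimes>\<^bsub>P\<^esub> c) (xs, s) = relation_fun (\<lambda>i. d i * c ([], i)) (xs, s)"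
    unfolding mult_tensor_power0[OF assms] by (auto simp: relation_fun_def split: list.splits)
qed

lemma relation_fun_add: "relation_fun c \<oplus>\<^bsub>P\<^esub> relation_fun d = relation_fun (\<lambda>i. c i + d i)"
  by (auto simp: fun_eq_iff path_algebra_add relation_fun_def algebra_simps split: list.splits)

lemma relation_fun_zero: "relation_fun (\<lambda>i. 0) = \<zero>\<^bsub>P\<^esub>"
  by (auto simp: fun_eq_iff path_algebra_zero relation_fun_def split: list.splits)

lemma relation_fun_zero_apply: "relation_fun (\<lambda>i. 0) q = 0"
  by (simp add: relation_fun_zero zero_apply)

lemma relation_fun_scaled: "scaled a (relation_fun c) = relation_fun (\<lambda>i. a * c i)"
  by (auto simp: fun_eq_iff relation_fun_def split: list.splits)

lemma tensor_power_closed: "tensor_power n d \<subseteq> carrier P"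
  by (auto simp: tensor_power_iff)

lemma W0: "W n 0 = tensor_power n 0" and W1: "W n (Suc 0) = tensor_power n 1"
  by (simp_all add: W_def)

text \<open>For p = 2 the defining formula has a factor k on each side of R. As R is stable under k,
  it absorbs both, and the unit of k gives the converse inclusion.\<close>

lemma W2: "W n 2 = (relations n :: (path \<Rightarrow> 'a) set)"
proof -
  let ?R = "relations n :: (path \<Rightarrow> 'a) set" and ?T = "tensor_power n 0 :: (path \<Rightarrow> 'a) set"
  have "{tensor n (tensor n (tensor_power n i) ?R) (tensor_power n j) | i j. i + 2 + j = 2} =
      {tensor n (tensor n ?T ?R) ?T}"
    by auto
  then have W: "W n 2 = tensor n (tensor n ?T ?R) ?T"
    by (simp add: W_def)
  have "tensor n ?T ?R \<subseteq> ?R"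
  proof (rule tensor_subset[OF tensor_power_closed relations_closed])
    show "\<zero>\<^bsub>P\<^esub> \<in> ?R" unfolding relations_eq relation_fun_zero[symmetric] by (rule rangeI)
  qed (auto simp: relations_eq relation_fun_add relation_fun_left tensor_power_iff)
  then have 1: "tensor n ?T ?R \<subseteq> ?R" .
  then have closed: "tensor n ?T ?R \<subseteq> carrier P"
    using relations_closed by blast
  have "tensor n (tensor n ?T ?R) ?T \<subseteq> ?R"
  proof (rule tensor_subset[OF closed tensor_power_closed])
    show "\<zero>\<^bsub>P\<^esub> \<in> ?R" unfolding relations_eq relation_fun_zero[symmetric] by (rule rangeI)
    fix f g assume "f \<in> tensor n ?T ?R" "g \<in> ?T"
    then obtain c where "f = relation_fun c" "homogeneous 0 g"
      using 1 by (auto simp: relations_eq tensor_power_iff)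
    then show "f \<otimes>\<^bsub>P\<^esub> g \<in> ?R"
      by (simp add: relations_eq relation_fun_right)
  qed (auto simp: relations_eq relation_fun_add)
  moreover have "?R \<subseteq> tensor n (tensor n ?T ?R) ?T"
  proof
    fix r assume r: "r \<in> ?R"
    then have "(\<one>\<^bsub>P\<^esub> \<otimes>\<^bsub>P\<^esub> r) \<otimes>\<^bsub>P\<^esub> \<one>\<^bsub>P\<^esub> \<in> tensor n (tensor n ?T ?R) ?T"
      by (intro tensor_mult closed tensor_power_closed relations_closed one_tensor_power)
    then show "r \<in> tensor n (tensor n ?T ?R) ?T"
      using r relations_closed by (auto simp: subset_iff)
  qed
  ultimately show ?thesis by (simp add: W)
qed

text \<open>What membership in the tensor product of V^i, R and V^j means for coefficients: with the
  outer letters fixed, the two letters in the window vary as in a relation.\<close>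

lemma tensor_relation_slice:
  assumes w: "w \<in> tensor n (tensor n (tensor_power n i) (relations n)) (tensor_power n j)"
  shows "w \<in> carrier P" "homogeneous (i + 2 + j) w"
    "length pre = i \<Longrightarrow> length suf = j \<Longrightarrow>
      \<exists>c. \<forall>x y. w (pre @ [x, y] @ suf, s) = relation_fun c ([x, y], path_target (suf, s))"
proof -
  let ?R = "relations n :: (path \<Rightarrow> 'a) set"
  \<comment> \<open>\<open>?X\<close> treats the left and middle factors and \<open>?Y\<close> adds
    the right one. Both are stable under sums because relations are, so only single products have to
    be examined.\<close>
  let ?X = "{w \<in> carrier P. homogeneous (i + 2) w \<and> (\<forall>pre t. length pre = i \<longrightarrow>
      (\<exists>c. \<forall>x y. w (pre @ [x, y], t) = relation_fun c ([x, y], t)))}"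
  let ?Y = "{w \<in> carrier P. homogeneous (i + 2 + j) w \<and> (\<forall>pre suf s. length pre = i \<longrightarrow> length suf = j \<longrightarrow>
      (\<exists>c. \<forall>x y. w (pre @ [x, y] @ suf, s) = relation_fun c ([x, y], path_target (suf, s))))}"
  have X: "tensor n (tensor_power n i) ?R \<subseteq> ?X"
  proof (rule tensor_subset[OF tensor_power_closed relations_closed])
    show "\<zero>\<^bsub>P\<^esub> \<in> ?X"
      by (auto simp: relation_fun_zero_apply zero_apply intro!: exI[of _ "\<lambda>_. 0"])
  next
    fix f g assume fg: "f \<in> ?X" "g \<in> ?X"
    have "\<exists>c. \<forall>x y. (f \<oplus>\<^bsub>P\<^esub> g) (pre @ [x, y], t) = relation_fun c ([x, y], t)"
      if pre: "length pre = i" for pre t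
    proof -
      obtain c d where "\<forall>x y. f (pre @ [x, y], t) = relation_fun c ([x, y], t)"
        "\<forall>x y. g (pre @ [x, y], t) = relation_fun d ([x, y], t)"
        using fg pre by blast
      then show ?thesis
        by (intro exI[of _ "\<lambda>i. c i + d i"]) (simp add: relation_fun_add[symmetric] path_algebra_add)
    qed
    then show "f \<oplus>\<^bsub>P\<^esub> g \<in> ?X" using fg by (simp add: homogeneous_add)
  next
    fix f :: "path \<Rightarrow> 'a" and g assume f: "f \<in> tensor_power n i" and "g \<in> ?R"
    then obtain d where g: "g = relation_fun d" by (auto simp: relations_eq)
    have "(f \<otimes>\<^bsub>P\<^esub> g) (pre @ [x, y], t) = relation_fun (\<lambda>i. f (pre, i) * d i) ([x, y], t)" for pre x y t
      using homogeneous_mult_right[OF homogeneous_relation_fun, of "[x, y]" f d pre t]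
      by (simp add: g relation_fun_def)
    moreover have "homogeneous (i + 2) (f \<otimes>\<^bsub>P\<^esub> g)"
      using f by (auto simp only: g tensor_power_iff intro!: homogeneous_mult homogeneous_relation_fun)
    ultimately show "f \<otimes>\<^bsub>P\<^esub> g \<in> ?X"
      using f by (auto simp: g tensor_power_iff)
  qed
  have "tensor n (tensor n (tensor_power n i) ?R) (tensor_power n j) \<subseteq> ?Y"
  proof (rule tensor_subset[OF _ tensor_power_closed])
    show "tensor n (tensor_power n i) ?R \<subseteq> carrier P" using X by blast
    show "\<zero>\<^bsub>P\<^esub> \<in> ?Y"
      by (auto simp: relation_fun_zero_apply zero_apply intro!: exI[of _ "\<lambda>_. 0"])
  next
    fix f g assume fg: "f \<in> ?Y" "g \<in> ?Y"
    have "\<exists>c. \<forall>x y. (f \<oplus>\<^bsub>P\<^esub> g) (pre @ [x, y] @ suf, s) = relation_fun c ([x, y], path_target (suf, s))"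
      if pre: "length pre = i" "length suf = j" for pre suf s
    proof -
      obtain c d where "\<forall>x y. f (pre @ [x, y] @ suf, s) = relation_fun c ([x, y], path_target (suf, s))"
        "\<forall>x y. g (pre @ [x, y] @ suf, s) = relation_fun d ([x, y], path_target (suf, s))"
        using fg pre by blast
      then show ?thesis
        by (intro exI[of _ "\<lambda>i. c i + d i"]) (simp add: relation_fun_add[symmetric] path_algebra_add)
    qed
    then show "f \<oplus>\<^bsub>P\<^esub> g \<in> ?Y" using fg by (simp add: homogeneous_add)
  next
    fix f g :: "path \<Rightarrow> 'a" assume "f \<in> tensor n (tensor_power n i) ?R" and g: "g \<in> tensor_power n j"
    then have f: "f \<in> ?X" using X by blast
    have "\<exists>c. \<forall>x y. (f \<otimes>\<^bsub>P\<^esub> g) (pre @ [x, y] @ suf, s) = relation_fun c ([x, y], path_target (suf, s))"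
      if pre: "length pre = i" "length suf = j" for pre suf s
    proof -
      obtain c where c: "\<forall>x y. f (pre @ [x, y], path_target (suf, s)) = relation_fun c ([x, y], path_target (suf, s))"
        using f pre by blast
      have "homogeneous j g" using g by (simp add: tensor_power_iff)
      then have "(f \<otimes>\<^bsub>P\<^esub> g) (pre @ [x, y] @ suf, s) =
          f (pre @ [x, y], path_target (suf, s)) * g (suf, s)" for x y
        using homogeneous_mult_right[of j g suf f "pre @ [x, y]" s] pre(2) by simp
      then show ?thesis using c
        by (intro exI[of _ "\<lambda>i. g (suf, s) * c i"])
          (simp add: relation_fun_scaled[symmetric])
    qed
    moreover have "homogeneous (i + 2 + j) (f \<otimes>\<^bsub>P\<^esub> g)"
      using f g by (auto simp only: tensor_power_iff intro!: homogeneous_mult)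
    ultimately show "f \<otimes>\<^bsub>P\<^esub> g \<in> ?Y"
      using f g by (auto simp: tensor_power_iff)
  qed
  then have "w \<in> ?Y" using w by blast
  then show "w \<in> carrier P" "homogeneous (i + 2 + j) w"
    "length pre = i \<Longrightarrow> length suf = j \<Longrightarrow>
      \<exists>c. \<forall>x y. w (pre @ [x, y] @ suf, s) = relation_fun c ([x, y], path_target (suf, s))"
    by blast+
qed

text \<open>The quiver is connected with more than two vertices, so every edge shares one of its ends with
  another edge.\<close>

lemma exists_adjacent_arrow:
  assumes "x \<in> arrows n"
  shows "\<exists>y\<in>arrows n. y \<noteq> x \<and> arrow_target y = arrow_target x \<or>
    y \<noteq> bar x \<and> arrow_target y = arrow_source x"
proof -
  have "\<exists>y\<in>arrows_into n i. y \<noteq> z" if "2 \<le> i" "i < n - 1" for i z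
    using that by (cases z) (auto simp: arrows_into_cases)
  moreover have "2 \<le> arrow_target x \<and> arrow_target x < n - 1 \<or> 2 \<le> arrow_source x \<and> arrow_source x < n - 1"
    using assms n_ge_4 by (cases x) (auto simp: arrows_def)
  ultimately show ?thesis unfolding arrows_into_def by blast
qed

text \<open>Take a path with nonzero coefficient and look at its first three letters, which are
  covered by two overlapping windows. Either window allows one summand of a relation to be exchanged
  for another, given by an adjacent arrow; the other window then rules out the resulting
  path.\<close>

lemma W_ge_3:
  assumes "p \<ge> 3" shows "W n p = {\<zero>\<^bsub>P\<^esub>}"
proof -
  have "w = \<zero>\<^bsub>P\<^esub>" if w: "w \<in> W n p" for w
  proof (rule ccontr)
    assume "w \<noteq> \<zero>\<^bsub>P\<^esub>"
    then obtain q where q: "w q \<noteq> 0" by (auto simp: path_algebra_zero fun_eq_iff)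
    have slice: "w \<in> tensor n (tensor n (tensor_power n i) (relations n)) (tensor_power n j)"
      if "i + 2 + j = p" for i j
      using w assms that unfolding W_def by auto
    have w0: "w \<in> tensor n (tensor n (tensor_power n 0) (relations n)) (tensor_power n (p - 2))"
      and w1: "w \<in> tensor n (tensor n (tensor_power n 1) (relations n)) (tensor_power n (p - 3))"
      using assms by (auto intro!: slice)
    have "length (fst q) = p"
      using homogeneousD[OF tensor_relation_slice(2)[OF w0] q] assms by simp
    then obtain x y z suf s where q_eq: "q = (x # y # z # suf, s)" and len: "length suf = p - 3"
      using assms by (cases q; cases "fst q"; cases "tl (fst q)"; cases "tl (tl (fst q))") auto
    have "length (z # suf) = p - 2" using len assms by simp
    then obtain c where c: "\<And>x y. w ([] @ [x, y] @ z # suf, s) = relation_fun c ([x, y], path_target (z # suf, s))"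
      using tensor_relation_slice(3)[OF w0, of "[]" "z # suf" s] by blast
    obtain d where d: "\<And>y z. w ([x] @ [y, z] @ suf, s) = relation_fun d ([y, z], path_target (suf, s))"
      using tensor_relation_slice(3)[OF w1, of "[x]" suf s] len by auto
    \<comment> \<open>Both windows contain relations, so the second letter is bar(x) and the third
      is the bar of the second, hence x again. The coefficients of both relations at the relevant
      vertices are nonzero.\<close>
    have xyz: "x \<in> arrows n" "y = bar x" "z = x" "path_target (z # suf, s) = arrow_target x"
        "c (arrow_target x) \<noteq> 0" "path_target (suf, s) = arrow_source x" "d (arrow_source x) \<noteq> 0"
      using q c[of x y] d[of y z] unfolding q_eq relation_fun_def by (auto split: if_splits)
    obtain x' where x': "x' \<in> arrows n" "x' \<noteq> x \<and> arrow_target x' = arrow_target x \<or>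
        x' \<noteq> bar x \<and> arrow_target x' = arrow_source x"
      using exists_adjacent_arrow[OF xyz(1)] by blast
    show False
    proof (cases "x' \<noteq> x \<and> arrow_target x' = arrow_target x")
      \<comment> \<open>By the first window the path x' bar(x') x ... also has a nonzero
        coefficient, but the second window would then force x = x'.\<close>
      case True
      obtain d' where "\<And>y z. w ([x'] @ [y, z] @ suf, s) = relation_fun d' ([y, z], path_target (suf, s))"
        using tensor_relation_slice(3)[OF w1, of "[x']" suf s] len by auto
      from this[of "bar x'" z] have "w ([x', bar x', z] @ suf, s) = 0"
        using True xyz by (auto simp: relation_fun_def)
      then show False
        using c[of x' "bar x'"] True x'(1) xyz by (auto simp: relation_fun_def)
    next
      \<comment> \<open>By the second window the path x x' bar(x') ... has a nonzero coefficient,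
        but the first window would then force x' = bar(x).\<close>
      case False
      then have x'_bar: "x' \<noteq> bar x" "arrow_target x' = arrow_source x" using x'(2) by auto
      have "length (bar x' # suf) = p - 2" using len assms by simp
      then obtain c' where "\<And>u v. w ([] @ [u, v] @ bar x' # suf, s) = relation_fun c' ([u, v], path_target (bar x' # suf, s))"
        using tensor_relation_slice(3)[OF w0, of "[]" "bar x' # suf" s] by blast
      from this[of x x'] have "w ([x, x', bar x'] @ suf, s) = 0"
        using x'_bar by (auto simp: relation_fun_def)
      then show False
        using d[of x' "bar x'"] x'_bar x'(1) xyz by (auto simp: relation_fun_def)
    qed
  qed
  moreover have "\<zero>\<^bsub>P\<^esub> \<in> W n p"
    using assms tensor_zero by (auto simp: W_def)
  ultimately show ?thesis by blast
qed

end

section \<open>Bimodule maps on Koszul chains\<close>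

context type_D begin

lemma W_cases:
  obtains "p < 2" "W n p = (tensor_power n p :: (path \<Rightarrow> 'a) set)"
  | "p = 2" "W n p = (relations n :: (path \<Rightarrow> 'a) set)"
  | "p \<ge> 3" "W n p = {\<zero>\<^bsub>P\<^esub>}"
proof -
  consider "p < 2" | "p = 2" | "p \<ge> 3" by linarith
  then show ?thesis
    using that W2 W_ge_3 by cases (auto simp: W_def)
qed

section \<open>Closure properties of the spaces of Koszul chains\<close>

lemma W_closed: "w \<in> W n p \<Longrightarrow> w \<in> carrier P"
  using relations_closed by (cases rule: W_cases[of p]) (auto simp: tensor_power_iff)

lemma W_homogeneous: "w \<in> W n p \<Longrightarrow> homogeneous p w"
  by (cases rule: W_cases[of p])
    (auto simp: tensor_power_iff relations_eq intro: homogeneous_relation_fun[simplified])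

lemma W_zero [simp]: "\<zero>\<^bsub>P\<^esub> \<in> W n p"
proof (cases rule: W_cases[of p])
  case 2
  then show ?thesis unfolding relation_fun_zero[symmetric] by (simp add: relations_eq)
qed (auto simp: tensor_power_iff)

lemma W_add: "v \<in> W n p \<Longrightarrow> w \<in> W n p \<Longrightarrow> v \<oplus>\<^bsub>P\<^esub> w \<in> W n p"
  by (cases rule: W_cases[of p])
    (auto simp: tensor_power_iff homogeneous_add relations_eq relation_fun_add)

lemma W_left:
  assumes "c \<in> tensor_power n 0" "w \<in> W n p" shows "c \<otimes>\<^bsub>P\<^esub> w \<in> W n p"
  using assms
  by (cases rule: W_cases[of p])
    (auto simp: tensor_power_iff relations_eq relation_fun_left intro: homogeneous_mult[of 0, simplified])

lemma W_right:
  assumes "c \<in> tensor_power n 0" "w \<in> W n p" shows "w \<otimes>\<^bsub>P\<^esub> c \<in> W n p"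
  using assms
  by (cases rule: W_cases[of p])
    (auto simp: tensor_power_iff relations_eq relation_fun_right intro: homogeneous_mult[of _ _ 0, simplified])

lemma W_scaled: "w \<in> W n p \<Longrightarrow> scaled (c :: 'a) w \<in> W n p"
  using W_left[of "scaled c \<one>\<^bsub>P\<^esub>" w p] scaled_one[of w c] W_closed[of w p]
  by (simp add: scaled_tensor_power)

lemma W_finsum: "(\<And>j. j \<in> S \<Longrightarrow> u j \<in> W n p) \<Longrightarrow> (\<Oplus>\<^bsub>P\<^esub>j\<in>S. u j) \<in> W n p"
proof (induction S rule: infinite_finite_induct)
  case (insert j S)
  then have "(\<Oplus>\<^bsub>P\<^esub>j\<in>insert j S. u j) = u j \<oplus>\<^bsub>P\<^esub> (\<Oplus>\<^bsub>P\<^esub>j\<in>S. u j)"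
    using W_closed by (intro P.finsum_insert) auto
  then show ?case using insert by (simp add: W_add)
qed auto

section \<open>The ground field inside A\<close>

definition scalar :: "'a \<Rightarrow> (path \<Rightarrow> 'a) set" where
  "scalar c = proj n (scaled c \<one>\<^bsub>P\<^esub>)"

lemma scaled_one_closed [simp]: "scaled c \<one>\<^bsub>P\<^esub> \<in> carrier P"
  by (simp add: scaled_closed)

lemma scalar_closed [simp]: "scalar c \<in> carrier A"
  by (simp add: scalar_def)

lemma scalar_mult: "scalar c \<otimes>\<^bsub>A\<^esub> scalar d = scalar (c * d)"
  unfolding scalar_def proj.hom_mult[OF scaled_one_closed scaled_one_closed, symmetric]
  by (simp add: scaled_mult mult.assoc)

lemma scalar_add: "scalar c \<oplus>\<^bsub>A\<^esub> scalar d = scalar (c + d)"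
  unfolding scalar_def proj.hom_add[OF scaled_one_closed scaled_one_closed, symmetric]
  by (simp add: path_algebra_add algebra_simps)

lemma scalar_1 [simp]: "scalar 1 = \<one>\<^bsub>A\<^esub>"
  by (simp add: scalar_def)

lemma scalar_0 [simp]: "scalar 0 = \<zero>\<^bsub>A\<^esub>"
  using proj.hom_zero by (simp add: scalar_def path_algebra_zero)

lemma scalar_minus: "scalar (- c) = \<ominus>\<^bsub>A\<^esub> scalar c"
  using scalar_add[of c "- c"] by (intro A.minus_equality[symmetric]) (simp_all add: scalar_add)

lemma scalar_minus_1: "x \<in> carrier A \<Longrightarrow> scalar (- 1) \<otimes>\<^bsub>A\<^esub> x = \<ominus>\<^bsub>A\<^esub> x"
  by (simp add: scalar_minus A.l_minus)

lemma scalar_commute: "x \<in> carrier A \<Longrightarrow> x \<otimes>\<^bsub>A\<^esub> scalar c = scalar c \<otimes>\<^bsub>A\<^esub> x"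
proof -
  assume "x \<in> carrier A"
  then obtain f where f: "f \<in> carrier P" "x = proj n f" using proj_surj by auto
  have "f \<otimes>\<^bsub>P\<^esub> scaled c \<one>\<^bsub>P\<^esub> = scaled c \<one>\<^bsub>P\<^esub> \<otimes>\<^bsub>P\<^esub> f"
    using f by (simp add: mult_scaled scaled_mult)
  then show ?thesis
    unfolding scalar_def f using f(1) by (simp flip: proj.hom_mult)
qed

lemma scalar_left_commute:
  "x \<in> carrier A \<Longrightarrow> y \<in> carrier A \<Longrightarrow> x \<otimes>\<^bsub>A\<^esub> (scalar c \<otimes>\<^bsub>A\<^esub> y) = scalar c \<otimes>\<^bsub>A\<^esub> (x \<otimes>\<^bsub>A\<^esub> y)"
  by (simp add: A.m_assoc[symmetric] scalar_commute)

text \<open>Cochains without the convention on values outside \<open>W n p\<close>, so that the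
  projection \<open>proj n\<close>, which enters the differential, can be treated on the same
  footing.\<close>

definition bimodule_map :: "nat \<Rightarrow> 'a cochain \<Rightarrow> bool" where
  "bimodule_map p f \<longleftrightarrow> f \<in> W n p \<rightarrow> carrier A \<and>
     (\<forall>w\<in>W n p. \<forall>w'\<in>W n p. f (w \<oplus>\<^bsub>P\<^esub> w') = f w \<oplus>\<^bsub>A\<^esub> f w') \<and>
     (\<forall>c\<in>tensor_power n 0. \<forall>d\<in>tensor_power n 0. \<forall>w\<in>W n p.
        f (c \<otimes>\<^bsub>P\<^esub> w \<otimes>\<^bsub>P\<^esub> d) = proj n c \<otimes>\<^bsub>A\<^esub> f w \<otimes>\<^bsub>A\<^esub> proj n d)"

lemma cochains_iff: "f \<in> cochains n p \<longleftrightarrow> bimodule_map p f \<and> f \<in> extensional (W n p)"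
  unfolding cochains_def bimodule_map_def PiE_def by auto

lemma proj_tensor_power [simp]: "c \<in> tensor_power n d \<Longrightarrow> proj n c \<in> carrier A"
  by (simp add: tensor_power_iff)

context
  fixes p f assumes f: "bimodule_map p f"
begin

lemma bimodule_map_closed: "w \<in> W n p \<Longrightarrow> f w \<in> carrier A"
  and bimodule_map_add: "w \<in> W n p \<Longrightarrow> w' \<in> W n p \<Longrightarrow> f (w \<oplus>\<^bsub>P\<^esub> w') = f w \<oplus>\<^bsub>A\<^esub> f w'"
  using f by (auto simp: bimodule_map_def)

lemma bimodule_map_left:
  assumes "c \<in> tensor_power n 0" "w \<in> W n p" shows "f (c \<otimes>\<^bsub>P\<^esub> w) = proj n c \<otimes>\<^bsub>A\<^esub> f w"
proof -
  have "f (c \<otimes>\<^bsub>P\<^esub> w \<otimes>\<^bsub>P\<^esub> \<one>\<^bsub>P\<^esub>) = proj n c \<otimes>\<^bsub>A\<^esub> f w \<otimes>\<^bsub>A\<^esub> proj n \<one>\<^bsub>P\<^esub>"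
    using f assms one_tensor_power unfolding bimodule_map_def by blast
  then show ?thesis
    using assms W_closed[of w p] bimodule_map_closed[of w] by (simp add: tensor_power_iff)
qed

lemma bimodule_map_right:
  assumes "c \<in> tensor_power n 0" "w \<in> W n p" shows "f (w \<otimes>\<^bsub>P\<^esub> c) = f w \<otimes>\<^bsub>A\<^esub> proj n c"
proof -
  have "f (\<one>\<^bsub>P\<^esub> \<otimes>\<^bsub>P\<^esub> w \<otimes>\<^bsub>P\<^esub> c) = proj n \<one>\<^bsub>P\<^esub> \<otimes>\<^bsub>A\<^esub> f w \<otimes>\<^bsub>A\<^esub> proj n c"
    using f assms one_tensor_power unfolding bimodule_map_def by blast
  then show ?thesis
    using assms W_closed[of w p] bimodule_map_closed[of w] by (simp add: tensor_power_iff)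
qed

lemma bimodule_map_scaled: "w \<in> W n p \<Longrightarrow> f (scaled c w) = scalar c \<otimes>\<^bsub>A\<^esub> f w"
  using bimodule_map_left[of "scaled c \<one>\<^bsub>P\<^esub>" w] scaled_one[of w c] W_closed[of w p]
  by (simp add: scaled_tensor_power scalar_def)

lemma bimodule_map_zero: "f \<zero>\<^bsub>P\<^esub> = \<zero>\<^bsub>A\<^esub>"
  using bimodule_map_add[of "\<zero>\<^bsub>P\<^esub>" "\<zero>\<^bsub>P\<^esub>"] bimodule_map_closed[of "\<zero>\<^bsub>P\<^esub>"] by simp

lemma bimodule_map_finsum:
  "(\<And>j. j \<in> S \<Longrightarrow> u j \<in> W n p) \<Longrightarrow> f (\<Oplus>\<^bsub>P\<^esub>j\<in>S. u j) = (\<Oplus>\<^bsub>A\<^esub>j\<in>S. f (u j))"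
proof (induction S rule: infinite_finite_induct)
  case (insert j S)
  then have "(\<Oplus>\<^bsub>P\<^esub>j\<in>insert j S. u j) = u j \<oplus>\<^bsub>P\<^esub> (\<Oplus>\<^bsub>P\<^esub>j\<in>S. u j)"
    using W_closed by (intro P.finsum_insert) auto
  moreover have "(\<Oplus>\<^bsub>A\<^esub>j\<in>insert j S. f (u j)) = f (u j) \<oplus>\<^bsub>A\<^esub> (\<Oplus>\<^bsub>A\<^esub>j\<in>S. f (u j))"
    using insert bimodule_map_closed by (intro A.finsum_insert) auto
  ultimately show ?case using insert by (simp add: bimodule_map_add W_finsum)
qed (auto simp: bimodule_map_zero)

end

text \<open>For p = 1 this is the cochain x -> x with which the Koszul differential
  convolves.\<close>

lemma bimodule_map_proj: "bimodule_map p (proj n)"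
  unfolding bimodule_map_def using W_closed by (auto simp: tensor_power_iff)

lemma bimodule_mapI:
  assumes "\<And>w. w \<in> W n p \<Longrightarrow> f w \<in> carrier A"
    and "\<And>w w'. w \<in> W n p \<Longrightarrow> w' \<in> W n p \<Longrightarrow> f (w \<oplus>\<^bsub>P\<^esub> w') = f w \<oplus>\<^bsub>A\<^esub> f w'"
    and "\<And>c w. c \<in> tensor_power n 0 \<Longrightarrow> w \<in> W n p \<Longrightarrow> f (c \<otimes>\<^bsub>P\<^esub> w) = proj n c \<otimes>\<^bsub>A\<^esub> f w"
    and "\<And>c w. c \<in> tensor_power n 0 \<Longrightarrow> w \<in> W n p \<Longrightarrow> f (w \<otimes>\<^bsub>P\<^esub> c) = f w \<otimes>\<^bsub>A\<^esub> proj n c"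
  shows "bimodule_map p f"
  using assms unfolding bimodule_map_def by (simp add: W_left)

text \<open>One chosen arrow into each vertex. The coefficients of a relation at a vertex agree up
  to sign, so the one at this arrow determines the coefficient of sigma_i.\<close>

definition lead_arrow :: "nat \<Rightarrow> arrow" where
  "lead_arrow i = (if i < 2 then Star i else Arr (i - 1))"

lemma lead_arrow: "i < n \<Longrightarrow> lead_arrow i \<in> arrows n" "i < n \<Longrightarrow> arrow_target (lead_arrow i) = i"
  using n_ge_4 by (auto simp: lead_arrow_def arrows_def)

definition relation_coeff :: "(path \<Rightarrow> 'a) \<Rightarrow> nat \<Rightarrow> 'a" where
  "relation_coeff r i = arrow_sign (lead_arrow i) * r ([lead_arrow i, bar (lead_arrow i)], i)"

lemma arrow_sign_square [simp]: "arrow_sign x * arrow_sign x = (1 :: 'a)"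
  by (cases x) auto

lemma relation_coeff_relation_fun: "i < n \<Longrightarrow> relation_coeff (relation_fun c) i = c i"
  by (simp add: relation_coeff_def relation_fun_def lead_arrow mult.left_commute)

lemma vertex_mult:
  "(f \<otimes>\<^bsub>P\<^esub> vertex_elt i) (xs, s) = (if s = i then f (xs, s) else 0)"
  "(vertex_elt i \<otimes>\<^bsub>P\<^esub> f) (xs, s) = (if path_target (xs, s) = i then f (xs, s) else 0)"
proof -
  have "homogeneous 0 (vertex_elt i)"
    by (simp add: homogeneous_def vertex_elt_def)
  then show "(f \<otimes>\<^bsub>P\<^esub> vertex_elt i) (xs, s) = (if s = i then f (xs, s) else 0)"
    "(vertex_elt i \<otimes>\<^bsub>P\<^esub> f) (xs, s) = (if path_target (xs, s) = i then f (xs, s) else 0)"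
    by (auto simp: tensor_power0_mult mult_tensor_power0 vertex_elt_def)
qed

text \<open>The coefficients at the paths in \<open>L\<close> are coordinates on \<open>W n p\<close>, as a bimodule over \<open>k\<close>.\<close>

lemma W_basis:
  obtains L :: "path set" and b :: "path \<Rightarrow> path \<Rightarrow> 'a" where
    "finite L" "\<And>l. l \<in> L \<Longrightarrow> b l \<in> W n p" "\<And>l. l \<in> L \<Longrightarrow> length (fst l) = p" "\<And>l. l \<in> L \<Longrightarrow> snd l < n"
    "\<And>l. l \<in> L \<Longrightarrow> b l \<otimes>\<^bsub>P\<^esub> vertex_elt (snd l) = b l"
    "\<And>u. u \<in> W n p \<Longrightarrow> u = (\<Oplus>\<^bsub>P\<^esub>l\<in>L. scaled (u l) (b l))"
proof -
  consider "p = 0" | "p = 1" | "p = 2" | "p \<ge> 3" by linarith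
  then show ?thesis
  proof cases
    case 1
    define L :: "path set" where "L = Pair [] ` {..<n}"
    show ?thesis
    proof (rule that[of L path_elt])
      fix u :: "path \<Rightarrow> 'a" assume u: "u \<in> W n p"
      show "u = (\<Oplus>\<^bsub>P\<^esub>l\<in>L. scaled (u l) (path_elt l))"
      proof
        fix q
        have "(\<Oplus>\<^bsub>P\<^esub>l\<in>L. scaled (u l) (path_elt l)) q = (\<Sum>l\<in>L. u l * path_elt l q)"
          by (rule finsum_apply) (auto simp: L_def intro!: scaled_closed)
        also have "\<dots> = (\<Sum>l\<in>L. if l = q then u l else 0)"
          by (intro sum.cong) (auto simp: path_elt_def)
        also have "\<dots> = u q"
        proof -
          have "q \<in> L" if "u q \<noteq> 0"
          proof -
            have "length (fst q) = 0" "is_path n q"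
              using W_homogeneous[OF u] W_closed[OF u] that homogeneousD[of 0 u q]
              unfolding path_algebra_carrier 1 by blast+
            then show ?thesis by (cases q) (auto simp: L_def)
          qed
          then show ?thesis by (auto simp: L_def)
        qed
        finally show "u q = (\<Oplus>\<^bsub>P\<^esub>l\<in>L. scaled (u l) (path_elt l)) q" ..
      qed
    qed (auto simp: L_def 1 W0 vertex_elt_path[symmetric] fun_eq_iff vertex_mult, auto simp: vertex_elt_def)
  next
    case 2
    define L :: "path set" where "L = (\<lambda>x. ([x], arrow_source x)) ` arrows n"
    show ?thesis
    proof (rule that[of L path_elt])
      fix u :: "path \<Rightarrow> 'a" assume u: "u \<in> W n p"
      show "u = (\<Oplus>\<^bsub>P\<^esub>l\<in>L. scaled (u l) (path_elt l))"
      proof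
        fix q
        have "(\<Oplus>\<^bsub>P\<^esub>l\<in>L. scaled (u l) (path_elt l)) q = (\<Sum>l\<in>L. u l * path_elt l q)"
          by (rule finsum_apply) (auto simp: L_def arrow_source_less intro!: scaled_closed)
        also have "\<dots> = (\<Sum>l\<in>L. if l = q then u l else 0)"
          by (intro sum.cong) (auto simp: path_elt_def)
        also have "\<dots> = u q"
        proof -
          have "q \<in> L" if "u q \<noteq> 0"
          proof -
            have "length (fst q) = 1" "is_path n q"
              using W_homogeneous[OF u] W_closed[OF u] that homogeneousD[of 1 u q]
              unfolding path_algebra_carrier 2 by blast+
            then show ?thesis by (cases q; cases "fst q") (auto simp: L_def)
          qed
          then show ?thesis by (auto simp: L_def)
        qed
        finally show "u q = (\<Oplus>\<^bsub>P\<^esub>l\<in>L. scaled (u l) (path_elt l)) q" ..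
      qed
    qed (auto simp: L_def 2 W1 arrow_elt_path[symmetric] arrow_source_less fun_eq_iff vertex_mult,
        auto simp: arrow_elt_def)
  next
    case 3
    define lead where "lead = (\<lambda>i. ([lead_arrow i, bar (lead_arrow i)], i))"
    define L :: "path set" where "L = lead ` {..<n}"
    \<comment> \<open>The sign makes the coefficient of \<open>b l\<close> at the path
      \<open>l\<close> equal to 1.\<close>
    define b :: "path \<Rightarrow> path \<Rightarrow> 'a" where
      "b = (\<lambda>l. relation_fun (\<lambda>i. if i = snd l then arrow_sign (lead_arrow i) else 0))"
    show ?thesis
    proof (rule that[of L b])
      fix u :: "path \<Rightarrow> 'a" assume "u \<in> W n p"
      then obtain c where u: "u = relation_fun c" by (auto simp: 3 W2 relations_eq)
      have inj: "inj_on lead {..<n}" by (auto simp: lead_def inj_on_def)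
      have "(\<Oplus>\<^bsub>P\<^esub>l\<in>L. scaled (u l) (b l)) q = u q" for q
      proof -
        have "(\<Oplus>\<^bsub>P\<^esub>l\<in>L. scaled (u l) (b l)) q = (\<Sum>l\<in>L. u l * b l q)"
          by (rule finsum_apply) (auto simp: b_def intro!: scaled_closed)
        also have "\<dots> = (\<Sum>i<n. u (lead i) * b (lead i) q)"
          unfolding L_def by (simp add: sum.reindex[OF inj])
        also have "\<dots> = (\<Sum>i<n. c i * sigma n i q)"
        proof (rule sum.cong)
          fix i assume i: "i \<in> {..<n}"
          have "u (lead i) = c i * arrow_sign (lead_arrow i)"
            using i by (simp add: u lead_def relation_fun_def lead_arrow)
          moreover have "b (lead i) = scaled (arrow_sign (lead_arrow i)) (sigma n i)"
            using i unfolding b_def sigma_relation_fun[OF i[simplified]] relation_fun_scaled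
            by (intro relation_fun_cong) (auto simp: lead_def)
          ultimately show "u (lead i) * b (lead i) q = c i * sigma n i q"
            by (simp add: mult.assoc)
        qed simp
        also have "\<dots> = u q" unfolding u by (rule fun_cong[OF relation_fun_eq])
        finally show ?thesis .
      qed
      then show "u = (\<Oplus>\<^bsub>P\<^esub>l\<in>L. scaled (u l) (b l))" by (auto simp: fun_eq_iff)
    next
      fix l assume "l \<in> L"
      have "homogeneous 0 (vertex_elt (snd l))"
        by (simp add: homogeneous_def vertex_elt_def)
      then show "b l \<otimes>\<^bsub>P\<^esub> vertex_elt (snd l) = b l"
        unfolding b_def by (auto simp: relation_fun_right vertex_elt_def intro!: relation_fun_cong)
    qed (auto simp: L_def lead_def b_def 3 W2 relations_eq)
  next
    case 4
    show ?thesis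
      by (rule that[of "{}"]) (use W_ge_3[OF 4] in auto)
  qed
qed

section \<open>Convolution of bimodule maps\<close>

lemma bimodule_map_vertex:
  "bimodule_map p f \<Longrightarrow> w \<in> W n p \<Longrightarrow> i < n \<Longrightarrow> f (vertex_elt i \<otimes>\<^bsub>P\<^esub> w) = proj n (vertex_elt i) \<otimes>\<^bsub>A\<^esub> f w"
  "bimodule_map p f \<Longrightarrow> w \<in> W n p \<Longrightarrow> i < n \<Longrightarrow> f (w \<otimes>\<^bsub>P\<^esub> vertex_elt i) = f w \<otimes>\<^bsub>A\<^esub> proj n (vertex_elt i)"
  by (simp_all add: bimodule_map_left bimodule_map_right)

text \<open>The function \<open>\<Phi>\<close> is built from w alone, without a decomposition: w is
  expanded in its left part along the basis of \<open>W n p\<close>, and g is applied to what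
  remains on the right. It then agrees with the prescribed sum for every decomposition.\<close>

lemma convolution_well_defined:
  assumes f: "bimodule_map p f" and g: "bimodule_map q g"
  obtains \<Phi> where "\<And>(N::nat) u v. (\<And>j. j < N \<Longrightarrow> u j \<in> W n p \<and> v j \<in> W n q) \<Longrightarrow>
    \<Phi> (\<Oplus>\<^bsub>P\<^esub>j\<in>{..<N}. u j \<otimes>\<^bsub>P\<^esub> v j) = (\<Oplus>\<^bsub>A\<^esub>j\<in>{..<N}. f (u j) \<otimes>\<^bsub>A\<^esub> g (v j))"
proof -
  obtain L :: "path set" and b :: "path \<Rightarrow> path \<Rightarrow> 'a" where
    L: "finite L" "\<And>l. l \<in> L \<Longrightarrow> b l \<in> W n p" "\<And>l. l \<in> L \<Longrightarrow> length (fst l) = p" "\<And>l. l \<in> L \<Longrightarrow> snd l < n"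
    "\<And>l. l \<in> L \<Longrightarrow> b l \<otimes>\<^bsub>P\<^esub> vertex_elt (snd l) = b l"
    and expand: "\<And>u. u \<in> W n p \<Longrightarrow> u = (\<Oplus>\<^bsub>P\<^esub>l\<in>L. scaled (u l) (b l))"
    by (rule W_basis[of p]) (rule that)
  \<comment> \<open>The right factor of w standing behind the path \<open>l\<close>: the
    coefficients of the continuations of \<open>l\<close> in w.\<close>
  define slice :: "path \<Rightarrow> (path \<Rightarrow> 'a) \<Rightarrow> path \<Rightarrow> 'a" where
    "slice = (\<lambda>l w (ys, s). if path_target (ys, s) = snd l then w (fst l @ ys, s) else 0)"
  define \<Phi> where "\<Phi> = (\<lambda>w. \<Oplus>\<^bsub>A\<^esub>l\<in>L. f (b l) \<otimes>\<^bsub>A\<^esub> g (slice l w))"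
  have slice_mult: "slice l (u \<otimes>\<^bsub>P\<^esub> v) = scaled (u l) (vertex_elt (snd l) \<otimes>\<^bsub>P\<^esub> v)"
    if l: "l \<in> L" and u: "u \<in> W n p" for l u v
  proof (rule ext, rule prod.induct)
    fix ys s
    show "slice l (u \<otimes>\<^bsub>P\<^esub> v) (ys, s) = u l * (vertex_elt (snd l) \<otimes>\<^bsub>P\<^esub> v) (ys, s)"
      using homogeneous_mult_left[OF W_homogeneous[OF u], of v "fst l @ ys" s] L(3)[OF l]
      by (cases l) (auto simp: slice_def vertex_mult)
  qed
  have slice_add: "slice l (w \<oplus>\<^bsub>P\<^esub> w') = slice l w \<oplus>\<^bsub>P\<^esub> slice l w'" for l w w'
    by (auto simp: slice_def path_algebra_add)
  have \<Phi>_mult: "\<Phi> (u \<otimes>\<^bsub>P\<^esub> v) = f u \<otimes>\<^bsub>A\<^esub> g v" if u: "u \<in> W n p" and v: "v \<in> W n q" for u v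
  proof -
    \<comment> \<open>Slicing a product u v leaves the coefficient of u at \<open>l\<close> and an
      idempotent in front of v. The idempotent is absorbed by \<open>b l\<close>, which has its
      source there, and the scalar moves to the left.\<close>
    have summand: "f (b l) \<otimes>\<^bsub>A\<^esub> g (slice l (u \<otimes>\<^bsub>P\<^esub> v)) = f (scaled (u l) (b l)) \<otimes>\<^bsub>A\<^esub> g v" if l: "l \<in> L" for l
    proof -
      have "g (slice l (u \<otimes>\<^bsub>P\<^esub> v)) = scalar (u l) \<otimes>\<^bsub>A\<^esub> (proj n (vertex_elt (snd l)) \<otimes>\<^bsub>A\<^esub> g v)"
        using l u v L(4)[OF l]
        by (simp add: slice_mult bimodule_map_scaled[OF g] bimodule_map_vertex[OF g] W_left)
      moreover have "f (b l) = f (b l) \<otimes>\<^bsub>A\<^esub> proj n (vertex_elt (snd l))"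
        using L(2,4,5)[OF l] bimodule_map_vertex(2)[OF f] by metis
      ultimately show ?thesis
        using L(2,4)[OF l] v A.m_assoc[of "f (b l)" "proj n (vertex_elt (snd l))" "g v"]
        by (simp add: bimodule_map_scaled[OF f] bimodule_map_closed[OF f] bimodule_map_closed[OF g]
            scalar_left_commute A.m_assoc)
    qed
    have "\<Phi> (u \<otimes>\<^bsub>P\<^esub> v) = (\<Oplus>\<^bsub>A\<^esub>l\<in>L. f (scaled (u l) (b l)) \<otimes>\<^bsub>A\<^esub> g v)"
      unfolding \<Phi>_def using summand L v W_scaled
      by (intro A.finsum_cong') (auto intro!: A.m_closed bimodule_map_closed[OF f] bimodule_map_closed[OF g])
    also have "\<dots> = (\<Oplus>\<^bsub>A\<^esub>l\<in>L. f (scaled (u l) (b l))) \<otimes>\<^bsub>A\<^esub> g v"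
      using L v W_scaled
      by (intro A.finsum_ldistr[symmetric]) (auto intro!: bimodule_map_closed[OF f] bimodule_map_closed[OF g])
    also have "(\<Oplus>\<^bsub>A\<^esub>l\<in>L. f (scaled (u l) (b l))) = f (\<Oplus>\<^bsub>P\<^esub>l\<in>L. scaled (u l) (b l))"
      using L W_scaled by (intro bimodule_map_finsum[OF f, symmetric]) auto
    finally show ?thesis using expand[OF u] by simp
  qed
  \<comment> \<open>That the slices lie in \<open>W n q\<close> is carried along in the induction,
    since additivity of g is known only there.\<close>
  have sums: "(\<forall>l\<in>L. slice l (\<Oplus>\<^bsub>P\<^esub>j\<in>{..<N}. u j \<otimes>\<^bsub>P\<^esub> v j) \<in> W n q) \<and>
      \<Phi> (\<Oplus>\<^bsub>P\<^esub>j\<in>{..<N}. u j \<otimes>\<^bsub>P\<^esub> v j) = (\<Oplus>\<^bsub>A\<^esub>j\<in>{..<N}. f (u j) \<otimes>\<^bsub>A\<^esub> g (v j))"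
    if "\<And>j. j < N \<Longrightarrow> u j \<in> W n p \<and> v j \<in> W n q" for N :: nat and u v
    using that
  proof (induction N)
    case 0
    have "slice l \<zero>\<^bsub>P\<^esub> = \<zero>\<^bsub>P\<^esub>" for l
      by (auto simp: slice_def path_algebra_zero)
    moreover have "\<Phi> \<zero>\<^bsub>P\<^esub> = \<zero>\<^bsub>A\<^esub>"
      unfolding \<Phi>_def using L calculation
      by (intro A.add.finprod_one_eqI) (simp add: bimodule_map_zero[OF g] bimodule_map_closed[OF f])
    ultimately show ?case by simp
  next
    case (Suc N)
    let ?S = "\<Oplus>\<^bsub>P\<^esub>j\<in>{..<N}. u j \<otimes>\<^bsub>P\<^esub> v j" and ?T = "u N \<otimes>\<^bsub>P\<^esub> v N"
    have mem: "j \<le> N \<Longrightarrow> u j \<in> W n p" "j \<le> N \<Longrightarrow> v j \<in> W n q" for j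
      using Suc.prems by auto
    have uv: "u N \<in> W n p" "v N \<in> W n q" using Suc.prems by auto
    have IH: "\<forall>l\<in>L. slice l ?S \<in> W n q" "\<Phi> ?S = (\<Oplus>\<^bsub>A\<^esub>j\<in>{..<N}. f (u j) \<otimes>\<^bsub>A\<^esub> g (v j))"
      using Suc by auto
    have "(\<Oplus>\<^bsub>P\<^esub>j\<in>{..<Suc N}. u j \<otimes>\<^bsub>P\<^esub> v j) = ?T \<oplus>\<^bsub>P\<^esub> ?S"
      unfolding lessThan_Suc using W_closed[OF mem(1)] W_closed[OF mem(2)]
      by (intro P.finsum_insert) auto
    moreover have "(\<Oplus>\<^bsub>A\<^esub>j\<in>{..<Suc N}. f (u j) \<otimes>\<^bsub>A\<^esub> g (v j)) =
        f (u N) \<otimes>\<^bsub>A\<^esub> g (v N) \<oplus>\<^bsub>A\<^esub> (\<Oplus>\<^bsub>A\<^esub>j\<in>{..<N}. f (u j) \<otimes>\<^bsub>A\<^esub> g (v j))"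
      unfolding lessThan_Suc using mem
      by (intro A.finsum_insert) (auto intro!: A.m_closed bimodule_map_closed[OF f] bimodule_map_closed[OF g])
    moreover have slice_T: "slice l ?T \<in> W n q" if "l \<in> L" for l
      using that uv L(4) by (simp add: slice_mult W_scaled W_left)
    moreover have "\<Phi> (?T \<oplus>\<^bsub>P\<^esub> ?S) = \<Phi> ?T \<oplus>\<^bsub>A\<^esub> \<Phi> ?S"
    proof -
      have "\<Phi> (?T \<oplus>\<^bsub>P\<^esub> ?S) = (\<Oplus>\<^bsub>A\<^esub>l\<in>L. f (b l) \<otimes>\<^bsub>A\<^esub> g (slice l ?T) \<oplus>\<^bsub>A\<^esub> f (b l) \<otimes>\<^bsub>A\<^esub> g (slice l ?S))"
        unfolding \<Phi>_def using IH(1) slice_T L(2)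
        by (intro A.finsum_cong')
          (auto simp: slice_add bimodule_map_add[OF g] A.r_distr bimodule_map_closed[OF f] bimodule_map_closed[OF g])
      also have "\<dots> = \<Phi> ?T \<oplus>\<^bsub>A\<^esub> \<Phi> ?S"
        unfolding \<Phi>_def using IH(1) slice_T L(2)
        by (intro A.finsum_addf) (auto simp: bimodule_map_closed[OF f] bimodule_map_closed[OF g])
      finally show ?thesis .
    qed
    ultimately show ?case
      using IH uv by (simp add: slice_add W_add \<Phi>_mult)
  qed
  show ?thesis
    by (rule that[of \<Phi>]) (rule sums[THEN conjunct2])
qed

text \<open>The definition admits decompositions indexed by initial segments only; enumerating
  \<open>S\<close> removes this restriction, and the well-definedness of \<open>\<Phi>\<close>
  settles the \<open>THE\<close>.\<close>

lemma convolution_eq: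
  assumes f: "bimodule_map p f" and g: "bimodule_map q g" and S: "finite S"
    and uv: "\<And>j. j \<in> S \<Longrightarrow> u j \<in> W n p" "\<And>j. j \<in> S \<Longrightarrow> v j \<in> W n q"
    and w: "w = (\<Oplus>\<^bsub>P\<^esub>j\<in>S. u j \<otimes>\<^bsub>P\<^esub> v j)"
  shows "convolution n p q f g w = (\<Oplus>\<^bsub>A\<^esub>j\<in>S. f (u j) \<otimes>\<^bsub>A\<^esub> g (v j))"
proof -
  obtain h where "bij_betw h {0..<card S} S"
    using ex_bij_betw_nat_finite[OF S] by blast
  then have h: "inj_on h {..<card S}" "S = h ` {..<card S}"
    by (auto simp: bij_betw_def atLeast0LessThan)
  then have h_mem: "h j \<in> S" if "j < card S" for j using that by blast
  have "(\<Oplus>\<^bsub>P\<^esub>j\<in>h ` {..<card S}. u j \<otimes>\<^bsub>P\<^esub> v j) = (\<Oplus>\<^bsub>P\<^esub>j\<in>{..<card S}. u (h j) \<otimes>\<^bsub>P\<^esub> v (h j))"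
    using h W_closed[OF uv(1)] W_closed[OF uv(2)] by (intro P.finsum_reindex) auto
  then have w': "w = (\<Oplus>\<^bsub>P\<^esub>j\<in>{..<card S}. u (h j) \<otimes>\<^bsub>P\<^esub> v (h j))"
    using w h(2) by simp
  have "(\<Oplus>\<^bsub>A\<^esub>j\<in>h ` {..<card S}. f (u j) \<otimes>\<^bsub>A\<^esub> g (v j)) = (\<Oplus>\<^bsub>A\<^esub>j\<in>{..<card S}. f (u (h j)) \<otimes>\<^bsub>A\<^esub> g (v (h j)))"
    using h uv
    by (intro A.finsum_reindex) (auto intro!: A.m_closed bimodule_map_closed[OF f] bimodule_map_closed[OF g])
  then have y: "(\<Oplus>\<^bsub>A\<^esub>j\<in>S. f (u j) \<otimes>\<^bsub>A\<^esub> g (v j)) = (\<Oplus>\<^bsub>A\<^esub>j\<in>{..<card S}. f (u (h j)) \<otimes>\<^bsub>A\<^esub> g (v (h j)))"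
    using h(2) by simp
  obtain \<Phi> where \<Phi>: "\<And>(N::nat) u v. (\<And>j. j < N \<Longrightarrow> u j \<in> W n p \<and> v j \<in> W n q) \<Longrightarrow>
      \<Phi> (\<Oplus>\<^bsub>P\<^esub>j\<in>{..<N}. u j \<otimes>\<^bsub>P\<^esub> v j) = (\<Oplus>\<^bsub>A\<^esub>j\<in>{..<N}. f (u j) \<otimes>\<^bsub>A\<^esub> g (v j))"
    using convolution_well_defined[OF f g] by blast
  let ?y = "\<Oplus>\<^bsub>A\<^esub>j\<in>S. f (u j) \<otimes>\<^bsub>A\<^esub> g (v j)"
  show ?thesis
    unfolding convolution_def
  proof (rule the_equality)
    show "\<exists>(N::nat) u v. (\<forall>j<N. u j \<in> W n p \<and> v j \<in> W n q) \<and>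
        w = (\<Oplus>\<^bsub>P\<^esub>j\<in>{..<N}. u j \<otimes>\<^bsub>P\<^esub> v j) \<and>
        ?y = (\<Oplus>\<^bsub>A\<^esub>j\<in>{..<N}. f (u j) \<otimes>\<^bsub>A\<^esub> g (v j))"
      by (intro exI[of _ "card S"] exI[of _ "u \<circ> h"] exI[of _ "v \<circ> h"] conjI)
        (use w' y uv h_mem in auto)
  next
    fix y assume "\<exists>(N::nat) u v. (\<forall>j<N. u j \<in> W n p \<and> v j \<in> W n q) \<and>
        w = (\<Oplus>\<^bsub>P\<^esub>j\<in>{..<N}. u j \<otimes>\<^bsub>P\<^esub> v j) \<and> y = (\<Oplus>\<^bsub>A\<^esub>j\<in>{..<N}. f (u j) \<otimes>\<^bsub>A\<^esub> g (v j))"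
    then have "y = \<Phi> w" using \<Phi> by auto
    moreover have "\<Phi> w = ?y"
      unfolding w' y using uv h_mem by (intro \<Phi>) auto
    ultimately show "y = ?y" by simp
  qed
qed

lemma convolution_0_left:
  assumes "bimodule_map 0 f" "bimodule_map q g" "w \<in> W n q"
  shows "convolution n 0 q f g w = f \<one>\<^bsub>P\<^esub> \<otimes>\<^bsub>A\<^esub> g w"
proof -
  have "convolution n 0 q f g w = (\<Oplus>\<^bsub>A\<^esub>j\<in>{0::nat}. f \<one>\<^bsub>P\<^esub> \<otimes>\<^bsub>A\<^esub> g w)"
    using assms W_closed[of w q] by (intro convolution_eq) (auto simp: W0)
  then show ?thesis
    using assms bimodule_map_closed[OF assms(1), of "\<one>\<^bsub>P\<^esub>"] bimodule_map_closed[OF assms(2)]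
    by (simp add: W0)
qed

lemma convolution_0_right:
  assumes "bimodule_map p f" "bimodule_map 0 g" "w \<in> W n p"
  shows "convolution n p 0 f g w = f w \<otimes>\<^bsub>A\<^esub> g \<one>\<^bsub>P\<^esub>"
proof -
  have "convolution n p 0 f g w = (\<Oplus>\<^bsub>A\<^esub>j\<in>{0::nat}. f w \<otimes>\<^bsub>A\<^esub> g \<one>\<^bsub>P\<^esub>)"
    using assms W_closed[of w p] by (intro convolution_eq) (auto simp: W0)
  then show ?thesis
    using assms bimodule_map_closed[OF assms(2), of "\<one>\<^bsub>P\<^esub>"] bimodule_map_closed[OF assms(1)]
    by (simp add: W0)
qed

lemma convolution_zero:
  assumes "bimodule_map p f" "bimodule_map q g"
  shows "convolution n p q f g \<zero>\<^bsub>P\<^esub> = \<zero>\<^bsub>A\<^esub>"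
  using convolution_eq[OF assms, of "{}"] by simp

text \<open>The image of the relation with coefficients \<open>c\<close> under x bar(x) -> m x.
  Differentials of 1-cochains and products of two 1-cochains are of this form.\<close>

definition relation_sum :: "(nat \<Rightarrow> 'a) \<Rightarrow> (arrow \<Rightarrow> (path \<Rightarrow> 'a) set) \<Rightarrow> (path \<Rightarrow> 'a) set" where
  "relation_sum c m = (\<Oplus>\<^bsub>A\<^esub>x\<in>arrows n. scalar (c (arrow_target x) * arrow_sign x) \<otimes>\<^bsub>A\<^esub> m x)"

text \<open>The relation as an explicit element of the tensor square of V, with the scalar on the
  left factor; this is the decomposition on which convolutions of 1-cochains are evaluated.\<close>

lemma relation_fun_arrows:
  "relation_fun c = (\<Oplus>\<^bsub>P\<^esub>x\<in>arrows n. scaled (c (arrow_target x) * arrow_sign x) (arrow_elt x) \<otimes>\<^bsub>P\<^esub> arrow_elt (bar x))"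
proof
  fix q :: path
  obtain xs s where q: "q = (xs, s)" by fastforce
  have "scaled k (arrow_elt x) \<otimes>\<^bsub>P\<^esub> arrow_elt (bar x) = scaled k (path_elt ([x, bar x], arrow_target x))" for k x
    by (simp add: scaled_mult arrow_elt_path path_elt_mult)
  note mult = this
  have "(\<Oplus>\<^bsub>P\<^esub>x\<in>arrows n. scaled (c (arrow_target x) * arrow_sign x) (arrow_elt x) \<otimes>\<^bsub>P\<^esub> arrow_elt (bar x)) q =
    (\<Sum>x\<in>arrows n. (scaled (c (arrow_target x) * arrow_sign x) (arrow_elt x) \<otimes>\<^bsub>P\<^esub> arrow_elt (bar x)) q)"
    by (rule finsum_apply) (auto intro!: P.m_closed scaled_closed)
  also have "\<dots> = (\<Sum>x\<in>arrows n. if x = hd xs then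
      (if xs = [x, bar x] \<and> s = arrow_target x then c (arrow_target x) * arrow_sign x else 0) else 0)"
    unfolding mult by (intro sum.cong) (auto simp: path_elt_def q)
  also have "\<dots> = relation_fun c q"
    by (auto simp: q relation_fun_def split: list.splits)
  finally show "relation_fun c q = (\<Oplus>\<^bsub>P\<^esub>x\<in>arrows n. scaled (c (arrow_target x) * arrow_sign x) (arrow_elt x) \<otimes>\<^bsub>P\<^esub> arrow_elt (bar x)) q" ..
qed

lemma convolution_1_1:
  assumes f: "bimodule_map (Suc 0) f" and g: "bimodule_map (Suc 0) g"
  shows "convolution n (Suc 0) (Suc 0) f g (relation_fun c) =
    relation_sum c (\<lambda>x. f (arrow_elt x) \<otimes>\<^bsub>A\<^esub> g (arrow_elt (bar x)))"
proof -
  have W: "x \<in> arrows n \<Longrightarrow> arrow_elt x \<in> (W n (Suc 0) :: (path \<Rightarrow> 'a) set)" for x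
    by (simp add: W1)
  have "convolution n (Suc 0) (Suc 0) f g (relation_fun c) =
      (\<Oplus>\<^bsub>A\<^esub>x\<in>arrows n. f (scaled (c (arrow_target x) * arrow_sign x) (arrow_elt x)) \<otimes>\<^bsub>A\<^esub> g (arrow_elt (bar x)))"
    by (intro convolution_eq[OF f g] relation_fun_arrows) (auto simp: W W_scaled)
  also have "\<dots> = relation_sum c (\<lambda>x. f (arrow_elt x) \<otimes>\<^bsub>A\<^esub> g (arrow_elt (bar x)))"
    unfolding relation_sum_def
    by (intro A.finsum_cong')
      (auto simp: W bimodule_map_scaled[OF f] bimodule_map_closed[OF f] bimodule_map_closed[OF g] A.m_assoc)
  finally show ?thesis .
qed

end

section \<open>Cochains and their values\<close>

context type_D begin

section \<open>Peirce components of A and bimodule maps with prescribed values\<close>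

abbreviation idem :: "nat \<Rightarrow> (path \<Rightarrow> 'a) set" where
  "idem i \<equiv> proj n (vertex_elt i)"

abbreviation arr :: "arrow \<Rightarrow> (path \<Rightarrow> 'a) set" where
  "arr x \<equiv> proj n (arrow_elt x)"

text \<open>The Peirce component e_i A e_j. A value of a bimodule map on an arrow from j to i is
  bound to lie there.\<close>

definition block :: "nat \<Rightarrow> nat \<Rightarrow> (path \<Rightarrow> 'a) set set" where
  "block i j = {a \<in> carrier A. idem i \<otimes>\<^bsub>A\<^esub> a = a \<and> a \<otimes>\<^bsub>A\<^esub> idem j = a}"

lemma blockD:
  "a \<in> block i j \<Longrightarrow> a \<in> carrier A"
  "a \<in> block i j \<Longrightarrow> idem i \<otimes>\<^bsub>A\<^esub> a = a"
  "a \<in> block i j \<Longrightarrow> a \<otimes>\<^bsub>A\<^esub> idem j = a"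
  by (simp_all add: block_def)

lemma block_zero [simp]: "i < n \<Longrightarrow> j < n \<Longrightarrow> \<zero>\<^bsub>A\<^esub> \<in> block i j"
  by (simp add: block_def)

lemma block_add: "i < n \<Longrightarrow> j < n \<Longrightarrow> a \<in> block i j \<Longrightarrow> b \<in> block i j \<Longrightarrow> a \<oplus>\<^bsub>A\<^esub> b \<in> block i j"
  by (simp add: block_def A.l_distr A.r_distr)

lemma block_minus: "i < n \<Longrightarrow> j < n \<Longrightarrow> a \<in> block i j \<Longrightarrow> \<ominus>\<^bsub>A\<^esub> a \<in> block i j"
  by (simp add: block_def A.l_minus A.r_minus)

lemma block_mult:
  assumes "i < n" "k < n" "a \<in> block i j" "b \<in> block j k" shows "a \<otimes>\<^bsub>A\<^esub> b \<in> block i k"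
proof -
  have "idem i \<otimes>\<^bsub>A\<^esub> (a \<otimes>\<^bsub>A\<^esub> b) = (idem i \<otimes>\<^bsub>A\<^esub> a) \<otimes>\<^bsub>A\<^esub> b"
    using assms blockD(1) by (intro A.m_assoc[symmetric]) auto
  moreover have "(a \<otimes>\<^bsub>A\<^esub> b) \<otimes>\<^bsub>A\<^esub> idem k = a \<otimes>\<^bsub>A\<^esub> (b \<otimes>\<^bsub>A\<^esub> idem k)"
    using assms blockD(1) by (intro A.m_assoc) auto
  ultimately show ?thesis using assms by (simp add: block_def)
qed

lemma block_scalar: "i < n \<Longrightarrow> j < n \<Longrightarrow> a \<in> block i j \<Longrightarrow> scalar c \<otimes>\<^bsub>A\<^esub> a \<in> block i j"
  by (simp add: block_def scalar_left_commute A.m_assoc)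

lemma vertex_elt_square: "vertex_elt i \<otimes>\<^bsub>P\<^esub> vertex_elt i = vertex_elt i"
  by (simp add: vertex_elt_path path_elt_mult)

lemma idem_block: "i < n \<Longrightarrow> idem i \<in> block i i"
  by (simp add: block_def proj.hom_mult[symmetric] vertex_elt_square)

lemma idem_orthogonal: "i < n \<Longrightarrow> j < n \<Longrightarrow> i \<noteq> j \<Longrightarrow> idem i \<otimes>\<^bsub>A\<^esub> idem j = \<zero>\<^bsub>A\<^esub>"
proof -
  assume ij: "i < n" "j < n" "i \<noteq> j"
  then have "vertex_elt i \<otimes>\<^bsub>P\<^esub> vertex_elt j = \<zero>\<^bsub>P\<^esub>"
    by (simp add: vertex_elt_path path_elt_mult)
  with ij show ?thesis using proj.hom_mult[of "vertex_elt i" "vertex_elt j"] by simp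
qed

lemma arr_block: "x \<in> arrows n \<Longrightarrow> arr x \<in> block (arrow_target x) (arrow_source x)"
proof -
  assume x: "x \<in> arrows n"
  have "vertex_elt (arrow_target x) \<otimes>\<^bsub>P\<^esub> arrow_elt x = arrow_elt x" "arrow_elt x \<otimes>\<^bsub>P\<^esub> vertex_elt (arrow_source x) = arrow_elt x"
    by (simp_all add: vertex_elt_path arrow_elt_path path_elt_mult)
  then show ?thesis
    using x by (simp add: block_def proj.hom_mult[symmetric] arrow_source_less arrow_target_less)
qed

lemma tensor_power0_idem:
  assumes "c \<in> tensor_power n 0" "i < n"
  shows "proj n c \<otimes>\<^bsub>A\<^esub> idem i = scalar (c ([], i)) \<otimes>\<^bsub>A\<^esub> idem i"
    "idem i \<otimes>\<^bsub>A\<^esub> proj n c = scalar (c ([], i)) \<otimes>\<^bsub>A\<^esub> idem i"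
proof -
  have c: "c \<in> carrier P" "homogeneous 0 c" using assms by (auto simp: tensor_power_iff)
  have "c (xs, s) = 0" if "xs \<noteq> []" for xs s
    using homogeneousD[OF c(2), of "(xs, s)"] that by auto
  then have "c \<otimes>\<^bsub>P\<^esub> vertex_elt i = scaled (c ([], i)) (vertex_elt i)" "vertex_elt i \<otimes>\<^bsub>P\<^esub> c = scaled (c ([], i)) (vertex_elt i)"
    by (auto simp: fun_eq_iff vertex_mult) (auto simp: vertex_elt_def)
  moreover have "proj n (scaled (c ([], i)) (vertex_elt i)) = scalar (c ([], i)) \<otimes>\<^bsub>A\<^esub> idem i"
    using assms(2) by (subst scaled_one) (simp_all add: scalar_def)
  ultimately show "proj n c \<otimes>\<^bsub>A\<^esub> idem i = scalar (c ([], i)) \<otimes>\<^bsub>A\<^esub> idem i"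
    "idem i \<otimes>\<^bsub>A\<^esub> proj n c = scalar (c ([], i)) \<otimes>\<^bsub>A\<^esub> idem i"
    using c assms by (simp_all flip: proj.hom_mult)
qed

lemma tensor_power0_block:
  assumes "c \<in> tensor_power n 0" "a \<in> block i j" "i < n" "j < n"
  shows "proj n c \<otimes>\<^bsub>A\<^esub> a = scalar (c ([], i)) \<otimes>\<^bsub>A\<^esub> a"
    "a \<otimes>\<^bsub>A\<^esub> proj n c = scalar (c ([], j)) \<otimes>\<^bsub>A\<^esub> a"
proof -
  note a = blockD[OF assms(2)]
  have "proj n c \<otimes>\<^bsub>A\<^esub> (idem i \<otimes>\<^bsub>A\<^esub> a) = scalar (c ([], i)) \<otimes>\<^bsub>A\<^esub> (idem i \<otimes>\<^bsub>A\<^esub> a)"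
    using a(1) assms(1,3) tensor_power0_idem(1)[OF assms(1,3)] by (simp flip: A.m_assoc)
  then show "proj n c \<otimes>\<^bsub>A\<^esub> a = scalar (c ([], i)) \<otimes>\<^bsub>A\<^esub> a" using a by simp
  have "(a \<otimes>\<^bsub>A\<^esub> idem j) \<otimes>\<^bsub>A\<^esub> proj n c = a \<otimes>\<^bsub>A\<^esub> (scalar (c ([], j)) \<otimes>\<^bsub>A\<^esub> idem j)"
    using a(1) assms tensor_power0_idem(2)[OF assms(1,4)] by (simp add: A.m_assoc)
  also have "\<dots> = scalar (c ([], j)) \<otimes>\<^bsub>A\<^esub> (a \<otimes>\<^bsub>A\<^esub> idem j)"
    using a(1) assms by (simp add: scalar_left_commute)
  finally show "a \<otimes>\<^bsub>A\<^esub> proj n c = scalar (c ([], j)) \<otimes>\<^bsub>A\<^esub> a" using a by simp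
qed

text \<open>The common construction of cochains in degrees 0, 1 and 2: coordinates that transform
  under k at the ends \<open>t i\<close> and \<open>s i\<close> are paired with values from the
  matching Peirce components.\<close>

lemma bimodule_map_coordinates:
  fixes \<kappa> :: "'b \<Rightarrow> (path \<Rightarrow> 'a) \<Rightarrow> 'a"
  assumes I: "finite I" "\<And>i. i \<in> I \<Longrightarrow> val i \<in> block (t i) (s i)" "\<And>i. i \<in> I \<Longrightarrow> t i < n" "\<And>i. i \<in> I \<Longrightarrow> s i < n"
    and add: "\<And>i w w'. i \<in> I \<Longrightarrow> w \<in> W n p \<Longrightarrow> w' \<in> W n p \<Longrightarrow> \<kappa> i (w \<oplus>\<^bsub>P\<^esub> w') = \<kappa> i w + \<kappa> i w'"
    and left: "\<And>i c w. i \<in> I \<Longrightarrow> c \<in> tensor_power n 0 \<Longrightarrow> w \<in> W n p \<Longrightarrow> \<kappa> i (c \<otimes>\<^bsub>P\<^esub> w) = c ([], t i) * \<kappa> i w"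
    and right: "\<And>i c w. i \<in> I \<Longrightarrow> c \<in> tensor_power n 0 \<Longrightarrow> w \<in> W n p \<Longrightarrow> \<kappa> i (w \<otimes>\<^bsub>P\<^esub> c) = \<kappa> i w * c ([], s i)"
  shows "bimodule_map p (\<lambda>w. \<Oplus>\<^bsub>A\<^esub>i\<in>I. scalar (\<kappa> i w) \<otimes>\<^bsub>A\<^esub> val i)"
proof (rule bimodule_mapI)
  have val: "i \<in> I \<Longrightarrow> val i \<in> carrier A" for i using I(2) blockD(1) by blast
  show "(\<Oplus>\<^bsub>A\<^esub>i\<in>I. scalar (\<kappa> i w) \<otimes>\<^bsub>A\<^esub> val i) \<in> carrier A" for w
    using val by (intro A.finsum_closed) auto
  fix w :: "path \<Rightarrow> 'a" assume w: "w \<in> W n p"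
  show "(\<Oplus>\<^bsub>A\<^esub>i\<in>I. scalar (\<kappa> i (w \<oplus>\<^bsub>P\<^esub> w')) \<otimes>\<^bsub>A\<^esub> val i) =
      (\<Oplus>\<^bsub>A\<^esub>i\<in>I. scalar (\<kappa> i w) \<otimes>\<^bsub>A\<^esub> val i) \<oplus>\<^bsub>A\<^esub> (\<Oplus>\<^bsub>A\<^esub>i\<in>I. scalar (\<kappa> i w') \<otimes>\<^bsub>A\<^esub> val i)"
    if w': "w' \<in> W n p" for w' :: "path \<Rightarrow> 'a"
  proof -
    have "(\<Oplus>\<^bsub>A\<^esub>i\<in>I. scalar (\<kappa> i (w \<oplus>\<^bsub>P\<^esub> w')) \<otimes>\<^bsub>A\<^esub> val i) =
        (\<Oplus>\<^bsub>A\<^esub>i\<in>I. scalar (\<kappa> i w) \<otimes>\<^bsub>A\<^esub> val i \<oplus>\<^bsub>A\<^esub> scalar (\<kappa> i w') \<otimes>\<^bsub>A\<^esub> val i)"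
      using val w w' by (intro A.finsum_cong') (auto simp: add scalar_add[symmetric] A.l_distr)
    also have "\<dots> = (\<Oplus>\<^bsub>A\<^esub>i\<in>I. scalar (\<kappa> i w) \<otimes>\<^bsub>A\<^esub> val i) \<oplus>\<^bsub>A\<^esub> (\<Oplus>\<^bsub>A\<^esub>i\<in>I. scalar (\<kappa> i w') \<otimes>\<^bsub>A\<^esub> val i)"
      using val by (intro A.finsum_addf) auto
    finally show ?thesis .
  qed
  fix c :: "path \<Rightarrow> 'a" assume c: "c \<in> tensor_power n 0"
  have "proj n c \<otimes>\<^bsub>A\<^esub> (\<Oplus>\<^bsub>A\<^esub>i\<in>I. scalar (\<kappa> i w) \<otimes>\<^bsub>A\<^esub> val i) = (\<Oplus>\<^bsub>A\<^esub>i\<in>I. proj n c \<otimes>\<^bsub>A\<^esub> (scalar (\<kappa> i w) \<otimes>\<^bsub>A\<^esub> val i))"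
    using val c I(1) by (intro A.finsum_rdistr) auto
  also have "\<dots> = (\<Oplus>\<^bsub>A\<^esub>i\<in>I. scalar (\<kappa> i (c \<otimes>\<^bsub>P\<^esub> w)) \<otimes>\<^bsub>A\<^esub> val i)"
  proof (intro A.finsum_cong' refl)
    fix i assume i: "i \<in> I"
    have "proj n c \<otimes>\<^bsub>A\<^esub> (scalar (\<kappa> i w) \<otimes>\<^bsub>A\<^esub> val i) = scalar (\<kappa> i w) \<otimes>\<^bsub>A\<^esub> (proj n c \<otimes>\<^bsub>A\<^esub> val i)"
      using val[OF i] c by (intro scalar_left_commute) auto
    also have "\<dots> = (scalar (\<kappa> i w) \<otimes>\<^bsub>A\<^esub> scalar (c ([], t i))) \<otimes>\<^bsub>A\<^esub> val i"
      using tensor_power0_block(1)[OF c I(2,3,4)[OF i]] val[OF i] by (simp add: A.m_assoc)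
    finally show "proj n c \<otimes>\<^bsub>A\<^esub> (scalar (\<kappa> i w) \<otimes>\<^bsub>A\<^esub> val i) = scalar (\<kappa> i (c \<otimes>\<^bsub>P\<^esub> w)) \<otimes>\<^bsub>A\<^esub> val i"
      using i c w by (simp add: left scalar_mult mult.commute)
  qed (use val in auto)
  finally show "(\<Oplus>\<^bsub>A\<^esub>i\<in>I. scalar (\<kappa> i (c \<otimes>\<^bsub>P\<^esub> w)) \<otimes>\<^bsub>A\<^esub> val i) =
    proj n c \<otimes>\<^bsub>A\<^esub> (\<Oplus>\<^bsub>A\<^esub>i\<in>I. scalar (\<kappa> i w) \<otimes>\<^bsub>A\<^esub> val i)" ..
  have "(\<Oplus>\<^bsub>A\<^esub>i\<in>I. scalar (\<kappa> i w) \<otimes>\<^bsub>A\<^esub> val i) \<otimes>\<^bsub>A\<^esub> proj n c = (\<Oplus>\<^bsub>A\<^esub>i\<in>I. (scalar (\<kappa> i w) \<otimes>\<^bsub>A\<^esub> val i) \<otimes>\<^bsub>A\<^esub> proj n c)"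
    using val c I(1) by (intro A.finsum_ldistr) auto
  also have "\<dots> = (\<Oplus>\<^bsub>A\<^esub>i\<in>I. scalar (\<kappa> i (w \<otimes>\<^bsub>P\<^esub> c)) \<otimes>\<^bsub>A\<^esub> val i)"
  proof (intro A.finsum_cong' refl)
    fix i assume i: "i \<in> I"
    have "(scalar (\<kappa> i w) \<otimes>\<^bsub>A\<^esub> val i) \<otimes>\<^bsub>A\<^esub> proj n c = scalar (\<kappa> i w) \<otimes>\<^bsub>A\<^esub> (val i \<otimes>\<^bsub>A\<^esub> proj n c)"
      using val[OF i] c by (intro A.m_assoc) auto
    also have "\<dots> = (scalar (\<kappa> i w) \<otimes>\<^bsub>A\<^esub> scalar (c ([], s i))) \<otimes>\<^bsub>A\<^esub> val i"
      using tensor_power0_block(2)[OF c I(2,3,4)[OF i]] val[OF i] by (simp add: A.m_assoc)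
    finally show "(scalar (\<kappa> i w) \<otimes>\<^bsub>A\<^esub> val i) \<otimes>\<^bsub>A\<^esub> proj n c = scalar (\<kappa> i (w \<otimes>\<^bsub>P\<^esub> c)) \<otimes>\<^bsub>A\<^esub> val i"
      using i c w by (simp add: right scalar_mult)
  qed (use val in auto)
  finally show "(\<Oplus>\<^bsub>A\<^esub>i\<in>I. scalar (\<kappa> i (w \<otimes>\<^bsub>P\<^esub> c)) \<otimes>\<^bsub>A\<^esub> val i) =
    (\<Oplus>\<^bsub>A\<^esub>i\<in>I. scalar (\<kappa> i w) \<otimes>\<^bsub>A\<^esub> val i) \<otimes>\<^bsub>A\<^esub> proj n c" ..
qed

section \<open>Cochains are determined by their values at 1, on arrows and on relations\<close>

lemma bimodule_map_restrict: "bimodule_map p f \<Longrightarrow> (\<lambda>w\<in>W n p. f w) \<in> cochains n p"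
  unfolding cochains_iff bimodule_map_def
  by (auto simp: W_add W_left W_right)

lemma cochains_bimodule_map: "f \<in> cochains n p \<Longrightarrow> bimodule_map p f"
  by (simp add: cochains_iff)

lemma bimodule_map_1_closed: "x \<in> arrows n \<Longrightarrow> arrow_elt x \<in> (W n (Suc 0) :: (path \<Rightarrow> 'a) set)"
  by (simp add: W1)

lemma sigma_W2: "i < n \<Longrightarrow> sigma n i \<in> (W n 2 :: (path \<Rightarrow> 'a) set)"
  by (simp add: W2 relations_eq sigma_relation_fun)

lemma bimodule_map_1_block:
  assumes f: "bimodule_map (Suc 0) f" and x: "x \<in> arrows n"
  shows "f (arrow_elt x) \<in> block (arrow_target x) (arrow_source x)"
proof -
  have e: "vertex_elt (arrow_target x) \<otimes>\<^bsub>P\<^esub> arrow_elt x = arrow_elt x" "arrow_elt x \<otimes>\<^bsub>P\<^esub> vertex_elt (arrow_source x) = arrow_elt x"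
    by (simp_all add: vertex_elt_path arrow_elt_path path_elt_mult)
  note W = bimodule_map_1_closed[OF x]
  show ?thesis
    unfolding block_def
    using bimodule_map_closed[OF f W] bimodule_map_vertex(1)[OF f W arrow_target_less[OF x]]
      bimodule_map_vertex(2)[OF f W arrow_source_less[OF x]] by (simp add: e)
qed

lemma W1_expand:
  assumes w: "w \<in> W n (Suc 0)"
  shows "w = (\<Oplus>\<^bsub>P\<^esub>x\<in>arrows n. scaled (w ([x], arrow_source x)) (arrow_elt x))"
proof
  fix q :: path
  obtain xs s where q: "q = (xs, s)" by fastforce
  have "(\<Oplus>\<^bsub>P\<^esub>x\<in>arrows n. scaled (w ([x], arrow_source x)) (arrow_elt x)) q =
      (\<Sum>x\<in>arrows n. w ([x], arrow_source x) * arrow_elt x q)"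
    by (rule finsum_apply) (auto intro!: scaled_closed)
  also have "\<dots> = (\<Sum>x\<in>arrows n. if x = hd xs then (if q = ([x], arrow_source x) then w q else 0) else 0)"
    by (intro sum.cong) (auto simp: arrow_elt_def q)
  also have "\<dots> = w q"
  proof -
    have "hd xs \<in> arrows n \<and> q = ([hd xs], arrow_source (hd xs))" if "w q \<noteq> 0"
    proof -
      have "length (fst q) = Suc 0" "is_path n q"
        using W_homogeneous[OF w] W_closed[OF w] that homogeneousD[of "Suc 0" w q]
        unfolding path_algebra_carrier by blast+
      then show ?thesis by (cases xs) (auto simp: q)
    qed
    then show ?thesis by auto
  qed
  finally show "w q = (\<Oplus>\<^bsub>P\<^esub>x\<in>arrows n. scaled (w ([x], arrow_source x)) (arrow_elt x)) q" ..
qed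

lemma relation_fun_expand: "relation_fun c = (\<Oplus>\<^bsub>P\<^esub>i\<in>{..<n}. scaled (c i) (sigma n i))"
  by (rule ext, subst finsum_apply) (auto intro!: scaled_closed simp: relation_fun_eq[symmetric])

lemma bimodule_map_0_value:
  assumes "bimodule_map 0 f" "w \<in> W n 0"
  shows "f w = proj n w \<otimes>\<^bsub>A\<^esub> f \<one>\<^bsub>P\<^esub>" "f w = f \<one>\<^bsub>P\<^esub> \<otimes>\<^bsub>A\<^esub> proj n w"
  using bimodule_map_left[OF assms(1), of w "\<one>\<^bsub>P\<^esub>"] bimodule_map_right[OF assms(1), of w "\<one>\<^bsub>P\<^esub>"] assms(2)
    W_closed[OF assms(2)]
  by (simp_all add: W0)

lemma cochain_eqI:
  fixes f g :: "'a cochain"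
  assumes "f \<in> cochains n p" "g \<in> cochains n p" "\<And>w. w \<in> W n p \<Longrightarrow> f w = g w"
  shows "f = g"
  using assms by (intro extensionalityI[of f "W n p" g]) (auto simp: cochains_iff)

text \<open>The bimodule W_0 = k is generated by 1.\<close>

lemma cochain_0_eqI:
  fixes f g :: "'a cochain"
  assumes "f \<in> cochains n 0" "g \<in> cochains n 0" "f \<one>\<^bsub>P\<^esub> = g \<one>\<^bsub>P\<^esub>"
  shows "f = g"
  using assms by (intro cochain_eqI[OF assms(1,2)]) (simp add: bimodule_map_0_value(1)[OF cochains_bimodule_map])

lemma bimodule_map_linear:
  assumes f: "bimodule_map p f" and u: "\<And>j. j \<in> S \<Longrightarrow> u j \<in> W n p"
  shows "f (\<Oplus>\<^bsub>P\<^esub>j\<in>S. scaled (c j) (u j)) = (\<Oplus>\<^bsub>A\<^esub>j\<in>S. scalar (c j) \<otimes>\<^bsub>A\<^esub> f (u j))"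
proof -
  have "f (\<Oplus>\<^bsub>P\<^esub>j\<in>S. scaled (c j) (u j)) = (\<Oplus>\<^bsub>A\<^esub>j\<in>S. f (scaled (c j) (u j)))"
    using u by (intro bimodule_map_finsum[OF f] W_scaled)
  also have "\<dots> = (\<Oplus>\<^bsub>A\<^esub>j\<in>S. scalar (c j) \<otimes>\<^bsub>A\<^esub> f (u j))"
    using u bimodule_map_closed[OF f] by (intro A.finsum_cong') (auto simp: bimodule_map_scaled[OF f])
  finally show ?thesis .
qed

lemma cochain_1_eqI:
  fixes f g :: "'a cochain"
  assumes f: "f \<in> cochains n (Suc 0)" and g: "g \<in> cochains n (Suc 0)"
    and eq: "\<And>x. x \<in> arrows n \<Longrightarrow> f (arrow_elt x) = g (arrow_elt x)"
  shows "f = g"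
proof (rule cochain_eqI[OF f g])
  fix w :: "path \<Rightarrow> 'a" assume w: "w \<in> W n (Suc 0)"
  let ?c = "\<lambda>x. w ([x], arrow_source x)"
  note f' = cochains_bimodule_map[OF f] and g' = cochains_bimodule_map[OF g]
  have "f (\<Oplus>\<^bsub>P\<^esub>x\<in>arrows n. scaled (?c x) (arrow_elt x)) = g (\<Oplus>\<^bsub>P\<^esub>x\<in>arrows n. scaled (?c x) (arrow_elt x))"
    using eq bimodule_map_closed[OF g' bimodule_map_1_closed]
    unfolding bimodule_map_linear[OF f', of "arrows n" arrow_elt ?c, OF bimodule_map_1_closed, simplified]
      bimodule_map_linear[OF g', of "arrows n" arrow_elt ?c, OF bimodule_map_1_closed, simplified]
    by (intro A.finsum_cong') auto
  then show "f w = g w" using W1_expand[OF w] by simp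
qed

lemma cochain_2_relation_fun:
  assumes f: "bimodule_map 2 f"
  shows "f (relation_fun c) = (\<Oplus>\<^bsub>A\<^esub>i\<in>{..<n}. scalar (c i) \<otimes>\<^bsub>A\<^esub> f (sigma n i))"
  unfolding relation_fun_expand by (rule bimodule_map_linear[OF f]) (simp add: sigma_W2)

lemma cochain_2_eqI:
  fixes f g :: "'a cochain"
  assumes f: "f \<in> cochains n 2" and g: "g \<in> cochains n 2"
    and eq: "\<And>i. i < n \<Longrightarrow> f (sigma n i) = g (sigma n i)"
  shows "f = g"
proof (rule cochain_eqI[OF f g])
  fix w :: "path \<Rightarrow> 'a" assume "w \<in> W n 2"
  then obtain c where w: "w = relation_fun c" by (auto simp: W2 relations_eq)
  note f' = cochains_bimodule_map[OF f] and g' = cochains_bimodule_map[OF g]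
  show "f w = g w"
    unfolding w cochain_2_relation_fun[OF f'] cochain_2_relation_fun[OF g']
    using eq bimodule_map_closed[OF g' sigma_W2] by (intro A.finsum_cong') auto
qed

lemma finsum_delta:
  assumes "finite I" "j \<in> I" "a \<in> carrier A" and b: "\<And>i. i \<in> I \<Longrightarrow> i \<noteq> j \<Longrightarrow> b i \<in> carrier A"
  shows "(\<Oplus>\<^bsub>A\<^esub>i\<in>I. scalar (of_bool (i = j)) \<otimes>\<^bsub>A\<^esub> (if i = j then a else b i)) = a"
proof -
  have "(\<Oplus>\<^bsub>A\<^esub>i\<in>I. scalar (of_bool (i = j)) \<otimes>\<^bsub>A\<^esub> (if i = j then a else b i)) = (\<Oplus>\<^bsub>A\<^esub>i\<in>I. if j = i then a else \<zero>\<^bsub>A\<^esub>)"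
    using assms by (intro A.finsum_cong') auto
  also have "\<dots> = a" using A.finsum_singleton[of j I "\<lambda>_. a"] assms by simp
  finally show ?thesis .
qed

lemma cochain_0_exists:
  assumes val: "\<And>i. i < n \<Longrightarrow> val i \<in> block i i"
  obtains f where "f \<in> cochains n 0" "f \<one>\<^bsub>P\<^esub> = (\<Oplus>\<^bsub>A\<^esub>i\<in>{..<n}. val i)"
proof -
  define f where "f = (\<lambda>w :: path \<Rightarrow> 'a. \<Oplus>\<^bsub>A\<^esub>i\<in>{..<n}. scalar (w ([], i)) \<otimes>\<^bsub>A\<^esub> val i)"
  have "bimodule_map 0 f"
    unfolding f_def
    by (rule bimodule_map_coordinates[where t = "\<lambda>i. i" and s = "\<lambda>i. i"])
      (auto simp: val W0 path_algebra_add tensor_power_iff tensor_power0_mult mult_tensor_power0)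
  moreover have "f \<one>\<^bsub>P\<^esub> = (\<Oplus>\<^bsub>A\<^esub>i\<in>{..<n}. val i)"
    unfolding f_def using blockD(1)[OF val] by (intro A.finsum_cong') (auto simp: path_algebra_one)
  ultimately show ?thesis
    by (intro that[of "restrict f (W n 0)"] bimodule_map_restrict) (simp_all add: W0)
qed

lemma cochain_1_exists:
  assumes val: "\<And>x. x \<in> arrows n \<Longrightarrow> val x \<in> block (arrow_target x) (arrow_source x)"
  obtains f where "f \<in> cochains n (Suc 0)" "\<And>x. x \<in> arrows n \<Longrightarrow> f (arrow_elt x) = val x"
proof -
  define f where "f = (\<lambda>w :: path \<Rightarrow> 'a. \<Oplus>\<^bsub>A\<^esub>x\<in>arrows n. scalar (w ([x], arrow_source x)) \<otimes>\<^bsub>A\<^esub> val x)"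
  have "bimodule_map (Suc 0) f"
    unfolding f_def
    by (rule bimodule_map_coordinates[where t = arrow_target and s = arrow_source])
      (auto simp: val path_algebra_add tensor_power_iff tensor_power0_mult mult_tensor_power0
        arrow_source_less arrow_target_less)
  moreover have "f (arrow_elt x) = val x" if "x \<in> arrows n" for x
  proof -
    have "f (arrow_elt x) = (\<Oplus>\<^bsub>A\<^esub>y\<in>arrows n. scalar (of_bool (y = x)) \<otimes>\<^bsub>A\<^esub> (if y = x then val x else val y))"
      unfolding f_def using blockD(1)[OF val] by (intro A.finsum_cong') (auto simp: arrow_elt_def)
    then show ?thesis using finsum_delta[of "arrows n" x "val x" val] blockD(1)[OF val] that by simp
  qed
  ultimately show ?thesis
    using that[of "restrict f (W n (Suc 0))"] bimodule_map_restrict by (simp add: bimodule_map_1_closed)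
qed

lemma cochain_2_exists:
  assumes val: "\<And>i. i < n \<Longrightarrow> val i \<in> block i i"
  obtains f where "f \<in> cochains n 2" "\<And>i. i < n \<Longrightarrow> f (sigma n i) = val i"
proof -
  define f where "f = (\<lambda>w :: path \<Rightarrow> 'a. \<Oplus>\<^bsub>A\<^esub>i\<in>{..<n}. scalar (relation_coeff w i) \<otimes>\<^bsub>A\<^esub> val i)"
  have "bimodule_map 2 f"
    unfolding f_def
    by (rule bimodule_map_coordinates[where t = "\<lambda>i. i" and s = "\<lambda>i. i"])
      (auto simp: val path_algebra_add tensor_power_iff tensor_power0_mult mult_tensor_power0
        relation_coeff_def lead_arrow algebra_simps)
  moreover have "f (sigma n j) = val j" if "j < n" for j
  proof -
    have "f (sigma n j) = (\<Oplus>\<^bsub>A\<^esub>i\<in>{..<n}. scalar (of_bool (i = j)) \<otimes>\<^bsub>A\<^esub> (if i = j then val j else val i))"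
      unfolding f_def using blockD(1)[OF val] that
      by (intro A.finsum_cong') (auto simp: sigma_relation_fun relation_coeff_relation_fun)
    then show ?thesis using finsum_delta[of "{..<n}" j "val j" val] blockD(1)[OF val] that by simp
  qed
  ultimately show ?thesis
    using that[of "restrict f (W n 2)"] bimodule_map_restrict by (simp add: sigma_W2)
qed

text \<open>Existence and uniqueness give the \<open>THE\<close> in \<open>cochain1\<close> its
  meaning, as soon as every value lies in the Peirce component of its arrow.\<close>

lemma cochain1:
  assumes val: "\<And>x. x \<in> arrows n \<Longrightarrow> val x \<in> block (arrow_target x) (arrow_source x)"
  shows "cochain1 n val \<in> cochains n (Suc 0)" "x \<in> arrows n \<Longrightarrow> cochain1 n val (arrow_elt x) = val x"
proof -
  obtain f where f: "f \<in> cochains n (Suc 0)" "\<And>x. x \<in> arrows n \<Longrightarrow> f (arrow_elt x) = val x"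
    using cochain_1_exists[of val] val by blast
  have "cochain1 n val = f"
    unfolding cochain1_def using f by (intro the_equality) (auto intro!: cochain_1_eqI)
  then show "cochain1 n val \<in> cochains n (Suc 0)" "x \<in> arrows n \<Longrightarrow> cochain1 n val (arrow_elt x) = val x"
    using f by auto
qed

lemma cochain2:
  assumes val: "\<And>i. i < n \<Longrightarrow> val i \<in> block i i"
  shows "cochain2 n val \<in> cochains n 2" "i < n \<Longrightarrow> cochain2 n val (sigma n i) = val i"
proof -
  obtain f where f: "f \<in> cochains n 2" "\<And>i. i < n \<Longrightarrow> f (sigma n i) = val i"
    using cochain_2_exists[of val] val by blast
  have "cochain2 n val = f"
    unfolding cochain2_def using f by (intro the_equality) (auto intro!: cochain_2_eqI)
  then show "cochain2 n val \<in> cochains n 2" "i < n \<Longrightarrow> cochain2 n val (sigma n i) = val i"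
    using f by auto
qed

section \<open>Sums over the arrows occurring in a relation\<close>

lemma relation_sum_closed:
  "(\<And>x. x \<in> arrows n \<Longrightarrow> m x \<in> carrier A) \<Longrightarrow> relation_sum c m \<in> carrier A"
  unfolding relation_sum_def by (intro A.finsum_closed) auto

lemma relation_sum_cong:
  assumes "\<And>x. x \<in> arrows n \<Longrightarrow> m x = m' x" "\<And>x. x \<in> arrows n \<Longrightarrow> m' x \<in> carrier A"
  shows "relation_sum c m = relation_sum c m'"
  unfolding relation_sum_def using assms by (intro A.finsum_cong') auto

lemma relation_sum_add:
  assumes "\<And>x. x \<in> arrows n \<Longrightarrow> m x \<in> carrier A" "\<And>x. x \<in> arrows n \<Longrightarrow> m' x \<in> carrier A"
  shows "relation_sum c (\<lambda>x. m x \<oplus>\<^bsub>A\<^esub> m' x) = relation_sum c m \<oplus>\<^bsub>A\<^esub> relation_sum c m'"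
proof -
  have "relation_sum c (\<lambda>x. m x \<oplus>\<^bsub>A\<^esub> m' x) = (\<Oplus>\<^bsub>A\<^esub>x\<in>arrows n. scalar (c (arrow_target x) * arrow_sign x) \<otimes>\<^bsub>A\<^esub> m x \<oplus>\<^bsub>A\<^esub>
      scalar (c (arrow_target x) * arrow_sign x) \<otimes>\<^bsub>A\<^esub> m' x)"
    unfolding relation_sum_def using assms by (intro A.finsum_cong') (auto simp: A.r_distr)
  also have "\<dots> = relation_sum c m \<oplus>\<^bsub>A\<^esub> relation_sum c m'"
    unfolding relation_sum_def using assms by (intro A.finsum_addf) auto
  finally show ?thesis .
qed

text \<open>Only additivity and compatibility with scalars are asked of D, so that the lemma serves
  for negation, multiplication by an element, commutators and derivations alike.\<close>

lemma relation_sum_map: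
  assumes m: "\<And>x. x \<in> arrows n \<Longrightarrow> m x \<in> carrier A"
    and D: "D \<in> carrier A \<rightarrow> carrier A" "\<And>a b. a \<in> carrier A \<Longrightarrow> b \<in> carrier A \<Longrightarrow> D (a \<oplus>\<^bsub>A\<^esub> b) = D a \<oplus>\<^bsub>A\<^esub> D b"
      "\<And>c a. a \<in> carrier A \<Longrightarrow> D (scalar c \<otimes>\<^bsub>A\<^esub> a) = scalar c \<otimes>\<^bsub>A\<^esub> D a"
  shows "D (relation_sum c m) = relation_sum c (\<lambda>x. D (m x))"
proof -
  have zero: "D \<zero>\<^bsub>A\<^esub> = \<zero>\<^bsub>A\<^esub>"
    using D(3)[of "\<zero>\<^bsub>A\<^esub>" 0] D(1) by (auto simp: Pi_iff)
  have "D (\<Oplus>\<^bsub>A\<^esub>x\<in>S. scalar (c (arrow_target x) * arrow_sign x) \<otimes>\<^bsub>A\<^esub> m x) =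
      (\<Oplus>\<^bsub>A\<^esub>x\<in>S. scalar (c (arrow_target x) * arrow_sign x) \<otimes>\<^bsub>A\<^esub> D (m x))"
    if "finite S" "S \<subseteq> arrows n" for S
    using that
  proof (induction S rule: finite_induct)
    case (insert x S)
    then have "(\<Oplus>\<^bsub>A\<^esub>x\<in>insert x S. scalar (c (arrow_target x) * arrow_sign x) \<otimes>\<^bsub>A\<^esub> m x) =
        (scalar (c (arrow_target x) * arrow_sign x) \<otimes>\<^bsub>A\<^esub> m x) \<oplus>\<^bsub>A\<^esub>
        (\<Oplus>\<^bsub>A\<^esub>x\<in>S. scalar (c (arrow_target x) * arrow_sign x) \<otimes>\<^bsub>A\<^esub> m x)"
      using m by (intro A.finsum_insert) auto
    moreover have "(\<Oplus>\<^bsub>A\<^esub>x\<in>insert x S. scalar (c (arrow_target x) * arrow_sign x) \<otimes>\<^bsub>A\<^esub> D (m x)) =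
        (scalar (c (arrow_target x) * arrow_sign x) \<otimes>\<^bsub>A\<^esub> D (m x)) \<oplus>\<^bsub>A\<^esub>
        (\<Oplus>\<^bsub>A\<^esub>x\<in>S. scalar (c (arrow_target x) * arrow_sign x) \<otimes>\<^bsub>A\<^esub> D (m x))"
      using m D(1) insert by (intro A.finsum_insert) (auto simp: Pi_iff)
    moreover have "(\<Oplus>\<^bsub>A\<^esub>x\<in>S. scalar (c (arrow_target x) * arrow_sign x) \<otimes>\<^bsub>A\<^esub> m x) \<in> carrier A"
      using m insert by (intro A.finsum_closed) auto
    ultimately show ?case using insert m D by simp
  qed (simp add: zero)
  then show ?thesis unfolding relation_sum_def by simp
qed

text \<open>The scalars in \<open>relation_sum\<close> are the coefficients of the relation at the
  paths x bar(x), hence coordinates in the sense of \<open>bimodule_map_coordinates\<close>.\<close>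

lemma relation_sum_linear:
  assumes m: "\<And>x. x \<in> arrows n \<Longrightarrow> m x \<in> block (arrow_target x) (arrow_target x)"
    and G: "\<And>c. G (relation_fun c) = relation_sum c m"
  shows "bimodule_map 2 G"
proof -
  let ?F = "\<lambda>w. \<Oplus>\<^bsub>A\<^esub>x\<in>arrows n. scalar (w ([x, bar x], arrow_target x)) \<otimes>\<^bsub>A\<^esub> m x"
  have "bimodule_map 2 ?F"
    by (rule bimodule_map_coordinates[where t = arrow_target and s = arrow_target])
      (auto simp: m path_algebra_add tensor_power_iff tensor_power0_mult mult_tensor_power0 arrow_target_less)
  moreover have "G w = ?F w" if wW: "w \<in> W n 2" for w :: "path \<Rightarrow> 'a"
  proof -
    obtain c where w: "w = relation_fun c" using wW by (auto simp: W2 relations_eq)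
    then show ?thesis
      using blockD(1)[OF m] unfolding w G relation_sum_def
      by (intro A.finsum_cong') (auto simp: relation_fun_def)
  qed
  ultimately show ?thesis
    unfolding bimodule_map_def by (auto simp: W_add W_left W_right)
qed

end

section \<open>The Koszul differential\<close>

text \<open>The Leibniz rule for the inner derivation a -> z a - a z, which is what a coboundary of
  degree one does to arrows.\<close>

lemma (in ring) commutator_leibniz:
  assumes "a \<in> carrier R" "b \<in> carrier R" "z \<in> carrier R"
  shows "(z \<otimes> a \<ominus> a \<otimes> z) \<otimes> b \<oplus> a \<otimes> (z \<otimes> b \<ominus> b \<otimes> z) = z \<otimes> (a \<otimes> b) \<ominus> (a \<otimes> b) \<otimes> z"
  using assms by (simp add: minus_eq l_distr r_distr m_assoc l_minus r_minus a_assoc r_neg1)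

context type_D begin

lemma add_pow_sign:
  assumes "x \<in> carrier A"
  shows "[((- 1 :: int) ^ k)] \<cdot>\<^bsub>A\<^esub> x = (if even k then x else \<ominus>\<^bsub>A\<^esub> x)"
  using assms A.add.int_pow_neg[of x 1] by (auto simp: minus_one_power_iff)

lemma bimodule_map_cong:
  "bimodule_map p f \<Longrightarrow> (\<And>w. w \<in> W n p \<Longrightarrow> g w = f w) \<Longrightarrow> bimodule_map p g"
  unfolding bimodule_map_def by (auto simp: W_add W_left W_right)

lemma bimodule_map_plus:
  assumes f: "bimodule_map p f" and g: "bimodule_map p g"
  shows "bimodule_map p (\<lambda>w. f w \<oplus>\<^bsub>A\<^esub> g w)"
  using bimodule_map_closed[OF f] bimodule_map_closed[OF g]
  by (intro bimodule_mapI)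
    (auto simp: bimodule_map_add[OF f] bimodule_map_add[OF g] bimodule_map_left[OF f] bimodule_map_left[OF g]
      bimodule_map_right[OF f] bimodule_map_right[OF g] A.l_distr A.r_distr A.a_ac)

lemma bimodule_map_uminus:
  assumes f: "bimodule_map p f"
  shows "bimodule_map p (\<lambda>w. \<ominus>\<^bsub>A\<^esub> f w)"
  using bimodule_map_closed[OF f]
  by (intro bimodule_mapI)
    (auto simp: bimodule_map_add[OF f] bimodule_map_left[OF f] bimodule_map_right[OF f]
      A.l_minus A.r_minus A.minus_add)

lemma bimodule_map_null: "bimodule_map p (\<lambda>w. \<zero>\<^bsub>A\<^esub>)"
  by (rule bimodule_mapI) auto

section \<open>The groups of cochains\<close>

abbreviation CG :: "nat \<Rightarrow> 'a cochain monoid" where "CG p \<equiv> cochain_group n p"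

lemma CG_carrier: "carrier (CG p) = cochains n p"
  by (simp add: cochain_group_def)

lemma CG_mult: "f \<otimes>\<^bsub>CG p\<^esub> g = (\<lambda>w\<in>W n p. f w \<oplus>\<^bsub>A\<^esub> g w)"
  by (simp add: cochain_group_def)

lemma CG_one: "\<one>\<^bsub>CG p\<^esub> = (\<lambda>w\<in>W n p. \<zero>\<^bsub>A\<^esub>)"
  by (simp add: cochain_group_def)

lemma cochain_closed: "(f :: 'a cochain) \<in> cochains n p \<Longrightarrow> w \<in> W n p \<Longrightarrow> f w \<in> carrier A"
  by (rule bimodule_map_closed[OF cochains_bimodule_map])

lemma CG_comm_group: "comm_group (CG p)"
proof (rule comm_groupI)
  fix f g h assume "f \<in> carrier (CG p)" "g \<in> carrier (CG p)"
  note fg = this[unfolded CG_carrier]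
  then show "f \<otimes>\<^bsub>CG p\<^esub> g \<in> carrier (CG p)"
    unfolding CG_carrier CG_mult by (intro bimodule_map_restrict bimodule_map_plus cochains_bimodule_map)
  show "f \<otimes>\<^bsub>CG p\<^esub> g = g \<otimes>\<^bsub>CG p\<^esub> f"
    unfolding CG_mult using fg by (intro restrict_ext A.a_comm) (auto simp: cochain_closed)
  assume "h \<in> carrier (CG p)"
  then show "f \<otimes>\<^bsub>CG p\<^esub> g \<otimes>\<^bsub>CG p\<^esub> h = f \<otimes>\<^bsub>CG p\<^esub> (g \<otimes>\<^bsub>CG p\<^esub> h)"
    unfolding CG_mult CG_carrier using fg by (intro restrict_ext) (auto simp: cochain_closed A.a_assoc)
next
  show "\<one>\<^bsub>CG p\<^esub> \<in> carrier (CG p)"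
    unfolding CG_carrier CG_one by (intro bimodule_map_restrict bimodule_map_null)
  fix f assume "f \<in> carrier (CG p)"
  then have f: "f \<in> cochains n p" by (simp add: CG_carrier)
  have m: "(\<lambda>w\<in>W n p. \<ominus>\<^bsub>A\<^esub> f w) \<in> cochains n p"
    using f by (intro bimodule_map_restrict bimodule_map_uminus cochains_bimodule_map)
  have "f \<in> extensional (W n p)" using f by (simp add: cochains_iff)
  then show "\<one>\<^bsub>CG p\<^esub> \<otimes>\<^bsub>CG p\<^esub> f = f"
    unfolding CG_mult CG_one using f
    by (intro extensionalityI[of _ "W n p"]) (auto simp: cochain_closed)
  show "\<exists>g\<in>carrier (CG p). g \<otimes>\<^bsub>CG p\<^esub> f = \<one>\<^bsub>CG p\<^esub>"
    unfolding CG_carrier using f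
    by (intro bexI[OF _ m]) (auto simp: CG_mult CG_one cochain_closed A.l_neg intro!: restrict_ext)
qed

lemma CG_group: "group (CG p)"
  using CG_comm_group by (simp add: comm_group_def)

section \<open>The differential in each degree\<close>

lemma koszul_diff_0:
  assumes f: "bimodule_map 0 f" and w: "w \<in> W n (Suc 0)"
  shows "koszul_diff n 0 f w = f \<one>\<^bsub>P\<^esub> \<otimes>\<^bsub>A\<^esub> proj n w \<ominus>\<^bsub>A\<^esub> proj n w \<otimes>\<^bsub>A\<^esub> f \<one>\<^bsub>P\<^esub>"
proof -
  have "f \<one>\<^bsub>P\<^esub> \<in> carrier A" "proj n w \<in> carrier A"
    using bimodule_map_closed[OF f, of "\<one>\<^bsub>P\<^esub>"] W_closed[OF w] by (auto simp: W0)
  then show ?thesis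
    using w convolution_0_left[OF f bimodule_map_proj w] convolution_0_right[OF bimodule_map_proj f w] add_pow_sign[of _ 0]
    by (simp add: koszul_diff_def)
qed

lemma proj_finsum: "u \<in> S \<rightarrow> carrier P \<Longrightarrow> proj n (\<Oplus>\<^bsub>P\<^esub>j\<in>S. u j) = (\<Oplus>\<^bsub>A\<^esub>j\<in>S. proj n (u j))"
  by (induction S rule: infinite_finite_induct) (simp_all add: Pi_def)

text \<open>Multiplying out a relation in A gives its image under the projection, which is
  zero.\<close>

lemma relation_sum_proj: "relation_sum c (\<lambda>x. arr x \<otimes>\<^bsub>A\<^esub> arr (bar x)) = \<zero>\<^bsub>A\<^esub>"
proof -
  have "relation_sum c (\<lambda>x. arr x \<otimes>\<^bsub>A\<^esub> arr (bar x)) = convolution n (Suc 0) (Suc 0) (proj n) (proj n) (relation_fun c)"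
    using convolution_1_1[OF bimodule_map_proj bimodule_map_proj] by simp
  also have "\<dots> = (\<Oplus>\<^bsub>A\<^esub>x\<in>arrows n. proj n (scaled (c (arrow_target x) * arrow_sign x) (arrow_elt x)) \<otimes>\<^bsub>A\<^esub> arr (bar x))"
    by (intro convolution_eq bimodule_map_proj relation_fun_arrows) (auto simp: bimodule_map_1_closed W_scaled)
  also have "\<dots> = (\<Oplus>\<^bsub>A\<^esub>x\<in>arrows n. proj n (scaled (c (arrow_target x) * arrow_sign x) (arrow_elt x) \<otimes>\<^bsub>P\<^esub> arrow_elt (bar x)))"
    by (intro A.finsum_cong') (auto simp: scaled_closed)
  also have "\<dots> = proj n (relation_fun c)"
    unfolding relation_fun_arrows by (subst proj_finsum) (auto simp: scaled_closed)
  also have "\<dots> = \<zero>\<^bsub>A\<^esub>"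
    by (rule proj_relation) (simp add: relations_eq)
  finally show ?thesis .
qed

lemma arr_closed [simp]: "x \<in> arrows n \<Longrightarrow> arr x \<in> carrier A"
  by simp

lemma value_closed: "bimodule_map (Suc 0) f \<Longrightarrow> x \<in> arrows n \<Longrightarrow> f (arrow_elt x) \<in> carrier A"
  by (rule bimodule_map_closed) (auto simp: bimodule_map_1_closed)

lemma koszul_diff_1:
  assumes f: "bimodule_map (Suc 0) f"
  shows "koszul_diff n (Suc 0) f (relation_fun c) =
    relation_sum c (\<lambda>x. f (arrow_elt x) \<otimes>\<^bsub>A\<^esub> arr (bar x) \<oplus>\<^bsub>A\<^esub> arr x \<otimes>\<^bsub>A\<^esub> f (arrow_elt (bar x)))"
proof -
  have "relation_fun c \<in> W n (Suc 0 + 1)"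
    using W2 by (simp add: relations_eq numeral_2_eq_2)
  moreover have closed: "relation_sum c (\<lambda>x. arr x \<otimes>\<^bsub>A\<^esub> f (arrow_elt (bar x))) \<in> carrier A"
      "relation_sum c (\<lambda>x. f (arrow_elt x) \<otimes>\<^bsub>A\<^esub> arr (bar x)) \<in> carrier A"
    by (intro relation_sum_closed, simp add: value_closed[OF f])+
  ultimately have "koszul_diff n (Suc 0) f (relation_fun c) =
      relation_sum c (\<lambda>x. f (arrow_elt x) \<otimes>\<^bsub>A\<^esub> arr (bar x)) \<oplus>\<^bsub>A\<^esub> relation_sum c (\<lambda>x. arr x \<otimes>\<^bsub>A\<^esub> f (arrow_elt (bar x)))"
    using convolution_1_1[OF f bimodule_map_proj, of c] convolution_1_1[OF bimodule_map_proj f, of c] add_pow_sign[of _ "Suc 0"]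
    by (simp add: koszul_diff_def a_minus_def)
  then show ?thesis
    by (simp add: relation_sum_add value_closed[OF f])
qed

lemma koszul_diff_ge_2:
  assumes f: "bimodule_map p f" and p: "p \<ge> 2"
  shows "koszul_diff n p f = \<one>\<^bsub>CG (p + 1)\<^esub>"
proof -
  have "W n (p + 1) = {\<zero>\<^bsub>P\<^esub>}" using p by (intro W_ge_3) simp
  then show ?thesis
    unfolding koszul_diff_def CG_one
    using convolution_zero[OF f bimodule_map_proj, of 1] convolution_zero[OF bimodule_map_proj f, of 1] add_pow_sign[of "\<zero>\<^bsub>A\<^esub>" p]
    by (intro restrict_ext) (simp add: a_minus_def)
qed

text \<open>In W_0 = k one has c 1 = 1 c, and the map is linear over k on both sides.\<close>

lemma commutes_tensor_power0:
  assumes f: "bimodule_map 0 f" and c: "c \<in> tensor_power n 0"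
  shows "f \<one>\<^bsub>P\<^esub> \<otimes>\<^bsub>A\<^esub> proj n c = proj n c \<otimes>\<^bsub>A\<^esub> f \<one>\<^bsub>P\<^esub>"
  using bimodule_map_0_value[OF f, of c] c by (simp add: W0)

lemma one_value_closed: "bimodule_map 0 f \<Longrightarrow> f \<one>\<^bsub>P\<^esub> \<in> carrier A"
  by (rule bimodule_map_closed) (auto simp: W0)

lemma bimodule_map_mult_left:
  assumes g: "bimodule_map p g" and z: "z \<in> carrier A" "\<And>c. c \<in> tensor_power n 0 \<Longrightarrow> z \<otimes>\<^bsub>A\<^esub> proj n c = proj n c \<otimes>\<^bsub>A\<^esub> z"
  shows "bimodule_map p (\<lambda>w. z \<otimes>\<^bsub>A\<^esub> g w)"
proof (rule bimodule_mapI)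
  fix c w :: "path \<Rightarrow> 'a" assume c: "c \<in> tensor_power n 0" and w: "w \<in> W n p"
  note closed = z(1) bimodule_map_closed[OF g w] proj_tensor_power[OF c]
  have "z \<otimes>\<^bsub>A\<^esub> g (c \<otimes>\<^bsub>P\<^esub> w) = (z \<otimes>\<^bsub>A\<^esub> proj n c) \<otimes>\<^bsub>A\<^esub> g w"
    using closed by (simp add: bimodule_map_left[OF g c w] A.m_assoc)
  then show "z \<otimes>\<^bsub>A\<^esub> g (c \<otimes>\<^bsub>P\<^esub> w) = proj n c \<otimes>\<^bsub>A\<^esub> (z \<otimes>\<^bsub>A\<^esub> g w)"
    using closed by (simp add: z(2)[OF c] A.m_assoc)
  show "z \<otimes>\<^bsub>A\<^esub> g (w \<otimes>\<^bsub>P\<^esub> c) = z \<otimes>\<^bsub>A\<^esub> g w \<otimes>\<^bsub>A\<^esub> proj n c"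
    using closed by (simp add: bimodule_map_right[OF g c w] A.m_assoc)
qed (use z in \<open>auto simp: bimodule_map_closed[OF g] bimodule_map_add[OF g] A.r_distr\<close>)

lemma bimodule_map_mult_right:
  assumes g: "bimodule_map p g" and z: "z \<in> carrier A" "\<And>c. c \<in> tensor_power n 0 \<Longrightarrow> z \<otimes>\<^bsub>A\<^esub> proj n c = proj n c \<otimes>\<^bsub>A\<^esub> z"
  shows "bimodule_map p (\<lambda>w. g w \<otimes>\<^bsub>A\<^esub> z)"
proof (rule bimodule_mapI)
  fix c w :: "path \<Rightarrow> 'a" assume c: "c \<in> tensor_power n 0" and w: "w \<in> W n p"
  note closed = z(1) bimodule_map_closed[OF g w] proj_tensor_power[OF c]
  show "g (c \<otimes>\<^bsub>P\<^esub> w) \<otimes>\<^bsub>A\<^esub> z = proj n c \<otimes>\<^bsub>A\<^esub> (g w \<otimes>\<^bsub>A\<^esub> z)"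
    using closed by (simp add: bimodule_map_left[OF g c w] A.m_assoc)
  show "g (w \<otimes>\<^bsub>P\<^esub> c) \<otimes>\<^bsub>A\<^esub> z = g w \<otimes>\<^bsub>A\<^esub> z \<otimes>\<^bsub>A\<^esub> proj n c"
    using closed by (simp add: bimodule_map_right[OF g c w] A.m_assoc z(2)[OF c])
qed (use z in \<open>auto simp: bimodule_map_closed[OF g] bimodule_map_add[OF g] A.l_distr\<close>)

lemma relation_product_block:
  assumes "bimodule_map (Suc 0) f" "bimodule_map (Suc 0) g" "x \<in> arrows n"
  shows "f (arrow_elt x) \<otimes>\<^bsub>A\<^esub> g (arrow_elt (bar x)) \<in> block (arrow_target x) (arrow_target x)"
  using bimodule_map_1_block[OF assms(1,3)] bimodule_map_1_block[OF assms(2), of "bar x"] assms(3)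
  by (intro block_mult) (auto simp: arrow_target_less)

lemma koszul_diff_closed:
  fixes f :: "'a cochain"
  assumes "f \<in> cochains n p" shows "koszul_diff n p f \<in> cochains n (p + 1)"
proof -
  note f = cochains_bimodule_map[OF assms]
  consider "p = 0" | "p = Suc 0" | "p \<ge> 2" by linarith
  then have "bimodule_map (p + 1) (koszul_diff n p f)"
  proof cases
    case 1
    note f0 = f[unfolded 1]
    have "bimodule_map (Suc 0) (\<lambda>w. f \<one>\<^bsub>P\<^esub> \<otimes>\<^bsub>A\<^esub> proj n w \<oplus>\<^bsub>A\<^esub> \<ominus>\<^bsub>A\<^esub> (proj n w \<otimes>\<^bsub>A\<^esub> f \<one>\<^bsub>P\<^esub>))"
      using one_value_closed[OF f0] commutes_tensor_power0[OF f0]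
      by (intro bimodule_map_plus bimodule_map_uminus bimodule_map_mult_left bimodule_map_mult_right bimodule_map_proj)
    then have "bimodule_map (Suc 0) (koszul_diff n 0 f)"
      by (rule bimodule_map_cong) (simp add: koszul_diff_0[OF f0] a_minus_def)
    then show ?thesis by (simp add: 1)
  next
    case 2
    note f1 = f[unfolded 2]
    have "bimodule_map 2 (koszul_diff n (Suc 0) f)"
      using relation_product_block[OF f1 bimodule_map_proj] relation_product_block[OF bimodule_map_proj f1]
      by (intro relation_sum_linear[OF _ koszul_diff_1[OF f1]] block_add) (auto simp: arrow_target_less)
    then show ?thesis by (simp add: 2 numeral_2_eq_2)
  next
    case 3
    then show ?thesis
      using koszul_diff_ge_2[OF f 3] bimodule_map_restrict[OF bimodule_map_null] cochains_bimodule_map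
      by (simp add: CG_one)
  qed
  then show ?thesis by (simp add: cochains_iff koszul_diff_def)
qed

lemma koszul_diff_hom: "koszul_diff n p \<in> hom (CG p) (CG (p + 1))"
proof (rule homI)
  fix f assume "f \<in> carrier (CG p)"
  then show "koszul_diff n p f \<in> carrier (CG (p + 1))"
    using koszul_diff_closed by (simp add: CG_carrier)
next
  fix f g assume fg: "f \<in> carrier (CG p)" "g \<in> carrier (CG p)"
  interpret G: comm_group "CG p" by (rule CG_comm_group)
  interpret H: comm_group "CG (p + 1)" by (rule CG_comm_group)
  have closed: "f \<otimes>\<^bsub>CG p\<^esub> g \<in> cochains n p" using fg G.m_closed by (simp add: CG_carrier)
  have closed': "koszul_diff n p f \<otimes>\<^bsub>CG (p + 1)\<^esub> koszul_diff n p g \<in> cochains n (p + 1)"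
    using fg koszul_diff_closed H.m_closed by (simp add: CG_carrier)
  note f = cochains_bimodule_map[OF fg(1)[unfolded CG_carrier]] and g = cochains_bimodule_map[OF fg(2)[unfolded CG_carrier]]
  note sum = cochains_bimodule_map[OF closed]
  consider "p = 0" | "p = Suc 0" | "p \<ge> 2" by linarith
  then show "koszul_diff n p (f \<otimes>\<^bsub>CG p\<^esub> g) = koszul_diff n p f \<otimes>\<^bsub>CG (p + 1)\<^esub> koszul_diff n p g"
  proof cases
    case 1
    note f0 = f[unfolded 1] and g0 = g[unfolded 1] and s0 = sum[unfolded 1]
    show ?thesis
    proof (rule cochain_eqI[OF koszul_diff_closed[OF closed] closed'])
      fix w :: "path \<Rightarrow> 'a" assume w: "w \<in> W n (p + 1)"
      then have w': "w \<in> W n (Suc 0)" by (simp add: 1)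
      have "(f \<otimes>\<^bsub>CG 0\<^esub> g) \<one>\<^bsub>P\<^esub> = f \<one>\<^bsub>P\<^esub> \<oplus>\<^bsub>A\<^esub> g \<one>\<^bsub>P\<^esub>"
        by (simp add: CG_mult W0)
      then show "koszul_diff n p (f \<otimes>\<^bsub>CG p\<^esub> g) w = (koszul_diff n p f \<otimes>\<^bsub>CG (p + 1)\<^esub> koszul_diff n p g) w"
        using w w' koszul_diff_0[OF f0 w'] koszul_diff_0[OF g0 w'] koszul_diff_0[OF s0 w'] one_value_closed[OF f0] one_value_closed[OF g0]
          W_closed[OF w']
        by (simp add: 1 CG_mult A.minus_eq A.l_distr A.r_distr A.minus_add A.a_ac)
    qed
  next
    case 2
    note f1 = f[unfolded 2] and g1 = g[unfolded 2] and s1 = sum[unfolded 2]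
    show ?thesis
    proof (rule cochain_eqI[OF koszul_diff_closed[OF closed] closed'])
      fix w :: "path \<Rightarrow> 'a" assume w: "w \<in> W n (p + 1)"
      then have "w \<in> W n 2" by (simp add: 2 numeral_2_eq_2)
      then obtain c where c: "w = relation_fun c" by (auto simp: W2 relations_eq)
      have "(f \<otimes>\<^bsub>CG (Suc 0)\<^esub> g) (arrow_elt x) = f (arrow_elt x) \<oplus>\<^bsub>A\<^esub> g (arrow_elt x)" if "x \<in> arrows n" for x
        using that by (simp add: CG_mult bimodule_map_1_closed)
      then have "koszul_diff n (Suc 0) (f \<otimes>\<^bsub>CG (Suc 0)\<^esub> g) w = relation_sum c (\<lambda>x.
          (f (arrow_elt x) \<otimes>\<^bsub>A\<^esub> arr (bar x) \<oplus>\<^bsub>A\<^esub> arr x \<otimes>\<^bsub>A\<^esub> f (arrow_elt (bar x))) \<oplus>\<^bsub>A\<^esub>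
          (g (arrow_elt x) \<otimes>\<^bsub>A\<^esub> arr (bar x) \<oplus>\<^bsub>A\<^esub> arr x \<otimes>\<^bsub>A\<^esub> g (arrow_elt (bar x))))"
        unfolding c koszul_diff_1[OF s1]
        by (intro relation_sum_cong) (auto simp: value_closed[OF f1] value_closed[OF g1] A.l_distr A.r_distr A.a_ac)
      then show "koszul_diff n p (f \<otimes>\<^bsub>CG p\<^esub> g) w = (koszul_diff n p f \<otimes>\<^bsub>CG (p + 1)\<^esub> koszul_diff n p g) w"
        using w by (simp add: 2 CG_mult koszul_diff_1[OF f1] koszul_diff_1[OF g1] c relation_sum_add value_closed[OF f1] value_closed[OF g1])
    qed
  next
    case 3
    then show ?thesis by (simp add: koszul_diff_ge_2[OF f 3] koszul_diff_ge_2[OF g 3] koszul_diff_ge_2[OF sum 3] H.l_one[OF H.one_closed, simplified])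
  qed
qed

lemma koszul_diff_group_hom: "group_hom (CG p) (CG (p + 1)) (koszul_diff n p)"
  by (intro group_hom.intro group_hom_axioms.intro CG_group koszul_diff_hom)

lemma cocycles_iff: "f \<in> cocycles n p \<longleftrightarrow> f \<in> cochains n p \<and> koszul_diff n p f = \<one>\<^bsub>CG (p + 1)\<^esub>"
  by (auto simp: cocycles_def kernel_def CG_carrier)

lemma cocycles_cochains: "(f :: 'a cochain) \<in> cocycles n p \<Longrightarrow> f \<in> cochains n p"
  by (simp add: cocycles_iff)

lemma cocycles_ge_2: "p \<ge> 2 \<Longrightarrow> (f :: 'a cochain) \<in> cochains n p \<Longrightarrow> f \<in> cocycles n p"
  by (simp add: cocycles_iff koszul_diff_ge_2[OF cochains_bimodule_map])

lemma cocycles_subgroup: "subgroup (cocycles n p) (CG p)"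
  unfolding cocycles_def by (rule group_hom.subgroup_kernel[OF koszul_diff_group_hom])

lemma coboundaries_subgroup_cochains: "subgroup (coboundaries n p) (CG p)"
proof (cases p)
  case 0
  then show ?thesis using group.triv_subgroup[OF CG_group, of 0] by simp
next
  case (Suc k)
  then show ?thesis
    using group_hom.img_is_subgroup[OF koszul_diff_group_hom, of k] by (simp add: CG_carrier)
qed

lemma cocycle_1_iff:
  assumes f: "f \<in> cochains n (Suc 0)"
  shows "f \<in> cocycles n (Suc 0) \<longleftrightarrow> (\<forall>c. relation_sum c (\<lambda>x.
    f (arrow_elt x) \<otimes>\<^bsub>A\<^esub> arr (bar x) \<oplus>\<^bsub>A\<^esub> arr x \<otimes>\<^bsub>A\<^esub> f (arrow_elt (bar x))) = \<zero>\<^bsub>A\<^esub>)"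
proof -
  have W: "W n (Suc 0 + 1) = (range relation_fun :: (path \<Rightarrow> 'a) set)"
    using W2 by (simp add: relations_eq numeral_2_eq_2)
  have one: "\<one>\<^bsub>CG (Suc 0 + 1)\<^esub> \<in> cochains n (Suc 0 + 1)"
    using group.is_monoid[OF CG_group, THEN monoid.one_closed] by (simp only: CG_carrier)
  have "koszul_diff n (Suc 0) f = \<one>\<^bsub>CG (Suc 0 + 1)\<^esub> \<longleftrightarrow>
      (\<forall>c. koszul_diff n (Suc 0) f (relation_fun c) = \<one>\<^bsub>CG (Suc 0 + 1)\<^esub> (relation_fun c))"
    using cochain_eqI[OF koszul_diff_closed[OF f] one] unfolding W by auto
  then show ?thesis
    using f W by (simp add: cocycles_iff koszul_diff_1[OF cochains_bimodule_map[OF f]] CG_one del: One_nat_def)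
qed

text \<open>A coboundary of degree one sends each arrow to its commutator with a fixed element. By
  the Leibniz rule, its differential is the commutator of that element with the image of a relation,
  which is 0. In degrees at least two the next space of chains is zero.\<close>

lemma coboundaries_cocycles: "coboundaries n p \<subseteq> (cocycles n p :: 'a cochain set)"
proof -
  consider "p = 0" | "p = Suc 0" | k where "p = Suc k" "k \<ge> 1"
    by (metis One_nat_def Suc_leI not0_implies_Suc not_gr0)
  then show ?thesis
  proof cases
    case 1
    then show ?thesis using subgroup.one_closed[OF cocycles_subgroup, of 0] by simp
  next
    case 2
    have "koszul_diff n 0 h \<in> cocycles n (Suc 0)" if h: "h \<in> cochains n 0" for h :: "'a cochain"
    proof -
      let ?z = "h \<one>\<^bsub>P\<^esub>" and ?d = "koszul_diff n 0 h"
      note h0 = cochains_bimodule_map[OF h]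
      note z = one_value_closed[OF h0]
      have d: "?d (arrow_elt x) = ?z \<otimes>\<^bsub>A\<^esub> arr x \<ominus>\<^bsub>A\<^esub> arr x \<otimes>\<^bsub>A\<^esub> ?z" if "x \<in> arrows n" for x
        using koszul_diff_0[OF h0 bimodule_map_1_closed[OF that]] .
      have "relation_sum c (\<lambda>x. ?d (arrow_elt x) \<otimes>\<^bsub>A\<^esub> arr (bar x) \<oplus>\<^bsub>A\<^esub> arr x \<otimes>\<^bsub>A\<^esub> ?d (arrow_elt (bar x))) = \<zero>\<^bsub>A\<^esub>" for c
      proof -
        let ?D = "\<lambda>a. ?z \<otimes>\<^bsub>A\<^esub> a \<ominus>\<^bsub>A\<^esub> a \<otimes>\<^bsub>A\<^esub> ?z"
        have "?d (arrow_elt x) \<otimes>\<^bsub>A\<^esub> arr (bar x) \<oplus>\<^bsub>A\<^esub> arr x \<otimes>\<^bsub>A\<^esub> ?d (arrow_elt (bar x)) = ?D (arr x \<otimes>\<^bsub>A\<^esub> arr (bar x))"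
          if "x \<in> arrows n" for x
          using that z A.commutator_leibniz[of "arr x" "arr (bar x)" ?z] by (simp add: d)
        then have "relation_sum c (\<lambda>x. ?d (arrow_elt x) \<otimes>\<^bsub>A\<^esub> arr (bar x) \<oplus>\<^bsub>A\<^esub> arr x \<otimes>\<^bsub>A\<^esub> ?d (arrow_elt (bar x))) =
            relation_sum c (\<lambda>x. ?D (arr x \<otimes>\<^bsub>A\<^esub> arr (bar x)))"
          using z by (intro relation_sum_cong) auto
        also have "\<dots> = ?D (relation_sum c (\<lambda>x. arr x \<otimes>\<^bsub>A\<^esub> arr (bar x)))"
          using z
          by (intro relation_sum_map[symmetric])
            (auto simp: A.minus_eq A.l_distr A.r_distr A.minus_add A.a_ac scalar_left_commute A.m_assoc A.r_minus)
        also have "\<dots> = \<zero>\<^bsub>A\<^esub>"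
          using z by (simp add: relation_sum_proj A.minus_eq)
        finally show ?thesis .
      qed
      then show ?thesis
        using cocycle_1_iff koszul_diff_closed[OF h] by simp
    qed
    then show ?thesis by (auto simp: 2)
  next
    case 3
    then show ?thesis
      using koszul_diff_closed[of _ k] by (auto intro!: cocycles_ge_2)
  qed
qed

section \<open>The cohomology groups\<close>

abbreviation ZG :: "nat \<Rightarrow> 'a cochain monoid" where
  "ZG p \<equiv> (CG p)\<lparr>carrier := cocycles n p\<rparr>"

lemma ZG_comm_group: "comm_group (ZG p)"
proof (rule group.group_comm_groupI)
  show "group (ZG p)"
    by (rule group.subgroup_imp_group[OF CG_group cocycles_subgroup])
  fix f g assume "f \<in> carrier (ZG p)" "g \<in> carrier (ZG p)"
  then show "f \<otimes>\<^bsub>ZG p\<^esub> g = g \<otimes>\<^bsub>ZG p\<^esub> f"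
    using comm_monoid.m_comm[OF comm_group.axioms(1)[OF CG_comm_group], of f p g] cocycles_cochains
    by (simp add: CG_carrier)
qed

lemma coboundaries_subgroup: "subgroup (coboundaries n p) (ZG p)"
  by (rule group.subgroup_incl[OF CG_group coboundaries_subgroup_cochains cocycles_subgroup coboundaries_cocycles])

lemma coboundaries_normal: "coboundaries n p \<lhd> ZG p"
  using comm_group.subgroup_imp_normal[OF ZG_comm_group coboundaries_subgroup] .

lemma HK_group: "group (HK n p :: 'a cochain set monoid)"
  unfolding HK_def by (rule normal.factorgroup_is_group[OF coboundaries_normal])

lemma HK_carrier: "carrier (HK n p) = hk_class n p ` (cocycles n p :: 'a cochain set)"
  unfolding HK_def carrier_FactGroup by (simp add: hk_class_def r_coset_def)

lemma HK_one: "\<one>\<^bsub>HK n p\<^esub> = (coboundaries n p :: 'a cochain set)"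
  by (simp add: HK_def)

lemma HK_mult:
  assumes "f \<in> cocycles n p" "g \<in> cocycles n p"
  shows "hk_class n p f \<otimes>\<^bsub>HK n p\<^esub> hk_class n p g = hk_class n p (f \<otimes>\<^bsub>CG p\<^esub> g)"
proof -
  have coset: "hk_class n p f = coboundaries n p #>\<^bsub>ZG p\<^esub> f" for f :: "'a cochain"
    by (simp add: hk_class_def r_coset_def)
  show ?thesis
    unfolding coset HK_def mult_FactGroup using normal.rcos_sum[OF coboundaries_normal, of _ p] assms by simp
qed

lemma hk_class_one_iff: "(f :: 'a cochain) \<in> cocycles n p \<Longrightarrow> hk_class n p f = \<one>\<^bsub>HK n p\<^esub> \<longleftrightarrow> f \<in> (coboundaries n p :: 'a cochain set)"
  unfolding HK_one hk_class_def
  using group.coset_join1[OF CG_group _ _ coboundaries_subgroup_cochains, of p f]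
    group.coset_join2[OF CG_group _ coboundaries_subgroup_cochains, of f p]
    subgroup.subset[OF coboundaries_subgroup_cochains, of p] cocycles_cochains[of f p]
  by (auto simp: CG_carrier)

lemma hk_class_add_coboundary:
  assumes "b \<in> coboundaries n p" "f \<in> cochains n p"
  shows "hk_class n p (b \<otimes>\<^bsub>CG p\<^esub> f) = hk_class n p (f :: 'a cochain)"
proof -
  interpret group "CG p" by (rule CG_group)
  note B = coboundaries_subgroup_cochains[of p]
  have b: "b \<in> carrier (CG p)" using assms(1) subgroup.subset[OF B] by blast
  have "coboundaries n p #>\<^bsub>CG p\<^esub> (b \<otimes>\<^bsub>CG p\<^esub> f) = (coboundaries n p #>\<^bsub>CG p\<^esub> b) #>\<^bsub>CG p\<^esub> f"
    using b assms(2) subgroup.subset[OF B] by (simp add: coset_mult_assoc CG_carrier)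
  also have "coboundaries n p #>\<^bsub>CG p\<^esub> b = coboundaries n p"
    by (rule coset_join2[OF b B assms(1)])
  finally show ?thesis by (simp add: hk_class_def)
qed

lemma hk_class_eqI:
  assumes "f \<in> cochains n (Suc p)" "g \<in> cochains n (Suc p)" "h \<in> cochains n p"
    and "\<And>w. w \<in> W n (Suc p) \<Longrightarrow> f w = koszul_diff n p h w \<oplus>\<^bsub>A\<^esub> g w"
  shows "hk_class n (Suc p) f = hk_class n (Suc p) (g :: 'a cochain)"
proof -
  have b: "koszul_diff n p h \<in> coboundaries n (Suc p)" using assms(3) by simp
  then have "koszul_diff n p h \<otimes>\<^bsub>CG (Suc p)\<^esub> g \<in> cochains n (Suc p)"
    using group.is_monoid[OF CG_group, of "Suc p", THEN monoid.m_closed] koszul_diff_closed[OF assms(3)] assms(2) by (simp add: CG_carrier)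
  then have "f = koszul_diff n p h \<otimes>\<^bsub>CG (Suc p)\<^esub> g"
    using assms by (intro cochain_eqI[OF assms(1)]) (auto simp: CG_mult)
  then show ?thesis using hk_class_add_coboundary[OF b assms(2)] by simp
qed

end

section \<open>Derivations\<close>

lemma (in ring) add_minus_cancel:
  assumes "x \<in> carrier R" "y \<in> carrier R" "z \<in> carrier R"
  shows "(x \<oplus> y) \<oplus> (z \<ominus> y) = x \<oplus> z"
  using assms by (simp add: minus_eq a_assoc a_lcomm[of y z] r_neg)

lemma (in ring) minus_eq_zeroD:
  assumes "x \<ominus> y = \<zero>" "x \<in> carrier R" "y \<in> carrier R" shows "x = y"
  using minus_equality[of x "\<ominus> y"] assms by (simp add: minus_eq)

context type_D begin

text \<open>The cocycle condition is commutation with the arrows, and bilinearity gives commutation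
  with k; both together generate the path algebra, which maps onto A.\<close>

lemma cocycle_0_central:
  assumes f: "f \<in> cocycles n 0" and a: "a \<in> carrier A"
  shows "f \<one>\<^bsub>P\<^esub> \<otimes>\<^bsub>A\<^esub> a = a \<otimes>\<^bsub>A\<^esub> f \<one>\<^bsub>P\<^esub>"
proof -
  note f' = cochains_bimodule_map[OF cocycles_cochains[OF f]]
  note z = one_value_closed[OF f']
  obtain r where r: "r \<in> carrier P" "a = proj n r" using a proj_surj by auto
  from r(1) have "f \<one>\<^bsub>P\<^esub> \<otimes>\<^bsub>A\<^esub> proj n r = proj n r \<otimes>\<^bsub>A\<^esub> f \<one>\<^bsub>P\<^esub>"
  proof (induction rule: path_algebra_induct)
    case (vertex c i)
    then show ?case by (intro commutes_tensor_power0[OF f'] scaled_tensor_power) simp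
  next
    case (arrow x)
    have "koszul_diff n 0 f (arrow_elt x) = \<one>\<^bsub>CG (0 + 1)\<^esub> (arrow_elt x)"
      using f by (simp add: cocycles_iff)
    then show ?case
      using arrow z bimodule_map_1_closed[OF arrow] A.minus_eq_zeroD[of "f \<one>\<^bsub>P\<^esub> \<otimes>\<^bsub>A\<^esub> arr x" "arr x \<otimes>\<^bsub>A\<^esub> f \<one>\<^bsub>P\<^esub>"]
      by (simp add: koszul_diff_0[OF f'] CG_one)
  next
    case (add r s)
    then show ?case using z by (simp add: A.l_distr A.r_distr)
  next
    case (mult r s)
    then have "f \<one>\<^bsub>P\<^esub> \<otimes>\<^bsub>A\<^esub> proj n (r \<otimes>\<^bsub>P\<^esub> s) = (proj n r \<otimes>\<^bsub>A\<^esub> f \<one>\<^bsub>P\<^esub>) \<otimes>\<^bsub>A\<^esub> proj n s"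
      using z by (simp flip: A.m_assoc)
    also have "\<dots> = proj n r \<otimes>\<^bsub>A\<^esub> (proj n s \<otimes>\<^bsub>A\<^esub> f \<one>\<^bsub>P\<^esub>)"
      using mult z by (simp add: A.m_assoc)
    finally show ?case using mult z by (simp add: A.m_assoc)
  qed
  then show ?thesis by (simp add: r)
qed

lemma cochain0_cocycle:
  assumes z: "z \<in> carrier A" "\<And>a. a \<in> carrier A \<Longrightarrow> z \<otimes>\<^bsub>A\<^esub> a = a \<otimes>\<^bsub>A\<^esub> z"
  shows "cochain0 n z \<in> cocycles n 0" "cochain0 n z \<one>\<^bsub>P\<^esub> = z"
proof -
  have "bimodule_map 0 (\<lambda>c. proj n c \<otimes>\<^bsub>A\<^esub> z)"
    using z by (intro bimodule_map_mult_right bimodule_map_proj) auto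
  then have c: "cochain0 n z \<in> cochains n 0"
    unfolding cochain0_def by (rule bimodule_map_restrict)
  show one: "cochain0 n z \<one>\<^bsub>P\<^esub> = z"
    using z by (simp add: cochain0_def W0)
  have "\<one>\<^bsub>CG (0 + 1)\<^esub> \<in> cochains n (0 + 1)"
    using group.is_monoid[OF CG_group, THEN monoid.one_closed] by (simp only: CG_carrier)
  then have "koszul_diff n 0 (cochain0 n z) = \<one>\<^bsub>CG (0 + 1)\<^esub>"
    using z W_closed
    by (intro cochain_eqI[OF koszul_diff_closed[OF c]])
      (auto simp: koszul_diff_0[OF cochains_bimodule_map[OF c]] one CG_one A.minus_eq A.r_neg)
  then show "cochain0 n z \<in> cocycles n 0"
    using c by (simp add: cocycles_iff)
qed

text \<open>The Leibniz rule unfolded from the first letter, with values in A: each letter in turn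
  is replaced by its value under f.\<close>

fun path_derivation :: "'a cochain \<Rightarrow> arrow list \<Rightarrow> nat \<Rightarrow> (path \<Rightarrow> 'a) set" where
  "path_derivation f [] s = \<zero>\<^bsub>A\<^esub>"
| "path_derivation f (x # xs) s = f (arrow_elt x) \<otimes>\<^bsub>A\<^esub> proj n (path_elt (xs, s)) \<oplus>\<^bsub>A\<^esub>
    arr x \<otimes>\<^bsub>A\<^esub> path_derivation f xs s"

definition derivation :: "'a cochain \<Rightarrow> (path \<Rightarrow> 'a) \<Rightarrow> (path \<Rightarrow> 'a) set" where
  "derivation f r = (\<Oplus>\<^bsub>A\<^esub>q\<in>{q. r q \<noteq> 0}. scalar (r q) \<otimes>\<^bsub>A\<^esub> path_derivation f (fst q) (snd q))"

lemma path_elt_block: "is_path n (xs, s) \<Longrightarrow> proj n (path_elt (xs, s)) \<in> block (path_target (xs, s)) s"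
proof -
  assume p: "is_path n (xs, s)"
  have "s < n" using p by (induction xs) auto
  moreover have "vertex_elt (path_target (xs, s)) \<otimes>\<^bsub>P\<^esub> path_elt (xs, s) = path_elt (xs, s)"
      "path_elt (xs, s) \<otimes>\<^bsub>P\<^esub> vertex_elt s = path_elt (xs, s)"
    by (simp_all add: vertex_elt_path path_elt_mult)
  ultimately show ?thesis
    using p path_target_less[OF p] by (simp add: block_def proj.hom_mult[symmetric])
qed

context
  fixes f assumes f: "bimodule_map (Suc 0) f"
begin

lemma path_derivation_block:
  "is_path n (xs, s) \<Longrightarrow> path_derivation f xs s \<in> block (path_target (xs, s)) s"
proof (induction xs)
  case Nil
  then show ?case by simp
next
  case (Cons x xs)
  then have x: "x \<in> arrows n" "arrow_source x = path_target (xs, s)" and p: "is_path n (xs, s)" by auto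
  have s: "s < n" using p by (induction xs) auto
  note t = arrow_target_less[OF x(1)]
  have "f (arrow_elt x) \<otimes>\<^bsub>A\<^esub> proj n (path_elt (xs, s)) \<in> block (arrow_target x) s"
    using bimodule_map_1_block[OF f x(1)] path_elt_block[OF p] t s x(2) by (intro block_mult) auto
  moreover have "arr x \<otimes>\<^bsub>A\<^esub> path_derivation f xs s \<in> block (arrow_target x) s"
    using arr_block[OF x(1)] Cons.IH[OF p] t s x(2) by (intro block_mult) auto
  ultimately show ?case using t s by (simp add: block_add)
qed

lemma path_derivation_closed: "is_path n (xs, s) \<Longrightarrow> path_derivation f xs s \<in> carrier A"
  using path_derivation_block blockD(1) by blast

text \<open>Enlarging the support lets two elements be summed over a common finite set of paths,
  which is how additivity is obtained.\<close>

lemma derivation_superset: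
  assumes r: "r \<in> carrier P" and S: "finite S" "{q. r q \<noteq> 0} \<subseteq> S" "\<And>q. q \<in> S \<Longrightarrow> is_path n q"
  shows "derivation f r = (\<Oplus>\<^bsub>A\<^esub>q\<in>S. scalar (r q) \<otimes>\<^bsub>A\<^esub> path_derivation f (fst q) (snd q))"
proof -
  have "path_derivation f (fst q) (snd q) \<in> carrier A" if "q \<in> S" for q
    using S(3)[OF that] path_derivation_closed[of "fst q" "snd q"] by simp
  then show ?thesis
    unfolding derivation_def using S by (intro A.add.finprod_mono_neutral_cong_left) auto
qed

lemma derivation_closed: "r \<in> carrier P \<Longrightarrow> derivation f r \<in> carrier A"
  unfolding derivation_def path_algebra_carrier
  using path_derivation_closed by (intro A.finsum_closed) auto

lemma derivation_add:
  assumes "r \<in> carrier P" "s \<in> carrier P"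
  shows "derivation f (r \<oplus>\<^bsub>P\<^esub> s) = derivation f r \<oplus>\<^bsub>A\<^esub> derivation f s"
proof -
  let ?S = "{q. r q \<noteq> 0} \<union> {q. s q \<noteq> 0}"
  have S: "finite ?S" "\<And>q. q \<in> ?S \<Longrightarrow> is_path n q"
    using assms unfolding path_algebra_carrier by blast+
  then have d: "path_derivation f (fst q) (snd q) \<in> carrier A" if "q \<in> ?S" for q
    using S(2)[OF that] path_derivation_closed[of "fst q" "snd q"] by simp
  have "derivation f (r \<oplus>\<^bsub>P\<^esub> s) = (\<Oplus>\<^bsub>A\<^esub>q\<in>?S. scalar ((r \<oplus>\<^bsub>P\<^esub> s) q) \<otimes>\<^bsub>A\<^esub> path_derivation f (fst q) (snd q))"
    using S P.add.m_closed[OF assms] by (intro derivation_superset) (auto simp: path_algebra_add)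
  also have "\<dots> = (\<Oplus>\<^bsub>A\<^esub>q\<in>?S. scalar (r q) \<otimes>\<^bsub>A\<^esub> path_derivation f (fst q) (snd q) \<oplus>\<^bsub>A\<^esub>
      scalar (s q) \<otimes>\<^bsub>A\<^esub> path_derivation f (fst q) (snd q))"
    using d by (intro A.finsum_cong') (auto simp: path_algebra_add scalar_add[symmetric] A.l_distr)
  also have "\<dots> = (\<Oplus>\<^bsub>A\<^esub>q\<in>?S. scalar (r q) \<otimes>\<^bsub>A\<^esub> path_derivation f (fst q) (snd q)) \<oplus>\<^bsub>A\<^esub>
      (\<Oplus>\<^bsub>A\<^esub>q\<in>?S. scalar (s q) \<otimes>\<^bsub>A\<^esub> path_derivation f (fst q) (snd q))"
    using d by (intro A.finsum_addf) auto
  also have "\<dots> = derivation f r \<oplus>\<^bsub>A\<^esub> derivation f s"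
    using assms S derivation_superset[of r ?S] derivation_superset[of s ?S] by simp
  finally show ?thesis .
qed

lemma derivation_path:
  assumes "is_path n (xs, s)"
  shows "derivation f (scaled c (path_elt (xs, s))) = scalar c \<otimes>\<^bsub>A\<^esub> path_derivation f xs s"
proof -
  have "derivation f (scaled c (path_elt (xs, s))) = (\<Oplus>\<^bsub>A\<^esub>q\<in>{(xs, s)}. scalar (c * path_elt (xs, s) q) \<otimes>\<^bsub>A\<^esub> path_derivation f (fst q) (snd q))"
    using assms by (intro derivation_superset scaled_closed path_elt_closed) (auto simp: path_elt_def split: if_splits)
  then show ?thesis
    using path_derivation_closed[OF assms] by (simp add: path_elt_def)
qed

lemma derivation_zero: "derivation f \<zero>\<^bsub>P\<^esub> = \<zero>\<^bsub>A\<^esub>"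
  by (simp add: derivation_def zero_apply)

lemma proj_scaled: "r \<in> carrier P \<Longrightarrow> proj n (scaled c r) = scalar c \<otimes>\<^bsub>A\<^esub> proj n r"
  by (subst scaled_one) (auto simp: scalar_def)

text \<open>For a path that the arrow can be composed with, this is the recursion of
  \<open>path_derivation\<close>; otherwise everything vanishes.\<close>

lemma derivation_arrow_mult:
  assumes x: "x \<in> arrows n" and r: "r \<in> carrier P"
  shows "derivation f (arrow_elt x \<otimes>\<^bsub>P\<^esub> r) = f (arrow_elt x) \<otimes>\<^bsub>A\<^esub> proj n r \<oplus>\<^bsub>A\<^esub> arr x \<otimes>\<^bsub>A\<^esub> derivation f r"
  using r
proof (induction rule: path_span_induct)
  case (path c q)
  obtain xs s where q: "q = (xs, s)" by fastforce
  have p: "is_path n (xs, s)" using path q by simp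
  note fx = bimodule_map_1_block[OF f x] and ax = arr_block[OF x] and d = path_derivation_block[OF p]
    and e = path_elt_block[OF p]
  note closed = blockD(1)[OF fx] blockD(1)[OF ax] blockD(1)[OF d] blockD(1)[OF e]
  have mult: "arrow_elt x \<otimes>\<^bsub>P\<^esub> scaled c (path_elt q) =
      (if arrow_source x = path_target (xs, s) then scaled c (path_elt (x # xs, s)) else \<zero>\<^bsub>P\<^esub>)"
    by (simp add: q mult_scaled arrow_elt_path path_elt_mult) (simp add: path_algebra_zero)
  show ?case
  proof (cases "arrow_source x = path_target (xs, s)")
    case True
    then have "is_path n (x # xs, s)" using x p by simp
    then show ?thesis
      unfolding mult using True closed p
      by (simp add: q derivation_path proj_scaled A.r_distr scalar_left_commute)
  next
    case False
    note s = arrow_source_less[OF x] path_target_less[OF p]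
    \<comment> \<open>The arrow and the path do not meet: the inner vertices of the two Peirce
      components differ, so both Leibniz terms are products through orthogonal idempotents.\<close>
    have orth: "a \<otimes>\<^bsub>A\<^esub> b = \<zero>\<^bsub>A\<^esub>" if "a \<in> block (arrow_target x) (arrow_source x)" "b \<in> block (path_target (xs, s)) s" for a b
    proof -
      have "a \<otimes>\<^bsub>A\<^esub> b = (a \<otimes>\<^bsub>A\<^esub> idem (arrow_source x)) \<otimes>\<^bsub>A\<^esub> (idem (path_target (xs, s)) \<otimes>\<^bsub>A\<^esub> b)"
        using blockD[OF that(1)] blockD[OF that(2)] by simp
      also have "\<dots> = a \<otimes>\<^bsub>A\<^esub> ((idem (arrow_source x) \<otimes>\<^bsub>A\<^esub> idem (path_target (xs, s))) \<otimes>\<^bsub>A\<^esub> b)"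
        using blockD(1)[OF that(1)] blockD(1)[OF that(2)] s by (simp add: A.m_assoc)
      also have "\<dots> = \<zero>\<^bsub>A\<^esub>"
        using idem_orthogonal[OF s False] blockD(1)[OF that(1)] blockD(1)[OF that(2)] by simp
      finally show ?thesis .
    qed
    show ?thesis
      unfolding mult using False closed p orth[OF fx e] orth[OF ax d]
      by (simp add: q derivation_path derivation_zero proj_scaled scalar_left_commute)
  qed
next
  case (add r s)
  note closed = value_closed[OF f x] arr_closed[OF x] derivation_closed[OF add(1)] derivation_closed[OF add(2)]
  have "derivation f (arrow_elt x \<otimes>\<^bsub>P\<^esub> (r \<oplus>\<^bsub>P\<^esub> s)) = derivation f (arrow_elt x \<otimes>\<^bsub>P\<^esub> r) \<oplus>\<^bsub>A\<^esub> derivation f (arrow_elt x \<otimes>\<^bsub>P\<^esub> s)"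
    using add x by (simp add: P.r_distr derivation_add)
  then show ?case
    using add closed x by (simp add: derivation_add A.r_distr A.a_ac)
qed

lemma derivation_vertex_mult:
  assumes i: "i < n" and r: "r \<in> carrier P"
  shows "derivation f (scaled c (vertex_elt i) \<otimes>\<^bsub>P\<^esub> r) = proj n (scaled c (vertex_elt i)) \<otimes>\<^bsub>A\<^esub> derivation f r"
  using r
proof (induction rule: path_span_induct)
  case (path d q)
  obtain xs s where q: "q = (xs, s)" by fastforce
  have p: "is_path n (xs, s)" using path q by simp
  note D = path_derivation_block[OF p]
  note closed = blockD(1)[OF D]
  have mult: "scaled c (vertex_elt i) \<otimes>\<^bsub>P\<^esub> scaled d (path_elt q) =
      (if i = path_target (xs, s) then scaled (c * d) (path_elt (xs, s)) else \<zero>\<^bsub>P\<^esub>)"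
    by (simp add: q mult_scaled scaled_mult vertex_elt_path path_elt_mult mult_ac) (simp add: path_algebra_zero)
  show ?case
  proof (cases "i = path_target (xs, s)")
    case True
    have "proj n (scaled c (vertex_elt i)) \<otimes>\<^bsub>A\<^esub> derivation f (scaled d (path_elt q)) =
        scalar c \<otimes>\<^bsub>A\<^esub> (idem i \<otimes>\<^bsub>A\<^esub> (scalar d \<otimes>\<^bsub>A\<^esub> path_derivation f xs s))"
      using i closed p by (simp add: q derivation_path proj_scaled A.m_assoc)
    also have "idem i \<otimes>\<^bsub>A\<^esub> (scalar d \<otimes>\<^bsub>A\<^esub> path_derivation f xs s) = scalar d \<otimes>\<^bsub>A\<^esub> path_derivation f xs s"
      using i closed blockD(2)[OF D] by (simp add: scalar_left_commute True)
    finally show ?thesis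
      unfolding mult using True closed p
      by (simp add: derivation_path scalar_mult A.m_assoc[symmetric])
  next
    case False
    have "idem i \<otimes>\<^bsub>A\<^esub> path_derivation f xs s = idem i \<otimes>\<^bsub>A\<^esub> (idem (path_target (xs, s)) \<otimes>\<^bsub>A\<^esub> path_derivation f xs s)"
      using blockD(2)[OF D] by simp
    also have "\<dots> = \<zero>\<^bsub>A\<^esub>"
      using idem_orthogonal[OF i path_target_less[OF p] False] closed i path_target_less[OF p] by (simp flip: A.m_assoc)
    finally have "idem i \<otimes>\<^bsub>A\<^esub> path_derivation f xs s = \<zero>\<^bsub>A\<^esub>" .
    then show ?thesis
      unfolding mult using False closed p i
      by (simp add: q derivation_path derivation_zero proj_scaled scalar_left_commute A.m_assoc)
  qed
next
  case (add r s)
  have v: "scaled c (vertex_elt i) \<in> carrier P" using i by (intro scaled_closed) simp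
  have "derivation f (scaled c (vertex_elt i) \<otimes>\<^bsub>P\<^esub> (r \<oplus>\<^bsub>P\<^esub> s)) =
      derivation f (scaled c (vertex_elt i) \<otimes>\<^bsub>P\<^esub> r) \<oplus>\<^bsub>A\<^esub> derivation f (scaled c (vertex_elt i) \<otimes>\<^bsub>P\<^esub> s)"
    using add v by (simp add: P.r_distr derivation_add)
  then show ?case
    using add v derivation_closed by (simp add: derivation_add A.r_distr)
qed

lemma derivation_vertex: "i < n \<Longrightarrow> derivation f (scaled c (vertex_elt i)) = \<zero>\<^bsub>A\<^esub>"
  unfolding vertex_elt_path by (subst derivation_path) auto

lemma derivation_arrow: "x \<in> arrows n \<Longrightarrow> derivation f (arrow_elt x) = f (arrow_elt x)"
  using derivation_path[of "[x]" "arrow_source x" 1] bimodule_map_1_block[OF f, of x] blockD arrow_source_less[of x]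
  by (simp add: arrow_elt_path[symmetric] vertex_elt_path[symmetric])

text \<open>Induction over generators for the left factor. The right factor stays arbitrary because
  the product case applies the hypothesis for r to r' s.\<close>

lemma derivation_mult:
  assumes "r \<in> carrier P" "s \<in> carrier P"
  shows "derivation f (r \<otimes>\<^bsub>P\<^esub> s) = derivation f r \<otimes>\<^bsub>A\<^esub> proj n s \<oplus>\<^bsub>A\<^esub> proj n r \<otimes>\<^bsub>A\<^esub> derivation f s"
  using assms
proof (induction arbitrary: s rule: path_algebra_induct)
  case (vertex c i)
  then show ?case
    using derivation_closed scaled_closed[of "vertex_elt i" c] by (simp add: derivation_vertex_mult derivation_vertex)
next
  case (arrow x)
  then show ?case by (simp add: derivation_arrow_mult derivation_arrow)
next
  case (add r r')
  have "derivation f ((r \<oplus>\<^bsub>P\<^esub> r') \<otimes>\<^bsub>P\<^esub> s) = derivation f (r \<otimes>\<^bsub>P\<^esub> s) \<oplus>\<^bsub>A\<^esub> derivation f (r' \<otimes>\<^bsub>P\<^esub> s)"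
    using add by (simp add: P.l_distr derivation_add)
  then show ?case
    using add derivation_closed by (simp add: derivation_add A.l_distr A.a_ac)
next
  case (mult r r')
  have "derivation f ((r \<otimes>\<^bsub>P\<^esub> r') \<otimes>\<^bsub>P\<^esub> s) = derivation f (r \<otimes>\<^bsub>P\<^esub> (r' \<otimes>\<^bsub>P\<^esub> s))"
    using mult by (simp add: P.m_assoc)
  also have "\<dots> = derivation f r \<otimes>\<^bsub>A\<^esub> (proj n r' \<otimes>\<^bsub>A\<^esub> proj n s) \<oplus>\<^bsub>A\<^esub> proj n r \<otimes>\<^bsub>A\<^esub> (derivation f r' \<otimes>\<^bsub>A\<^esub> proj n s \<oplus>\<^bsub>A\<^esub> proj n r' \<otimes>\<^bsub>A\<^esub> derivation f s)"
    using mult by simp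
  also have "\<dots> = derivation f (r \<otimes>\<^bsub>P\<^esub> r') \<otimes>\<^bsub>A\<^esub> proj n s \<oplus>\<^bsub>A\<^esub> proj n (r \<otimes>\<^bsub>P\<^esub> r') \<otimes>\<^bsub>A\<^esub> derivation f s"
    using mult derivation_closed by (simp add: A.l_distr A.r_distr A.m_assoc A.a_assoc)
  finally show ?case .
qed

lemma derivation_scaled: "r \<in> carrier P \<Longrightarrow> derivation f (scaled c r) = scalar c \<otimes>\<^bsub>A\<^esub> derivation f r"
proof (induction rule: path_span_induct)
  case (path d q)
  obtain xs s where "q = (xs, s)" by fastforce
  then show ?case
    using path derivation_path[of xs s "c * d"] derivation_path[of xs s d] path_derivation_closed[of xs s]
    by (simp add: scalar_mult[symmetric] A.m_assoc mult.assoc)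
next
  case (add r s)
  have "scaled c (r \<oplus>\<^bsub>P\<^esub> s) = scaled c r \<oplus>\<^bsub>P\<^esub> scaled c s"
    by (simp add: path_algebra_add algebra_simps)
  then show ?case
    using add derivation_closed by (simp add: derivation_add scaled_closed A.r_distr)
qed

lemma derivation_finsum:
  "u \<in> S \<rightarrow> carrier P \<Longrightarrow> derivation f (\<Oplus>\<^bsub>P\<^esub>j\<in>S. u j) = (\<Oplus>\<^bsub>A\<^esub>j\<in>S. derivation f (u j))"
  by (induction S rule: infinite_finite_induct)
    (simp_all add: Pi_def derivation_zero derivation_add derivation_closed)

text \<open>On relations the derivation is the Koszul differential of f, so the cocycle condition
  says exactly that it kills R.\<close>

lemma derivation_relation_fun:
  "derivation f (relation_fun c) =
    relation_sum c (\<lambda>x. f (arrow_elt x) \<otimes>\<^bsub>A\<^esub> arr (bar x) \<oplus>\<^bsub>A\<^esub> arr x \<otimes>\<^bsub>A\<^esub> f (arrow_elt (bar x)))"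
  unfolding relation_fun_arrows relation_sum_def scaled_mult
proof (subst derivation_finsum)
  show "(\<Oplus>\<^bsub>A\<^esub>x\<in>arrows n. derivation f (scaled (c (arrow_target x) * arrow_sign x) (arrow_elt x \<otimes>\<^bsub>P\<^esub> arrow_elt (bar x)))) =
      (\<Oplus>\<^bsub>A\<^esub>x\<in>arrows n. scalar (c (arrow_target x) * arrow_sign x) \<otimes>\<^bsub>A\<^esub>
        (f (arrow_elt x) \<otimes>\<^bsub>A\<^esub> arr (bar x) \<oplus>\<^bsub>A\<^esub> arr x \<otimes>\<^bsub>A\<^esub> f (arrow_elt (bar x))))"
    by (rule A.finsum_cong') (auto simp: derivation_scaled derivation_mult derivation_arrow value_closed[OF f])
qed (auto intro!: scaled_closed)

end

section \<open>Derivations of A that extend 1-cocycles\<close>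

context
  fixes f :: "'a cochain" assumes f: "f \<in> cocycles n (Suc 0)"
begin

lemma cocycle_1: "bimodule_map (Suc 0) f"
  by (rule cochains_bimodule_map[OF cocycles_cochains[OF f]])

text \<open>By the Leibniz rule the elements of the ideal killed by the derivation form an ideal
  again, and this one contains the relations.\<close>

lemma derivation_relation_ideal:
  assumes "r \<in> relation_ideal n" shows "derivation f r = \<zero>\<^bsub>A\<^esub>"
proof -
  note d = cocycle_1
  \<comment> \<open>Membership in the relation ideal is part of \<open>?J\<close>: in D(r s) = D(r)
    s + r D(s) the term in which the element itself appears undifferentiated vanishes because its
    image in A is zero.\<close>
  let ?J = "{r \<in> relation_ideal n. derivation f r = \<zero>\<^bsub>A\<^esub>}"
  have proj: "r \<in> relation_ideal n \<Longrightarrow> proj n r = \<zero>\<^bsub>A\<^esub>" for r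
    using proj_eq_iff[of r "\<zero>\<^bsub>P\<^esub>"] by (simp add: P.minus_eq rel.Icarr)
  have uminus: "derivation f (\<ominus>\<^bsub>P\<^esub> r) = \<ominus>\<^bsub>A\<^esub> derivation f r" if "r \<in> carrier P" for r
    using that derivation_scaled[OF d that, of "- 1"] derivation_closed[OF d that]
    by (simp add: a_inv_apply scalar_minus_1)
  have "ideal ?J P"
  proof (rule idealI)
    have zero: "\<zero>\<^bsub>P\<^esub> \<in> ?J" by (simp add: derivation_zero[OF d])
    show "subgroup ?J (add_monoid P)"
    proof (rule P.add.subgroupI)
      show "?J \<noteq> {}" using zero by blast
    qed (use derivation_add[OF d] uminus in \<open>auto simp: rel.Icarr\<close>)
  qed (use derivation_mult[OF d] derivation_closed[OF d] proj in
      \<open>auto simp: rel.Icarr rel.I_l_closed rel.I_r_closed P.ring_axioms\<close>)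
  moreover have "relations n \<subseteq> ?J"
  proof
    fix r :: "path \<Rightarrow> 'a" assume "r \<in> relations n"
    then show "r \<in> ?J"
      using f P.genideal_self[OF relations_closed] derivation_relation_fun[OF d] cocycle_1_iff[OF cocycles_cochains[OF f]]
      by (auto simp: relations_eq relation_ideal_def)
  qed
  ultimately have "relation_ideal n \<subseteq> ?J"
    unfolding relation_ideal_def by (rule P.genideal_minimal)
  then show ?thesis using assms by blast
qed

text \<open>Any representative may be chosen, as two of them differ by an element on which the
  derivation vanishes.\<close>

definition quotient_derivation :: "(path \<Rightarrow> 'a) set \<Rightarrow> (path \<Rightarrow> 'a) set" where
  "quotient_derivation a = derivation f (SOME r. r \<in> carrier P \<and> proj n r = a)"

lemma quotient_derivation_proj:
  assumes r: "r \<in> carrier P" shows "quotient_derivation (proj n r) = derivation f r"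
proof -
  note d = cocycle_1
  define s where "s = (SOME s. s \<in> carrier P \<and> proj n s = proj n r)"
  have s: "s \<in> carrier P" "proj n s = proj n r"
    unfolding s_def using someI[of "\<lambda>s. s \<in> carrier P \<and> proj n s = proj n r"] r by auto
  have "derivation f (s \<ominus>\<^bsub>P\<^esub> r) = \<zero>\<^bsub>A\<^esub>"
    using s r by (intro derivation_relation_ideal) (simp flip: proj_eq_iff)
  moreover have "s = (s \<ominus>\<^bsub>P\<^esub> r) \<oplus>\<^bsub>P\<^esub> r"
    using s(1) r by (simp add: P.minus_eq P.a_assoc P.l_neg)
  ultimately have "derivation f s = derivation f r"
    using s(1) r derivation_add[OF d, of "s \<ominus>\<^bsub>P\<^esub> r" r] derivation_closed[OF d r] by simp
  then show ?thesis by (simp add: quotient_derivation_def s_def)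
qed

lemma quotient_derivation:
  assumes "a \<in> carrier A" "b \<in> carrier A"
  shows "quotient_derivation a \<in> carrier A"
    "quotient_derivation (a \<oplus>\<^bsub>A\<^esub> b) = quotient_derivation a \<oplus>\<^bsub>A\<^esub> quotient_derivation b"
    "quotient_derivation (a \<otimes>\<^bsub>A\<^esub> b) = quotient_derivation a \<otimes>\<^bsub>A\<^esub> b \<oplus>\<^bsub>A\<^esub> a \<otimes>\<^bsub>A\<^esub> quotient_derivation b"
    "quotient_derivation (scalar c \<otimes>\<^bsub>A\<^esub> a) = scalar c \<otimes>\<^bsub>A\<^esub> quotient_derivation a"
proof -
  note d = cocycle_1
  obtain r s where r: "r \<in> carrier P" "a = proj n r" and s: "s \<in> carrier P" "b = proj n s"
    using assms proj_surj by auto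
  show "quotient_derivation a \<in> carrier A"
    using r derivation_closed[OF d] by (simp add: quotient_derivation_proj)
  show "quotient_derivation (a \<oplus>\<^bsub>A\<^esub> b) = quotient_derivation a \<oplus>\<^bsub>A\<^esub> quotient_derivation b"
    unfolding r s using r(1) s(1)
    by (subst proj.hom_add[symmetric]) (simp_all add: quotient_derivation_proj derivation_add[OF d] del: proj.hom_add)
  show "quotient_derivation (a \<otimes>\<^bsub>A\<^esub> b) = quotient_derivation a \<otimes>\<^bsub>A\<^esub> b \<oplus>\<^bsub>A\<^esub> a \<otimes>\<^bsub>A\<^esub> quotient_derivation b"
    unfolding r s using r(1) s(1)
    by (subst proj.hom_mult[symmetric]) (simp_all add: quotient_derivation_proj derivation_mult[OF d] del: proj.hom_mult)
  show "quotient_derivation (scalar c \<otimes>\<^bsub>A\<^esub> a) = scalar c \<otimes>\<^bsub>A\<^esub> quotient_derivation a"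
    unfolding r using r(1)
    by (subst proj_scaled[OF d, symmetric]) (simp_all add: quotient_derivation_proj derivation_scaled[OF d] scaled_closed)
qed

lemma quotient_derivation_arr: "x \<in> arrows n \<Longrightarrow> quotient_derivation (arr x) = f (arrow_elt x)"
  by (simp add: quotient_derivation_proj derivation_arrow[OF cocycle_1])

lemma quotient_derivation_block:
  assumes a: "a \<in> block i j" and ij: "i < n" "j < n" shows "quotient_derivation a \<in> block i j"
proof -
  note ac = blockD[OF a]
  have e: "quotient_derivation (idem k) = \<zero>\<^bsub>A\<^esub>" if "k < n" for k
    using that derivation_vertex[OF cocycle_1 that, of 1] by (simp add: quotient_derivation_proj)
  have "quotient_derivation (idem i \<otimes>\<^bsub>A\<^esub> a) = idem i \<otimes>\<^bsub>A\<^esub> quotient_derivation a"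
    "quotient_derivation (a \<otimes>\<^bsub>A\<^esub> idem j) = quotient_derivation a \<otimes>\<^bsub>A\<^esub> idem j"
    using ac(1) ij quotient_derivation(1)[OF ac(1) ac(1)] by (simp_all add: quotient_derivation(3) e)
  then show ?thesis
    using ac quotient_derivation(1)[OF ac(1) ac(1)] by (simp add: block_def)
qed

end

section \<open>The cup product\<close>

lemma cup_cochain_0:
  assumes f: "bimodule_map 0 f" and g: "bimodule_map q g"
  shows "cup_cochain n 0 q f g = (\<lambda>w\<in>W n q. f \<one>\<^bsub>P\<^esub> \<otimes>\<^bsub>A\<^esub> g w)"
    "cup_cochain n q 0 g f = (\<lambda>w\<in>W n q. g w \<otimes>\<^bsub>A\<^esub> f \<one>\<^bsub>P\<^esub>)"
  unfolding cup_cochain_def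
  using one_value_closed[OF f] bimodule_map_closed[OF g] add_pow_sign[of _ 0]
  by (auto intro!: restrict_ext simp: convolution_0_left[OF f g] convolution_0_right[OF g f])

lemma cup_cochain_1_1:
  assumes f: "bimodule_map (Suc 0) f" and g: "bimodule_map (Suc 0) g"
  shows "cup_cochain n (Suc 0) (Suc 0) f g (relation_fun c) =
    \<ominus>\<^bsub>A\<^esub> relation_sum c (\<lambda>x. f (arrow_elt x) \<otimes>\<^bsub>A\<^esub> g (arrow_elt (bar x)))"
proof -
  have "relation_fun c \<in> W n (Suc 0 + Suc 0)"
    using W2 by (simp add: relations_eq numeral_2_eq_2)
  moreover have "relation_sum c (\<lambda>x. f (arrow_elt x) \<otimes>\<^bsub>A\<^esub> g (arrow_elt (bar x))) \<in> carrier A"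
    by (intro relation_sum_closed) (simp add: value_closed[OF f] value_closed[OF g])
  ultimately show ?thesis
    using add_pow_sign[of _ "Suc 0"] by (simp add: cup_cochain_def convolution_1_1[OF f g])
qed

lemma cup_cochain_ge_3:
  assumes f: "bimodule_map p f" and g: "bimodule_map q g" and pq: "p + q \<ge> 3"
  shows "cup_cochain n p q f g = \<one>\<^bsub>CG (p + q)\<^esub>"
  unfolding cup_cochain_def CG_one W_ge_3[OF pq]
  using add_pow_sign[of "\<zero>\<^bsub>A\<^esub>" "p * q"] by (intro restrict_ext) (simp add: convolution_zero[OF f g])

lemma minus_relation_sum:
  assumes "\<And>x. x \<in> arrows n \<Longrightarrow> m x \<in> carrier A"
  shows "\<ominus>\<^bsub>A\<^esub> relation_sum c m = relation_sum c (\<lambda>x. \<ominus>\<^bsub>A\<^esub> m x)"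
  using assms by (intro relation_sum_map[where D = "\<lambda>a. \<ominus>\<^bsub>A\<^esub> a"]) (auto simp: A.minus_add A.r_minus A.a_comm)

lemma cup_cochain_closed:
  fixes f g :: "'a cochain"
  assumes f: "f \<in> cocycles n p" and g: "g \<in> cocycles n q"
  shows "cup_cochain n p q f g \<in> cochains n (p + q)"
proof -
  note f' = cochains_bimodule_map[OF cocycles_cochains[OF f]] and g' = cochains_bimodule_map[OF cocycles_cochains[OF g]]
  consider "p = 0" | "q = 0" | "p = Suc 0" "q = Suc 0" | "p + q \<ge> 3" by linarith
  then show ?thesis
  proof cases
    case 1
    note f0 = f'[unfolded 1]
    show ?thesis
      unfolding 1 cup_cochain_0[OF f0 g'] using cocycle_0_central[OF f[unfolded 1]] one_value_closed[OF f0]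
      by (simp, intro bimodule_map_restrict bimodule_map_mult_left[OF g']) simp_all
  next
    case 2
    note g0 = g'[unfolded 2]
    show ?thesis
      unfolding 2 cup_cochain_0[OF g0 f'] using cocycle_0_central[OF g[unfolded 2]] one_value_closed[OF g0]
      by (simp, intro bimodule_map_restrict bimodule_map_mult_right[OF f']) simp_all
  next
    case 3
    note f1 = f'[unfolded 3] and g1 = g'[unfolded 3]
    have "bimodule_map 2 (cup_cochain n (Suc 0) (Suc 0) f g)"
      using relation_product_block[OF f1 g1] arrow_target_less value_closed[OF f1] value_closed[OF g1]
      by (intro relation_sum_linear[where m = "\<lambda>x. \<ominus>\<^bsub>A\<^esub> (f (arrow_elt x) \<otimes>\<^bsub>A\<^esub> g (arrow_elt (bar x)))"])
        (auto simp: cup_cochain_1_1[OF f1 g1] minus_relation_sum block_minus)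
    then show ?thesis
      unfolding 3 by (simp add: cochains_iff numeral_2_eq_2) (simp add: cup_cochain_def)
  next
    case 4
    then show ?thesis
      using cup_cochain_ge_3[OF f' g' 4] group.is_monoid[OF CG_group, THEN monoid.one_closed] by (simp add: CG_carrier)
  qed
qed

text \<open>If one degree is 0, that factor has a central value and the sign is 1; in total degree
  at least three both sides are maps on the zero space.\<close>

lemma cup_cochain_commute:
  fixes f g :: "'a cochain"
  assumes f: "f \<in> cocycles n p" and g: "g \<in> cocycles n q" and pq: "p = 0 \<or> q = 0 \<or> p + q \<ge> 3"
  shows "cup_cochain n p q f g = cup_cochain n q p g f"
proof -
  note f' = cochains_bimodule_map[OF cocycles_cochains[OF f]] and g' = cochains_bimodule_map[OF cocycles_cochains[OF g]]
  consider "p = 0" | "q = 0" | "p + q \<ge> 3" using pq by blast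
  then show ?thesis
  proof cases
    case 1
    then show ?thesis
      using cup_cochain_0[OF f'[unfolded 1] g'] cocycle_0_central[OF f[unfolded 1]] bimodule_map_closed[OF g']
      by (auto intro!: restrict_ext)
  next
    case 2
    then show ?thesis
      using cup_cochain_0[OF g'[unfolded 2] f'] cocycle_0_central[OF g[unfolded 2]] bimodule_map_closed[OF f']
      by (auto intro!: restrict_ext)
  next
    case 3
    then show ?thesis
      using cup_cochain_ge_3[OF f' g' 3] cup_cochain_ge_3[OF g' f'] by (simp add: add.commute)
  qed
qed

lemma W2_cases:
  assumes "w \<in> W n (Suc (Suc 0))" obtains c where "w = relation_fun c"
  using assms W2 by (auto simp: relations_eq numeral_2_eq_2)

lemma hk_class_eq_2I:
  fixes f g h :: "'a cochain"
  assumes "f \<in> cochains n 2" "g \<in> cochains n 2" and h: "h \<in> cochains n (Suc 0)"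
    and eq: "\<And>c. f (relation_fun c) =
      relation_sum c (\<lambda>x. h (arrow_elt x) \<otimes>\<^bsub>A\<^esub> arr (bar x) \<oplus>\<^bsub>A\<^esub> arr x \<otimes>\<^bsub>A\<^esub> h (arrow_elt (bar x))) \<oplus>\<^bsub>A\<^esub> g (relation_fun c)"
  shows "hk_class n 2 f = hk_class n 2 g"
  unfolding numeral_2_eq_2
proof (rule hk_class_eqI[OF _ _ h])
  show "f \<in> cochains n (Suc (Suc 0))" "g \<in> cochains n (Suc (Suc 0))"
    using assms by (simp_all add: numeral_2_eq_2)
  fix w :: "path \<Rightarrow> 'a" assume "w \<in> W n (Suc (Suc 0))"
  then obtain c where "w = relation_fun c" by (rule W2_cases)
  then show "f w = koszul_diff n (Suc 0) h w \<oplus>\<^bsub>A\<^esub> g w"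
    using eq by (simp add: koszul_diff_1[OF cochains_bimodule_map[OF h]])
qed

text \<open>If \<open>D\<close> is the derivation of the algebra extending \<open>f\<close>, then the differential of \<open>D \<circ> g\<close> is the sum of
  the two products: apply \<open>D\<close> to the cocycle condition for \<open>g\<close>.\<close>

lemma cup_cochain_anticommute:
  fixes f g :: "'a cochain"
  assumes f: "f \<in> cocycles n (Suc 0)" and g: "g \<in> cocycles n (Suc 0)"
  shows "hk_class n 2 (cup_cochain n (Suc 0) (Suc 0) f g \<otimes>\<^bsub>CG 2\<^esub> cup_cochain n (Suc 0) (Suc 0) g f) = \<one>\<^bsub>HK n 2\<^esub>"
proof -
  note f' = cochains_bimodule_map[OF cocycles_cochains[OF f]] and g' = cochains_bimodule_map[OF cocycles_cochains[OF g]]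
  note fv = value_closed[OF f'] and gv = value_closed[OF g']
  define D where "D = quotient_derivation f"
  note Dq = quotient_derivation[OF f, folded D_def]
  have Dc: "a \<in> carrier A \<Longrightarrow> D a \<in> carrier A" for a using Dq(1)[of a a] by blast
  have D_block: "D (g (arrow_elt x)) \<in> block (arrow_target x) (arrow_source x)" if "x \<in> arrows n" for x
    unfolding D_def using that
    by (intro quotient_derivation_block[OF f] bimodule_map_1_block[OF g'] arrow_source_less arrow_target_less)
  define k where "k = cochain1 n (\<lambda>x. D (g (arrow_elt x)))"
  have k: "k \<in> cochains n (Suc 0)" "\<And>x. x \<in> arrows n \<Longrightarrow> k (arrow_elt x) = D (g (arrow_elt x))"
    unfolding k_def using cochain1[of "\<lambda>x. D (g (arrow_elt x))"] D_block by simp_all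
  let ?fg = "cup_cochain n (Suc 0) (Suc 0) f g" and ?gf = "cup_cochain n (Suc 0) (Suc 0) g f"
  have c: "?fg \<in> cochains n 2" "?gf \<in> cochains n 2"
    using cup_cochain_closed[OF f g] cup_cochain_closed[OF g f] by (simp_all add: numeral_2_eq_2)
  interpret G: comm_group "CG 2" by (rule CG_comm_group)
  have sum: "?fg \<otimes>\<^bsub>CG 2\<^esub> ?gf \<in> cochains n 2" using c G.m_closed by (simp add: CG_carrier)
  have "hk_class n 2 (?fg \<otimes>\<^bsub>CG 2\<^esub> ?gf) = hk_class n 2 \<one>\<^bsub>CG 2\<^esub>"
  proof (rule hk_class_eq_2I[OF sum _ k(1)])
    show "\<one>\<^bsub>CG 2\<^esub> \<in> cochains n 2" using G.one_closed by (simp add: CG_carrier)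
    fix c
    let ?S = "relation_sum c"
    have W: "relation_fun c \<in> W n 2" by (simp add: W2 relations_eq)
    let ?K = "\<lambda>x. k (arrow_elt x) \<otimes>\<^bsub>A\<^esub> arr (bar x) \<oplus>\<^bsub>A\<^esub> arr x \<otimes>\<^bsub>A\<^esub> k (arrow_elt (bar x))"
    let ?FG = "\<lambda>x. f (arrow_elt x) \<otimes>\<^bsub>A\<^esub> g (arrow_elt (bar x))"
    let ?GF = "\<lambda>x. g (arrow_elt x) \<otimes>\<^bsub>A\<^esub> f (arrow_elt (bar x))"
    let ?G = "\<lambda>x. g (arrow_elt x) \<otimes>\<^bsub>A\<^esub> arr (bar x) \<oplus>\<^bsub>A\<^esub> arr x \<otimes>\<^bsub>A\<^esub> g (arrow_elt (bar x))"
    have closed: "?S ?K \<in> carrier A" "?S ?FG \<in> carrier A" "?S ?GF \<in> carrier A"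
      by (intro relation_sum_closed; simp add: fv gv k Dc)+
    have "\<zero>\<^bsub>A\<^esub> = D (?S ?G)"
      using Dq(4)[of "\<zero>\<^bsub>A\<^esub>" "\<zero>\<^bsub>A\<^esub>" 0] Dc g cocycle_1_iff[OF cocycles_cochains[OF g]] by simp
    also have "\<dots> = ?S (\<lambda>x. D (?G x))"
      using Dq Dc by (intro relation_sum_map) (auto simp: gv)
    also have "\<dots> = ?S (\<lambda>x. ?K x \<oplus>\<^bsub>A\<^esub> (?FG x \<oplus>\<^bsub>A\<^esub> ?GF x))"
      using Dc by (intro relation_sum_cong)
        (auto simp: Dq(2,3) gv fv k quotient_derivation_arr[OF f, folded D_def] A.a_ac)
    also have "\<dots> = ?S ?K \<oplus>\<^bsub>A\<^esub> (?S ?FG \<oplus>\<^bsub>A\<^esub> ?S ?GF)"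
      using Dc by (simp add: relation_sum_add gv fv k)
    finally have "?S ?K = \<ominus>\<^bsub>A\<^esub> (?S ?FG \<oplus>\<^bsub>A\<^esub> ?S ?GF)"
      using closed A.minus_equality[of "?S ?K" "?S ?FG \<oplus>\<^bsub>A\<^esub> ?S ?GF"] by simp
    then show "(?fg \<otimes>\<^bsub>CG 2\<^esub> ?gf) (relation_fun c) = ?S ?K \<oplus>\<^bsub>A\<^esub> \<one>\<^bsub>CG 2\<^esub> (relation_fun c)"
      using closed W by (simp add: CG_mult CG_one cup_cochain_1_1[OF f' g'] cup_cochain_1_1[OF g' f'] A.minus_add)
  qed
  also have "\<dots> = \<one>\<^bsub>HK n 2\<^esub>"
    using hk_class_one_iff[of "\<one>\<^bsub>CG 2\<^esub>" 2] subgroup.one_closed[OF coboundaries_subgroup_cochains]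
      subgroup.one_closed[OF cocycles_subgroup] by blast
  finally show ?thesis .
qed

section \<open>Independence of the representatives, and products as cohomology classes\<close>

lemma mem_hk_class:
  fixes f f' :: "'a cochain"
  assumes "f' \<in> hk_class n p f" "f \<in> cocycles n p"
  obtains b where "b \<in> coboundaries n p" "f' = b \<otimes>\<^bsub>CG p\<^esub> f" "f' \<in> cocycles n p"
proof -
  obtain b where b: "b \<in> coboundaries n p" "f' = b \<otimes>\<^bsub>CG p\<^esub> f"
    using assms(1) by (auto simp: hk_class_def r_coset_def)
  moreover have "f' \<in> cocycles n p"
    using b assms(2) coboundaries_cocycles subgroup.m_closed[OF cocycles_subgroup] by blast
  ultimately show ?thesis by (rule that)
qed

lemma hk_class_self: "f \<in> cocycles n p \<Longrightarrow> f \<in> (hk_class n p f :: 'a cochain set)"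
  unfolding hk_class_def
  using group.rcos_self[OF CG_group _ coboundaries_subgroup_cochains, of f p] cocycles_cochains by (simp add: CG_carrier)

text \<open>Multiplication by a central element is a map of complexes, so products with classes of
  degree 0 respect coboundaries.\<close>

lemma koszul_diff_central:
  fixes f h :: "'a cochain"
  assumes f: "f \<in> cocycles n 0" and h: "h \<in> cochains n k"
  defines "zh \<equiv> \<lambda>w\<in>W n k. f \<one>\<^bsub>P\<^esub> \<otimes>\<^bsub>A\<^esub> h w"
  shows "zh \<in> cochains n k"
    "w \<in> W n (Suc k) \<Longrightarrow> koszul_diff n k zh w = f \<one>\<^bsub>P\<^esub> \<otimes>\<^bsub>A\<^esub> koszul_diff n k h w"
proof -
  let ?z = "f \<one>\<^bsub>P\<^esub>"
  note z = one_value_closed[OF cochains_bimodule_map[OF cocycles_cochains[OF f]]] cocycle_0_central[OF f]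
  note hm = cochains_bimodule_map[OF h]
  show zh: "zh \<in> cochains n k"
    unfolding zh_def using z by (intro bimodule_map_restrict bimodule_map_mult_left[OF hm]) simp_all
  note zhm = cochains_bimodule_map[OF zh]
  assume w: "w \<in> W n (Suc k)"
  show "koszul_diff n k zh w = ?z \<otimes>\<^bsub>A\<^esub> koszul_diff n k h w"
  proof -
    consider "k = 0" | "k = Suc 0" | "k \<ge> 2" by linarith
    then show ?thesis
    proof cases
      case 1
      note w0 = w[unfolded 1] W_closed[OF w] and h0 = hm[unfolded 1]
      have "proj n w \<otimes>\<^bsub>A\<^esub> (?z \<otimes>\<^bsub>A\<^esub> h \<one>\<^bsub>P\<^esub>) = ?z \<otimes>\<^bsub>A\<^esub> (proj n w \<otimes>\<^bsub>A\<^esub> h \<one>\<^bsub>P\<^esub>)"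
        using z(1) z(2)[of "proj n w"] w0 one_value_closed[OF h0] by (simp flip: A.m_assoc)
      moreover have "zh \<one>\<^bsub>P\<^esub> = ?z \<otimes>\<^bsub>A\<^esub> h \<one>\<^bsub>P\<^esub>" by (simp add: zh_def 1 W0)
      ultimately show ?thesis
        using koszul_diff_0[OF h0 w0(1)] koszul_diff_0[OF zhm[unfolded 1] w0(1)] z(1) w0 one_value_closed[OF h0]
        by (simp add: 1 A.minus_eq A.r_distr A.r_minus A.m_assoc)
    next
      case 2
      note h1 = hm[unfolded 2] and zh1 = zhm[unfolded 2]
      obtain c where c: "w = relation_fun c" using w W2_cases by (auto simp: 2)
      let ?m = "\<lambda>x. h (arrow_elt x) \<otimes>\<^bsub>A\<^esub> arr (bar x) \<oplus>\<^bsub>A\<^esub> arr x \<otimes>\<^bsub>A\<^esub> h (arrow_elt (bar x))"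
      have v: "zh (arrow_elt x) = ?z \<otimes>\<^bsub>A\<^esub> h (arrow_elt x)" if "x \<in> arrows n" for x
        using that by (simp add: zh_def 2 bimodule_map_1_closed)
      have "arr x \<otimes>\<^bsub>A\<^esub> (?z \<otimes>\<^bsub>A\<^esub> h (arrow_elt (bar x))) = ?z \<otimes>\<^bsub>A\<^esub> (arr x \<otimes>\<^bsub>A\<^esub> h (arrow_elt (bar x)))" if "x \<in> arrows n" for x
        using z(1) z(2)[of "arr x"] that value_closed[OF h1] by (simp flip: A.m_assoc)
      then have "koszul_diff n (Suc 0) zh (relation_fun c) = relation_sum c (\<lambda>x. ?z \<otimes>\<^bsub>A\<^esub> ?m x)"
        unfolding koszul_diff_1[OF zh1] using z(1) value_closed[OF h1]
        by (intro relation_sum_cong) (auto simp: v A.r_distr A.m_assoc)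
      also have "\<dots> = ?z \<otimes>\<^bsub>A\<^esub> relation_sum c ?m"
        using z(1) value_closed[OF h1]
        by (intro relation_sum_map[symmetric]) (auto simp: A.r_distr scalar_left_commute)
      finally show ?thesis by (simp add: 2 c koszul_diff_1[OF h1])
    next
      case 3
      then show ?thesis using w z(1) by (simp add: koszul_diff_ge_2[OF hm] koszul_diff_ge_2[OF zhm] CG_one)
    qed
  qed
qed

lemma cup_right_0:
  fixes f g g' :: "'a cochain"
  assumes f: "f \<in> cocycles n 0" and g: "g \<in> cocycles n q" and g': "g' \<in> hk_class n q g"
  shows "hk_class n q (cup_cochain n 0 q f g') = hk_class n q (cup_cochain n 0 q f g)"
proof -
  obtain b where b: "b \<in> coboundaries n q" "g' = b \<otimes>\<^bsub>CG q\<^esub> g" "g' \<in> cocycles n q"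
    using mem_hk_class[OF g' g] by blast
  note fm = cochains_bimodule_map[OF cocycles_cochains[OF f]] and gm = cochains_bimodule_map[OF cocycles_cochains[OF g]]
    and gm' = cochains_bimodule_map[OF cocycles_cochains[OF b(3)]]
  let ?z = "f \<one>\<^bsub>P\<^esub>"
  note z = one_value_closed[OF fm] cocycle_0_central[OF f]
  have closed: "cup_cochain n 0 q f g \<in> cochains n q" "cup_cochain n 0 q f g' \<in> cochains n q"
    using cup_cochain_closed[OF f g] cup_cochain_closed[OF f b(3)] by simp_all
  show ?thesis
  proof (cases q)
    case 0
    then have "g' = g"
      using b group.is_monoid[OF CG_group, THEN monoid.l_one, of g 0] cocycles_cochains[OF g] by (simp add: CG_carrier)
    then show ?thesis by simp
  next
    case (Suc k)
    then obtain h where h: "h \<in> cochains n k" "b = koszul_diff n k h" using b(1) by auto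
    note dh = cochains_bimodule_map[OF koszul_diff_closed[OF h(1)]]
    define zh where "zh = (\<lambda>w\<in>W n k. ?z \<otimes>\<^bsub>A\<^esub> h w)"
    note zh = koszul_diff_central[OF f h(1), folded zh_def]
    show ?thesis
      unfolding Suc
    proof (rule hk_class_eqI[OF closed(2)[unfolded Suc] closed(1)[unfolded Suc] zh(1)])
      fix w :: "path \<Rightarrow> 'a" assume w: "w \<in> W n (Suc k)"
      have "g' w = koszul_diff n k h w \<oplus>\<^bsub>A\<^esub> g w"
        using w by (simp add: b(2) h(2) Suc CG_mult)
      then show "cup_cochain n 0 (Suc k) f g' w = koszul_diff n k zh w \<oplus>\<^bsub>A\<^esub> cup_cochain n 0 (Suc k) f g w"
        using w z(1) bimodule_map_closed[OF gm[unfolded Suc] w] bimodule_map_closed[OF dh] cup_cochain_0(1)[OF fm gm] cup_cochain_0(1)[OF fm gm']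
        by (simp add: Suc zh(2) A.r_distr)
    qed
  qed
qed

text \<open>Changing f by a coboundary adds [z, x] g(bar x) to the summands of the product, with z
  the value of a 0-cochain at 1. This is corrected by the differential of z g, and the remainder is
  z times the cocycle expression of g.\<close>

lemma cup_left_1_1:
  fixes f g f' :: "'a cochain"
  assumes f: "f \<in> cocycles n (Suc 0)" and g: "g \<in> cocycles n (Suc 0)" and f': "f' \<in> hk_class n (Suc 0) f"
  shows "hk_class n 2 (cup_cochain n (Suc 0) (Suc 0) f' g) = hk_class n 2 (cup_cochain n (Suc 0) (Suc 0) f g)"
proof -
  obtain b where b: "b \<in> coboundaries n (Suc 0)" "f' = b \<otimes>\<^bsub>CG (Suc 0)\<^esub> f" "f' \<in> cocycles n (Suc 0)"
    using mem_hk_class[OF f' f] by blast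
  then obtain h where h: "h \<in> cochains n 0" "b = koszul_diff n 0 h" by auto
  note hm = cochains_bimodule_map[OF h(1)]
  note fm = cochains_bimodule_map[OF cocycles_cochains[OF f]] and gm = cochains_bimodule_map[OF cocycles_cochains[OF g]]
    and fm' = cochains_bimodule_map[OF cocycles_cochains[OF b(3)]]
  note fv = value_closed[OF fm] and gv = value_closed[OF gm]
  let ?z = "h \<one>\<^bsub>P\<^esub>"
  note z = one_value_closed[OF hm]
  \<comment> \<open>The element z need not be central; it commutes with k, which is enough to make z
    g a bimodule map.\<close>
  define k where "k = (\<lambda>w\<in>W n (Suc 0). ?z \<otimes>\<^bsub>A\<^esub> g w)"
  have k: "k \<in> cochains n (Suc 0)"
    unfolding k_def using z commutes_tensor_power0[OF hm] by (intro bimodule_map_restrict bimodule_map_mult_left[OF gm])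
  have kv: "x \<in> arrows n \<Longrightarrow> k (arrow_elt x) = ?z \<otimes>\<^bsub>A\<^esub> g (arrow_elt x)" for x
    by (simp add: k_def bimodule_map_1_closed)
  have fv': "f' (arrow_elt x) = (?z \<otimes>\<^bsub>A\<^esub> arr x \<ominus>\<^bsub>A\<^esub> arr x \<otimes>\<^bsub>A\<^esub> ?z) \<oplus>\<^bsub>A\<^esub> f (arrow_elt x)" if "x \<in> arrows n" for x
    using that bimodule_map_1_closed[OF that] by (simp add: b(2) h(2) CG_mult koszul_diff_0[OF hm])
  have closed: "cup_cochain n (Suc 0) (Suc 0) f' g \<in> cochains n 2" "cup_cochain n (Suc 0) (Suc 0) f g \<in> cochains n 2"
    using cup_cochain_closed[OF b(3) g] cup_cochain_closed[OF f g] by (simp_all add: numeral_2_eq_2)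
  show ?thesis
  proof (rule hk_class_eq_2I[OF closed k])
    fix c
    let ?S = "relation_sum c"
    let ?K = "\<lambda>x. k (arrow_elt x) \<otimes>\<^bsub>A\<^esub> arr (bar x) \<oplus>\<^bsub>A\<^esub> arr x \<otimes>\<^bsub>A\<^esub> k (arrow_elt (bar x))"
    let ?H = "\<lambda>x. (?z \<otimes>\<^bsub>A\<^esub> arr x \<ominus>\<^bsub>A\<^esub> arr x \<otimes>\<^bsub>A\<^esub> ?z) \<otimes>\<^bsub>A\<^esub> g (arrow_elt (bar x))"
    let ?F = "\<lambda>x. f (arrow_elt x) \<otimes>\<^bsub>A\<^esub> g (arrow_elt (bar x))"
    let ?G = "\<lambda>x. g (arrow_elt x) \<otimes>\<^bsub>A\<^esub> arr (bar x) \<oplus>\<^bsub>A\<^esub> arr x \<otimes>\<^bsub>A\<^esub> g (arrow_elt (bar x))"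
    have c: "?S ?K \<in> carrier A" "?S ?H \<in> carrier A" "?S ?F \<in> carrier A"
      by (intro relation_sum_closed; simp add: fv gv kv z)+
    have "?S ?K \<oplus>\<^bsub>A\<^esub> ?S ?H = ?S (\<lambda>x. ?K x \<oplus>\<^bsub>A\<^esub> ?H x)"
      by (simp add: relation_sum_add fv gv kv z)
    also have "\<dots> = ?S (\<lambda>x. ?z \<otimes>\<^bsub>A\<^esub> ?G x)"
    proof (rule relation_sum_cong)
      fix x assume x: "x \<in> arrows n"
      have "?H x = ?z \<otimes>\<^bsub>A\<^esub> (arr x \<otimes>\<^bsub>A\<^esub> g (arrow_elt (bar x))) \<ominus>\<^bsub>A\<^esub> arr x \<otimes>\<^bsub>A\<^esub> (?z \<otimes>\<^bsub>A\<^esub> g (arrow_elt (bar x)))"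
        using z gv x by (simp add: A.minus_eq A.l_distr A.l_minus A.m_assoc)
      then show "?K x \<oplus>\<^bsub>A\<^esub> ?H x = ?z \<otimes>\<^bsub>A\<^esub> ?G x"
        using z gv x by (simp add: kv A.r_distr A.m_assoc A.add_minus_cancel)
      show "?z \<otimes>\<^bsub>A\<^esub> ?G x \<in> carrier A" using z gv x by simp
    qed
    also have "\<dots> = ?z \<otimes>\<^bsub>A\<^esub> ?S ?G"
      using z gv by (intro relation_sum_map[symmetric]) (auto simp: A.r_distr scalar_left_commute)
    also have "\<dots> = \<zero>\<^bsub>A\<^esub>"
      using g z cocycle_1_iff[OF cocycles_cochains[OF g]] by simp
    finally have "?S ?K = \<ominus>\<^bsub>A\<^esub> ?S ?H"
      using c A.minus_equality[of "?S ?K" "?S ?H"] by simp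
    moreover have "?S (\<lambda>x. f' (arrow_elt x) \<otimes>\<^bsub>A\<^esub> g (arrow_elt (bar x))) = ?S ?H \<oplus>\<^bsub>A\<^esub> ?S ?F"
      using fv gv z
      by (subst relation_sum_add[symmetric]) (auto intro!: relation_sum_cong simp: fv' A.l_distr)
    ultimately show "cup_cochain n (Suc 0) (Suc 0) f' g (relation_fun c) = ?S ?K \<oplus>\<^bsub>A\<^esub> cup_cochain n (Suc 0) (Suc 0) f g (relation_fun c)"
      using c by (simp add: cup_cochain_1_1[OF fm' gm] cup_cochain_1_1[OF fm gm] A.minus_add)
  qed
qed

lemma cup_cochain_cocycle:
  fixes f g :: "'a cochain"
  assumes f: "f \<in> cocycles n p" and g: "g \<in> cocycles n q"
  shows "cup_cochain n p q f g \<in> cocycles n (p + q)"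
proof -
  have zero_left: "cup_cochain n 0 k f g \<in> cocycles n k" if f: "f \<in> cocycles n 0" and g: "g \<in> cocycles n k" for k and f g :: "'a cochain"
  proof -
    note fm = cochains_bimodule_map[OF cocycles_cochains[OF f]] and gm = cochains_bimodule_map[OF cocycles_cochains[OF g]]
    note z = one_value_closed[OF fm]
    note d = koszul_diff_central[OF f cocycles_cochains[OF g], folded cup_cochain_0(1)[OF fm gm]]
    have "koszul_diff n k (cup_cochain n 0 k f g) = \<one>\<^bsub>CG (k + 1)\<^esub>"
    proof (rule cochain_eqI[OF koszul_diff_closed[OF d(1)]])
      show "\<one>\<^bsub>CG (k + 1)\<^esub> \<in> cochains n (k + 1)"
        using group.is_monoid[OF CG_group, THEN monoid.one_closed] by (simp only: CG_carrier)
      show "koszul_diff n k (cup_cochain n 0 k f g) w = \<one>\<^bsub>CG (k + 1)\<^esub> w" if "w \<in> W n (k + 1)" for w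
        using that g z d(2)[of w] by (simp add: cocycles_iff CG_one)
    qed
    then show ?thesis using d(1) by (simp add: cocycles_iff)
  qed
  consider "p = 0" | "q = 0" | "p + q \<ge> 2" by linarith
  then show ?thesis
  proof cases
    case 1
    then show ?thesis using zero_left f g by simp
  next
    case 2
    then show ?thesis using zero_left[of g f p] cup_cochain_commute[OF f g] f g by simp
  next
    case 3
    then show ?thesis by (intro cocycles_ge_2 cup_cochain_closed f g)
  qed
qed

lemma HK_carrierI: "(f :: 'a cochain) \<in> cocycles n p \<Longrightarrow> hk_class n p f \<in> carrier (HK n p)"
  by (simp add: HK_carrier)

lemma cup_commute_1_1:
  fixes f g :: "'a cochain"
  assumes f: "f \<in> cocycles n (Suc 0)" and g: "g \<in> cocycles n (Suc 0)"
  shows "hk_class n 2 (cup_cochain n (Suc 0) (Suc 0) f g) =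
    inv\<^bsub>HK n 2\<^esub> hk_class n 2 (cup_cochain n (Suc 0) (Suc 0) g f)"
proof -
  interpret H: group "HK n 2 :: 'a cochain set monoid" by (rule HK_group)
  have c: "cup_cochain n (Suc 0) (Suc 0) f g \<in> cocycles n 2" "cup_cochain n (Suc 0) (Suc 0) g f \<in> cocycles n 2"
    using cup_cochain_cocycle[OF f g] cup_cochain_cocycle[OF g f] by (simp_all add: numeral_2_eq_2)
  show ?thesis
    using c HK_carrierI HK_mult[OF c] cup_cochain_anticommute[OF f g] by (intro H.inv_equality[symmetric]) simp_all
qed

text \<open>All classes in the union that defines \<open>cup\<close> coincide.\<close>

lemma cup_class:
  fixes f g :: "'a cochain"
  assumes f: "f \<in> cocycles n p" and g: "g \<in> cocycles n q"
  shows "cup n p q (hk_class n p f) (hk_class n q g) = hk_class n (p + q) (cup_cochain n p q f g)"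
proof -
  have "hk_class n (p + q) (cup_cochain n p q f' g') = hk_class n (p + q) (cup_cochain n p q f g)"
    if f': "f' \<in> hk_class n p f" and g': "g' \<in> hk_class n q g" for f' g'
  proof -
    have fz: "f' \<in> cocycles n p" and gz: "g' \<in> cocycles n q"
      using mem_hk_class f f' g g' by blast+
    have trivial: "f' = f" if "p = 0"
    proof -
      obtain b where "b \<in> coboundaries n p" "f' = b \<otimes>\<^bsub>CG p\<^esub> f" using mem_hk_class[OF f' f] by blast
      then show ?thesis
        using that group.is_monoid[OF CG_group, THEN monoid.l_one, of f 0] cocycles_cochains[OF f] by (simp add: CG_carrier)
    qed
    have trivial': "g' = g" if "q = 0"
    proof -
      obtain b where "b \<in> coboundaries n q" "g' = b \<otimes>\<^bsub>CG q\<^esub> g" using mem_hk_class[OF g' g] by blast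
      then show ?thesis
        using that group.is_monoid[OF CG_group, THEN monoid.l_one, of g 0] cocycles_cochains[OF g] by (simp add: CG_carrier)
    qed
    consider "p = 0" | "q = 0" | "p = Suc 0" "q = Suc 0" | "p + q \<ge> 3" by linarith
    then show ?thesis
    proof cases
      case 1
      then show ?thesis using cup_right_0[where f = f and g = g and g' = g'] f g g' trivial by simp
    next
      case 2
      then show ?thesis
        using cup_right_0[where f = g and g = f and g' = f'] f g f' trivial' cup_cochain_commute[OF fz g] cup_cochain_commute[OF f g] by simp
    next
      case 3
      have left: "hk_class n 2 (cup_cochain n (Suc 0) (Suc 0) f' g') = hk_class n 2 (cup_cochain n (Suc 0) (Suc 0) f g')"
        using cup_left_1_1[where f = f and g = g' and f' = f'] f f' gz 3 by simp
      \<comment> \<open>The second factor is brought to the left by anticommutativity, replaced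
        there, and brought back; the two inverses cancel.\<close>
      have "hk_class n 2 (cup_cochain n (Suc 0) (Suc 0) f g') = inv\<^bsub>HK n 2\<^esub> hk_class n 2 (cup_cochain n (Suc 0) (Suc 0) g' f)"
        using cup_commute_1_1[of f g'] f gz 3 by simp
      also have "\<dots> = inv\<^bsub>HK n 2\<^esub> hk_class n 2 (cup_cochain n (Suc 0) (Suc 0) g f)"
        using cup_left_1_1[where f = g and g = f and f' = g'] f g g' 3 by simp
      also have "\<dots> = hk_class n 2 (cup_cochain n (Suc 0) (Suc 0) f g)"
        using cup_commute_1_1[of f g] f g 3 by simp
      finally show ?thesis using left 3 by (simp add: numeral_2_eq_2)
    next
      case 4
      then show ?thesis
        using cup_cochain_ge_3 cochains_bimodule_map cocycles_cochains f g fz gz by metis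
    qed
  qed
  then show ?thesis
    unfolding cup_def using hk_class_self[OF f] hk_class_self[OF g] by blast
qed

lemma cup_graded_commutative:
  assumes "X \<in> carrier (HK n p)" "Y \<in> carrier (HK n q)"
  shows "(cup n p q X Y :: 'a cochain set) = cup n q p Y X [^]\<^bsub>HK n (p + q)\<^esub> ((- 1 :: int) ^ (p * q))"
proof -
  obtain f g :: "'a cochain" where f: "f \<in> cocycles n p" "X = hk_class n p f" and g: "g \<in> cocycles n q" "Y = hk_class n q g"
    using assms by (auto simp: HK_carrier)
  interpret H: group "HK n (p + q) :: 'a cochain set monoid" by (rule HK_group)
  let ?F = "hk_class n (p + q) (cup_cochain n p q f g)" and ?G = "hk_class n (p + q) (cup_cochain n q p g f)"
  have c: "?F \<in> carrier (HK n (p + q))" "?G \<in> carrier (HK n (p + q))"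
    using cup_cochain_cocycle[OF f(1) g(1)] cup_cochain_cocycle[OF g(1) f(1)] by (auto simp: HK_carrier add.commute)
  have power: "x [^]\<^bsub>HK n (p + q)\<^esub> ((- 1 :: int) ^ (p * q)) = (if even (p * q) then x else inv\<^bsub>HK n (p + q)\<^esub> x)"
    if "x \<in> carrier (HK n (p + q))" for x :: "'a cochain set"
    using that H.int_pow_neg[of x 1] by (auto simp: minus_one_power_iff H.int_pow_1)
  have "?F = ?G [^]\<^bsub>HK n (p + q)\<^esub> ((- 1 :: int) ^ (p * q))"
  proof (cases "p = Suc 0 \<and> q = Suc 0")
    case True
    then show ?thesis
      using power[OF c(2)] cup_commute_1_1[of f g] f(1) g(1) by (simp add: numeral_2_eq_2)
  next
    case False
    then have pq: "p = 0 \<or> q = 0 \<or> p + q \<ge> 3" by linarith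
    \<comment> \<open>In total degree at least three the class is neutral, so the sign in the
      exponent does no harm whichever it is.\<close>
    have "?G = \<one>\<^bsub>HK n (p + q)\<^esub>" if "p + q \<ge> 3"
      using that cup_cochain_ge_3[of q g p f] cochains_bimodule_map cocycles_cochains f(1) g(1)
        hk_class_one_iff[of "\<one>\<^bsub>CG (p + q)\<^esub>" "p + q"] subgroup.one_closed[OF coboundaries_subgroup_cochains]
        subgroup.one_closed[OF cocycles_subgroup]
      by (simp add: add.commute)
    then have "?G [^]\<^bsub>HK n (p + q)\<^esub> ((- 1 :: int) ^ (p * q)) = ?G"
      using pq power[OF c(2)] by auto
    then show ?thesis using cup_cochain_commute[OF f(1) g(1) pq] by simp
  qed
  then show ?thesis
    using cup_class[OF f(1) g(1)] cup_class[OF g(1) f(1)] by (simp add: f(2) g(2) add.commute)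
qed

lemma cup_unit:
  assumes "X \<in> carrier (HK n p)"
  shows "(cup n 0 p (hk_class n 0 (cochain0 n \<one>\<^bsub>A\<^esub>)) X :: 'a cochain set) = X"
proof -
  obtain f :: "'a cochain" where f: "f \<in> cocycles n p" "X = hk_class n p f"
    using assms by (auto simp: HK_carrier)
  have e: "cochain0 n \<one>\<^bsub>A\<^esub> \<in> cocycles n 0" "cochain0 n \<one>\<^bsub>A\<^esub> \<one>\<^bsub>P\<^esub> = \<one>\<^bsub>A\<^esub>"
    by (rule cochain0_cocycle; simp)+
  note fm = cochains_bimodule_map[OF cocycles_cochains[OF f(1)]] and em = cochains_bimodule_map[OF cocycles_cochains[OF e(1)]]
  have "cup_cochain n 0 p (cochain0 n \<one>\<^bsub>A\<^esub>) f = f"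
    using cup_cochain_closed[OF e(1) f(1)] cup_cochain_0(1)[OF em fm]
    by (intro cochain_eqI[OF _ cocycles_cochains[OF f(1)]]) (auto simp: e(2) bimodule_map_closed[OF fm])
  then show ?thesis using cup_class[OF e(1) f(1)] by (simp add: f(2))
qed

end

section \<open>Computations with the relations\<close>

lemma (in monoid) intertwine_pow:
  assumes "x \<otimes> u = v \<otimes> x" "x \<in> carrier G" "u \<in> carrier G" "v \<in> carrier G"
  shows "x \<otimes> u [^] (k::nat) = v [^] k \<otimes> x"
proof (induction k)
  case (Suc k)
  have "x \<otimes> u [^] Suc k = (x \<otimes> u [^] k) \<otimes> u" using assms by (simp add: m_assoc)
  also have "\<dots> = v [^] k \<otimes> (x \<otimes> u)" using assms by (simp add: Suc m_assoc)
  also have "\<dots> = v [^] Suc k \<otimes> x" using assms by (simp add: m_assoc)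
  finally show ?case .
qed (use assms in simp)

lemma (in monoid) nat_pow_2: "x \<in> carrier G \<Longrightarrow> x [^] (2::nat) = x \<otimes> x"
  by (simp add: numeral_2_eq_2)

text \<open>The relations of the preprojective algebra as plain identities in a ring, with
  \<open>a i\<close> and \<open>b i\<close> for a_i and a_i^*. Vertices are left out, so that words
  can be manipulated without tracking sources and targets.\<close>

locale D_relations = ring R for R (structure) +
  fixes n :: nat and a b :: "nat \<Rightarrow> 'a"
  assumes n_ge: "n \<ge> 4"
    and a_closed: "\<And>i. i \<le> n - 2 \<Longrightarrow> a i \<in> carrier R"
    and b_closed: "\<And>i. i \<le> n - 2 \<Longrightarrow> b i \<in> carrier R"
    and rel_low: "\<And>i. i < 2 \<Longrightarrow> b i \<otimes> a i = \<zero>"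
    and rel_2: "a 0 \<otimes> b 0 \<oplus> a 1 \<otimes> b 1 = b 2 \<otimes> a 2"
    and rel_mid: "\<And>i. 2 \<le> i \<Longrightarrow> i < n - 2 \<Longrightarrow> a i \<otimes> b i = b (Suc i) \<otimes> a (Suc i)"
    and rel_top: "a (n - 2) \<otimes> b (n - 2) = \<zero>"
begin

text \<open>The loop a_i^* a_i. The value 0 beyond i = n - 2 stands for the last vertex, where the
  relation makes a_{n-2} a_{n-2}^* vanish; so \<open>ab\<close> and the intertwining rules hold up
  to the end of the branch.\<close>

definition y :: "nat \<Rightarrow> 'a" where
  "y i = (if i \<le> n - 2 then b i \<otimes> a i else \<zero>)"

definition p :: "nat \<Rightarrow> 'a" where "p i = a i \<otimes> b i"

definition g :: "nat \<Rightarrow> 'a" where "g i = b i \<otimes> (p (1 - i) \<otimes> a i)"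

text \<open>The path along the long branch from vertex 2 to vertex k + 2, and \<open>down\<close>
  the way back. For k = 0 it is 1 and not e_2, so that it is used only next to an element living at
  vertex 2.\<close>

primrec up :: "nat \<Rightarrow> 'a" where
  "up 0 = \<one>"
| "up (Suc k) = a (2 + k) \<otimes> up k"

primrec down :: "nat \<Rightarrow> 'a" where
  "down 0 = \<one>"
| "down (Suc k) = down k \<otimes> b (2 + k)"

lemma low_closed [simp]: "i < 2 \<Longrightarrow> a i \<in> carrier R" "i < 2 \<Longrightarrow> b i \<in> carrier R"
  using n_ge by (auto intro: a_closed b_closed)

lemma y_closed [simp]: "y i \<in> carrier R"
  by (simp add: y_def a_closed b_closed)

lemma p_closed [simp]: "i < 2 \<Longrightarrow> p i \<in> carrier R"
  by (simp add: p_def)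

lemma g_closed [simp]: "i < 2 \<Longrightarrow> g i \<in> carrier R"
  by (simp add: g_def)

lemma up_closed [simp]: "k \<le> n - 3 \<Longrightarrow> up k \<in> carrier R"
  using n_ge by (induction k) (auto intro!: a_closed)

lemma down_closed [simp]: "k \<le> n - 3 \<Longrightarrow> down k \<in> carrier R"
  using n_ge by (induction k) (auto intro!: b_closed)

lemma ab: "2 \<le> i \<Longrightarrow> i \<le> n - 2 \<Longrightarrow> a i \<otimes> b i = y (Suc i)"
  using rel_mid[of i] rel_top n_ge by (cases "i = n - 2") (auto simp: y_def)

lemma a_y: "2 \<le> i \<Longrightarrow> i \<le> n - 2 \<Longrightarrow> a i \<otimes> y i = y (Suc i) \<otimes> a i"
  by (simp add: y_def[of i] ab[symmetric] a_closed b_closed m_assoc)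

lemma y_b: "2 \<le> i \<Longrightarrow> i \<le> n - 2 \<Longrightarrow> b i \<otimes> y (Suc i) = y i \<otimes> b i"
  by (simp add: y_def[of i] ab[symmetric] a_closed b_closed m_assoc)

lemma a_y_pow: "2 \<le> i \<Longrightarrow> i \<le> n - 2 \<Longrightarrow> a i \<otimes> y i [^] (k::nat) = y (Suc i) [^] k \<otimes> a i"
  by (intro intertwine_pow a_y) (auto intro: a_closed)

lemma b_y_pow: "2 \<le> i \<Longrightarrow> i \<le> n - 2 \<Longrightarrow> b i \<otimes> y (Suc i) [^] (k::nat) = y i [^] k \<otimes> b i"
  by (intro intertwine_pow y_b) (auto intro: b_closed)

text \<open>Induction from the last vertex downwards: y_i^{n-i} = b_i y_{i+1}^{n-i-1} a_i.\<close>

lemma y_nilpotent: "2 \<le> i \<Longrightarrow> i < n \<Longrightarrow> y i [^] (n - i) = \<zero>"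
proof (induction "n - i" arbitrary: i)
  case (Suc k)
  show ?case
  proof (cases "k = 0")
    case True
    then have "n - i = 1" "\<not> i \<le> n - 2" using Suc n_ge by linarith+
    then show ?thesis by (simp add: y_def)
  next
    case False
    then have i: "Suc i < n" "i \<le> n - 2" "k = n - Suc i" using Suc by linarith+
    have "y i [^] (n - i) = y i [^] k \<otimes> (b i \<otimes> a i)"
      using i Suc.hyps(2)[symmetric] by (simp add: y_def[of i])
    also have "\<dots> = (b i \<otimes> y (Suc i) [^] k) \<otimes> a i"
      using i Suc.prems by (simp add: b_y_pow m_assoc a_closed b_closed)
    also have "\<dots> = \<zero>"
      using Suc.hyps(1)[of "Suc i"] i Suc.prems by (simp add: a_closed b_closed)
    finally show ?thesis .
  qed
qed simp

lemma y_nilpotent_ge: "2 \<le> i \<Longrightarrow> i < n \<Longrightarrow> n - i \<le> k \<Longrightarrow> y i [^] k = \<zero>"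
  using y_nilpotent[of i] nat_pow_mult[of "y i" "n - i" "k - (n - i)"] by simp

section \<open>Calculations at the branching vertex 2\<close>

lemma y2: "i < 2 \<Longrightarrow> y 2 = p i \<oplus> p (1 - i)"
proof -
  assume "i < 2"
  then consider "i = 0" | "i = 1" by linarith
  then show ?thesis
    using rel_2 n_ge by cases (auto simp: y_def p_def a_comm)
qed

lemma p_a: "i < 2 \<Longrightarrow> p i \<otimes> a i = \<zero>" and b_p: "i < 2 \<Longrightarrow> b i \<otimes> p i = \<zero>"
  and p_p: "i < 2 \<Longrightarrow> p i \<otimes> p i = \<zero>"
proof -
  assume i: "i < 2"
  show "p i \<otimes> a i = \<zero>" using i by (simp add: p_def m_assoc rel_low)
  show 1: "b i \<otimes> p i = \<zero>" using i by (simp add: p_def m_assoc[symmetric] rel_low)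
  show "p i \<otimes> p i = \<zero>" using i 1 by (simp add: p_def m_assoc)
qed

lemma y2_a: "i < 2 \<Longrightarrow> y 2 \<otimes> a i = p (1 - i) \<otimes> a i"
  by (simp add: y2[of i] l_distr p_a)

lemma b_y2: "i < 2 \<Longrightarrow> b i \<otimes> y 2 = b i \<otimes> p (1 - i)"
  by (simp add: y2[of i] r_distr b_p)

lemma p_y2: "i < 2 \<Longrightarrow> p i \<otimes> y 2 = p i \<otimes> p (1 - i)" and y2_p: "i < 2 \<Longrightarrow> y 2 \<otimes> p i = p (1 - i) \<otimes> p i"
  by (simp_all add: y2[of i] r_distr l_distr p_p)

text \<open>Both sides equal p_{1-i} p_i, because the squares of p_0 and p_1 vanish and y_2 is their
  sum.\<close>

lemma p_swap: "i < 2 \<Longrightarrow> y 2 \<otimes> p i = p (1 - i) \<otimes> y 2"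
  using p_y2[of "1 - i"] by (simp add: y2_p)

definition swap :: "nat \<Rightarrow> nat \<Rightarrow> nat" where
  "swap k i = (if even k then i else 1 - i)"

lemma swap_less [simp]: "i < 2 \<Longrightarrow> swap k i < 2"
  by (auto simp: swap_def)

lemma y2_pow_p: "i < 2 \<Longrightarrow> y 2 [^] (k::nat) \<otimes> p i = p (swap k i) \<otimes> y 2 [^] k"
proof (induction k arbitrary: i)
  case (Suc k)
  have "y 2 [^] Suc k \<otimes> p i = y 2 [^] k \<otimes> (y 2 \<otimes> p i)"
    using Suc by (simp add: m_assoc)
  also have "\<dots> = (y 2 [^] k \<otimes> p (1 - i)) \<otimes> y 2"
    using Suc.prems by (simp add: p_swap m_assoc)
  also have "\<dots> = p (swap k (1 - i)) \<otimes> y 2 [^] Suc k"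
    using Suc.prems by (subst Suc.IH) (simp_all add: m_assoc)
  finally show ?case using Suc.prems by (simp add: swap_def split: if_splits)
qed (simp add: swap_def)

text \<open>Two factors y_2 in front of a_i become p_i p_{1-i}, and the a_i at the start of p_i
  leaves b_i p_{1-i} a_i = g_i behind it.\<close>

lemma y2_square_a: "i < 2 \<Longrightarrow> a i \<otimes> g i = (y 2 [^] (2::nat)) \<otimes> a i"
proof -
  assume i: "i < 2"
  have "(y 2 [^] (2::nat)) \<otimes> a i = y 2 \<otimes> (p (1 - i) \<otimes> a i)"
    using i by (simp add: nat_pow_2 m_assoc y2_a)
  also have "\<dots> = (p i \<otimes> p (1 - i)) \<otimes> a i"
    using i y2_p[of "1 - i"] by (simp flip: m_assoc)
  also have "\<dots> = a i \<otimes> g i"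
    using i by (simp add: g_def p_def[of i] m_assoc)
  finally show ?thesis ..
qed

lemma b_y2_square: "i < 2 \<Longrightarrow> b i \<otimes> (y 2 [^] (2::nat)) = g i \<otimes> b i"
proof -
  assume i: "i < 2"
  have "b i \<otimes> (y 2 [^] (2::nat)) = (b i \<otimes> p (1 - i)) \<otimes> y 2"
    using i by (simp add: nat_pow_2 b_y2 flip: m_assoc)
  also have "\<dots> = b i \<otimes> (p (1 - i) \<otimes> p i)"
    using i p_y2[of "1 - i"] by (simp add: m_assoc)
  also have "\<dots> = g i \<otimes> b i"
    using i by (simp add: g_def p_def[of i] m_assoc)
  finally show ?thesis .
qed

lemma y2_pow_a: "i < 2 \<Longrightarrow> y 2 [^] (2 * l) \<otimes> a i = a i \<otimes> g i [^] (l::nat)"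
  using intertwine_pow[OF y2_square_a, of i l] by (simp add: nat_pow_pow)

lemma b_y2_pow: "i < 2 \<Longrightarrow> b i \<otimes> y 2 [^] (2 * l) = g i [^] (l::nat) \<otimes> b i"
  using intertwine_pow[OF b_y2_square, of i l] by (simp add: nat_pow_pow)

text \<open>An even power of y_2 passes to the right of a_i as a power of g_i, which brings b_i next
  to a_i.\<close>

lemma b_y2_a_even: "i < 2 \<Longrightarrow> even k \<Longrightarrow> b i \<otimes> (y 2 [^] (k::nat) \<otimes> a i) = \<zero>"
  by (elim evenE) (simp add: y2_pow_a rel_low flip: m_assoc)

text \<open>All but one of the factors y_2 pass to the left as powers of g_i; the last one gives b_i
  p_{1-i} a_i = g_i.\<close>

lemma b_y2_a_odd: "i < 2 \<Longrightarrow> b i \<otimes> (y 2 [^] (2 * l + 1) \<otimes> a i) = g i [^] Suc l"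
proof -
  assume i: "i < 2"
  have "b i \<otimes> (y 2 [^] (2 * l + 1) \<otimes> a i) = (b i \<otimes> y 2 [^] (2 * l)) \<otimes> (y 2 \<otimes> a i)"
    using i by (simp add: m_assoc)
  also have "\<dots> = g i [^] l \<otimes> (b i \<otimes> (p (1 - i) \<otimes> a i))"
    using i by (simp add: b_y2_pow y2_a m_assoc)
  finally show ?thesis using i by (simp add: g_def)
qed

text \<open>\<open>socle_low i\<close> is $\pi_1$ for $i = 1$ and $-\pi_0$ for $i = 0$, and \<open>socle k\<close> is $\pi_{k+2}$.\<close>

definition socle_low :: "nat \<Rightarrow> 'a" where
  "socle_low i = b i \<otimes> (y 2 [^] (n - 3) \<otimes> a i)"

definition socle :: "nat \<Rightarrow> 'a" where
  "socle k = up k \<otimes> (y 2 [^] (n - 3 - k) \<otimes> (p 1 \<otimes> down k))"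

text \<open>An element from vertex k + 2 to vertex k + 3 that produces neighbouring socle elements
  when multiplied by b_{k+2} from either side; it is the 1-cochain value relating their
  classes.\<close>

definition link :: "nat \<Rightarrow> 'a" where
  "link k = up (Suc k) \<otimes> (y 2 [^] (n - 4 - k) \<otimes> (p 1 \<otimes> down k))"

lemma socle_low_closed [simp]: "i < 2 \<Longrightarrow> socle_low i \<in> carrier R"
  by (simp add: socle_low_def)

lemma socle_closed [simp]: "k \<le> n - 3 \<Longrightarrow> socle k \<in> carrier R"
  by (simp add: socle_def)

lemma y2_nilpotent: "k \<ge> n - 2 \<Longrightarrow> y 2 [^] (k::nat) = \<zero>"
  using n_ge by (intro y_nilpotent_ge) auto

lemma y2_pow_n3: "y 2 [^] (n - 3) \<otimes> y 2 = \<zero>" "y 2 \<otimes> y 2 [^] (n - 3) = \<zero>"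
proof -
  have "Suc (n - 3) = n - 2" using n_ge by linarith
  then have "y 2 [^] Suc (n - 3) = \<zero>" using y2_nilpotent[of "n - 2"] by simp
  then show "y 2 [^] (n - 3) \<otimes> y 2 = \<zero>" by simp
  then show "y 2 \<otimes> y 2 [^] (n - 3) = \<zero>"
    using nat_pow_Suc2[of "y 2" "n - 3"] by simp
qed

section \<open>Transport of loops along the long branch\<close>

lemma up_y: "k \<le> n - 3 \<Longrightarrow> up k \<otimes> y 2 [^] (j::nat) = y (2 + k) [^] j \<otimes> up k"
proof (induction k)
  case (Suc k)
  have k: "k \<le> n - 3" "2 + k \<le> n - 2" "a (2 + k) \<in> carrier R" using Suc.prems n_ge by (auto intro: a_closed)
  have "up (Suc k) \<otimes> y 2 [^] j = (a (2 + k) \<otimes> y (2 + k) [^] j) \<otimes> up k"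
    using Suc.IH k by (simp add: m_assoc)
  then show ?case using k a_y_pow[of "2 + k" j] by (simp add: m_assoc)
qed simp

lemma down_y: "k \<le> n - 3 \<Longrightarrow> down k \<otimes> y (2 + k) [^] (j::nat) = y 2 [^] j \<otimes> down k"
proof (induction k)
  case (Suc k)
  have k: "k \<le> n - 3" "2 + k \<le> n - 2" "b (2 + k) \<in> carrier R" using Suc.prems n_ge by (auto intro: b_closed)
  have "down (Suc k) \<otimes> y (2 + Suc k) [^] j = (down k \<otimes> y (2 + k) [^] j) \<otimes> b (2 + k)"
    using b_y_pow[of "2 + k" j] k by (simp add: m_assoc)
  then show ?case using Suc.IH k by (simp add: m_assoc)
qed simp

lemma y_up: "Suc k \<le> n - 3 \<Longrightarrow> b (2 + k) \<otimes> up (Suc k) = up k \<otimes> y 2"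
proof -
  assume k: "Suc k \<le> n - 3"
  then have "2 + k \<le> n - 2" "k \<le> n - 3" by auto
  then have "b (2 + k) \<otimes> up (Suc k) = y (2 + k) \<otimes> up k"
    by (simp add: y_def a_closed b_closed m_assoc)
  also have "\<dots> = up k \<otimes> y 2"
    using up_y[of k 1] k by simp
  finally show ?thesis .
qed

lemma down_y': "Suc k \<le> n - 3 \<Longrightarrow> down (Suc k) \<otimes> a (2 + k) = y 2 \<otimes> down k"
proof -
  assume k: "Suc k \<le> n - 3"
  then have "2 + k \<le> n - 2" "k \<le> n - 3" by auto
  then have "down (Suc k) \<otimes> a (2 + k) = down k \<otimes> y (2 + k)"
    by (simp add: y_def a_closed b_closed m_assoc)
  also have "\<dots> = y 2 \<otimes> down k"
    using down_y[of k 1] k by simp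
  finally show ?thesis .
qed

lemma down_up: "k \<le> n - 3 \<Longrightarrow> down k \<otimes> up k = y 2 [^] k"
proof (induction k)
  case (Suc k)
  then have k: "k \<le> n - 3" "b (2 + k) \<in> carrier R" "a (2 + k) \<in> carrier R" using n_ge by (auto intro: a_closed b_closed)
  have "down (Suc k) \<otimes> up (Suc k) = down k \<otimes> (b (2 + k) \<otimes> up (Suc k))"
    using k by (simp add: m_assoc)
  also have "\<dots> = (down k \<otimes> up k) \<otimes> y 2"
    using k y_up[OF Suc.prems] by (simp add: m_assoc del: up.simps)
  finally show ?case using Suc.IH k by simp
qed simp

section \<open>The socle elements are annihilated by all arrows\<close>

lemma socle_y: "k \<le> n - 3 \<Longrightarrow> socle k = y (2 + k) [^] (n - 3 - k) \<otimes> (up k \<otimes> (p 1 \<otimes> down k))"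
  using up_y[of k "n - 3 - k"] by (simp add: socle_def flip: m_assoc)

lemma up_zero: "k \<le> n - 3 \<Longrightarrow> j \<ge> n - 2 - k \<Longrightarrow> up k \<otimes> y 2 [^] (j::nat) = \<zero>"
  using up_y[of k j] y_nilpotent_ge[of "2 + k" j] n_ge by simp

lemma down_zero: "k \<le> n - 3 \<Longrightarrow> j \<ge> n - 2 - k \<Longrightarrow> y 2 [^] (j::nat) \<otimes> down k = \<zero>"
  using down_y[of k j] y_nilpotent_ge[of "2 + k" j] n_ge by simp

text \<open>Passing the power of y_2 across p_1 changes at most the index of p, so the nilpotency
  bound at the far end applies as before.\<close>

lemma down_zero': "k \<le> n - 3 \<Longrightarrow> j \<ge> n - 2 - k \<Longrightarrow> y 2 [^] (j::nat) \<otimes> (p 1 \<otimes> down k) = \<zero>"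
proof -
  assume k: "k \<le> n - 3" "j \<ge> n - 2 - k"
  have "y 2 [^] j \<otimes> (p 1 \<otimes> down k) = p (swap j 1) \<otimes> (y 2 [^] j \<otimes> down k)"
    using k y2_pow_p[of 1 j] by (simp flip: m_assoc)
  then show ?thesis using k by (simp add: down_zero)
qed

text \<open>The path is now one step longer while the power of y_2 is the same, and the nilpotency
  exponent at the next vertex is smaller by one.\<close>

lemma a_socle: "k \<le> n - 4 \<Longrightarrow> a (2 + k) \<otimes> socle k = \<zero>"
proof -
  assume k: "k \<le> n - 4"
  then have k': "Suc k \<le> n - 3" "k \<le> n - 3" "a (2 + k) \<in> carrier R" using n_ge by (auto intro: a_closed)
  have "a (2 + k) \<otimes> socle k = (up (Suc k) \<otimes> y 2 [^] (n - 3 - k)) \<otimes> (p 1 \<otimes> down k)"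
    using k' by (simp add: socle_def m_assoc)
  then show ?thesis using k' up_zero[of "Suc k" "n - 3 - k"] by simp
qed

lemma socle_b: "k \<le> n - 4 \<Longrightarrow> socle k \<otimes> b (2 + k) = \<zero>"
proof -
  assume k: "k \<le> n - 4"
  then have k': "Suc k \<le> n - 3" "k \<le> n - 3" "b (2 + k) \<in> carrier R" using n_ge by (auto intro: b_closed)
  have "socle k \<otimes> b (2 + k) = up k \<otimes> (y 2 [^] (n - 3 - k) \<otimes> (p 1 \<otimes> down (Suc k)))"
    using k' by (simp add: socle_def m_assoc)
  then show ?thesis using k' down_zero'[of "Suc k" "n - 3 - k"] by (simp del: down.simps)
qed

text \<open>Going back one step turns the last arrow of the path into a factor y_2; the exponent
  then exceeds what \<open>down (Suc k)\<close> allows.\<close>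

lemma b_socle: "Suc k \<le> n - 3 \<Longrightarrow> b (2 + k) \<otimes> socle (Suc k) = \<zero>"
proof -
  assume k: "Suc k \<le> n - 3"
  then have k': "k \<le> n - 3" "b (2 + k) \<in> carrier R" using n_ge by (auto intro: b_closed)
  have e: "Suc (n - 3 - Suc k) = n - 3 - k" using k by linarith
  have j: "y 2 [^] (n - 3 - k) = y 2 \<otimes> y 2 [^] (n - 3 - Suc k)"
    using nat_pow_Suc2[OF y_closed, of 2 "n - 3 - Suc k"] unfolding e .
  have "b (2 + k) \<otimes> socle (Suc k) = (up k \<otimes> y 2) \<otimes> (y 2 [^] (n - 3 - Suc k) \<otimes> (p 1 \<otimes> down (Suc k)))"
    using k k' y_up[OF k] unfolding socle_def by (subst m_assoc[symmetric]) (simp_all del: up.simps down.simps)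
  also have "\<dots> = up k \<otimes> (y 2 [^] (n - 3 - k) \<otimes> (p 1 \<otimes> down (Suc k)))"
    unfolding j using k k' by (simp add: m_assoc del: up.simps down.simps)
  also have "\<dots> = \<zero>"
    using k k' down_zero'[of "Suc k" "n - 3 - k"] by (simp del: up.simps down.simps)
  finally show ?thesis .
qed

text \<open>The mirror image of \<open>b_socle\<close>, except that the new factor y_2 arises behind
  p_1. It is passed to the front, where p_1 becomes p_0, and raises the exponent beyond what
  \<open>up (Suc k)\<close> allows.\<close>

lemma socle_a: "Suc k \<le> n - 3 \<Longrightarrow> socle (Suc k) \<otimes> a (2 + k) = \<zero>"
proof -
  assume k: "Suc k \<le> n - 3"
  then have k': "k \<le> n - 3" "a (2 + k) \<in> carrier R" using n_ge by (auto intro: a_closed)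
  let ?j = "n - 3 - Suc k"
  have j: "n - 2 - Suc k \<le> Suc ?j" using k by linarith
  have "socle (Suc k) \<otimes> a (2 + k) = up (Suc k) \<otimes> (y 2 [^] ?j \<otimes> (p 1 \<otimes> (down (Suc k) \<otimes> a (2 + k))))"
    using k k' by (simp add: socle_def m_assoc del: up.simps down.simps)
  also have "\<dots> = up (Suc k) \<otimes> (y 2 [^] ?j \<otimes> ((p 1 \<otimes> y 2) \<otimes> down k))"
    using k k' down_y'[OF k] by (simp add: m_assoc del: up.simps down.simps)
  also have "p 1 \<otimes> y 2 = y 2 \<otimes> p 0" using p_swap[of 0] by simp
  also have "up (Suc k) \<otimes> (y 2 [^] ?j \<otimes> ((y 2 \<otimes> p 0) \<otimes> down k)) = (up (Suc k) \<otimes> y 2 [^] Suc ?j) \<otimes> (p 0 \<otimes> down k)"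
    using k k' by (simp add: m_assoc del: up.simps down.simps)
  also have "\<dots> = \<zero>"
    using k k' up_zero[of "Suc k" "Suc ?j"] j by (simp del: up.simps down.simps nat_pow_Suc)
  finally show ?thesis .
qed

lemma socle_0: "socle 0 = y 2 [^] (n - 3) \<otimes> p 1"
  by (simp add: socle_def)

text \<open>Moving the power of y_2 to the right turns p_j into p_0 or p_1. If the index is i, then
  b_i p_i = 0; if not, b_i p_{1-i} = b_i y_2 supplies the one factor needed for nilpotency.\<close>

lemma b_y2_p: "i < 2 \<Longrightarrow> j < 2 \<Longrightarrow> b i \<otimes> (y 2 [^] (n - 3) \<otimes> p j) = \<zero>"
proof -
  assume i: "i < 2" and j: "j < 2"
  show ?thesis
  proof (cases "i = swap (n - 3) j")
    case True
    have "b i \<otimes> (y 2 [^] (n - 3) \<otimes> p j) = (b i \<otimes> p i) \<otimes> y 2 [^] (n - 3)"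
      using i j by (simp add: y2_pow_p True m_assoc)
    then show ?thesis using i by (simp add: b_p)
  next
    case False
    then have "swap (n - 3) j = 1 - i" using i j by (auto simp: swap_def split: if_splits)
    then have "b i \<otimes> (y 2 [^] (n - 3) \<otimes> p j) = (b i \<otimes> y 2) \<otimes> y 2 [^] (n - 3)"
      using i j by (simp add: y2_pow_p b_y2 m_assoc)
    also have "\<dots> = b i \<otimes> (y 2 \<otimes> y 2 [^] (n - 3))" using i by (simp add: m_assoc)
    finally show ?thesis using i by (simp only: y2_pow_n3) simp
  qed
qed

text \<open>Either p_j a_i = 0 directly, or p_j a_i = y_2 a_i and the power of y_2 reaches n -
  2.\<close>

lemma y2_pow_p_a: "i < 2 \<Longrightarrow> j < 2 \<Longrightarrow> y 2 [^] (n - 3) \<otimes> (p j \<otimes> a i) = \<zero>"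
proof -
  assume i: "i < 2" and j: "j < 2"
  show ?thesis
  proof (cases "i = j")
    case True
    then show ?thesis using i by (simp add: p_a)
  next
    case False
    then have "j = 1 - i" using i j by linarith
    then have "y 2 [^] (n - 3) \<otimes> (p j \<otimes> a i) = (y 2 [^] (n - 3) \<otimes> y 2) \<otimes> a i"
      using i y2_a[OF i] by (simp add: m_assoc)
    then show ?thesis using i by (simp only: y2_pow_n3) simp
  qed
qed

lemma b_socle_0: "i < 2 \<Longrightarrow> b i \<otimes> socle 0 = \<zero>"
  by (simp add: socle_0 b_y2_p)

lemma socle_0_a: "i < 2 \<Longrightarrow> socle 0 \<otimes> a i = \<zero>"
  by (simp add: socle_0 m_assoc y2_pow_p_a)

text \<open>The leading a_i b_i = p_i moves to the right of the power of y_2 and meets a_i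
  there.\<close>

lemma a_socle_low: "i < 2 \<Longrightarrow> a i \<otimes> socle_low i = \<zero>"
proof -
  assume i: "i < 2"
  have "swap (n - 3) (swap (n - 3) i) = i" using i by (auto simp: swap_def)
  then have "p i \<otimes> y 2 [^] (n - 3) = y 2 [^] (n - 3) \<otimes> p (swap (n - 3) i)"
    using y2_pow_p[of "swap (n - 3) i" "n - 3"] i by simp
  then have "a i \<otimes> socle_low i = y 2 [^] (n - 3) \<otimes> (p (swap (n - 3) i) \<otimes> a i)"
    using i by (simp add: socle_low_def p_def[of i, symmetric] flip: m_assoc)
  then show ?thesis using i by (simp add: y2_pow_p_a)
qed

lemma socle_low_b: "i < 2 \<Longrightarrow> socle_low i \<otimes> b i = \<zero>"
  using b_y2_p[of i i] by (simp add: socle_low_def p_def m_assoc)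

text \<open>For even n the exponent n - 3 is odd, and (n - 2) / 2 copies of g_i result.\<close>

lemma socle_low_even: "even n \<Longrightarrow> i < 2 \<Longrightarrow> socle_low i = g i [^] ((n - 2) div 2)"
proof -
  assume n: "even n" and i: "i < 2"
  obtain l where l: "n = 2 * l" using n by (elim evenE)
  have "n - 3 = 2 * (l - 2) + 1" "Suc (l - 2) = (n - 2) div 2" using l n_ge by auto
  then show ?thesis using b_y2_a_odd[OF i, of "l - 2"] by (simp add: socle_low_def)
qed

lemma socle_low_odd: "odd n \<Longrightarrow> i < 2 \<Longrightarrow> socle_low i = \<zero>"
  unfolding socle_low_def using n_ge by (intro b_y2_a_even) auto

text \<open>A power g_i^{k+1} equals b_i y_2^{2k+1} a_i, with one factor y_2 less than twice the
  exponent; hence the bound on 2l is strict.\<close>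

lemma g_pow_zero: "i < 2 \<Longrightarrow> 2 * l > n - 2 \<Longrightarrow> g i [^] (l::nat) = \<zero>"
proof -
  assume i: "i < 2" and l: "2 * l > n - 2"
  then obtain k where k: "l = Suc k" by (cases l) auto
  show ?thesis
  proof (cases "2 * k + 1 \<ge> n - 2")
    case True
    then show ?thesis using b_y2_a_odd[OF i, of k] i y2_nilpotent[OF True] by (simp add: k)
  next
    case False
    then show ?thesis using l k by simp
  qed
qed

lemma link_b: "Suc k \<le> n - 3 \<Longrightarrow> link k \<otimes> b (2 + k) = socle (Suc k)"
proof -
  assume k: "Suc k \<le> n - 3"
  then have k': "k \<le> n - 3" "b (2 + k) \<in> carrier R" "n - 4 - k = n - 3 - Suc k" using n_ge by (auto intro: b_closed)
  show ?thesis using k k' by (simp add: link_def socle_def m_assoc del: up.simps)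
qed

lemma b_link: "Suc k \<le> n - 3 \<Longrightarrow> b (2 + k) \<otimes> link k = socle k"
proof -
  assume k: "Suc k \<le> n - 3"
  then have k': "k \<le> n - 3" "b (2 + k) \<in> carrier R" "Suc (n - 4 - k) = n - 3 - k" using n_ge by (auto intro: b_closed)
  have j: "y 2 [^] (n - 3 - k) = y 2 \<otimes> y 2 [^] (n - 4 - k)"
    using nat_pow_Suc2[OF y_closed, of 2 "n - 4 - k"] unfolding k'(3) .
  have "b (2 + k) \<otimes> link k = (up k \<otimes> y 2) \<otimes> (y 2 [^] (n - 4 - k) \<otimes> (p 1 \<otimes> down k))"
    using k k' y_up[OF k] unfolding link_def by (subst m_assoc[symmetric]) (simp_all del: up.simps)
  also have "\<dots> = socle k"
    unfolding socle_def j using k k' by (simp add: m_assoc)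
  finally show ?thesis .
qed

end

section \<open>Diagonal elements\<close>

context type_D begin

lemma arrow_mem: "i \<le> n - 2 \<Longrightarrow> Arr i \<in> arrows n" "i \<le> n - 2 \<Longrightarrow> Star i \<in> arrows n"
  by (auto simp: arrows_def)

lemma relation_sum_vertex:
  assumes m: "\<And>x. x \<in> arrows n \<Longrightarrow> m x \<in> carrier A"
  shows "relation_sum (\<lambda>j. of_bool (j = i)) m = (\<Oplus>\<^bsub>A\<^esub>x\<in>arrows_into n i. scalar (arrow_sign x) \<otimes>\<^bsub>A\<^esub> m x)"
proof -
  have "relation_sum (\<lambda>j. of_bool (j = i)) m =
      (\<Oplus>\<^bsub>A\<^esub>x\<in>arrows_into n i. scalar (of_bool (arrow_target x = i) * arrow_sign x) \<otimes>\<^bsub>A\<^esub> m x)"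
    unfolding relation_sum_def using m
    by (intro A.add.finprod_mono_neutral_cong_right) (auto simp: arrows_into_def)
  also have "\<dots> = (\<Oplus>\<^bsub>A\<^esub>x\<in>arrows_into n i. scalar (arrow_sign x) \<otimes>\<^bsub>A\<^esub> m x)"
    using m by (intro A.finsum_cong') (auto simp: arrows_into_def)
  finally show ?thesis .
qed

lemma relation_sum_vertex_cases:
  assumes m: "\<And>x. x \<in> arrows n \<Longrightarrow> m x \<in> carrier A"
  shows "i < 2 \<Longrightarrow> relation_sum (\<lambda>j. of_bool (j = i)) m = \<ominus>\<^bsub>A\<^esub> m (Star i)"
    "relation_sum (\<lambda>j. of_bool (j = 2)) m = m (Arr 0) \<oplus>\<^bsub>A\<^esub> (m (Arr 1) \<oplus>\<^bsub>A\<^esub> \<ominus>\<^bsub>A\<^esub> m (Star 2))"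
    "2 \<le> i \<Longrightarrow> i < n - 2 \<Longrightarrow> relation_sum (\<lambda>j. of_bool (j = Suc i)) m = m (Arr i) \<oplus>\<^bsub>A\<^esub> \<ominus>\<^bsub>A\<^esub> m (Star (Suc i))"
    "relation_sum (\<lambda>j. of_bool (j = n - 1)) m = m (Arr (n - 2))"
proof -
  have closed: "m (Arr j) \<in> carrier A" "m (Star j) \<in> carrier A" if "j \<le> n - 2" for j
    using that m arrow_mem by auto
  show "relation_sum (\<lambda>j. of_bool (j = i)) m = \<ominus>\<^bsub>A\<^esub> m (Star i)" if "i < 2"
  proof -
    have "i \<le> n - 2" "i < n" using that n_ge_4 by auto
    then show ?thesis
      using that closed[of i] by (simp add: relation_sum_vertex[OF m] arrows_into_cases scalar_minus_1)
  qed
  show "relation_sum (\<lambda>j. of_bool (j = 2)) m = m (Arr 0) \<oplus>\<^bsub>A\<^esub> (m (Arr 1) \<oplus>\<^bsub>A\<^esub> \<ominus>\<^bsub>A\<^esub> m (Star 2))"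
  proof -
    have "2 \<le> n - 2" "1 \<le> n - 2" "2 < n" using n_ge_4 by auto
    then show ?thesis
      using closed[of 0] closed[of 1] closed[of 2] by (simp add: relation_sum_vertex[OF m] arrows_into_cases scalar_minus_1)
  qed
  show "relation_sum (\<lambda>j. of_bool (j = Suc i)) m = m (Arr i) \<oplus>\<^bsub>A\<^esub> \<ominus>\<^bsub>A\<^esub> m (Star (Suc i))" if "2 \<le> i" "i < n - 2"
  proof -
    have "Suc i < n" "Suc i \<noteq> n - 1" using that by auto
    then show ?thesis
      using that closed[of i] closed[of "Suc i"] by (simp add: relation_sum_vertex[OF m] arrows_into_cases scalar_minus_1)
  qed
  show "relation_sum (\<lambda>j. of_bool (j = n - 1)) m = m (Arr (n - 2))"
  proof -
    have "\<not> n - 1 < 2" "n - 1 \<noteq> 2" "n - 1 < n" using n_ge_4 by auto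
    then show ?thesis
      using closed[of "n - 2"] by (simp add: relation_sum_vertex[OF m] arrows_into_cases)
  qed
qed

text \<open>The required identities are the vanishing in A of the individual relations, read off
  vertex by vertex.\<close>

sublocale D: D_relations "preproj n :: (path \<Rightarrow> 'a) set ring" n "\<lambda>i. arr (Arr i)" "\<lambda>i. arr (Star i)"
proof unfold_locales
  let ?m = "\<lambda>x. arr x \<otimes>\<^bsub>A\<^esub> arr (bar x)"
  have m: "x \<in> arrows n \<Longrightarrow> ?m x \<in> carrier A" for x by simp
  have rel: "\<And>i. i < 2 \<Longrightarrow> \<zero>\<^bsub>A\<^esub> = \<ominus>\<^bsub>A\<^esub> ?m (Star i)"
    "\<zero>\<^bsub>A\<^esub> = ?m (Arr 0) \<oplus>\<^bsub>A\<^esub> (?m (Arr 1) \<oplus>\<^bsub>A\<^esub> \<ominus>\<^bsub>A\<^esub> ?m (Star 2))"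
    "\<And>i. 2 \<le> i \<Longrightarrow> i < n - 2 \<Longrightarrow> \<zero>\<^bsub>A\<^esub> = ?m (Arr i) \<oplus>\<^bsub>A\<^esub> \<ominus>\<^bsub>A\<^esub> ?m (Star (Suc i))"
    "\<zero>\<^bsub>A\<^esub> = ?m (Arr (n - 2))"
    by (rule relation_sum_vertex_cases[of ?m, unfolded relation_sum_proj]; simp)+
  have closed: "?m (Arr i) \<in> carrier A" "?m (Star i) \<in> carrier A" if "i \<le> n - 2" for i
    using m arrow_mem that by auto
  show "n \<ge> 4" by (rule n_ge_4)
  show "arr (Arr i) \<in> carrier A" "arr (Star i) \<in> carrier A" if "i \<le> n - 2" for i
    using that by (auto intro!: arr_closed arrow_mem)
  show "arr (Star i) \<otimes>\<^bsub>A\<^esub> arr (Arr i) = \<zero>\<^bsub>A\<^esub>" if "i < 2" for i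
  proof -
    have "i \<le> n - 2" using that n_ge_4 by linarith
    then have "?m (Star i) = \<ominus>\<^bsub>A\<^esub> (\<ominus>\<^bsub>A\<^esub> ?m (Star i))"
      using closed(2)[of i] by simp
    also have "\<dots> = \<zero>\<^bsub>A\<^esub>"
      unfolding rel(1)[OF that, symmetric] by simp
    finally show ?thesis by simp
  qed
  show "arr (Arr 0) \<otimes>\<^bsub>A\<^esub> arr (Star 0) \<oplus>\<^bsub>A\<^esub> arr (Arr 1) \<otimes>\<^bsub>A\<^esub> arr (Star 1) = arr (Star 2) \<otimes>\<^bsub>A\<^esub> arr (Arr 2)"
  proof -
    have c: "?m (Arr 0) \<in> carrier A" "?m (Arr 1) \<in> carrier A" "?m (Star 2) \<in> carrier A"
      using closed n_ge_4 by auto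
    then have "(?m (Arr 0) \<oplus>\<^bsub>A\<^esub> ?m (Arr 1)) \<ominus>\<^bsub>A\<^esub> ?m (Star 2) = \<zero>\<^bsub>A\<^esub>"
      using rel(2) by (simp only: A.minus_eq A.a_assoc A.a_closed A.a_inv_closed)
    then have "?m (Arr 0) \<oplus>\<^bsub>A\<^esub> ?m (Arr 1) = ?m (Star 2)"
      by (rule A.minus_eq_zeroD[OF _ A.a_closed[OF c(1,2)] c(3)])
    then show ?thesis by simp
  qed
  show "arr (Arr i) \<otimes>\<^bsub>A\<^esub> arr (Star i) = arr (Star (Suc i)) \<otimes>\<^bsub>A\<^esub> arr (Arr (Suc i))" if i: "2 \<le> i" "i < n - 2" for i
  proof -
    have c: "?m (Arr i) \<in> carrier A" "?m (Star (Suc i)) \<in> carrier A"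
      using closed i by auto
    have "?m (Arr i) = ?m (Star (Suc i))"
      by (rule A.minus_eq_zeroD[OF _ c]) (simp only: A.minus_eq rel(3)[OF i, symmetric])
    then show ?thesis by simp
  qed
  show "arr (Arr (n - 2)) \<otimes>\<^bsub>A\<^esub> arr (Star (n - 2)) = \<zero>\<^bsub>A\<^esub>"
    using rel(4) by simp
qed

section \<open>Elements given by their diagonal Peirce components\<close>

definition diag :: "(nat \<Rightarrow> (path \<Rightarrow> 'a) set) \<Rightarrow> (path \<Rightarrow> 'a) set" where
  "diag c = (\<Oplus>\<^bsub>A\<^esub>i\<in>{..<n}. c i)"

abbreviation diagonal :: "(nat \<Rightarrow> (path \<Rightarrow> 'a) set) \<Rightarrow> bool" where
  "diagonal c \<equiv> \<forall>i<n. c i \<in> block i i"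

lemma block_orthogonal:
  assumes "a \<in> block i j" "b \<in> block k l" "j < n" "k < n" "j \<noteq> k"
  shows "a \<otimes>\<^bsub>A\<^esub> b = \<zero>\<^bsub>A\<^esub>"
proof -
  note a = blockD[OF assms(1)] and b = blockD[OF assms(2)]
  have "a \<otimes>\<^bsub>A\<^esub> b = (a \<otimes>\<^bsub>A\<^esub> idem j) \<otimes>\<^bsub>A\<^esub> (idem k \<otimes>\<^bsub>A\<^esub> b)" using a b by simp
  also have "\<dots> = a \<otimes>\<^bsub>A\<^esub> ((idem j \<otimes>\<^bsub>A\<^esub> idem k) \<otimes>\<^bsub>A\<^esub> b)"
    using a(1) b(1) assms by (simp add: A.m_assoc)
  also have "\<dots> = \<zero>\<^bsub>A\<^esub>" using a(1) b(1) assms by (simp add: idem_orthogonal)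
  finally show ?thesis .
qed

lemma diag_closed: "diagonal c \<Longrightarrow> diag c \<in> carrier A"
  unfolding diag_def using blockD(1) by (intro A.finsum_closed) blast

lemma diag_cong: "diagonal d \<Longrightarrow> (\<And>i. i < n \<Longrightarrow> c i = d i) \<Longrightarrow> diag c = diag d"
  unfolding diag_def using blockD(1) by (intro A.finsum_cong') auto

lemma diag_left:
  assumes c: "diagonal c" and a: "a \<in> block i j" "i < n"
  shows "diag c \<otimes>\<^bsub>A\<^esub> a = c i \<otimes>\<^bsub>A\<^esub> a"
proof -
  have closed: "\<And>k. k < n \<Longrightarrow> c k \<in> carrier A" "a \<in> carrier A" using c a blockD(1) by blast+
  have "diag c \<otimes>\<^bsub>A\<^esub> a = (\<Oplus>\<^bsub>A\<^esub>k\<in>{..<n}. c k \<otimes>\<^bsub>A\<^esub> a)"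
    unfolding diag_def using closed by (intro A.finsum_ldistr) auto
  also have "\<dots> = (\<Oplus>\<^bsub>A\<^esub>k\<in>{..<n}. if i = k then c k \<otimes>\<^bsub>A\<^esub> a else \<zero>\<^bsub>A\<^esub>)"
    using closed c a block_orthogonal[of "c _" _ _ a i j] by (intro A.finsum_cong') auto
  also have "\<dots> = c i \<otimes>\<^bsub>A\<^esub> a"
    using A.finsum_singleton[of i "{..<n}" "\<lambda>k. c k \<otimes>\<^bsub>A\<^esub> a"] closed a(2) by simp
  finally show ?thesis .
qed

lemma diag_right:
  assumes c: "diagonal c" and a: "a \<in> block i j" "j < n"
  shows "a \<otimes>\<^bsub>A\<^esub> diag c = a \<otimes>\<^bsub>A\<^esub> c j"
proof -
  have closed: "\<And>k. k < n \<Longrightarrow> c k \<in> carrier A" "a \<in> carrier A" using c a blockD(1) by blast+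
  have "a \<otimes>\<^bsub>A\<^esub> diag c = (\<Oplus>\<^bsub>A\<^esub>k\<in>{..<n}. a \<otimes>\<^bsub>A\<^esub> c k)"
    unfolding diag_def using closed by (intro A.finsum_rdistr) auto
  also have "\<dots> = (\<Oplus>\<^bsub>A\<^esub>k\<in>{..<n}. if j = k then a \<otimes>\<^bsub>A\<^esub> c k else \<zero>\<^bsub>A\<^esub>)"
    using closed c a block_orthogonal[of a i j "c _" _] by (intro A.finsum_cong') auto
  also have "\<dots> = a \<otimes>\<^bsub>A\<^esub> c j"
    using A.finsum_singleton[of j "{..<n}" "\<lambda>k. a \<otimes>\<^bsub>A\<^esub> c k"] closed a(2) by simp
  finally show ?thesis .
qed

lemma diag_mult:
  assumes c: "diagonal c" and d: "diagonal d"
  shows "diag c \<otimes>\<^bsub>A\<^esub> diag d = diag (\<lambda>i. c i \<otimes>\<^bsub>A\<^esub> d i)"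
proof -
  have closed: "\<And>k. k < n \<Longrightarrow> c k \<in> carrier A" "\<And>k. k < n \<Longrightarrow> d k \<in> carrier A" using c d blockD(1) by blast+
  have "diag c \<otimes>\<^bsub>A\<^esub> diag d = (\<Oplus>\<^bsub>A\<^esub>k\<in>{..<n}. c k \<otimes>\<^bsub>A\<^esub> diag d)"
    unfolding diag_def[of c] using closed diag_closed[OF d] by (intro A.finsum_ldistr) auto
  also have "\<dots> = diag (\<lambda>i. c i \<otimes>\<^bsub>A\<^esub> d i)"
    unfolding diag_def[of "\<lambda>i. c i \<otimes>\<^bsub>A\<^esub> d i"]
  proof (intro A.finsum_cong' refl)
    fix k assume "k \<in> {..<n}"
    then show "c k \<otimes>\<^bsub>A\<^esub> diag d = c k \<otimes>\<^bsub>A\<^esub> d k" using c diag_right[OF d, of "c k" k k] by simp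
  qed (use closed in auto)
  finally show ?thesis .
qed

lemma diag_idem: "diag idem = \<one>\<^bsub>A\<^esub>"
proof -
  have "\<one>\<^bsub>P\<^esub> = (\<Oplus>\<^bsub>P\<^esub>i\<in>{..<n}. vertex_elt i)"
  proof
    fix q :: path
    obtain xs s where q: "q = (xs, s)" by fastforce
    have "(\<Oplus>\<^bsub>P\<^esub>i\<in>{..<n}. vertex_elt i) q = (\<Sum>i<n. vertex_elt i q)"
      by (rule finsum_apply) auto
    also have "\<dots> = (\<Sum>i<n. if i = s then of_bool (xs = []) else 0)"
      by (intro sum.cong) (auto simp: q vertex_elt_def)
    also have "\<dots> = \<one>\<^bsub>P\<^esub> q" by (auto simp: q path_algebra_one)
    finally show "\<one>\<^bsub>P\<^esub> q = (\<Oplus>\<^bsub>P\<^esub>i\<in>{..<n}. vertex_elt i) q" ..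
  qed
  then have "proj n \<one>\<^bsub>P\<^esub> = diag idem"
    by (simp add: diag_def proj_finsum)
  then show ?thesis by simp
qed

text \<open>Commutation with every arrow, expressed by the components at its two ends. For families
  in the diagonal Peirce components it yields centrality of the sum.\<close>

definition intertwining :: "(nat \<Rightarrow> (path \<Rightarrow> 'a) set) \<Rightarrow> bool" where
  "intertwining c \<longleftrightarrow> (\<forall>x\<in>arrows n. arr x \<otimes>\<^bsub>A\<^esub> c (arrow_source x) = c (arrow_target x) \<otimes>\<^bsub>A\<^esub> arr x)"

text \<open>Commutation with k is automatic for a diagonal family, and commutation with the arrows
  is \<open>intertwining\<close>.\<close>

lemma diag_central:
  assumes c: "diagonal c" "intertwining c" and a: "a \<in> carrier A"
  shows "diag c \<otimes>\<^bsub>A\<^esub> a = a \<otimes>\<^bsub>A\<^esub> diag c"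
proof -
  note closed = diag_closed[OF c(1)]
  obtain r where r: "r \<in> carrier P" "a = proj n r" using a proj_surj by auto
  from r(1) have "diag c \<otimes>\<^bsub>A\<^esub> proj n r = proj n r \<otimes>\<^bsub>A\<^esub> diag c"
  proof (induction rule: path_algebra_induct)
    case (vertex d i)
    have "scalar d \<otimes>\<^bsub>A\<^esub> idem i \<in> block i i" using vertex by (intro block_scalar idem_block)
    moreover have "proj n (scaled d (vertex_elt i)) = scalar d \<otimes>\<^bsub>A\<^esub> idem i"
      using vertex by (subst scaled_one) (auto simp: scalar_def)
    moreover have "c i \<otimes>\<^bsub>A\<^esub> (scalar d \<otimes>\<^bsub>A\<^esub> idem i) = scalar d \<otimes>\<^bsub>A\<^esub> idem i \<otimes>\<^bsub>A\<^esub> c i"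
      using vertex c(1) blockD[of "c i" i i] by (simp add: scalar_left_commute A.m_assoc)
    ultimately show ?case
      using vertex diag_left[OF c(1)] diag_right[OF c(1)] by simp
  next
    case (arrow x)
    then show ?case
      using diag_left[OF c(1) arr_block] diag_right[OF c(1) arr_block] c(2)
      by (simp add: intertwining_def arrow_source_less arrow_target_less)
  next
    case (add r s)
    then show ?case using closed by (simp add: A.l_distr A.r_distr)
  next
    case (mult r s)
    then have "diag c \<otimes>\<^bsub>A\<^esub> proj n (r \<otimes>\<^bsub>P\<^esub> s) = (proj n r \<otimes>\<^bsub>A\<^esub> diag c) \<otimes>\<^bsub>A\<^esub> proj n s"
      using closed by (simp flip: A.m_assoc)
    also have "\<dots> = proj n r \<otimes>\<^bsub>A\<^esub> (proj n s \<otimes>\<^bsub>A\<^esub> diag c)"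
      using mult closed by (simp add: A.m_assoc)
    finally show ?case using mult closed by (simp add: A.m_assoc)
  qed
  then show ?thesis by (simp add: r)
qed

section \<open>Classes given by values at vertices, arrows and relations, and their products\<close>

definition central_class :: "(nat \<Rightarrow> (path \<Rightarrow> 'a) set) \<Rightarrow> 'a cochain set" where
  "central_class c = hk_class n 0 (cochain0 n (diag c))"

definition arrow_class :: "(arrow \<Rightarrow> (path \<Rightarrow> 'a) set) \<Rightarrow> 'a cochain set" where
  "arrow_class v = hk_class n (Suc 0) (cochain1 n v)"

definition relation_class :: "(nat \<Rightarrow> (path \<Rightarrow> 'a) set) \<Rightarrow> 'a cochain set" where
  "relation_class c = hk_class n 2 (cochain2 n c)"

abbreviation arrow_valued :: "(arrow \<Rightarrow> (path \<Rightarrow> 'a) set) \<Rightarrow> bool" where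
  "arrow_valued v \<equiv> \<forall>x\<in>arrows n. v x \<in> block (arrow_target x) (arrow_source x)"

lemma diag_cocycle:
  assumes "diagonal c" "intertwining c"
  shows "cochain0 n (diag c) \<in> cocycles n 0" "cochain0 n (diag c) \<one>\<^bsub>P\<^esub> = diag c"
  using cochain0_cocycle[of "diag c"] diag_closed diag_central assms by blast+

lemma cochain1_cong: "(\<And>x. x \<in> arrows n \<Longrightarrow> v x = v' x) \<Longrightarrow> cochain1 n v = cochain1 n v'"
  unfolding cochain1_def by (intro arg_cong[of _ _ The] ext) auto

lemma cochain2_cong: "(\<And>i. i < n \<Longrightarrow> c i = c' i) \<Longrightarrow> cochain2 n c = cochain2 n c'"
  unfolding cochain2_def by (intro arg_cong[of _ _ The] ext) auto

lemma diagonal_mult: "diagonal c \<Longrightarrow> diagonal d \<Longrightarrow> diagonal (\<lambda>i. c i \<otimes>\<^bsub>A\<^esub> d i)"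
  using block_mult by blast

lemma intertwining_mult:
  assumes c: "diagonal c" "intertwining c" and d: "diagonal d" "intertwining d"
  shows "intertwining (\<lambda>i. c i \<otimes>\<^bsub>A\<^esub> d i)"
  unfolding intertwining_def
proof
  fix x assume x: "x \<in> arrows n"
  let ?s = "arrow_source x" and ?t = "arrow_target x"
  have closed: "c ?s \<in> carrier A" "c ?t \<in> carrier A" "d ?s \<in> carrier A" "d ?t \<in> carrier A"
    using c(1) d(1) blockD(1) arrow_source_less[OF x] arrow_target_less[OF x] by blast+
  have "arr x \<otimes>\<^bsub>A\<^esub> (c ?s \<otimes>\<^bsub>A\<^esub> d ?s) = (arr x \<otimes>\<^bsub>A\<^esub> c ?s) \<otimes>\<^bsub>A\<^esub> d ?s"
    using closed x by (simp add: A.m_assoc)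
  also have "\<dots> = c ?t \<otimes>\<^bsub>A\<^esub> (arr x \<otimes>\<^bsub>A\<^esub> d ?s)"
    using closed x c(2) by (simp add: A.m_assoc intertwining_def)
  also have "\<dots> = (c ?t \<otimes>\<^bsub>A\<^esub> d ?t) \<otimes>\<^bsub>A\<^esub> arr x"
    using closed x d(2) by (simp add: A.m_assoc intertwining_def)
  finally show "arr x \<otimes>\<^bsub>A\<^esub> (c ?s \<otimes>\<^bsub>A\<^esub> d ?s) = (c ?t \<otimes>\<^bsub>A\<^esub> d ?t) \<otimes>\<^bsub>A\<^esub> arr x" .
qed

lemma cup_central_central:
  assumes c: "diagonal c" "intertwining c" and d: "diagonal d" "intertwining d"
  shows "cup n 0 0 (central_class c) (central_class d) = central_class (\<lambda>i. c i \<otimes>\<^bsub>A\<^esub> d i)"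
proof -
  note f = diag_cocycle[OF c] and g = diag_cocycle[OF d]
  note cd = diag_cocycle[OF diagonal_mult[OF c(1) d(1)] intertwining_mult[OF c d]]
  have "cup_cochain n 0 0 (cochain0 n (diag c)) (cochain0 n (diag d)) = cochain0 n (diag (\<lambda>i. c i \<otimes>\<^bsub>A\<^esub> d i))"
    using cup_cochain_closed[OF f(1) g(1)] cocycles_cochains[OF cd(1)] cd(2)
      cup_cochain_0(1)[OF cochains_bimodule_map cochains_bimodule_map, OF cocycles_cochains[OF f(1)] cocycles_cochains[OF g(1)]]
    by (intro cochain_0_eqI) (simp_all add: f(2) g(2) W0 diag_mult[OF c(1) d(1)])
  then show ?thesis
    using cup_class[OF f(1) g(1)] by (simp add: central_class_def)
qed

text \<open>The value at sigma_i lies in e_i A e_i, so the central factor acts on it through its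
  component at i alone.\<close>

lemma cup_central_relation:
  assumes c: "diagonal c" "intertwining c" and d: "diagonal d"
  shows "cup n 0 2 (central_class c) (relation_class d) = relation_class (\<lambda>i. c i \<otimes>\<^bsub>A\<^esub> d i)"
proof -
  note f = diag_cocycle[OF c]
  note g = cochain2[of d, OF d[rule_format]] and cd = cochain2[of "\<lambda>i. c i \<otimes>\<^bsub>A\<^esub> d i", OF diagonal_mult[OF c(1) d, rule_format]]
  note gz = cocycles_ge_2[OF order_refl g(1)]
  have "cup_cochain n 0 2 (cochain0 n (diag c)) (cochain2 n d) \<in> cochains n 2"
    using cup_cochain_closed[OF f(1) gz] by (simp only: add_0)
  moreover have "diag c \<otimes>\<^bsub>A\<^esub> d i = c i \<otimes>\<^bsub>A\<^esub> d i" if "i < n" for i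
    using that d diag_left[OF c(1), of "d i" i i] by simp
  ultimately have "cup_cochain n 0 2 (cochain0 n (diag c)) (cochain2 n d) = cochain2 n (\<lambda>i. c i \<otimes>\<^bsub>A\<^esub> d i)"
    using cd cup_cochain_0(1)[OF cochains_bimodule_map cochains_bimodule_map, OF cocycles_cochains[OF f(1)] g(1)]
    by (intro cochain_2_eqI) (simp_all add: f(2) g(2) sigma_W2)
  then show ?thesis
    using cup_class[OF f(1) gz] unfolding central_class_def relation_class_def by (simp only: add_0)
qed

text \<open>The value on an arrow begins at the target on its left, so the central factor acts
  through its component there.\<close>

lemma cup_central_arrow:
  assumes c: "diagonal c" "intertwining c" and v: "arrow_valued v" "cochain1 n v \<in> cocycles n (Suc 0)"
  shows "cup n 0 (Suc 0) (central_class c) (arrow_class v) = arrow_class (\<lambda>x. c (arrow_target x) \<otimes>\<^bsub>A\<^esub> v x)"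
proof -
  note f = diag_cocycle[OF c]
  note g = cochain1[of v, OF v(1)[rule_format]]
  have "c (arrow_target x) \<otimes>\<^bsub>A\<^esub> v x \<in> block (arrow_target x) (arrow_source x)" if "x \<in> arrows n" for x
    using that c(1) v(1) arrow_source_less[OF that] arrow_target_less[OF that] by (intro block_mult) auto
  note cd = cochain1[of "\<lambda>x. c (arrow_target x) \<otimes>\<^bsub>A\<^esub> v x", OF this]
  moreover have "diag c \<otimes>\<^bsub>A\<^esub> v x = c (arrow_target x) \<otimes>\<^bsub>A\<^esub> v x" if "x \<in> arrows n" for x
    using that v(1) diag_left[OF c(1), of "v x" "arrow_target x" "arrow_source x"] arrow_target_less by simp
  ultimately have "cup_cochain n 0 (Suc 0) (cochain0 n (diag c)) (cochain1 n v) = cochain1 n (\<lambda>x. c (arrow_target x) \<otimes>\<^bsub>A\<^esub> v x)"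
    using cup_cochain_closed[OF f(1) v(2)] cd
      cup_cochain_0(1)[OF cochains_bimodule_map cochains_bimodule_map, OF cocycles_cochains[OF f(1)] g(1)]
    by (intro cochain_1_eqI) (simp_all add: f(2) g(2) bimodule_map_1_closed)
  then show ?thesis
    using cup_class[OF f(1) v(2)] by (simp add: central_class_def arrow_class_def)
qed

lemma relation_class_eqI:
  assumes c: "diagonal c" "diagonal d" and u: "arrow_valued u"
    and eq: "\<And>i. i < n \<Longrightarrow> c i = relation_sum (\<lambda>j. of_bool (j = i))
      (\<lambda>x. u x \<otimes>\<^bsub>A\<^esub> arr (bar x) \<oplus>\<^bsub>A\<^esub> arr x \<otimes>\<^bsub>A\<^esub> u (bar x)) \<oplus>\<^bsub>A\<^esub> d i"
  shows "relation_class c = relation_class d"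
proof -
  note f = cochain2[of c, OF c(1)[rule_format]] and g = cochain2[of d, OF c(2)[rule_format]] and h = cochain1[of u, OF u[rule_format]]
  let ?h = "koszul_diff n (Suc 0) (cochain1 n u)"
  have uc: "x \<in> arrows n \<Longrightarrow> u x \<in> carrier A" for x using u blockD(1) by blast
  have "cochain1 n u \<in> cochains n (Suc 0)" using h(1) by simp
  note u_map = cochains_bimodule_map[OF this]
  have b: "?h \<in> coboundaries n 2" using h(1) by (simp add: numeral_2_eq_2)
  have hc: "?h \<in> cochains n 2" using koszul_diff_closed[OF h(1)] by (simp add: numeral_2_eq_2)
  interpret G: comm_group "CG 2" by (rule CG_comm_group)
  have sum: "?h \<otimes>\<^bsub>CG 2\<^esub> cochain2 n d \<in> cochains n 2"
    using hc g(1) G.m_closed by (simp add: CG_carrier)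
  have "cochain2 n c \<in> cochains n 2" using f(1) by simp
  then have "cochain2 n c = ?h \<otimes>\<^bsub>CG 2\<^esub> cochain2 n d"
  proof (rule cochain_2_eqI[OF _ sum])
    fix i assume i: "i < n"
    have "?h (sigma n i) = relation_sum (\<lambda>j. of_bool (j = i)) (\<lambda>x. u x \<otimes>\<^bsub>A\<^esub> arr (bar x) \<oplus>\<^bsub>A\<^esub> arr x \<otimes>\<^bsub>A\<^esub> u (bar x))"
      unfolding sigma_relation_fun[OF i] koszul_diff_1[OF u_map]
      using h(2) uc by (intro relation_sum_cong) auto
    then show "cochain2 n c (sigma n i) = (?h \<otimes>\<^bsub>CG 2\<^esub> cochain2 n d) (sigma n i)"
      using i eq[OF i] by (simp add: f(2) g(2) CG_mult sigma_W2)
  qed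
  then show ?thesis
    using hk_class_add_coboundary[OF b g(1)] by (simp add: relation_class_def)
qed

lemma relation_class_zero: "relation_class (\<lambda>i. \<zero>\<^bsub>A\<^esub>) = \<one>\<^bsub>HK n 2\<^esub>"
proof -
  have z: "diagonal (\<lambda>i. \<zero>\<^bsub>A\<^esub>)" by simp
  note f = cochain2[of "\<lambda>i. \<zero>\<^bsub>A\<^esub>", OF z[rule_format]]
  have "\<one>\<^bsub>CG 2\<^esub> \<in> cochains n 2"
    using group.is_monoid[OF CG_group, THEN monoid.one_closed] by (simp only: CG_carrier)
  then have "cochain2 n (\<lambda>i. \<zero>\<^bsub>A\<^esub>) = \<one>\<^bsub>CG 2\<^esub>"
    using f by (intro cochain_2_eqI) (auto simp: CG_one sigma_W2)
  then show ?thesis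
    unfolding relation_class_def
    using hk_class_one_iff[of "\<one>\<^bsub>CG 2\<^esub>" 2] subgroup.one_closed[OF coboundaries_subgroup_cochains]
      subgroup.one_closed[OF cocycles_subgroup] by metis
qed

lemma arrow_class_zero: "arrow_class (\<lambda>x. \<zero>\<^bsub>A\<^esub>) = \<one>\<^bsub>HK n (Suc 0)\<^esub>"
proof -
  have z: "arrow_valued (\<lambda>x. \<zero>\<^bsub>A\<^esub>)" by (simp add: arrow_source_less arrow_target_less)
  note f = cochain1[of "\<lambda>x. \<zero>\<^bsub>A\<^esub>", OF z[rule_format]]
  have "\<one>\<^bsub>CG (Suc 0)\<^esub> \<in> cochains n (Suc 0)"
    using group.is_monoid[OF CG_group, THEN monoid.one_closed] by (simp only: CG_carrier)
  then have "cochain1 n (\<lambda>x. \<zero>\<^bsub>A\<^esub>) = \<one>\<^bsub>CG (Suc 0)\<^esub>"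
    using f by (intro cochain_1_eqI) (auto simp: CG_one bimodule_map_1_closed)
  then show ?thesis
    unfolding arrow_class_def
    using hk_class_one_iff[of "\<one>\<^bsub>CG (Suc 0)\<^esub>" "Suc 0"] subgroup.one_closed[OF coboundaries_subgroup_cochains]
      subgroup.one_closed[OF cocycles_subgroup] by metis
qed

lemma central_class_zero: "central_class (\<lambda>i. \<zero>\<^bsub>A\<^esub>) = \<one>\<^bsub>HK n 0\<^esub>"
proof -
  have z: "diagonal (\<lambda>i. \<zero>\<^bsub>A\<^esub>)" "intertwining (\<lambda>i. \<zero>\<^bsub>A\<^esub>)" by (simp_all add: intertwining_def)
  have "\<one>\<^bsub>CG 0\<^esub> \<in> cochains n 0"
    using group.is_monoid[OF CG_group, THEN monoid.one_closed] by (simp only: CG_carrier)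
  then have "cochain0 n (diag (\<lambda>i. \<zero>\<^bsub>A\<^esub>)) = \<one>\<^bsub>CG 0\<^esub>"
    using diag_cocycle[OF z] cocycles_cochains by (intro cochain_0_eqI) (auto simp: CG_one W0 diag_def)
  then show ?thesis
    unfolding central_class_def
    using hk_class_one_iff[of "\<one>\<^bsub>CG 0\<^esub>" 0] subgroup.one_closed[OF coboundaries_subgroup_cochains]
      subgroup.one_closed[OF cocycles_subgroup] by metis
qed

end

section \<open>The distinguished elements\<close>

context type_D begin

lemma arr_low: "i < 2 \<Longrightarrow> arr (Arr i) \<in> block 2 i" "i < 2 \<Longrightarrow> arr (Star i) \<in> block i 2"
proof -
  assume "i < 2"
  moreover from this have "i \<le> n - 2" using n_ge_4 by linarith
  ultimately show "arr (Arr i) \<in> block 2 i" "arr (Star i) \<in> block i 2"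
    using arr_block[OF arrow_mem(1)] arr_block[OF arrow_mem(2)] by fastforce+
qed

lemma arr_high: "2 \<le> i \<Longrightarrow> i \<le> n - 2 \<Longrightarrow> arr (Arr i) \<in> block (Suc i) i"
  "2 \<le> i \<Longrightarrow> i \<le> n - 2 \<Longrightarrow> arr (Star i) \<in> block i (Suc i)"
  using arr_block[OF arrow_mem(1), of i] arr_block[OF arrow_mem(2), of i] by simp_all

lemma small_less [simp]: "2 < n" "i < 2 \<Longrightarrow> i < n"
  using n_ge_4 by auto

lemma y_block: "2 \<le> i \<Longrightarrow> i < n \<Longrightarrow> D.y i \<in> block i i"
  unfolding D.y_def by (auto intro: block_mult[OF _ _ arr_high(2) arr_high(1)])

lemma p_block: "i < 2 \<Longrightarrow> D.p i \<in> block 2 2"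
  unfolding D.p_def by (rule block_mult[OF _ _ arr_low]) auto

lemma g_block: "i < 2 \<Longrightarrow> D.g i \<in> block i i"
  unfolding D.g_def by (intro block_mult[OF _ _ arr_low(2) block_mult[OF _ _ p_block arr_low(1)]]) auto

lemma pow_block_left:
  assumes "a \<in> block i i" "b \<in> block i j" "i < n" "j < n" shows "a [^]\<^bsub>A\<^esub> (k::nat) \<otimes>\<^bsub>A\<^esub> b \<in> block i j"
proof (induction k)
  case (Suc k)
  have "a [^]\<^bsub>A\<^esub> Suc k \<otimes>\<^bsub>A\<^esub> b = a \<otimes>\<^bsub>A\<^esub> (a [^]\<^bsub>A\<^esub> k \<otimes>\<^bsub>A\<^esub> b)"
    using assms(1,2) blockD(1) A.nat_pow_Suc2[of a k] by (metis A.m_assoc A.nat_pow_closed)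
  then show ?case using Suc assms block_mult by metis
qed (use assms blockD in auto)

lemma pow_block_right:
  assumes "a \<in> block j j" "b \<in> block i j" "i < n" "j < n" shows "b \<otimes>\<^bsub>A\<^esub> a [^]\<^bsub>A\<^esub> (k::nat) \<in> block i j"
proof (induction k)
  case (Suc k)
  have "b \<otimes>\<^bsub>A\<^esub> a [^]\<^bsub>A\<^esub> Suc k = (b \<otimes>\<^bsub>A\<^esub> a [^]\<^bsub>A\<^esub> k) \<otimes>\<^bsub>A\<^esub> a"
    using assms(1,2) blockD(1) by (simp add: A.m_assoc)
  then show ?case using Suc assms block_mult by metis
qed (use assms blockD in auto)

lemma pow_block: "a \<in> block i i \<Longrightarrow> i < n \<Longrightarrow> k > 0 \<Longrightarrow> a [^]\<^bsub>A\<^esub> (k::nat) \<in> block i i"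
  using pow_block_left[of a i a i "k - 1"] by (cases k) auto

lemma up_block: "k \<le> n - 3 \<Longrightarrow> w \<in> block 2 j \<Longrightarrow> j < n \<Longrightarrow> D.up k \<otimes>\<^bsub>A\<^esub> w \<in> block (2 + k) j"
proof (induction k)
  case 0
  then show ?case using blockD(1)[of w 2 j] by simp
next
  case (Suc k)
  then have k: "2 + k \<le> n - 2" "k \<le> n - 3" by auto
  have "D.up (Suc k) \<otimes>\<^bsub>A\<^esub> w = arr (Arr (2 + k)) \<otimes>\<^bsub>A\<^esub> (D.up k \<otimes>\<^bsub>A\<^esub> w)"
    using k D.a_closed[of "2 + k"] blockD(1)[OF Suc.prems(2)] by (simp add: A.m_assoc)
  moreover have "\<dots> \<in> block (2 + Suc k) j"
    using block_mult[OF _ _ arr_high(1)[of "2 + k"] Suc.IH] k Suc.prems by simp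
  ultimately show ?case by simp
qed

lemma down_block: "k \<le> n - 3 \<Longrightarrow> w \<in> block i 2 \<Longrightarrow> i < n \<Longrightarrow> w \<otimes>\<^bsub>A\<^esub> D.down k \<in> block i (2 + k)"
proof (induction k)
  case 0
  then show ?case using blockD(1)[of w i 2] by simp
next
  case (Suc k)
  then have k: "2 + k \<le> n - 2" "k \<le> n - 3" by auto
  have "w \<otimes>\<^bsub>A\<^esub> D.down (Suc k) = (w \<otimes>\<^bsub>A\<^esub> D.down k) \<otimes>\<^bsub>A\<^esub> arr (Star (2 + k))"
    using k D.b_closed[of "2 + k"] blockD(1)[OF Suc.prems(2)] by (simp add: A.m_assoc)
  moreover have "\<dots> \<in> block i (2 + Suc k)"
    using block_mult[OF _ _ Suc.IH arr_high(2)[of "2 + k"]] k Suc.prems by simp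
  ultimately show ?case by simp
qed

lemma middle_block: "k \<le> n - 3 \<Longrightarrow> D.y 2 [^]\<^bsub>A\<^esub> (j::nat) \<otimes>\<^bsub>A\<^esub> (D.p 1 \<otimes>\<^bsub>A\<^esub> D.down k) \<in> block 2 (2 + k)"
  using n_ge_4 by (intro pow_block_left y_block down_block p_block) auto

lemma socle_block: "k \<le> n - 3 \<Longrightarrow> D.socle k \<in> block (2 + k) (2 + k)"
  unfolding D.socle_def using n_ge_4 by (intro up_block middle_block) auto

lemma link_block: "Suc k \<le> n - 3 \<Longrightarrow> D.link k \<in> block (Suc (2 + k)) (2 + k)"
  unfolding D.link_def using n_ge_4 up_block[OF _ middle_block, of "Suc k" k "n - 4 - k"] by simp

lemma y2_pow_a_block: "i < 2 \<Longrightarrow> D.y 2 [^]\<^bsub>A\<^esub> (k::nat) \<otimes>\<^bsub>A\<^esub> arr (Arr i) \<in> block 2 i"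
  by (intro pow_block_left y_block arr_low) auto

lemma b_y2_pow_block: "i < 2 \<Longrightarrow> arr (Star i) \<otimes>\<^bsub>A\<^esub> D.y 2 [^]\<^bsub>A\<^esub> (k::nat) \<in> block i 2"
  by (intro pow_block_right y_block arr_low) auto

lemma a_y_pow_block: "2 \<le> i \<Longrightarrow> i \<le> n - 2 \<Longrightarrow> arr (Arr i) \<otimes>\<^bsub>A\<^esub> D.y i [^]\<^bsub>A\<^esub> (k::nat) \<in> block (Suc i) i"
  by (intro pow_block_right y_block arr_high) auto

lemma socle_low_block: "i < 2 \<Longrightarrow> D.socle_low i \<in> block i i"
  unfolding D.socle_low_def by (intro block_mult[OF _ _ arr_low(2) y2_pow_a_block]) auto

text \<open>The components of z_l. The case l = 0 is separate because a zeroth power would be the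
  unit of A and not e_i.\<close>

definition z_val :: "nat \<Rightarrow> nat \<Rightarrow> (path \<Rightarrow> 'a) set" where
  "z_val l i = (if l = 0 then idem i else if i < 2 then D.g i [^]\<^bsub>A\<^esub> l else D.y i [^]\<^bsub>A\<^esub> (2 * l))"

definition pi_val :: "nat \<Rightarrow> (path \<Rightarrow> 'a) set" where
  "pi_val i = (if i = 0 then \<ominus>\<^bsub>A\<^esub> D.socle_low 0 else if i = 1 then D.socle_low 1 else D.socle (i - 2))"

abbreviation single :: "nat \<Rightarrow> (path \<Rightarrow> 'a) set \<Rightarrow> nat \<Rightarrow> (path \<Rightarrow> 'a) set" where
  "single i v \<equiv> (\<lambda>j. if j = i then v else \<zero>\<^bsub>A\<^esub>)"

lemma z_val_diagonal: "diagonal (z_val l)"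
  using pow_block[OF g_block] pow_block[OF y_block] idem_block by (auto simp: z_val_def)

lemma pi_val_block: "i < n \<Longrightarrow> pi_val i \<in> block i i"
proof -
  assume i: "i < n"
  consider "i = 0" | "i = 1" | "i \<ge> 2" by linarith
  then show ?thesis
  proof cases
    case 3
    then obtain k where k: "i = 2 + k" using le_Suc_ex by blast
    then have "k \<le> n - 3" using i by linarith
    then show ?thesis using socle_block[of k] by (simp add: pi_val_def k)
  qed (use i block_minus[OF _ _ socle_low_block] socle_low_block[of 1] in \<open>auto simp: pi_val_def\<close>)
qed

lemma single_diagonal: "i < n \<Longrightarrow> v \<in> block i i \<Longrightarrow> diagonal (single i v)"
  by auto

lemma arrow_cases:
  assumes "x \<in> arrows n"
  obtains i where "i < 2" "x = Arr i" | i where "i < 2" "x = Star i"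
  | i where "2 \<le> i" "i \<le> n - 2" "x = Arr i" | i where "2 \<le> i" "i \<le> n - 2" "x = Star i"
  using assms unfolding arrows_def by (auto simp: not_less[symmetric]) (metis not_less)+

text \<open>Even powers of y_2 pass the short branches as powers of g_i, and the y_i pass along the
  long branch.\<close>

lemma z_val_intertwining: "intertwining (z_val l)"
  unfolding intertwining_def
proof
  fix x assume x: "x \<in> arrows n"
  show "arr x \<otimes>\<^bsub>A\<^esub> z_val l (arrow_source x) = z_val l (arrow_target x) \<otimes>\<^bsub>A\<^esub> arr x"
  proof (cases "l = 0")
    case True
    then show ?thesis using blockD[OF arr_block[OF x]] by (simp add: z_val_def)
  next
    case False
    from x show ?thesis
      by (cases rule: arrow_cases)
        (use False in \<open>simp_all add: z_val_def D.y2_pow_a D.b_y2_pow D.a_y_pow D.b_y_pow\<close>)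
  qed
qed

text \<open>Since arrows annihilate it on both sides, each pi_i is central and its products with
  anything beginning or ending in an arrow vanish.\<close>

lemma arr_pi_val:
  assumes x: "x \<in> arrows n"
  shows "arr x \<otimes>\<^bsub>A\<^esub> pi_val (arrow_source x) = \<zero>\<^bsub>A\<^esub>" "pi_val (arrow_target x) \<otimes>\<^bsub>A\<^esub> arr x = \<zero>\<^bsub>A\<^esub>"
proof -
  have low: "i = 0 \<or> i = 1" if "i < 2" for i :: nat using that by linarith
  have high: "\<exists>k. i = 2 + k \<and> k \<le> n - 4" if "2 \<le> i" "i \<le> n - 2" for i
    using that by (intro exI[of _ "i - 2"]) auto
  have closed: "arr x \<in> carrier A" using x by simp
  have c0: "D.socle_low 0 \<in> carrier A" by simp
  have k: "k \<le> n - 4 \<Longrightarrow> Suc k \<le> n - 3" for k using n_ge_4 by linarith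
  from x show "arr x \<otimes>\<^bsub>A\<^esub> pi_val (arrow_source x) = \<zero>\<^bsub>A\<^esub>"
  proof (cases rule: arrow_cases)
    case (1 i)
    then show ?thesis
      using low[of i] closed c0 D.a_socle_low[of 0] D.a_socle_low[of 1] by (auto simp: pi_val_def A.r_minus)
  next
    case (2 i)
    then show ?thesis using D.b_socle_0[of i] by (simp add: pi_val_def)
  next
    case (3 i)
    then show ?thesis using high[of i] D.a_socle by (auto simp: pi_val_def)
  next
    case (4 i)
    then obtain j where "i = 2 + j" "j \<le> n - 4" using high by blast
    then show ?thesis using 4 D.b_socle[OF k] by (simp add: pi_val_def)
  qed
  from x show "pi_val (arrow_target x) \<otimes>\<^bsub>A\<^esub> arr x = \<zero>\<^bsub>A\<^esub>"
  proof (cases rule: arrow_cases)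
    case (1 i)
    then show ?thesis using D.socle_0_a[of i] by (simp add: pi_val_def)
  next
    case (2 i)
    then show ?thesis
      using low[of i] closed c0 D.socle_low_b[of 0] D.socle_low_b[of 1] by (auto simp: pi_val_def A.l_minus)
  next
    case (3 i)
    then obtain j where "i = 2 + j" "j \<le> n - 4" using high by blast
    then show ?thesis using 3 D.socle_a[OF k] by (simp add: pi_val_def)
  next
    case (4 i)
    then show ?thesis using high[of i] D.socle_b by (auto simp: pi_val_def)
  qed
qed

lemma single_pi_intertwining: "intertwining (single i (pi_val i))"
  unfolding intertwining_def
proof
  fix x assume x: "x \<in> arrows n"
  have "arr x \<otimes>\<^bsub>A\<^esub> single i (pi_val i) (arrow_source x) = \<zero>\<^bsub>A\<^esub>"
    using x arr_pi_val(1)[OF x] by (cases "arrow_source x = i") auto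
  moreover have "single i (pi_val i) (arrow_target x) \<otimes>\<^bsub>A\<^esub> arr x = \<zero>\<^bsub>A\<^esub>"
    using x arr_pi_val(2)[OF x] by (cases "arrow_target x = i") auto
  ultimately show "arr x \<otimes>\<^bsub>A\<^esub> single i (pi_val i) (arrow_source x) = single i (pi_val i) (arrow_target x) \<otimes>\<^bsub>A\<^esub> arr x"
    by simp
qed

section \<open>The distinguished elements of A in terms of their Peirce components\<close>

lemma word_Nil: "word n [] = \<one>\<^bsub>A\<^esub>" and word_Cons: "word n (x # xs) = arr x \<otimes>\<^bsub>A\<^esub> word n xs"
  by (simp_all add: word_def)

lemma word_closed: "set xs \<subseteq> arrows n \<Longrightarrow> word n xs \<in> carrier A"
  by (induction xs) (auto simp: word_Nil word_Cons)

lemma word_append: "set xs \<subseteq> arrows n \<Longrightarrow> set ys \<subseteq> arrows n \<Longrightarrow> word n (xs @ ys) = word n xs \<otimes>\<^bsub>A\<^esub> word n ys"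
  by (induction xs) (auto simp: word_Nil word_Cons word_closed A.m_assoc)

lemma word_y: "i \<le> n - 2 \<Longrightarrow> word n [Star i, Arr i] = D.y i"
  by (simp add: word_Nil word_Cons D.y_def D.a_closed)

lemma word_g: "word n [Star 0, Arr 1, Star 1, Arr 0] = D.g 0" "word n [Star 1, Arr 0, Star 0, Arr 1] = D.g 1"
  using D.low_closed[of 0] D.low_closed[of 1] by (simp_all add: word_Nil word_Cons D.g_def D.p_def A.m_assoc)

lemma word_up: "k \<le> n - 3 \<Longrightarrow> word n (map Arr (rev [2..<2 + k])) = D.up k"
  by (induction k) (simp_all add: word_Nil word_Cons)

lemma word_down: "k \<le> n - 3 \<Longrightarrow> word n (map Star [2..<2 + k]) = D.down k"
proof (induction k)
  case (Suc k)
  have "set (map Star [2..<2 + k]) \<subseteq> arrows n" "Star (2 + k) \<in> arrows n"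
    using Suc.prems by (auto simp: arrows_def)
  then show ?case
    using Suc word_append[of "map Star [2..<2 + k]" "[Star (2 + k)]"] by (simp add: word_Nil word_Cons)
qed (simp add: word_Nil)

lemma z_elt_eq: "z_elt n l = diag (z_val l)"
proof (cases "l = 0")
  case True
  then show ?thesis using diag_idem by (simp add: z_elt_def z_val_def[abs_def])
next
  case False
  have set: "{..<n} = insert 0 (insert 1 (insert (n - 1) {2..n - 2}))"
    using n_ge_4 by auto
  have c: "z_val l i \<in> carrier A" if "i < n" for i using z_val_diagonal blockD(1) that by blast
  \<comment> \<open>The sum defining z_l stops at vertex n - 2; the component at the last vertex may
    be added because it is zero.\<close>
  have zero: "z_val l (n - 1) = \<zero>\<^bsub>A\<^esub>"
  proof -
    have "\<not> n - 1 < 2" "2 \<le> n - 1" "n - 1 < n" "n - (n - 1) \<le> 2 * l" using False n_ge_4 by linarith+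
    then show ?thesis using False D.y_nilpotent_ge[of "n - 1" "2 * l"] by (simp only: z_val_def if_False)
  qed
  have S: "(\<Oplus>\<^bsub>A\<^esub>i\<in>{2..n - 2}. z_val l i) \<in> carrier A"
    using c n_ge_4 by (intro A.finsum_closed) auto
  let ?S = "{2..n - 2}"
  have insert: "(\<Oplus>\<^bsub>A\<^esub>i\<in>insert j T. z_val l i) = z_val l j \<oplus>\<^bsub>A\<^esub> (\<Oplus>\<^bsub>A\<^esub>i\<in>T. z_val l i)"
    if "finite T" "j \<notin> T" "insert j T \<subseteq> {..<n}" for j T
    using that c by (intro A.finsum_insert) auto
  have "diag (z_val l) = z_val l 0 \<oplus>\<^bsub>A\<^esub> (z_val l 1 \<oplus>\<^bsub>A\<^esub> (z_val l (n - 1) \<oplus>\<^bsub>A\<^esub> (\<Oplus>\<^bsub>A\<^esub>i\<in>{2..n - 2}. z_val l i)))"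
    unfolding diag_def set using n_ge_4
    by (subst insert, simp, force, force, subst insert, simp, force, force, subst insert, simp, force, force) (rule refl)
  also have "\<dots> = z_val l 0 \<oplus>\<^bsub>A\<^esub> z_val l 1 \<oplus>\<^bsub>A\<^esub> (\<Oplus>\<^bsub>A\<^esub>i\<in>{2..n - 2}. z_val l i)"
    unfolding zero using S c[of 0] c[of 1] n_ge_4 by (simp add: A.a_assoc)
  also have "(\<Oplus>\<^bsub>A\<^esub>i\<in>{2..n - 2}. z_val l i) = (\<Oplus>\<^bsub>A\<^esub>i\<in>{2..n - 2}. word n [Star i, Arr i] [^]\<^bsub>A\<^esub> (2 * l))"
    using False by (intro A.finsum_cong') (auto simp: z_val_def word_y)
  also have "z_val l 0 \<oplus>\<^bsub>A\<^esub> z_val l 1 \<oplus>\<^bsub>A\<^esub> \<dots> = z_elt n l"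
    using False by (simp add: z_elt_def z_val_def word_g[simplified])
  finally show ?thesis ..
qed

lemma pi_elt_eq:
  assumes i: "i < n" shows "pi_elt n i = pi_val i"
proof -
  have n3: "2 + (n - 3) = n - 1" using n_ge_4 by linarith
  have "\<exists>k. i = 2 + k \<and> k \<le> n - 3" if "\<not> i < 2"
    using that i by (intro exI[of _ "i - 2"]) auto
  then consider "i < 2" | k where "i = 2 + k" "k \<le> n - 3" by blast
  then show ?thesis
  proof cases
    case 1
    have mem: "Star i \<in> arrows n" "Arr i \<in> arrows n" "set (map Star [2..<n - 1]) \<subseteq> arrows n" "set (map Arr (rev [2..<n - 1])) \<subseteq> arrows n"
      using 1 n_ge_4 by (auto simp: arrows_def)
    have "word n ([Star i] @ map Star [2..<n - 1] @ map Arr (rev [2..<n - 1]) @ [Arr i]) =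
        arr (Star i) \<otimes>\<^bsub>A\<^esub> (D.down (n - 3) \<otimes>\<^bsub>A\<^esub> (D.up (n - 3) \<otimes>\<^bsub>A\<^esub> arr (Arr i)))"
      using mem word_up[of "n - 3", unfolded n3] word_down[of "n - 3", unfolded n3]
      by (simp add: word_append word_Nil word_Cons del: One_nat_def)
    \<comment> \<open>The way up and down the whole long branch collapses to y_2^{n-3}.\<close>
    also have "\<dots> = D.socle_low i"
      using 1 D.down_up[of "n - 3"] by (simp add: D.socle_low_def flip: A.m_assoc)
    finally have w: "word n ([Star i] @ map Star [2..<n - 1] @ map Arr (rev [2..<n - 1]) @ [Arr i]) = D.socle_low i" .
    have pi: "pi_elt n i = (if i = 0 then \<ominus>\<^bsub>A\<^esub> D.socle_low i else D.socle_low i)"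
      using 1 unfolding pi_elt_def Let_def w by (rule if_P)
    show ?thesis
    proof (cases "i = 0")
      case True
      show ?thesis unfolding pi pi_val_def unfolding True if_P[OF refl] by (rule refl)
    next
      case False
      then have i: "i = 1" using 1 by linarith
      show ?thesis unfolding pi pi_val_def if_not_P[OF False] if_P[OF i] unfolding i by (rule refl)
    qed
  next
    case 2
    \<comment> \<open>Besides the long branch the word runs through a_1 and a_1^*, and these two
      letters form p_1 in the middle.\<close>
    have up: "[1..<2 + k] = 1 # [2..<2 + k]" by (simp add: upt_conv_Cons numeral_2_eq_2)
    have mem: "Star 1 \<in> arrows n" "Arr 1 \<in> arrows n" "set (map Star [2..<2 + k]) \<subseteq> arrows n" "set (map Arr (rev [2..<2 + k])) \<subseteq> arrows n"
      using 2 n_ge_4 by (auto simp: arrows_def)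
    have w: "word n (map Arr (rev [1..<2 + k]) @ map Star [1..<2 + k]) = D.up k \<otimes>\<^bsub>A\<^esub> (D.p 1 \<otimes>\<^bsub>A\<^esub> D.down k)"
      unfolding up using mem word_up[OF 2(2)] word_down[OF 2(2)] 2(2) D.low_closed[of 1]
      by (simp add: word_append word_Nil word_Cons D.p_def A.m_assoc)
    have w': "word n (map Arr (rev [1..<i]) @ map Star [1..<i]) = D.up k \<otimes>\<^bsub>A\<^esub> (D.p 1 \<otimes>\<^bsub>A\<^esub> D.down k)"
      unfolding 2(1) by (rule w)
    have low: "\<not> i < 2" using 2 by simp
    have pi: "pi_val i = D.y i [^]\<^bsub>A\<^esub> (n - 3 - k) \<otimes>\<^bsub>A\<^esub> (D.up k \<otimes>\<^bsub>A\<^esub> (D.p 1 \<otimes>\<^bsub>A\<^esub> D.down k))"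
      unfolding 2(1) D.socle_y[OF 2(2), symmetric] pi_val_def by simp
    show ?thesis
    proof (cases "i = n - 1")
      case True
      \<comment> \<open>At the last vertex the definition has no power in front, in agreement with
        the exponent 0 of the general formula.\<close>
      then have k: "n - 3 - k = 0" using 2 by linarith
      have top: "\<not> i < n - 1" using True by simp
      have e: "pi_elt n i = word n (map Arr (rev [1..<n - 1]) @ map Star [1..<n - 1])"
        unfolding pi_elt_def if_not_P[OF low] if_not_P[OF top] by (rule refl)
      show ?thesis
        unfolding e True[symmetric] w' pi k using 2(2) by simp
    next
      case False
      then have i': "i \<le> n - 2" "i < n - 1" "n - i - 1 = n - 3 - k" using i 2 by linarith+
      show ?thesis
        unfolding pi_elt_def if_not_P[OF low] if_P[OF i'(2)] word_y[OF i'(1)] w' pi i'(3) by (rule refl)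
    qed
  qed
qed

lemma diag_single: "i < n \<Longrightarrow> v \<in> block i i \<Longrightarrow> diag (single i v) = v"
  using A.finsum_singleton[of i "{..<n}" "\<lambda>_. v"] blockD(1)[of v i i] by (simp add: diag_def eq_commute)

definition zeta_val :: "nat \<Rightarrow> arrow \<Rightarrow> (path \<Rightarrow> 'a) set" where
  "zeta_val l x = (case x of Arr i \<Rightarrow> arr x \<otimes>\<^bsub>A\<^esub> z_val l i | Star i \<Rightarrow> \<zero>\<^bsub>A\<^esub>)"

lemma zeta_val_block: "arrow_valued (zeta_val l)"
proof
  fix x assume x: "x \<in> arrows n"
  show "zeta_val l x \<in> block (arrow_target x) (arrow_source x)"
  proof (cases x)
    case (Arr i)
    have "i < n" using arrow_source_less[OF x] by (simp add: Arr)
    then have "arr x \<otimes>\<^bsub>A\<^esub> z_val l i \<in> block (arrow_target x) i"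
      using arr_block[OF x] arrow_target_less[OF x] z_val_diagonal[of l]
      by (intro block_mult[of _ _ _ i]) (auto simp: Arr)
    then show ?thesis by (simp add: zeta_val_def Arr)
  next
    case (Star i)
    then show ?thesis using arrow_source_less[OF x] arrow_target_less[OF x] by (simp add: zeta_val_def)
  qed
qed

lemma hk_elt_Z: "hk_elt n (Z l) = central_class (z_val l)"
  by (simp add: central_class_def z_elt_eq)

lemma hk_elt_Pi: "i < n \<Longrightarrow> hk_elt n (Pi i) = central_class (single i (pi_val i))"
  by (simp add: central_class_def pi_elt_eq diag_single pi_val_block)

lemma zeta_eq: "zeta n l = cochain1 n (zeta_val l)"
  unfolding zeta_def
proof (rule cochain1_cong)
  fix x assume x: "x \<in> arrows n"
  show "(case x of Arr i \<Rightarrow> word n [Arr i] \<otimes>\<^bsub>A\<^esub> z_elt n l | Star i \<Rightarrow> \<zero>\<^bsub>A\<^esub>) = zeta_val l x"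
  proof (cases x)
    case (Arr i)
    have "arr x \<otimes>\<^bsub>A\<^esub> diag (z_val l) = arr x \<otimes>\<^bsub>A\<^esub> z_val l i"
      using diag_right[OF z_val_diagonal arr_block[OF x]] arrow_source_less[OF x] by (simp add: Arr)
    then show ?thesis using x by (simp add: zeta_val_def Arr word_Nil word_Cons z_elt_eq)
  qed (simp add: zeta_val_def)
qed

lemma hk_elt_Zeta: "hk_elt n (Zeta l) = arrow_class (zeta_val l)"
  by (simp add: arrow_class_def zeta_eq)

lemma hk_elt_H: "hk_elt n (H j) = relation_class (single j (idem j))"
  by (simp add: relation_class_def eta_def)

lemma hk_elt_Gamma: "hk_elt n (Gamma l) = relation_class (single 0 (D.g 0 [^]\<^bsub>A\<^esub> l))"
  unfolding relation_class_def hk_elt.simps gamma_def word_g by (rule refl)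

lemma zeta_val_mult: "x \<in> arrows n \<Longrightarrow> z_val l (arrow_target x) \<otimes>\<^bsub>A\<^esub> arr x = arr x \<otimes>\<^bsub>A\<^esub> z_val l (arrow_source x)"
  using z_val_intertwining[of l] by (simp add: intertwining_def)

text \<open>Exactly one of x and bar(x) is an unstarred arrow, so one Leibniz term vanishes and the
  other is z_l x bar(x). The differential is therefore z_l times the image of a relation, which is
  0.\<close>

lemma zeta_cocycle: "cochain1 n (zeta_val l) \<in> cocycles n (Suc 0)"
proof -
  note zeta = cochain1[of "zeta_val l", OF zeta_val_block[rule_format]]
  have f: "cochain1 n (zeta_val l) \<in> cochains n (Suc 0)" using zeta(1) by simp
  have z: "\<And>i. i < n \<Longrightarrow> z_val l i \<in> carrier A" "diag (z_val l) \<in> carrier A"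
    using z_val_diagonal blockD(1) diag_closed by blast+
  have v: "zeta_val l x \<otimes>\<^bsub>A\<^esub> arr (bar x) \<oplus>\<^bsub>A\<^esub> arr x \<otimes>\<^bsub>A\<^esub> zeta_val l (bar x) = diag (z_val l) \<otimes>\<^bsub>A\<^esub> (arr x \<otimes>\<^bsub>A\<^esub> arr (bar x))"
    if x: "x \<in> arrows n" for x
  proof -
    have b: "arr (bar x) \<in> carrier A" "arr x \<in> carrier A" using x by auto
    note z' = z(1)[OF arrow_source_less[OF x]] z(1)[OF arrow_target_less[OF x]]
    have "diag (z_val l) \<otimes>\<^bsub>A\<^esub> (arr x \<otimes>\<^bsub>A\<^esub> arr (bar x)) = (z_val l (arrow_target x) \<otimes>\<^bsub>A\<^esub> arr x) \<otimes>\<^bsub>A\<^esub> arr (bar x)"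
      using b z diag_left[OF z_val_diagonal arr_block[OF x]] arrow_target_less[OF x] by (simp flip: A.m_assoc)
    moreover have "(z_val l (arrow_target x) \<otimes>\<^bsub>A\<^esub> arr x) \<otimes>\<^bsub>A\<^esub> arr (bar x) = zeta_val l x \<otimes>\<^bsub>A\<^esub> arr (bar x) \<oplus>\<^bsub>A\<^esub> arr x \<otimes>\<^bsub>A\<^esub> zeta_val l (bar x)"
    proof (cases x)
      case (Arr i)
      then show ?thesis using b z' zeta_val_mult[OF x, of l] by (simp add: zeta_val_def)
    next
      case (Star i)
      have "(z_val l (arrow_target x) \<otimes>\<^bsub>A\<^esub> arr x) \<otimes>\<^bsub>A\<^esub> arr (bar x) = arr x \<otimes>\<^bsub>A\<^esub> (z_val l (arrow_target (bar x)) \<otimes>\<^bsub>A\<^esub> arr (bar x))"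
        using b z' zeta_val_mult[OF x, of l] by (simp add: A.m_assoc)
      also have "\<dots> = arr x \<otimes>\<^bsub>A\<^esub> (arr (bar x) \<otimes>\<^bsub>A\<^esub> z_val l (arrow_target x))"
        using zeta_val_mult[of "bar x" l] x by simp
      finally have e: "(z_val l (arrow_target x) \<otimes>\<^bsub>A\<^esub> arr x) \<otimes>\<^bsub>A\<^esub> arr (bar x) =
          arr x \<otimes>\<^bsub>A\<^esub> (arr (bar x) \<otimes>\<^bsub>A\<^esub> z_val l (arrow_target x))" .
      have "zeta_val l x = \<zero>\<^bsub>A\<^esub>" "zeta_val l (bar x) = arr (bar x) \<otimes>\<^bsub>A\<^esub> z_val l (arrow_target x)"
        by (simp_all add: zeta_val_def Star)
      then show ?thesis unfolding e using b z' by simp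
    qed
    ultimately show ?thesis by simp
  qed
  have "relation_sum c (\<lambda>x. cochain1 n (zeta_val l) (arrow_elt x) \<otimes>\<^bsub>A\<^esub> arr (bar x) \<oplus>\<^bsub>A\<^esub>
      arr x \<otimes>\<^bsub>A\<^esub> cochain1 n (zeta_val l) (arrow_elt (bar x))) = \<zero>\<^bsub>A\<^esub>" for c
  proof -
    have "relation_sum c (\<lambda>x. cochain1 n (zeta_val l) (arrow_elt x) \<otimes>\<^bsub>A\<^esub> arr (bar x) \<oplus>\<^bsub>A\<^esub>
        arr x \<otimes>\<^bsub>A\<^esub> cochain1 n (zeta_val l) (arrow_elt (bar x))) =
        relation_sum c (\<lambda>x. diag (z_val l) \<otimes>\<^bsub>A\<^esub> (arr x \<otimes>\<^bsub>A\<^esub> arr (bar x)))"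
      using zeta(2) v z(2) by (intro relation_sum_cong) auto
    also have "\<dots> = diag (z_val l) \<otimes>\<^bsub>A\<^esub> relation_sum c (\<lambda>x. arr x \<otimes>\<^bsub>A\<^esub> arr (bar x))"
      using z(2) by (intro relation_sum_map[symmetric]) (auto simp: A.r_distr scalar_left_commute)
    also have "\<dots> = \<zero>\<^bsub>A\<^esub>" using z(2) by (simp add: relation_sum_proj)
    finally show ?thesis .
  qed
  then show ?thesis using cocycle_1_iff[OF f] by blast
qed

end

section \<open>Coboundaries of degree two\<close>

context type_D begin

text \<open>The form in which coboundaries are exhibited below: \<open>M i\<close> and
  \<open>N i\<close> are the contributions of a_i a_i^* and a_i^* a_i to the differential of u, and
  the last four hypotheses compare values at the sigma_i.\<close>

lemma relation_class_cases_eqI: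
  assumes c: "diagonal c" and d: "diagonal d" and u: "arrow_valued u"
    and M: "\<And>i. i \<le> n - 2 \<Longrightarrow> u (Arr i) \<otimes>\<^bsub>A\<^esub> arr (Star i) \<oplus>\<^bsub>A\<^esub> arr (Arr i) \<otimes>\<^bsub>A\<^esub> u (Star i) = M i"
    and N: "\<And>i. i \<le> n - 2 \<Longrightarrow> u (Star i) \<otimes>\<^bsub>A\<^esub> arr (Arr i) \<oplus>\<^bsub>A\<^esub> arr (Star i) \<otimes>\<^bsub>A\<^esub> u (Arr i) = N i"
    and low: "\<And>i. i < 2 \<Longrightarrow> c i = \<ominus>\<^bsub>A\<^esub> N i \<oplus>\<^bsub>A\<^esub> d i"
    and two: "c 2 = M 0 \<oplus>\<^bsub>A\<^esub> (M 1 \<oplus>\<^bsub>A\<^esub> \<ominus>\<^bsub>A\<^esub> N 2) \<oplus>\<^bsub>A\<^esub> d 2"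
    and mid: "\<And>i. 2 \<le> i \<Longrightarrow> i < n - 2 \<Longrightarrow> c (Suc i) = M i \<oplus>\<^bsub>A\<^esub> \<ominus>\<^bsub>A\<^esub> N (Suc i) \<oplus>\<^bsub>A\<^esub> d (Suc i)"
    and top: "c (n - 1) = M (n - 2) \<oplus>\<^bsub>A\<^esub> d (n - 1)"
  shows "relation_class c = relation_class d"
proof (rule relation_class_eqI[OF c d u])
  let ?m = "\<lambda>x. u x \<otimes>\<^bsub>A\<^esub> arr (bar x) \<oplus>\<^bsub>A\<^esub> arr x \<otimes>\<^bsub>A\<^esub> u (bar x)"
  have uc: "u x \<in> carrier A" if "x \<in> arrows n" for x using u blockD(1) that by blast
  have m: "?m x \<in> carrier A" if "x \<in> arrows n" for x
    using uc that by (intro A.a_closed A.m_closed arr_closed) simp_all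
  note S = relation_sum_vertex_cases[of ?m, OF m]
  fix i assume "i < n"
  then consider "i < 2" | "i = 2" | k where "i = Suc k" "2 \<le> k" "k < n - 2" | "i = n - 1"
    by (cases i) (auto, linarith)
  then show "c i = relation_sum (\<lambda>j. of_bool (j = i)) ?m \<oplus>\<^bsub>A\<^esub> d i"
  proof cases
    case 1
    then have "i \<le> n - 2" using n_ge_4 by linarith
    then show ?thesis using low[OF 1] N[of i] S(1)[of i] 1 by simp
  next
    case 2
    have "2 \<le> n - 2" "1 \<le> n - 2" "0 \<le> n - 2" using n_ge_4 by linarith+
    then have "relation_sum (\<lambda>j. of_bool (j = 2)) ?m = M 0 \<oplus>\<^bsub>A\<^esub> (M 1 \<oplus>\<^bsub>A\<^esub> \<ominus>\<^bsub>A\<^esub> N 2)"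
      using S(2) by (simp only: bar.simps M N)
    then show ?thesis unfolding 2 two by simp
  next
    case 3
    then have "relation_sum (\<lambda>j. of_bool (j = Suc k)) ?m = M k \<oplus>\<^bsub>A\<^esub> \<ominus>\<^bsub>A\<^esub> N (Suc k)"
      using S(3)[of k] M[of k] N[of "Suc k"] by simp
    then show ?thesis unfolding 3(1) mid[OF 3(2,3)] by simp
  next
    case 4
    have "relation_sum (\<lambda>j. of_bool (j = n - 1)) ?m = M (n - 2)"
      using S(4) M[of "n - 2"] by (simp only: bar.simps order_refl)
    then show ?thesis unfolding 4 top by simp
  qed
qed

lemma a_y_b: "2 \<le> i \<Longrightarrow> i \<le> n - 2 \<Longrightarrow> arr (Arr i) \<otimes>\<^bsub>A\<^esub> D.y i [^]\<^bsub>A\<^esub> (k::nat) \<otimes>\<^bsub>A\<^esub> arr (Star i) = D.y (Suc i) [^]\<^bsub>A\<^esub> Suc k"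
  using D.a_y_pow[of i k] D.ab[of i] D.a_closed[of i] D.b_closed[of i] by (simp add: A.m_assoc)

lemma b_a_y: "2 \<le> i \<Longrightarrow> i \<le> n - 2 \<Longrightarrow> arr (Star i) \<otimes>\<^bsub>A\<^esub> (arr (Arr i) \<otimes>\<^bsub>A\<^esub> D.y i [^]\<^bsub>A\<^esub> (k::nat)) = D.y i [^]\<^bsub>A\<^esub> Suc k"
  using A.nat_pow_Suc2[OF D.y_closed, of i k] D.a_closed[of i] D.b_closed[of i] by (simp add: D.y_def[of i] A.m_assoc)

lemma arrow_valuedI:
  assumes "\<And>i. i < 2 \<Longrightarrow> u (Arr i) \<in> block 2 i" "\<And>i. i < 2 \<Longrightarrow> u (Star i) \<in> block i 2"
    "\<And>i. 2 \<le> i \<Longrightarrow> i \<le> n - 2 \<Longrightarrow> u (Arr i) \<in> block (Suc i) i" "\<And>i. 2 \<le> i \<Longrightarrow> i \<le> n - 2 \<Longrightarrow> u (Star i) \<in> block i (Suc i)"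
  shows "arrow_valued u"
proof
  fix x assume "x \<in> arrows n"
  then show "u x \<in> block (arrow_target x) (arrow_source x)"
    by (cases rule: arrow_cases) (use assms in simp_all)
qed

text \<open>A telescoping cochain along the long branch: the power of y_j is pushed from vertex to
  vertex up to the last one, where y vanishes.\<close>

lemma relation_class_y:
  assumes j: "2 \<le> j" "j < n" and k: "k > 0"
  shows "relation_class (single j (D.y j [^]\<^bsub>A\<^esub> (k::nat))) = \<one>\<^bsub>HK n 2\<^esub>"
proof -
  obtain l where l: "k = Suc l" using k by (cases k) auto
  \<comment> \<open>Starting the nonzero values at the arrow a_j leaves y_j^k uncancelled at vertex
    j alone. The exponent \<open>l\<close> is k - 1, since the differential adds one factor
    y.\<close>
  define u where "u = case_arrow (\<lambda>i. if j \<le> i then \<ominus>\<^bsub>A\<^esub> (arr (Arr i) \<otimes>\<^bsub>A\<^esub> D.y i [^]\<^bsub>A\<^esub> l) else \<zero>\<^bsub>A\<^esub>) (\<lambda>i. \<zero>\<^bsub>A\<^esub>)"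
  have u: "u (Arr i) = (if j \<le> i then \<ominus>\<^bsub>A\<^esub> (arr (Arr i) \<otimes>\<^bsub>A\<^esub> D.y i [^]\<^bsub>A\<^esub> l) else \<zero>\<^bsub>A\<^esub>)" "u (Star i) = \<zero>\<^bsub>A\<^esub>" for i
    by (simp_all add: u_def)
  have "relation_class (single j (D.y j [^]\<^bsub>A\<^esub> k)) = relation_class (\<lambda>i. \<zero>\<^bsub>A\<^esub>)"
  proof (rule relation_class_cases_eqI[where u = u
        and M = "\<lambda>i. if j \<le> i then \<ominus>\<^bsub>A\<^esub> (D.y (Suc i) [^]\<^bsub>A\<^esub> k) else \<zero>\<^bsub>A\<^esub>" and N = "\<lambda>i. if j \<le> i then \<ominus>\<^bsub>A\<^esub> (D.y i [^]\<^bsub>A\<^esub> k) else \<zero>\<^bsub>A\<^esub>"])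
    show "diagonal (single j (D.y j [^]\<^bsub>A\<^esub> k))" using j k pow_block[OF y_block] by auto
    show "diagonal (\<lambda>i. \<zero>\<^bsub>A\<^esub>)" by simp
    show "arrow_valued u"
      by (rule arrow_valuedI) (use j a_y_pow_block in \<open>auto simp: u intro!: block_minus\<close>)
    fix i
    show "u (Arr i) \<otimes>\<^bsub>A\<^esub> arr (Star i) \<oplus>\<^bsub>A\<^esub> arr (Arr i) \<otimes>\<^bsub>A\<^esub> u (Star i) = (if j \<le> i then \<ominus>\<^bsub>A\<^esub> (D.y (Suc i) [^]\<^bsub>A\<^esub> k) else \<zero>\<^bsub>A\<^esub>)"
      if "i \<le> n - 2"
      using j a_y_b[of i l] D.a_closed[OF that] D.b_closed[OF that] by (simp add: u l A.l_minus that)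
    show "u (Star i) \<otimes>\<^bsub>A\<^esub> arr (Arr i) \<oplus>\<^bsub>A\<^esub> arr (Star i) \<otimes>\<^bsub>A\<^esub> u (Arr i) = (if j \<le> i then \<ominus>\<^bsub>A\<^esub> (D.y i [^]\<^bsub>A\<^esub> k) else \<zero>\<^bsub>A\<^esub>)"
      if "i \<le> n - 2"
      using j b_a_y[of i l] D.a_closed[OF that] D.b_closed[OF that] by (simp add: u l A.r_minus that)
  next
    have zero: "D.y (n - 1) [^]\<^bsub>A\<^esub> k = \<zero>\<^bsub>A\<^esub>" "Suc (n - 2) = n - 1"
    proof -
      have "2 \<le> n - 1" "n - 1 < n" "n - (n - 1) \<le> k" using k n_ge_4 by linarith+
      then show "D.y (n - 1) [^]\<^bsub>A\<^esub> k = \<zero>\<^bsub>A\<^esub>" by (rule D.y_nilpotent_ge)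
      show "Suc (n - 2) = n - 1" using n_ge_4 by linarith
    qed
    show "single j (D.y j [^]\<^bsub>A\<^esub> k) (n - 1) = (if j \<le> n - 2 then \<ominus>\<^bsub>A\<^esub> (D.y (Suc (n - 2)) [^]\<^bsub>A\<^esub> k) else \<zero>\<^bsub>A\<^esub>) \<oplus>\<^bsub>A\<^esub> \<zero>\<^bsub>A\<^esub>"
      unfolding zero using zero(1) by (cases "j = n - 1") simp_all
  qed (use j in \<open>auto simp: A.l_neg\<close>)
  then show ?thesis by (simp add: relation_class_zero)
qed

text \<open>The values on a_0^* and a_1 produce powers of g_0 and g_1 at the short ends with
  opposite signs; at vertex 2 their contributions cancel because an odd power of y_2 exchanges p_0
  and p_1.\<close>

lemma relation_class_g_swap:
  "relation_class (single 0 (D.g 0 [^]\<^bsub>A\<^esub> Suc l)) = relation_class (single 1 (D.g 1 [^]\<^bsub>A\<^esub> Suc l))"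
proof -
  let ?k = "2 * l + 1"
  let ?Y = "D.y 2 [^]\<^bsub>A\<^esub> ?k"
  define u where "u = case_arrow (\<lambda>i. if i = 1 then ?Y \<otimes>\<^bsub>A\<^esub> arr (Arr 1) else \<zero>\<^bsub>A\<^esub>)
      (\<lambda>i. if i = 0 then \<ominus>\<^bsub>A\<^esub> (arr (Star 0) \<otimes>\<^bsub>A\<^esub> ?Y) else \<zero>\<^bsub>A\<^esub>)"
  have u: "u (Arr i) = (if i = 1 then ?Y \<otimes>\<^bsub>A\<^esub> arr (Arr 1) else \<zero>\<^bsub>A\<^esub>)"
      "u (Star i) = (if i = 0 then \<ominus>\<^bsub>A\<^esub> (arr (Star 0) \<otimes>\<^bsub>A\<^esub> ?Y) else \<zero>\<^bsub>A\<^esub>)" for i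
    by (simp_all add: u_def)
  note low = D.low_closed[of 0] D.low_closed[of 1]
  \<comment> \<open>Here the oddness of the exponent 2l + 1 is used.\<close>
  have swap: "?Y \<otimes>\<^bsub>A\<^esub> D.p 1 = D.p 0 \<otimes>\<^bsub>A\<^esub> ?Y" using D.y2_pow_p[of 1 ?k] by (simp add: D.swap_def)
  have g: "arr (Star i) \<otimes>\<^bsub>A\<^esub> (?Y \<otimes>\<^bsub>A\<^esub> arr (Arr i)) = D.g i [^]\<^bsub>A\<^esub> Suc l" if "i < 2" for i
    using D.b_y2_a_odd[OF that, of l] .
  let ?M = "\<lambda>i::nat. if i = 0 then \<ominus>\<^bsub>A\<^esub> (D.p 0 \<otimes>\<^bsub>A\<^esub> ?Y) else if i = 1 then D.p 0 \<otimes>\<^bsub>A\<^esub> ?Y else \<zero>\<^bsub>A\<^esub>"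
  let ?N = "\<lambda>i::nat. if i = 0 then \<ominus>\<^bsub>A\<^esub> (D.g 0 [^]\<^bsub>A\<^esub> Suc l) else if i = 1 then D.g 1 [^]\<^bsub>A\<^esub> Suc l else \<zero>\<^bsub>A\<^esub>"
  have gc: "D.g i [^]\<^bsub>A\<^esub> Suc l \<in> carrier A" if "i < 2" for i using that by (intro A.nat_pow_closed D.g_closed)
  show ?thesis
  proof (rule relation_class_cases_eqI[where u = u and M = ?M and N = ?N])
    show "diagonal (single 0 (D.g 0 [^]\<^bsub>A\<^esub> Suc l))" "diagonal (single 1 (D.g 1 [^]\<^bsub>A\<^esub> Suc l))"
      using pow_block[OF g_block, of 0 "Suc l"] pow_block[OF g_block, of 1 "Suc l"] by auto
    show "arrow_valued u"
      by (rule arrow_valuedI) (use y2_pow_a_block[of 1 ?k] b_y2_pow_block[of 0 ?k] in \<open>auto simp: u intro!: block_minus\<close>)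
    fix i assume i: "i \<le> n - 2"
    note ab = D.a_closed[OF i] D.b_closed[OF i]
    show "u (Arr i) \<otimes>\<^bsub>A\<^esub> arr (Star i) \<oplus>\<^bsub>A\<^esub> arr (Arr i) \<otimes>\<^bsub>A\<^esub> u (Star i) = ?M i"
    proof -
      consider "i = 0" | "i = 1" | "i \<ge> 2" by linarith
      then show ?thesis
      proof cases
        case 1
        have "arr (Arr 0) \<otimes>\<^bsub>A\<^esub> (arr (Star 0) \<otimes>\<^bsub>A\<^esub> ?Y) = D.p 0 \<otimes>\<^bsub>A\<^esub> ?Y"
          using low by (simp add: D.p_def A.m_assoc)
        then show ?thesis unfolding 1 u using low by (simp add: A.r_minus)
      next
        case 2
        have "?Y \<otimes>\<^bsub>A\<^esub> arr (Arr 1) \<otimes>\<^bsub>A\<^esub> arr (Star 1) = D.p 0 \<otimes>\<^bsub>A\<^esub> ?Y"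
          using low unfolding swap[symmetric] by (simp add: D.p_def A.m_assoc)
        then show ?thesis unfolding 2 u using low by simp
      qed (use ab in \<open>auto simp: u\<close>)
    qed
    show "u (Star i) \<otimes>\<^bsub>A\<^esub> arr (Arr i) \<oplus>\<^bsub>A\<^esub> arr (Star i) \<otimes>\<^bsub>A\<^esub> u (Arr i) = ?N i"
    proof -
      consider "i = 0" | "i = 1" | "i \<ge> 2" by linarith
      then show ?thesis
      proof cases
        case 1
        have "(arr (Star 0) \<otimes>\<^bsub>A\<^esub> ?Y) \<otimes>\<^bsub>A\<^esub> arr (Arr 0) = D.g 0 [^]\<^bsub>A\<^esub> Suc l"
          using low g[of 0] A.m_assoc[of "arr (Star 0)" ?Y "arr (Arr 0)"] by simp
        then show ?thesis unfolding 1 u using low gc[of 0] by (simp add: A.l_minus)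
      next
        case 2
        then show ?thesis using low g[of 1] gc[of 1] by (simp add: u)
      qed (use ab in \<open>auto simp: u\<close>)
    qed
  next
    fix i :: nat assume "i < 2"
    then show "single 0 (D.g 0 [^]\<^bsub>A\<^esub> Suc l) i = \<ominus>\<^bsub>A\<^esub> ?N i \<oplus>\<^bsub>A\<^esub> single 1 (D.g 1 [^]\<^bsub>A\<^esub> Suc l) i"
      using gc[of 0] gc[of 1] less_2_cases[of i] by (auto simp: A.l_neg simp del: A.nat_pow_Suc)
  next
    have "D.p 0 \<otimes>\<^bsub>A\<^esub> ?Y \<in> carrier A" by simp
    then show "single 0 (D.g 0 [^]\<^bsub>A\<^esub> Suc l) 2 = ?M 0 \<oplus>\<^bsub>A\<^esub> (?M 1 \<oplus>\<^bsub>A\<^esub> \<ominus>\<^bsub>A\<^esub> ?N 2) \<oplus>\<^bsub>A\<^esub> single 1 (D.g 1 [^]\<^bsub>A\<^esub> Suc l) 2"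
      by (simp add: A.l_neg del: A.nat_pow_Suc)
  qed (use n_ge_4 in auto)
qed

text \<open>With equal values on a_i and a_i^* the differential contributes the power of g_i twice
  at vertex i. At vertex 2 it contributes p_i and p_{1-i} times an odd power of y_2, which add up to
  a power of y_2 alone and can be pushed to the end of the long branch.\<close>

lemma relation_class_g:
  assumes two: "(2::'a) \<noteq> 0" and i: "i < 2"
  shows "relation_class (single i (scalar s \<otimes>\<^bsub>A\<^esub> D.g i [^]\<^bsub>A\<^esub> Suc l)) = \<one>\<^bsub>HK n 2\<^esub>"
proof -
  \<comment> \<open>The two equal contributions at vertex i enter sigma_i with a minus sign, which
    leads to 2t = -s; this is where 2 has to be invertible.\<close>
  define t where "t = - s / 2"
  have st: "2 * t = - s" using two by (simp add: t_def)
  define k where "k = 2 * l + 1"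
  let ?Y = "D.y 2 [^]\<^bsub>A\<^esub> k"
  define u where "u = case_arrow
      (\<lambda>j. if j = i then scalar t \<otimes>\<^bsub>A\<^esub> (?Y \<otimes>\<^bsub>A\<^esub> arr (Arr i)) else if j < 2 then \<zero>\<^bsub>A\<^esub> else scalar t \<otimes>\<^bsub>A\<^esub> (arr (Arr j) \<otimes>\<^bsub>A\<^esub> D.y j [^]\<^bsub>A\<^esub> k))
      (\<lambda>j. if j = i then scalar t \<otimes>\<^bsub>A\<^esub> (arr (Star i) \<otimes>\<^bsub>A\<^esub> ?Y) else \<zero>\<^bsub>A\<^esub>)"
  have u: "u (Arr j) = (if j = i then scalar t \<otimes>\<^bsub>A\<^esub> (?Y \<otimes>\<^bsub>A\<^esub> arr (Arr i)) else if j < 2 then \<zero>\<^bsub>A\<^esub> else scalar t \<otimes>\<^bsub>A\<^esub> (arr (Arr j) \<otimes>\<^bsub>A\<^esub> D.y j [^]\<^bsub>A\<^esub> k))"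
    "u (Star j) = (if j = i then scalar t \<otimes>\<^bsub>A\<^esub> (arr (Star i) \<otimes>\<^bsub>A\<^esub> ?Y) else \<zero>\<^bsub>A\<^esub>)" for j
    by (simp_all add: u_def)
  define M where "M = (\<lambda>j. if j = i then scalar t \<otimes>\<^bsub>A\<^esub> D.y 2 [^]\<^bsub>A\<^esub> Suc k else if j < 2 then \<zero>\<^bsub>A\<^esub> else scalar t \<otimes>\<^bsub>A\<^esub> D.y (Suc j) [^]\<^bsub>A\<^esub> Suc k)"
  define N where "N = (\<lambda>j. if j = i then \<ominus>\<^bsub>A\<^esub> (scalar s \<otimes>\<^bsub>A\<^esub> D.g i [^]\<^bsub>A\<^esub> Suc l) else if j < 2 then \<zero>\<^bsub>A\<^esub> else scalar t \<otimes>\<^bsub>A\<^esub> D.y j [^]\<^bsub>A\<^esub> Suc k)"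
  have low: "arr (Arr i) \<in> carrier A" "arr (Star i) \<in> carrier A" using D.low_closed[OF i] by simp_all
  have p: "D.p i \<in> carrier A" "D.p (1 - i) \<in> carrier A" using i by simp_all
  have Y: "?Y \<in> carrier A" "D.y j [^]\<^bsub>A\<^esub> (r::nat) \<in> carrier A" for j r by simp_all
  have g: "D.g i [^]\<^bsub>A\<^esub> Suc l \<in> carrier A" using i by (intro A.nat_pow_closed D.g_closed)
  have bYa: "arr (Star i) \<otimes>\<^bsub>A\<^esub> (?Y \<otimes>\<^bsub>A\<^esub> arr (Arr i)) = D.g i [^]\<^bsub>A\<^esub> Suc l"
    unfolding k_def by (rule D.b_y2_a_odd[OF i])
  have swap: "?Y \<otimes>\<^bsub>A\<^esub> D.p i = D.p (1 - i) \<otimes>\<^bsub>A\<^esub> ?Y"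
    using D.y2_pow_p[OF i, of k] by (simp add: D.swap_def k_def)
  have "relation_class (single i (scalar s \<otimes>\<^bsub>A\<^esub> D.g i [^]\<^bsub>A\<^esub> Suc l)) = relation_class (\<lambda>i. \<zero>\<^bsub>A\<^esub>)"
  proof (rule relation_class_cases_eqI[where u = u and M = M and N = N])
    show "diagonal (single i (scalar s \<otimes>\<^bsub>A\<^esub> D.g i [^]\<^bsub>A\<^esub> Suc l))"
      using i pow_block[OF g_block[OF i], of "Suc l"]
      by (intro single_diagonal block_scalar) (simp_all del: A.nat_pow_Suc)
    show "diagonal (\<lambda>i. \<zero>\<^bsub>A\<^esub>)" by simp
    show "arrow_valued u"
      by (rule arrow_valuedI)
        (use i y2_pow_a_block[OF i, of k] b_y2_pow_block[OF i, of k] a_y_pow_block[of _ k] in \<open>auto simp: u intro!: block_scalar\<close>)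
    fix j assume j: "j \<le> n - 2"
    note ab = D.a_closed[OF j] D.b_closed[OF j]
    consider "j = i" | "j < 2" "j \<noteq> i" | "2 \<le> j" "j \<noteq> i" using i by linarith
    note cases = this
    from cases show "u (Arr j) \<otimes>\<^bsub>A\<^esub> arr (Star j) \<oplus>\<^bsub>A\<^esub> arr (Arr j) \<otimes>\<^bsub>A\<^esub> u (Star j) = M j"
    proof cases
      case 1
      have "scalar t \<otimes>\<^bsub>A\<^esub> (?Y \<otimes>\<^bsub>A\<^esub> arr (Arr i)) \<otimes>\<^bsub>A\<^esub> arr (Star i) = scalar t \<otimes>\<^bsub>A\<^esub> (D.p (1 - i) \<otimes>\<^bsub>A\<^esub> ?Y)"
        unfolding swap[symmetric] using low Y(1) by (simp add: D.p_def A.m_assoc)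
      moreover have "arr (Arr i) \<otimes>\<^bsub>A\<^esub> (scalar t \<otimes>\<^bsub>A\<^esub> (arr (Star i) \<otimes>\<^bsub>A\<^esub> ?Y)) = scalar t \<otimes>\<^bsub>A\<^esub> (D.p i \<otimes>\<^bsub>A\<^esub> ?Y)"
        using low Y(1) scalar_left_commute[of "arr (Arr i)" "arr (Star i) \<otimes>\<^bsub>A\<^esub> ?Y" t] by (simp add: D.p_def A.m_assoc)
      moreover have "scalar t \<otimes>\<^bsub>A\<^esub> (D.p (1 - i) \<otimes>\<^bsub>A\<^esub> ?Y) \<oplus>\<^bsub>A\<^esub> scalar t \<otimes>\<^bsub>A\<^esub> (D.p i \<otimes>\<^bsub>A\<^esub> ?Y) = scalar t \<otimes>\<^bsub>A\<^esub> D.y 2 [^]\<^bsub>A\<^esub> Suc k"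
      proof -
        have "D.y 2 [^]\<^bsub>A\<^esub> Suc k = (D.p i \<oplus>\<^bsub>A\<^esub> D.p (1 - i)) \<otimes>\<^bsub>A\<^esub> ?Y"
          using A.nat_pow_Suc2[OF D.y_closed, of 2 k] unfolding D.y2[OF i, symmetric] .
        then have "D.y 2 [^]\<^bsub>A\<^esub> Suc k = D.p (1 - i) \<otimes>\<^bsub>A\<^esub> ?Y \<oplus>\<^bsub>A\<^esub> D.p i \<otimes>\<^bsub>A\<^esub> ?Y"
          using A.l_distr[OF p Y(1)] A.a_comm[OF A.m_closed[OF p(1) Y(1)] A.m_closed[OF p(2) Y(1)]] by (simp only:)
        then show ?thesis
          using A.r_distr[OF A.m_closed[OF p(2) Y(1)] A.m_closed[OF p(1) Y(1)] scalar_closed[of t]] by (simp only:)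
      qed
      ultimately show ?thesis by (simp add: u M_def 1 del: A.nat_pow_Suc)
    next
      case 2
      then show ?thesis using ab by (simp add: u M_def)
    next
      case 3
      then have "arr (Arr j) \<otimes>\<^bsub>A\<^esub> D.y j [^]\<^bsub>A\<^esub> k \<otimes>\<^bsub>A\<^esub> arr (Star j) = D.y (Suc j) [^]\<^bsub>A\<^esub> Suc k"
        using a_y_b[of j k] j by simp
      then show ?thesis using 3 ab Y(2) by (simp add: u M_def A.m_assoc del: A.nat_pow_Suc)
    qed
    from cases show "u (Star j) \<otimes>\<^bsub>A\<^esub> arr (Arr j) \<oplus>\<^bsub>A\<^esub> arr (Star j) \<otimes>\<^bsub>A\<^esub> u (Arr j) = N j"
    proof cases
      case 1
      have "scalar t \<otimes>\<^bsub>A\<^esub> (arr (Star i) \<otimes>\<^bsub>A\<^esub> ?Y) \<otimes>\<^bsub>A\<^esub> arr (Arr i) = scalar t \<otimes>\<^bsub>A\<^esub> D.g i [^]\<^bsub>A\<^esub> Suc l"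
        unfolding bYa[symmetric] using low Y(1) by (simp add: A.m_assoc)
      moreover have "arr (Star i) \<otimes>\<^bsub>A\<^esub> (scalar t \<otimes>\<^bsub>A\<^esub> (?Y \<otimes>\<^bsub>A\<^esub> arr (Arr i))) = scalar t \<otimes>\<^bsub>A\<^esub> D.g i [^]\<^bsub>A\<^esub> Suc l"
        unfolding bYa[symmetric] using low Y(1) by (simp add: scalar_left_commute)
      moreover have "scalar t \<otimes>\<^bsub>A\<^esub> D.g i [^]\<^bsub>A\<^esub> Suc l \<oplus>\<^bsub>A\<^esub> scalar t \<otimes>\<^bsub>A\<^esub> D.g i [^]\<^bsub>A\<^esub> Suc l =
          scalar (2 * t) \<otimes>\<^bsub>A\<^esub> D.g i [^]\<^bsub>A\<^esub> Suc l"
        unfolding mult_2 scalar_add[symmetric] by (rule A.l_distr[OF scalar_closed scalar_closed g, symmetric])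
      moreover have "scalar (2 * t) \<otimes>\<^bsub>A\<^esub> D.g i [^]\<^bsub>A\<^esub> Suc l = \<ominus>\<^bsub>A\<^esub> (scalar s \<otimes>\<^bsub>A\<^esub> D.g i [^]\<^bsub>A\<^esub> Suc l)"
        unfolding st scalar_minus using g by (simp add: A.l_minus del: A.nat_pow_Suc)
      ultimately show ?thesis by (simp add: u N_def 1 del: A.nat_pow_Suc)
    next
      case 2
      then show ?thesis using ab by (simp add: u N_def)
    next
      case 3
      then have "arr (Star j) \<otimes>\<^bsub>A\<^esub> (arr (Arr j) \<otimes>\<^bsub>A\<^esub> D.y j [^]\<^bsub>A\<^esub> k) = D.y j [^]\<^bsub>A\<^esub> Suc k"
        using b_a_y[of j k] j by simp
      then show ?thesis using 3 ab Y(2) by (simp add: u N_def scalar_left_commute del: A.nat_pow_Suc)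
    qed
  next
    fix j :: nat assume "j < 2"
    then show "single i (scalar s \<otimes>\<^bsub>A\<^esub> D.g i [^]\<^bsub>A\<^esub> Suc l) j = \<ominus>\<^bsub>A\<^esub> N j \<oplus>\<^bsub>A\<^esub> \<zero>\<^bsub>A\<^esub>"
      using g by (simp add: N_def del: A.nat_pow_Suc)
  next
    have c: "scalar t \<otimes>\<^bsub>A\<^esub> D.y 2 [^]\<^bsub>A\<^esub> Suc k \<in> carrier A" by simp
    have "i = 0 \<or> i = 1" using i by linarith
    then show "single i (scalar s \<otimes>\<^bsub>A\<^esub> D.g i [^]\<^bsub>A\<^esub> Suc l) 2 = M 0 \<oplus>\<^bsub>A\<^esub> (M 1 \<oplus>\<^bsub>A\<^esub> \<ominus>\<^bsub>A\<^esub> N 2) \<oplus>\<^bsub>A\<^esub> \<zero>\<^bsub>A\<^esub>"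
      using c by (elim disjE) (simp_all add: M_def N_def A.r_neg del: A.nat_pow_Suc)
  next
    fix j assume "2 \<le> j" "j < n - 2"
    then show "single i (scalar s \<otimes>\<^bsub>A\<^esub> D.g i [^]\<^bsub>A\<^esub> Suc l) (Suc j) = M j \<oplus>\<^bsub>A\<^esub> \<ominus>\<^bsub>A\<^esub> N (Suc j) \<oplus>\<^bsub>A\<^esub> \<zero>\<^bsub>A\<^esub>"
      using i by (simp add: M_def N_def A.r_neg del: A.nat_pow_Suc)
  next
    have e: "Suc (n - 2) = n - 1" "\<not> n - 2 < 2" "n - 2 \<noteq> i" "n - 1 \<noteq> i" using i n_ge_4 by linarith+
    have "2 \<le> n - 1" "n - 1 < n" "n - (n - 1) \<le> Suc k" using n_ge_4 by linarith+
    then have "D.y (n - 1) [^]\<^bsub>A\<^esub> Suc k = \<zero>\<^bsub>A\<^esub>" by (rule D.y_nilpotent_ge)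
    then have "M (n - 2) = \<zero>\<^bsub>A\<^esub>" unfolding M_def e(1) if_not_P[OF e(2)] if_not_P[OF e(3)] by simp
    then show "single i (scalar s \<otimes>\<^bsub>A\<^esub> D.g i [^]\<^bsub>A\<^esub> Suc l) (n - 1) = M (n - 2) \<oplus>\<^bsub>A\<^esub> \<zero>\<^bsub>A\<^esub>"
      unfolding if_not_P[OF e(4)] by simp
  qed
  then show ?thesis by (simp only: relation_class_zero)
qed

text \<open>The value y_2^{n-3} a_1 on a_1 carries pi_1 to the socle element at vertex 2, and each
  \<open>link\<close> carries a socle element one vertex further. The intermediate contributions
  cancel.\<close>

lemma relation_class_socle:
  assumes k: "k \<le> n - 3"
  shows "relation_class (single (2 + k) (D.socle k)) = relation_class (single 1 (D.socle_low 1))"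
proof -
  define u where "u = case_arrow
      (\<lambda>j. if j = 1 then D.y 2 [^]\<^bsub>A\<^esub> (n - 3) \<otimes>\<^bsub>A\<^esub> arr (Arr 1) else if 2 \<le> j \<and> j < 2 + k then D.link (j - 2) else \<zero>\<^bsub>A\<^esub>) (\<lambda>j. \<zero>\<^bsub>A\<^esub>)"
  have u: "u (Arr j) = (if j = 1 then D.y 2 [^]\<^bsub>A\<^esub> (n - 3) \<otimes>\<^bsub>A\<^esub> arr (Arr 1) else if 2 \<le> j \<and> j < 2 + k then D.link (j - 2) else \<zero>\<^bsub>A\<^esub>)"
    "u (Star j) = \<zero>\<^bsub>A\<^esub>" for j by (simp_all add: u_def)
  define M where "M = (\<lambda>j. if j = 1 then D.socle 0 else if 2 \<le> j \<and> j < 2 + k then D.socle (j - 1) else \<zero>\<^bsub>A\<^esub>)"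
  define N where "N = (\<lambda>j. if j = 1 then D.socle_low 1 else if 2 \<le> j \<and> j < 2 + k then D.socle (j - 2) else \<zero>\<^bsub>A\<^esub>)"
  have s: "r \<le> n - 3 \<Longrightarrow> D.socle r \<in> carrier A" for r by (rule D.socle_closed)
  have sl: "D.socle_low 1 \<in> carrier A" "D.socle 0 \<in> carrier A" using D.socle_low_closed[of 1] D.socle_closed[of 0] by simp_all
  note low = D.low_closed[of 1, simplified]
  have split: "\<exists>r. j = 2 + r \<and> Suc r \<le> k" if "2 \<le> j \<and> j < 2 + k" for j
    using that by (intro exI[of _ "j - 2"]) linarith
  show ?thesis
  proof (rule relation_class_cases_eqI[where u = u and M = M and N = N])
    show "diagonal (single (2 + k) (D.socle k))" using k n_ge_4 by (intro single_diagonal socle_block) linarith+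
    show "diagonal (single 1 (D.socle_low 1))" using socle_low_block[of 1] by (intro single_diagonal) simp_all
    have link: "D.link (j - 2) \<in> block (Suc j) j" if "2 \<le> j \<and> j < 2 + k" for j
      using split[OF that] link_block k by auto
    show "arrow_valued u"
      by (rule arrow_valuedI) (use y2_pow_a_block[of 1 "n - 3"] link in \<open>simp_all add: u\<close>)
    fix j assume j: "j \<le> n - 2"
    note ab = D.a_closed[OF j] D.b_closed[OF j]
    consider "j = 1" | r where "j = 2 + r" "Suc r \<le> k" | "j \<noteq> 1" "\<not> (2 \<le> j \<and> j < 2 + k)" using split by blast
    note cases = this
    from cases show "u (Arr j) \<otimes>\<^bsub>A\<^esub> arr (Star j) \<oplus>\<^bsub>A\<^esub> arr (Arr j) \<otimes>\<^bsub>A\<^esub> u (Star j) = M j"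
    proof cases
      case 1
      then show ?thesis using ab by (simp add: u M_def D.socle_0 D.p_def A.m_assoc)
    next
      case 2
      then have r: "Suc r \<le> n - 3" using k by linarith
      have "Suc r = j - 1" "\<not> j = 1" "2 \<le> j \<and> j < 2 + k" using 2 by linarith+
      then show ?thesis using ab D.link_b[OF r] s[OF r] 2 by (simp add: u M_def)
    next
      case 3
      then show ?thesis unfolding u M_def if_not_P[OF 3(1)] if_not_P[OF 3(2)] using ab by simp
    qed
    from cases show "u (Star j) \<otimes>\<^bsub>A\<^esub> arr (Arr j) \<oplus>\<^bsub>A\<^esub> arr (Star j) \<otimes>\<^bsub>A\<^esub> u (Arr j) = N j"
    proof cases
      case 1
      then show ?thesis using ab sl by (simp add: u N_def D.socle_low_def)
    next
      case 2
      then have r: "Suc r \<le> n - 3" "r \<le> n - 3" using k by linarith+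
      then show ?thesis using ab D.b_link[OF r(1)] s[OF r(2)] 2 by (simp add: u N_def)
    next
      case 3
      then show ?thesis unfolding u N_def if_not_P[OF 3(1)] if_not_P[OF 3(2)] using ab by simp
    qed
  next
    fix j :: nat assume "j < 2"
    then have "j = 0 \<or> j = 1" by linarith
    then show "single (2 + k) (D.socle k) j = \<ominus>\<^bsub>A\<^esub> N j \<oplus>\<^bsub>A\<^esub> single 1 (D.socle_low 1) j"
      using sl by (elim disjE) (simp_all add: N_def A.l_neg)
  next
    show "single (2 + k) (D.socle k) 2 = M 0 \<oplus>\<^bsub>A\<^esub> (M 1 \<oplus>\<^bsub>A\<^esub> \<ominus>\<^bsub>A\<^esub> N 2) \<oplus>\<^bsub>A\<^esub> single 1 (D.socle_low 1) 2"
      using sl by (cases "k = 0") (simp_all add: M_def N_def A.r_neg)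
  next
    fix j assume j: "2 \<le> j" "j < n - 2"
    have c: "D.socle (j - 1) \<in> carrier A" using j by (intro s) linarith
    consider "j < Suc k" | "j = Suc k" | "j > Suc k" by linarith
    then show "single (2 + k) (D.socle k) (Suc j) = M j \<oplus>\<^bsub>A\<^esub> \<ominus>\<^bsub>A\<^esub> N (Suc j) \<oplus>\<^bsub>A\<^esub> single 1 (D.socle_low 1) (Suc j)"
      using j c by cases (simp_all add: M_def N_def A.r_neg)
  next
    have e: "2 \<le> n - 2" "n - 2 \<noteq> 1" "n - 1 \<noteq> 1" "n - 2 < 2 + k \<longleftrightarrow> k = n - 3" "n - 1 = 2 + k \<longleftrightarrow> k = n - 3" "n - 2 - 1 = n - 3"
      using n_ge_4 k by linarith+
    have "M (n - 2) = (if k = n - 3 then D.socle (n - 3) else \<zero>\<^bsub>A\<^esub>)" unfolding M_def if_not_P[OF e(2)] e(4,6) using e(1) by simp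
    then show "single (2 + k) (D.socle k) (n - 1) = M (n - 2) \<oplus>\<^bsub>A\<^esub> single 1 (D.socle_low 1) (n - 1)"
      unfolding if_not_P[OF e(3)] e(5) using s[OF order_refl] by simp
  qed
qed

end

section \<open>Products of distinguished classes\<close>

lemma CHAR_eq_2_iff: "CHAR('a::field) = 2 \<longleftrightarrow> (2 :: 'a) = 0"
proof
  assume "CHAR('a) = 2"
  then show "(2 :: 'a) = 0" using of_nat_CHAR[where 'a = 'a] by simp
next
  assume "(2 :: 'a) = 0"
  then have d: "CHAR('a) dvd 2" using of_nat_eq_0_iff_char_dvd[of 2, where 'a = 'a] by simp
  then have "CHAR('a) \<le> 2" "CHAR('a) \<noteq> 0" using dvd_imp_le[OF d] by (auto intro!: Nat.gr0I)
  moreover have "CHAR('a) \<noteq> 1" using of_nat_CHAR[where 'a = 'a] by (metis of_nat_1 zero_neq_one)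
  ultimately show "CHAR('a) = 2" by linarith
qed

context type_D begin

lemma central_class_cong: "(\<And>i. i < n \<Longrightarrow> c i = d i) \<Longrightarrow> diagonal d \<Longrightarrow> central_class c = central_class d"
  unfolding central_class_def by (subst diag_cong) auto

lemma relation_class_cong: "(\<And>i. i < n \<Longrightarrow> c i = d i) \<Longrightarrow> relation_class c = relation_class d"
  unfolding relation_class_def by (metis cochain2_cong)

lemma arrow_class_cong: "(\<And>x. x \<in> arrows n \<Longrightarrow> v x = w x) \<Longrightarrow> arrow_class v = arrow_class w"
  unfolding arrow_class_def by (metis cochain1_cong)

lemma central_class_eq_one: "(\<And>i. i < n \<Longrightarrow> c i = \<zero>\<^bsub>A\<^esub>) \<Longrightarrow> central_class c = \<one>\<^bsub>HK n 0\<^esub>"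
  unfolding central_class_zero[symmetric] by (rule central_class_cong) auto

lemma relation_class_eq_one: "(\<And>i. i < n \<Longrightarrow> c i = \<zero>\<^bsub>A\<^esub>) \<Longrightarrow> relation_class c = \<one>\<^bsub>HK n 2\<^esub>"
  unfolding relation_class_zero[symmetric] by (rule relation_class_cong)

lemma arrow_class_eq_one: "(\<And>x. x \<in> arrows n \<Longrightarrow> v x = \<zero>\<^bsub>A\<^esub>) \<Longrightarrow> arrow_class v = \<one>\<^bsub>HK n (Suc 0)\<^esub>"
  unfolding arrow_class_zero[symmetric] by (rule arrow_class_cong)

lemma central_class_closed: "diagonal c \<Longrightarrow> intertwining c \<Longrightarrow> central_class c \<in> carrier (HK n 0)"
  unfolding central_class_def using diag_cocycle(1) by (intro HK_carrierI)

lemma relation_class_closed: "diagonal c \<Longrightarrow> relation_class c \<in> carrier (HK n 2)"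
  unfolding relation_class_def using cochain2(1)[of c] by (intro HK_carrierI cocycles_ge_2) auto

lemma zero_cocycle: "cochain1 n (\<lambda>x. \<zero>\<^bsub>A\<^esub>) \<in> cocycles n (Suc 0)"
proof -
  have z: "arrow_valued (\<lambda>x. \<zero>\<^bsub>A\<^esub>)" by (simp add: arrow_source_less arrow_target_less)
  note f = cochain1[of "\<lambda>x. \<zero>\<^bsub>A\<^esub>", OF z[rule_format]]
  have "\<one>\<^bsub>CG (Suc 0)\<^esub> \<in> (cocycles n (Suc 0) :: 'a cochain set)" by (rule subgroup.one_closed[OF cocycles_subgroup])
  moreover have "cochain1 n (\<lambda>x. \<zero>\<^bsub>A\<^esub>) = \<one>\<^bsub>CG (Suc 0)\<^esub>"
    using f cocycles_cochains[OF calculation] by (intro cochain_1_eqI) (auto simp: CG_one bimodule_map_1_closed)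
  ultimately show ?thesis by simp
qed

text \<open>The hypothesis makes each summand of the product vanish, so the product is zero already
  as a cochain.\<close>

lemma cup_arrow_arrow:
  assumes v: "arrow_valued v" "cochain1 n v \<in> cocycles n (Suc 0)"
    and w: "arrow_valued w" "cochain1 n w \<in> cocycles n (Suc 0)"
    and zero: "\<And>x. x \<in> arrows n \<Longrightarrow> v x \<otimes>\<^bsub>A\<^esub> w (bar x) = \<zero>\<^bsub>A\<^esub>"
  shows "cup n (Suc 0) (Suc 0) (arrow_class v) (arrow_class w) = \<one>\<^bsub>HK n 2\<^esub>"
proof -
  note f = cochain1[of v, OF v(1)[rule_format]] and g = cochain1[of w, OF w(1)[rule_format]]
  let ?c = "cup_cochain n (Suc 0) (Suc 0) (cochain1 n v) (cochain1 n w)"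
  have c: "?c \<in> cocycles n 2" "\<one>\<^bsub>CG 2\<^esub> \<in> (cocycles n 2 :: 'a cochain set)"
    using cup_cochain_cocycle[OF v(2) w(2)] subgroup.one_closed[OF cocycles_subgroup] by (simp_all add: numeral_2_eq_2)
  have m: "bimodule_map (Suc 0) (cochain1 n v)" "bimodule_map (Suc 0) (cochain1 n w)"
    using v(2) w(2) cocycles_cochains cochains_bimodule_map by blast+
  have "?c = \<one>\<^bsub>CG 2\<^esub>"
  proof (rule cochain_2_eqI[OF c[THEN cocycles_cochains]])
    fix i assume i: "i < n"
    have "relation_sum (\<lambda>j. of_bool (j = i)) (\<lambda>x. cochain1 n v (arrow_elt x) \<otimes>\<^bsub>A\<^esub> cochain1 n w (arrow_elt (bar x))) =
        relation_sum (\<lambda>j. of_bool (j = i)) (\<lambda>x. \<zero>\<^bsub>A\<^esub>)"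
      using f(2) g(2) zero by (intro relation_sum_cong) auto
    then show "?c (sigma n i) = \<one>\<^bsub>CG 2\<^esub> (sigma n i)"
      unfolding sigma_relation_fun[OF i] cup_cochain_1_1[OF m]
      using sigma_W2[OF i] by (simp add: relation_sum_def CG_one sigma_relation_fun[OF i])
  qed
  then have "hk_class n 2 ?c = \<one>\<^bsub>HK n 2\<^esub>"
    using hk_class_one_iff[OF c(1)] subgroup.one_closed[OF coboundaries_subgroup_cochains, of 2] by simp
  then show ?thesis
    using cup_class[OF v(2) w(2)] by (simp add: arrow_class_def numeral_2_eq_2)
qed

lemma cup_ge_3:
  assumes X: "X \<in> carrier (HK n p)" and Y: "Y \<in> carrier (HK n q)" and pq: "p + q \<ge> 3"
  shows "(cup n p q X Y :: 'a cochain set) = \<one>\<^bsub>HK n (p + q)\<^esub>"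
proof -
  obtain f g :: "'a cochain" where f: "f \<in> cocycles n p" "X = hk_class n p f" and g: "g \<in> cocycles n q" "Y = hk_class n q g"
    using assms by (auto simp: HK_carrier)
  note fg = cochains_bimodule_map[OF cocycles_cochains[OF f(1)]] cochains_bimodule_map[OF cocycles_cochains[OF g(1)]]
  have "hk_class n (p + q) (\<one>\<^bsub>CG (p + q)\<^esub> :: 'a cochain) = \<one>\<^bsub>HK n (p + q)\<^esub>"
    using hk_class_one_iff[of "\<one>\<^bsub>CG (p + q)\<^esub>" "p + q"] subgroup.one_closed[OF coboundaries_subgroup_cochains]
      subgroup.one_closed[OF cocycles_subgroup] by metis
  then show ?thesis unfolding f(2) g(2) cup_class[OF f(1) g(1)] cup_cochain_ge_3[OF fg pq] .
qed

section \<open>Products of the values of the distinguished classes\<close>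

lemma z_val_mult:
  assumes i: "i < n" shows "z_val k i \<otimes>\<^bsub>A\<^esub> z_val l i = z_val (k + l) i"
proof -
  have c: "z_val k i \<in> block i i" for k using z_val_diagonal i by blast
  have y: "D.y i \<in> carrier A" by simp
  have g: "D.g i \<in> carrier A" if "i < 2" using that by (rule D.g_closed)
  show ?thesis
  proof (cases "k = 0 \<or> l = 0")
    case True
    then show ?thesis using blockD[OF c[of k]] blockD[OF c[of l]] by (auto simp: z_val_def)
  next
    case False
    then show ?thesis
      using A.nat_pow_mult[OF y, of "2 * k" "2 * l"] A.nat_pow_mult[OF g, of k l] by (simp add: z_val_def)
  qed
qed

lemma z_val_zero: "i < n \<Longrightarrow> 2 * l > n - 2 \<Longrightarrow> z_val l i = \<zero>\<^bsub>A\<^esub>"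
  using D.g_pow_zero[of i l] D.y_nilpotent_ge[of i "2 * l"] by (simp add: z_val_def)

text \<open>For positive l the component of z_l ends in the arrow a_i, which kills pi_i; at the last
  vertex the component is zero.\<close>

lemma z_val_pi_val:
  assumes l: "l > 0" and i: "i < n" shows "z_val l i \<otimes>\<^bsub>A\<^esub> pi_val i = \<zero>\<^bsub>A\<^esub>"
proof -
  have c: "pi_val i \<in> carrier A" using pi_val_block[OF i] by (rule blockD(1))
  obtain k where k: "l = Suc k" using l by (cases l) auto
  have a: "arr (Arr i) \<otimes>\<^bsub>A\<^esub> pi_val i = \<zero>\<^bsub>A\<^esub>" if "i \<le> n - 2"
    using arr_pi_val(1)[OF arrow_mem(1)[OF that]] by simp
  show ?thesis
  proof (cases "i < 2")
    case True
    then have i: "i \<le> n - 2" using n_ge_4 by linarith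
    have "D.g i \<otimes>\<^bsub>A\<^esub> pi_val i = \<zero>\<^bsub>A\<^esub>"
      using a[OF i] c D.low_closed[OF True] True by (simp add: D.g_def A.m_assoc)
    then show ?thesis using True c k by (simp add: z_val_def A.m_assoc)
  next
    case False
    have "D.y i \<otimes>\<^bsub>A\<^esub> pi_val i = \<zero>\<^bsub>A\<^esub>"
    proof (cases "i \<le> n - 2")
      case True
      then show ?thesis using a[OF True] c D.a_closed[OF True] D.b_closed[OF True] by (simp add: D.y_def A.m_assoc)
    qed (use c in \<open>simp add: D.y_def\<close>)
    moreover have "2 * l = Suc (2 * k + 1)" using k by simp
    ultimately show ?thesis using False l c by (simp only: z_val_def A.nat_pow_Suc) (simp add: A.m_assoc)
  qed
qed

lemma pi_val_g: "pi_val 0 \<otimes>\<^bsub>A\<^esub> D.g 0 = \<zero>\<^bsub>A\<^esub>"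
proof -
  have c: "pi_val 0 \<in> carrier A" using pi_val_block[of 0] by (intro blockD(1)) simp
  have "pi_val 0 \<otimes>\<^bsub>A\<^esub> arr (Star 0) = \<zero>\<^bsub>A\<^esub>" using arr_pi_val(2)[OF arrow_mem(2)[of 0]] by simp
  then show ?thesis using c D.low_closed[of 0] by (simp add: D.g_def flip: A.m_assoc)
qed

lemma pi_val_square:
  assumes i: "i < n" shows "pi_val i \<otimes>\<^bsub>A\<^esub> pi_val i = \<zero>\<^bsub>A\<^esub>"
proof -
  \<comment> \<open>Each pi_i can be written with an arrow in front, and pi_i times that arrow is
    0.\<close>
  have "\<exists>x\<in>arrows n. \<exists>w\<in>carrier A. arrow_target x = i \<and> pi_val i = arr x \<otimes>\<^bsub>A\<^esub> w"
  proof -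
    have high: "i = 2 + Suc (i - 3) \<and> Suc (i - 3) \<le> n - 3" if "i > 2"
      using that i by linarith
    consider "i = 0" | "i = 1" | "i = 2" | k where "i = 2 + Suc k" "Suc k \<le> n - 3"
    proof (cases "i > 2")
      case True
      show ?thesis by (rule that(4)[OF high[OF True, THEN conjunct1] high[OF True, THEN conjunct2]])
    next
      case False
      then have "i = 0 \<or> i = 1 \<or> i = 2" by linarith
      then show ?thesis using that(1-3) by (elim disjE)
    qed
    then show ?thesis
    proof cases
      case 1
      let ?w = "\<ominus>\<^bsub>A\<^esub> (D.y 2 [^]\<^bsub>A\<^esub> (n - 3) \<otimes>\<^bsub>A\<^esub> arr (Arr 0))"
      have "pi_val i = arr (Star 0) \<otimes>\<^bsub>A\<^esub> ?w" "?w \<in> carrier A" "arrow_target (Star 0) = i"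
        using 1 D.low_closed[of 0] by (simp_all add: pi_val_def D.socle_low_def A.r_minus)
      then show ?thesis using arrow_mem(2)[of 0] by blast
    next
      case 2
      let ?w = "D.y 2 [^]\<^bsub>A\<^esub> (n - 3) \<otimes>\<^bsub>A\<^esub> arr (Arr 1)"
      have "pi_val i = arr (Star 1) \<otimes>\<^bsub>A\<^esub> ?w" "?w \<in> carrier A" "arrow_target (Star 1) = i"
        using 2 D.low_closed[of 1] by (simp_all add: pi_val_def D.socle_low_def)
      moreover have "1 \<le> n - 2" using n_ge_4 by linarith
      ultimately show ?thesis using arrow_mem(2)[of 1] by blast
    next
      case 3
      \<comment> \<open>The power y_2^{n-3} has at least one factor, as n \<ge> 4, and this factor
        provides the leading arrow a_2^*.\<close>
      have m: "2 \<le> n - 2" "n - 3 = Suc (n - 4)" using n_ge_4 by linarith+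
      let ?w = "arr (Arr 2) \<otimes>\<^bsub>A\<^esub> (D.y 2 [^]\<^bsub>A\<^esub> (n - 4) \<otimes>\<^bsub>A\<^esub> D.p 1)"
      note ab = D.a_closed[OF m(1)] D.b_closed[OF m(1)]
      have y: "D.y 2 = arr (Star 2) \<otimes>\<^bsub>A\<^esub> arr (Arr 2)" using m(1) by (simp only: D.y_def if_True)
      have p: "D.p 1 \<in> carrier A" by simp
      have pow: "D.y 2 [^]\<^bsub>A\<^esub> (n - 3) = D.y 2 \<otimes>\<^bsub>A\<^esub> D.y 2 [^]\<^bsub>A\<^esub> (n - 4)"
        unfolding m(2) by (rule A.nat_pow_Suc2) simp
      have "D.y 2 [^]\<^bsub>A\<^esub> (n - 3) \<otimes>\<^bsub>A\<^esub> D.p 1 = D.y 2 \<otimes>\<^bsub>A\<^esub> (D.y 2 [^]\<^bsub>A\<^esub> (n - 4) \<otimes>\<^bsub>A\<^esub> D.p 1)"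
        unfolding pow by (intro A.m_assoc A.nat_pow_closed D.y_closed p)
      also have "\<dots> = arr (Star 2) \<otimes>\<^bsub>A\<^esub> arr (Arr 2) \<otimes>\<^bsub>A\<^esub> (D.y 2 [^]\<^bsub>A\<^esub> (n - 4) \<otimes>\<^bsub>A\<^esub> D.p 1)"
        unfolding y[symmetric] ..
      also have "\<dots> = arr (Star 2) \<otimes>\<^bsub>A\<^esub> ?w"
        by (rule A.m_assoc[OF ab(2,1)]) (intro A.m_closed A.nat_pow_closed D.y_closed p)
      finally have "pi_val i = arr (Star 2) \<otimes>\<^bsub>A\<^esub> ?w" using 3 by (simp add: pi_val_def D.socle_0)
      moreover have "?w \<in> carrier A" "arrow_target (Star 2) = i" using ab p 3 by simp_all
      ultimately show ?thesis using arrow_mem(2)[OF m(1)] by blast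
    next
      case 4
      then have k: "2 + k \<le> n - 2" "k \<le> n - 3" by linarith+
      let ?v = "D.y 2 [^]\<^bsub>A\<^esub> (n - 3 - Suc k) \<otimes>\<^bsub>A\<^esub> (D.p 1 \<otimes>\<^bsub>A\<^esub> D.down (Suc k))"
      have v: "?v \<in> carrier A" using D.down_closed[OF 4(2)] by simp
      have "pi_val i = D.socle (Suc k)" using 4(1) by (simp add: pi_val_def)
      also have "\<dots> = arr (Arr (2 + k)) \<otimes>\<^bsub>A\<^esub> (D.up k \<otimes>\<^bsub>A\<^esub> ?v)"
        using D.a_closed[OF k(1)] D.up_closed[OF k(2)] v
        by (simp add: D.socle_def A.m_assoc del: D.down.simps)
      finally have "pi_val i = arr (Arr (2 + k)) \<otimes>\<^bsub>A\<^esub> (D.up k \<otimes>\<^bsub>A\<^esub> ?v)" .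
      moreover have "D.up k \<otimes>\<^bsub>A\<^esub> ?v \<in> carrier A" using D.up_closed[OF k(2)] v by simp
      moreover have "arrow_target (Arr (2 + k)) = i" using 4(1) by simp
      ultimately show ?thesis using arrow_mem(1)[OF k(1)] by blast
    qed
  qed
  then obtain x w where x: "x \<in> arrows n" "w \<in> carrier A" "arrow_target x = i" "pi_val i = arr x \<otimes>\<^bsub>A\<^esub> w" by blast
  have c: "pi_val i \<in> carrier A" using pi_val_block[OF i] by (rule blockD(1))
  have "pi_val i \<otimes>\<^bsub>A\<^esub> (arr x \<otimes>\<^bsub>A\<^esub> w) = (pi_val i \<otimes>\<^bsub>A\<^esub> arr x) \<otimes>\<^bsub>A\<^esub> w"
    using c x by (simp add: A.m_assoc)
  also have "\<dots> = \<zero>\<^bsub>A\<^esub>" using arr_pi_val(2)[OF x(1)] x by simp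
  finally show ?thesis using x(4) by simp
qed

text \<open>The bound is not strict here, unlike for z_l: on a short branch the value equals
  y_2^{2l} a_i, so it vanishes as soon as y_2^{2l} does, even where g_i^l might not.\<close>

lemma zeta_val_zero:
  assumes x: "x \<in> arrows n" and l: "2 * l \<ge> n - 2" shows "zeta_val l x = \<zero>\<^bsub>A\<^esub>"
  using x
proof (cases rule: arrow_cases)
  case (1 i)
  have "l > 0" using l n_ge_4 by linarith
  then show ?thesis
    using 1 D.y2_pow_a[OF 1(1), of l] D.y2_nilpotent[OF l] D.low_closed[OF 1(1)] by (simp add: zeta_val_def z_val_def)
next
  case (3 i)
  have "l > 0" "n - i \<le> 2 * l" "i < n" using l n_ge_4 3 by linarith+
  then show ?thesis
    using 3 D.y_nilpotent_ge[of i "2 * l"] D.a_closed[of i] by (simp add: zeta_val_def z_val_def)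
qed (simp_all add: zeta_val_def)

text \<open>At 2l = n - 2 the components on the long branch have just become zero, and those at 0
  and 1 are the socle elements -pi_0 and pi_1.\<close>

lemma z_val_even:
  assumes "even n"
  shows "diag (z_val (m_D n)) = \<ominus>\<^bsub>A\<^esub> pi_elt n 0 \<oplus>\<^bsub>A\<^esub> pi_elt n 1"
proof -
  let ?s = "D.socle_low"
  have s: "?s 0 \<in> block 0 0" "?s 1 \<in> block 1 1" using socle_low_block[of 0] socle_low_block[of 1] by simp_all
  have n1: "0 < n" "1 < n" using n_ge_4 by linarith+
  have m: "2 * m_D n = n - 2" using assms by (simp add: m_D_def)
  then have m0: "m_D n \<noteq> 0" using n_ge_4 by linarith
  have "z_val (m_D n) i = single 0 (?s 0) i \<oplus>\<^bsub>A\<^esub> single 1 (?s 1) i" if i: "i < n" for i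
  proof -
    consider "i = 0" | "i = 1" | "i \<ge> 2" by linarith
    then show ?thesis
    proof cases
      case 3
      then have "D.y i [^]\<^bsub>A\<^esub> (2 * m_D n) = \<zero>\<^bsub>A\<^esub>" using i unfolding m by (intro D.y_nilpotent_ge) linarith+
      then show ?thesis using 3 m0 by (simp add: z_val_def)
    qed (use m0 D.socle_low_even[OF assms] s[THEN blockD(1)] in \<open>simp_all add: z_val_def m_D_def\<close>)
  qed
  then have "diag (z_val (m_D n)) = (\<Oplus>\<^bsub>A\<^esub>i\<in>{..<n}. single 0 (?s 0) i \<oplus>\<^bsub>A\<^esub> single 1 (?s 1) i)"
    unfolding diag_def using s[THEN blockD(1)] by (intro A.finsum_cong') auto
  also have "\<dots> = diag (single 0 (?s 0)) \<oplus>\<^bsub>A\<^esub> diag (single 1 (?s 1))"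
    unfolding diag_def using s[THEN blockD(1)] by (intro A.finsum_addf) auto
  also have "\<dots> = ?s 0 \<oplus>\<^bsub>A\<^esub> ?s 1" unfolding diag_single[OF n1(1) s(1)] diag_single[OF n1(2) s(2)] ..
  also have "?s 0 = \<ominus>\<^bsub>A\<^esub> pi_elt n 0" using s(1)[THEN blockD(1)] pi_elt_eq[OF n1(1)] by (simp add: pi_val_def)
  also have "?s 1 = pi_elt n 1" using pi_elt_eq[OF n1(2)] by (simp add: pi_val_def)
  finally show ?thesis .
qed

lemma minus_char_2: "CHAR('a) = 2 \<Longrightarrow> x \<in> carrier A \<Longrightarrow> \<ominus>\<^bsub>A\<^esub> x = x"
proof -
  assume c: "CHAR('a) = 2" and x: "x \<in> carrier A"
  have "1 + 1 = (0 :: 'a)" using c CHAR_eq_2_iff[where 'a = 'a] by simp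
  then have "(- 1 :: 'a) = 1" by (simp only: neg_eq_iff_add_eq_0)
  then have "scalar (- 1) \<otimes>\<^bsub>A\<^esub> x = x" using x by (simp only: scalar_1 A.l_one)
  then show ?thesis using scalar_minus_1[OF x] by (simp only:)
qed

text \<open>The commutator with the element whose components are y_i^{2l+1} for i \<ge> 2 and 0 at
  the short ends vanishes on the long branch by intertwining. On the short branches it gives the
  values of rho up to sign, and the sign disappears in characteristic 2.\<close>

lemma hk_elt_Rho:
  assumes char: "CHAR('a) = 2"
  shows "hk_elt n (Rho l) = arrow_class (\<lambda>x. \<zero>\<^bsub>A\<^esub>)"
proof -
  let ?k = "2 * l + 1"
  define v where "v = case_arrow (\<lambda>i. if i < 2 then D.y 2 [^]\<^bsub>A\<^esub> ?k \<otimes>\<^bsub>A\<^esub> arr (Arr i) else \<zero>\<^bsub>A\<^esub>)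
      (\<lambda>i. if i < 2 then arr (Star i) \<otimes>\<^bsub>A\<^esub> D.y 2 [^]\<^bsub>A\<^esub> ?k else \<zero>\<^bsub>A\<^esub>)"
  have v: "v (Arr i) = (if i < 2 then D.y 2 [^]\<^bsub>A\<^esub> ?k \<otimes>\<^bsub>A\<^esub> arr (Arr i) else \<zero>\<^bsub>A\<^esub>)"
      "v (Star i) = (if i < 2 then arr (Star i) \<otimes>\<^bsub>A\<^esub> D.y 2 [^]\<^bsub>A\<^esub> ?k else \<zero>\<^bsub>A\<^esub>)" for i
    by (simp_all add: v_def)
  have n2: "2 \<le> n - 2" using n_ge_4 by linarith
  have rho: "rho n l = cochain1 n v"
    unfolding rho_def Let_def word_y[OF n2]
  proof (rule cochain1_cong)
    fix x assume x: "x \<in> arrows n"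
    then show "(case x of Arr i \<Rightarrow> if i < 2 then D.y 2 [^]\<^bsub>A\<^esub> (2 * l + 1) \<otimes>\<^bsub>A\<^esub> word n [Arr i] else \<zero>\<^bsub>A\<^esub>
        | Star i \<Rightarrow> if i < 2 then word n [Star i] \<otimes>\<^bsub>A\<^esub> D.y 2 [^]\<^bsub>A\<^esub> (2 * l + 1) else \<zero>\<^bsub>A\<^esub>) = v x"
      by (cases x) (simp_all add: v word_Cons word_Nil)
  qed
  have vb: "arrow_valued v"
    using y2_pow_a_block b_y2_pow_block by (intro arrow_valuedI) (simp_all only: v if_True, simp_all)
  note f = cochain1[of v, OF vb[rule_format]]
  \<comment> \<open>The family is extended by 0 at the vertices 0 and 1, where an odd power of y_2
    has no counterpart.\<close>
  define c where "c i = (if 2 \<le> i then D.y i [^]\<^bsub>A\<^esub> ?k else \<zero>\<^bsub>A\<^esub>)" for i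
  have c: "diagonal c" using pow_block[OF y_block, of _ ?k] by (simp add: c_def)
  obtain h where h: "h \<in> cochains n 0" "h \<one>\<^bsub>P\<^esub> = diag c"
    using cochain_0_exists[of c] c unfolding diag_def by blast
  have hc: "koszul_diff n 0 h \<in> cochains n (Suc 0)" using koszul_diff_closed[OF h(1)] by simp
  have "cochain1 n v = koszul_diff n 0 h"
  proof (rule cochain_1_eqI[OF _ hc])
    show "cochain1 n v \<in> cochains n (Suc 0)" using f(1) by simp
    fix x assume x: "x \<in> arrows n"
    have ax: "arr x \<in> carrier A" "arrow_target x < n" "arrow_source x < n" using x arrow_target_less arrow_source_less by auto
    have cc: "c (arrow_target x) \<in> carrier A" "c (arrow_source x) \<in> carrier A" using c ax(2,3) blockD(1) by blast+
    have "koszul_diff n 0 h (arrow_elt x) = c (arrow_target x) \<otimes>\<^bsub>A\<^esub> arr x \<ominus>\<^bsub>A\<^esub> arr x \<otimes>\<^bsub>A\<^esub> c (arrow_source x)"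
      using koszul_diff_0[OF cochains_bimodule_map[OF h(1)] bimodule_map_1_closed[OF x]]
        diag_left[OF c arr_block[OF x]] diag_right[OF c arr_block[OF x]] ax by (simp add: h(2))
    also have "\<dots> = c (arrow_target x) \<otimes>\<^bsub>A\<^esub> arr x \<oplus>\<^bsub>A\<^esub> arr x \<otimes>\<^bsub>A\<^esub> c (arrow_source x)"
      using cc ax minus_char_2[OF char, of "arr x \<otimes>\<^bsub>A\<^esub> c (arrow_source x)"] by (simp add: A.minus_eq)
    finally have e: "koszul_diff n 0 h (arrow_elt x) = c (arrow_target x) \<otimes>\<^bsub>A\<^esub> arr x \<oplus>\<^bsub>A\<^esub> arr x \<otimes>\<^bsub>A\<^esub> c (arrow_source x)" .
    have dbl: "a \<oplus>\<^bsub>A\<^esub> a = \<zero>\<^bsub>A\<^esub>" if "a \<in> carrier A" for a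
      using A.r_neg[OF that] minus_char_2[OF char that] by simp
    have "c (arrow_target x) \<otimes>\<^bsub>A\<^esub> arr x \<oplus>\<^bsub>A\<^esub> arr x \<otimes>\<^bsub>A\<^esub> c (arrow_source x) = v x"
      using x
    proof (cases rule: arrow_cases)
      case (1 i)
      then show ?thesis using ax by (simp add: c_def v del: A.nat_pow_Suc)
    next
      case (2 i)
      then show ?thesis using ax by (simp add: c_def v del: A.nat_pow_Suc)
    next
      case (3 i)
      have "arr x \<otimes>\<^bsub>A\<^esub> c (arrow_source x) = c (arrow_target x) \<otimes>\<^bsub>A\<^esub> arr x" "v x = \<zero>\<^bsub>A\<^esub>"
        using 3 D.a_y_pow[OF 3(1,2), of ?k] by (simp_all add: c_def v del: A.nat_pow_Suc)
      then show ?thesis using dbl[of "c (arrow_target x) \<otimes>\<^bsub>A\<^esub> arr x"] cc ax by simp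
    next
      case (4 i)
      have "arr x \<otimes>\<^bsub>A\<^esub> c (arrow_source x) = c (arrow_target x) \<otimes>\<^bsub>A\<^esub> arr x" "v x = \<zero>\<^bsub>A\<^esub>"
        using 4 D.b_y_pow[OF 4(1,2), of ?k] by (simp_all add: c_def v del: A.nat_pow_Suc)
      then show ?thesis using dbl[of "c (arrow_target x) \<otimes>\<^bsub>A\<^esub> arr x"] cc ax by simp
    qed
    then show "cochain1 n v (arrow_elt x) = koszul_diff n 0 h (arrow_elt x)" using f(2) x e by simp
  qed
  then have "rho n l \<in> (coboundaries n (Suc 0) :: 'a cochain set)" unfolding rho using imageI[OF h(1), of "koszul_diff n 0"] by simp
  then have "hk_class n (Suc 0) (rho n l) = (\<one>\<^bsub>HK n (Suc 0)\<^esub> :: 'a cochain set)"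
    using subsetD[OF coboundaries_cocycles] hk_class_one_iff[of "rho n l" "Suc 0"] by simp
  then show ?thesis by (simp add: arrow_class_zero)
qed

section \<open>The products of the distinguished classes, one pair of types at a time\<close>

lemma Pi_diagonal: "i < n \<Longrightarrow> diagonal (single i (pi_val i))"
  by (rule single_diagonal[OF _ pi_val_block])

lemma H_diagonal: "j < n \<Longrightarrow> diagonal (single j (idem j))"
  by (rule single_diagonal[OF _ idem_block])

lemma Gamma_diagonal: "l > 0 \<Longrightarrow> diagonal (single 0 (D.g 0 [^]\<^bsub>A\<^esub> (l::nat)))"
  by (rule single_diagonal[OF _ pow_block[OF g_block]]) simp_all

text \<open>No bound on k + l is imposed: the listed sum, the exceptional value for even n and the
  vanishing are all read off from this one formula.\<close>

lemma hk_cup_Z_Z: "hk_cup n (Z k) (Z l) = central_class (z_val (k + l))"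
  unfolding hk_cup_def hk_deg.simps hk_elt_Z
    cup_central_central[OF z_val_diagonal z_val_intertwining z_val_diagonal z_val_intertwining]
  by (rule central_class_cong[OF z_val_mult z_val_diagonal])

lemma hk_cup_Z_Pi:
  assumes "l > 0" "i < n" shows "(hk_cup n (Z l) (Pi i) :: 'a cochain set) = \<one>\<^bsub>HK n 0\<^esub>"
  unfolding hk_cup_def hk_deg.simps hk_elt_Z hk_elt_Pi[OF assms(2)]
    cup_central_central[OF z_val_diagonal z_val_intertwining Pi_diagonal[OF assms(2)] single_pi_intertwining]
  using z_val_pi_val[OF assms] z_val_diagonal[of l, THEN spec, THEN mp, THEN blockD(1)] by (intro central_class_eq_one) simp

lemma hk_cup_Pi_Pi:
  assumes i: "i < n" and j: "j < n" shows "(hk_cup n (Pi i) (Pi j) :: 'a cochain set) = \<one>\<^bsub>HK n 0\<^esub>"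
  unfolding hk_cup_def hk_deg.simps hk_elt_Pi[OF i] hk_elt_Pi[OF j]
    cup_central_central[OF Pi_diagonal[OF i] single_pi_intertwining Pi_diagonal[OF j] single_pi_intertwining]
  using pi_val_square[OF i] pi_val_block[OF i, THEN blockD(1)] pi_val_block[OF j, THEN blockD(1)] by (intro central_class_eq_one) simp

lemma hk_cup_Z_Zeta: "hk_cup n (Z k) (Zeta l) = arrow_class (zeta_val (k + l))"
  unfolding hk_cup_def hk_deg.simps One_nat_def hk_elt_Z hk_elt_Zeta
    cup_central_arrow[OF z_val_diagonal z_val_intertwining zeta_val_block zeta_cocycle]
proof (rule arrow_class_cong)
  fix x assume x: "x \<in> arrows n"
  have c: "z_val k i \<in> carrier A" if "i < n" for k i using z_val_diagonal that blockD(1) by blast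
  show "z_val k (arrow_target x) \<otimes>\<^bsub>A\<^esub> zeta_val l x = zeta_val (k + l) x"
  proof (cases x)
    case (Arr i)
    have i: "i < n" using arrow_source_less[OF x] by (simp add: Arr)
    have "z_val k (arrow_target x) \<otimes>\<^bsub>A\<^esub> zeta_val l x = (z_val k (arrow_target x) \<otimes>\<^bsub>A\<^esub> arr x) \<otimes>\<^bsub>A\<^esub> z_val l i"
      using x c[OF i] c[OF arrow_target_less[OF x]] by (simp add: zeta_val_def Arr A.m_assoc)
    also have "\<dots> = arr x \<otimes>\<^bsub>A\<^esub> (z_val k i \<otimes>\<^bsub>A\<^esub> z_val l i)"
      using x c[OF i] zeta_val_mult[OF x, of k] by (simp add: Arr A.m_assoc)
    finally show ?thesis using z_val_mult[OF i] by (simp add: zeta_val_def Arr)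
  next
    case (Star i)
    then show ?thesis using c[OF arrow_target_less[OF x]] by (simp add: zeta_val_def)
  qed
qed

lemma hk_cup_Pi_Zeta:
  assumes i: "i < n" shows "(hk_cup n (Pi i) (Zeta l) :: 'a cochain set) = \<one>\<^bsub>HK n (Suc 0)\<^esub>"
  unfolding hk_cup_def hk_deg.simps One_nat_def hk_elt_Pi[OF i] hk_elt_Zeta
    cup_central_arrow[OF Pi_diagonal[OF i] single_pi_intertwining zeta_val_block zeta_cocycle]
proof (rule arrow_class_eq_one)
  fix x assume x: "x \<in> arrows n"
  have z: "zeta_val l x \<in> carrier A" using zeta_val_block x blockD(1) by blast
  show "single i (pi_val i) (arrow_target x) \<otimes>\<^bsub>A\<^esub> zeta_val l x = \<zero>\<^bsub>A\<^esub>"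
  proof (cases "arrow_target x = i")
    case True
    have c: "pi_val i \<in> carrier A" using pi_val_block[OF i] by (rule blockD(1))
    show ?thesis
    proof (cases x)
      case (Arr j)
      have "z_val l j \<in> carrier A" using z_val_diagonal blockD(1) arrow_source_less[OF x] by (simp add: Arr) blast
      then have "pi_val i \<otimes>\<^bsub>A\<^esub> zeta_val l x = (pi_val i \<otimes>\<^bsub>A\<^esub> arr x) \<otimes>\<^bsub>A\<^esub> z_val l j"
        using c x by (simp add: zeta_val_def Arr A.m_assoc)
      then show ?thesis using arr_pi_val(2)[OF x] True \<open>z_val l j \<in> carrier A\<close> by simp
    qed (use c in \<open>simp add: zeta_val_def\<close>)
  qed (use z in simp)
qed

lemma zero_valued: "arrow_valued (\<lambda>x. \<zero>\<^bsub>A\<^esub>)"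
  by (simp add: arrow_source_less arrow_target_less)

text \<open>In characteristic 2 the class of rho is represented by the zero cochain.\<close>

lemma hk_cup_central_Rho:
  assumes "diagonal c" "intertwining c" "CHAR('a) = 2"
  shows "cup n 0 (Suc 0) (central_class c) (hk_elt n (Rho l)) = \<one>\<^bsub>HK n (Suc 0)\<^esub>"
  unfolding hk_elt_Rho[OF assms(3)] cup_central_arrow[OF assms(1,2) zero_valued zero_cocycle]
proof (rule arrow_class_eq_one)
  fix x assume "x \<in> arrows n"
  then have "c (arrow_target x) \<in> carrier A" using assms(1) arrow_target_less blockD(1) by blast
  then show "c (arrow_target x) \<otimes>\<^bsub>A\<^esub> \<zero>\<^bsub>A\<^esub> = \<zero>\<^bsub>A\<^esub>" by simp
qed

lemma hk_cup_Z_H: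
  assumes j: "j < n" shows "hk_cup n (Z l) (H j) = relation_class (single j (z_val l j))"
  unfolding hk_cup_def hk_deg.simps hk_elt_Z hk_elt_H
    cup_central_relation[OF z_val_diagonal z_val_intertwining H_diagonal[OF j]]
  using z_val_diagonal[of l, THEN spec, THEN mp, THEN blockD(1)] z_val_diagonal[of l, THEN spec, THEN mp, THEN blockD(3)]
  by (intro relation_class_cong) simp

lemma hk_cup_Pi_H:
  assumes i: "i < n" and j: "j < n"
  shows "hk_cup n (Pi i) (H j) = (if i = j then relation_class (single i (pi_val i)) else \<one>\<^bsub>HK n 2\<^esub>)"
proof -
  have e: "hk_cup n (Pi i) (H j) = relation_class (\<lambda>k. single i (pi_val i) k \<otimes>\<^bsub>A\<^esub> single j (idem j) k)"
    unfolding hk_cup_def hk_deg.simps hk_elt_Pi[OF i] hk_elt_H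
    by (rule cup_central_relation[OF Pi_diagonal[OF i] single_pi_intertwining H_diagonal[OF j]])
  note c = blockD[OF pi_val_block[OF i]] blockD(1)[OF idem_block[OF j]]
  show ?thesis
  proof (cases "i = j")
    case True
    have "relation_class (\<lambda>k. single i (pi_val i) k \<otimes>\<^bsub>A\<^esub> single j (idem j) k) = relation_class (single i (pi_val i))"
      by (rule relation_class_cong) (use c True in simp)
    then show ?thesis using e True by simp
  next
    case False
    have "relation_class (\<lambda>k. single i (pi_val i) k \<otimes>\<^bsub>A\<^esub> single j (idem j) k) = \<one>\<^bsub>HK n 2\<^esub>"
      by (rule relation_class_eq_one) (use c False in simp)
    then show ?thesis using e False by simp
  qed
qed

lemma hk_cup_Z_Gamma:
  assumes l: "l > 0" shows "(hk_cup n (Z k) (Gamma l) :: 'a cochain set) = hk_elt n (Gamma (k + l))"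
  unfolding hk_cup_def hk_deg.simps hk_elt_Z hk_elt_Gamma
    cup_central_relation[OF z_val_diagonal z_val_intertwining Gamma_diagonal[OF l]]
proof (rule relation_class_cong)
  fix i assume i: "i < n"
  have "z_val k i \<in> carrier A" using z_val_diagonal i blockD(1) by blast
  moreover have "z_val k 0 \<otimes>\<^bsub>A\<^esub> D.g 0 [^]\<^bsub>A\<^esub> l = D.g 0 [^]\<^bsub>A\<^esub> (k + l)"
    using z_val_mult[of 0 k l] l by (simp add: z_val_def)
  ultimately show "z_val k i \<otimes>\<^bsub>A\<^esub> single 0 (D.g 0 [^]\<^bsub>A\<^esub> l) i = single 0 (D.g 0 [^]\<^bsub>A\<^esub> (k + l)) i"
    by simp
qed

lemma hk_cup_Pi_Gamma:
  assumes i: "i < n" and l: "l > 0" shows "(hk_cup n (Pi i) (Gamma l) :: 'a cochain set) = \<one>\<^bsub>HK n 2\<^esub>"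
  unfolding hk_cup_def hk_deg.simps hk_elt_Pi[OF i] hk_elt_Gamma
    cup_central_relation[OF Pi_diagonal[OF i] single_pi_intertwining Gamma_diagonal[OF l]]
proof (rule relation_class_eq_one)
  fix j assume "j < n"
  obtain k where k: "l = Suc k" using l by (cases l) auto
  have c: "pi_val i \<in> carrier A" using pi_val_block[OF i] by (rule blockD(1))
  have g: "D.g 0 \<in> carrier A" "D.g 0 [^]\<^bsub>A\<^esub> l \<in> carrier A" by simp_all
  have "pi_val 0 \<otimes>\<^bsub>A\<^esub> D.g 0 [^]\<^bsub>A\<^esub> l = (pi_val 0 \<otimes>\<^bsub>A\<^esub> D.g 0) \<otimes>\<^bsub>A\<^esub> D.g 0 [^]\<^bsub>A\<^esub> k"
    unfolding k A.nat_pow_Suc2[OF g(1)] using pi_val_block[of 0] blockD(1)[of "pi_val 0"] g by (simp add: A.m_assoc)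
  then have "pi_val 0 \<otimes>\<^bsub>A\<^esub> D.g 0 [^]\<^bsub>A\<^esub> l = \<zero>\<^bsub>A\<^esub>" using g by (simp add: pi_val_g)
  then show "single i (pi_val i) j \<otimes>\<^bsub>A\<^esub> single 0 (D.g 0 [^]\<^bsub>A\<^esub> l) j = \<zero>\<^bsub>A\<^esub>" using c g by simp
qed

text \<open>All cases are reduced to the value \<open>socle_low 1\<close> at sigma_1, except pi_0,
  which is a multiple of g_0^m or zero. The hypothesis on odd n excludes the indices 0 and 1, for
  which there are no basis elements.\<close>

lemma relation_class_pi:
  assumes i: "i < n" "odd n \<longrightarrow> 2 \<le> i"
  shows "relation_class (single i (pi_val i)) =
    (if even n \<and> CHAR('a) = 2 then hk_elt n (Gamma (m_D n)) else \<one>\<^bsub>HK n 2\<^esub>)"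
proof -
  let ?r = "relation_class (single 1 (D.socle_low 1))"
  have high: "relation_class (single i (pi_val i)) = ?r" if "i \<ge> 1"
  proof (cases "i = 1")
    case False
    then have "2 + (i - 2) = i" "i - 2 \<le> n - 3" "i \<noteq> 0" using that i by linarith+
    moreover from this have "pi_val i = D.socle (i - 2)" using False by (simp only: pi_val_def if_False)
    ultimately show ?thesis using relation_class_socle[of "i - 2"] by (simp only:)
  next
    case True
    have "pi_val 1 = D.socle_low 1" by (simp add: pi_val_def)
    then show ?thesis unfolding True by (simp only:)
  qed
  show ?thesis
  proof (cases "even n")
    case False
    then have "single 1 (D.socle_low 1) = (\<lambda>j. \<zero>\<^bsub>A\<^esub>)" using D.socle_low_odd[of 1] by (simp add: fun_eq_iff)
    then show ?thesis using False high i relation_class_zero by simp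
  next
    case True
    then obtain l where l: "m_D n = Suc l" using n_ge_4 by (cases "m_D n") (auto simp: m_D_def elim!: evenE)
    have s: "D.socle_low k = D.g k [^]\<^bsub>A\<^esub> Suc l" if "k < 2" for k
      using D.socle_low_even[OF True that] l by (simp add: m_D_def)
    have g: "D.g k [^]\<^bsub>A\<^esub> Suc l \<in> carrier A" if "k < 2" for k using that by (intro A.nat_pow_closed D.g_closed)
    have one2: "(1 :: nat) < 2" by simp
    have s1: "D.socle_low 1 = D.g 1 [^]\<^bsub>A\<^esub> Suc l" by (rule s) simp
    have r: "?r = (if CHAR('a) = 2 then hk_elt n (Gamma (m_D n)) else \<one>\<^bsub>HK n 2\<^esub>)"
    proof (cases "CHAR('a) = 2")
      case True
      then show ?thesis using relation_class_g_swap[of l] unfolding hk_elt_Gamma l s1 by (simp only: simp_thms if_True)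
    next
      case False
      have "scalar 1 \<otimes>\<^bsub>A\<^esub> D.g 1 [^]\<^bsub>A\<^esub> Suc l = D.g 1 [^]\<^bsub>A\<^esub> Suc l" unfolding scalar_1 by (rule A.l_one[OF g]) simp
      then show ?thesis using False relation_class_g[OF _ one2, of 1 l] \<open>scalar 1 \<otimes>\<^bsub>A\<^esub> _ = _\<close> unfolding s1 CHAR_eq_2_iff by (simp only: simp_thms if_False)
    qed
    show ?thesis
    proof (cases "i = 0")
      case i0: True
      \<comment> \<open>The sign of pi_0 is the reason why \<open>relation_class_g\<close> carries a
        scalar; in characteristic 2 it is simply dropped.\<close>
      have pi: "pi_val 0 = scalar (- 1) \<otimes>\<^bsub>A\<^esub> D.g 0 [^]\<^bsub>A\<^esub> Suc l"
        using s[of 0] scalar_minus_1[OF g[of 0]] by (simp add: pi_val_def)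
      show ?thesis
      proof (cases "CHAR('a) = 2")
        case char: True
        have "pi_val 0 = D.g 0 [^]\<^bsub>A\<^esub> Suc l"
          using pi scalar_minus_1[OF g[of 0]] minus_char_2[OF char g[of 0]] by simp
        then show ?thesis using True char unfolding i0 hk_elt_Gamma l by (simp only: simp_thms if_True)
      next
        case False
        then show ?thesis using relation_class_g[of 0 "- 1" l] unfolding i0 pi CHAR_eq_2_iff by (simp only: simp_thms if_False zero_less_numeral)
      qed
    next
      case False
      then show ?thesis using high r True by simp
    qed
  qed
qed

text \<open>On the long branch the value is a positive power of y_j, hence a coboundary. At vertices
  0 and 1 it is a power of g_j, which is a coboundary when 2 is invertible, and otherwise represents
  the same class for both vertices.\<close>

lemma relation_class_z:
  assumes l: "l > 0" and j: "j < n"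
  shows "relation_class (single j (z_val l j)) = (if CHAR('a) = 2 \<and> j < 2 then hk_elt n (Gamma l) else \<one>\<^bsub>HK n 2\<^esub>)"
proof -
  obtain k where k: "l = Suc k" using l by (cases l) auto
  show ?thesis
  proof (cases "j < 2")
    case False
    then have "z_val l j = D.y j [^]\<^bsub>A\<^esub> (2 * l)" using l by (simp add: z_val_def)
    then show ?thesis using False relation_class_y[of j "2 * l"] l j by (simp only: not_less) simp
  next
    case True
    have g: "D.g j [^]\<^bsub>A\<^esub> Suc k \<in> carrier A" using True by (intro A.nat_pow_closed D.g_closed)
    have z: "z_val l j = D.g j [^]\<^bsub>A\<^esub> Suc k" using True l by (simp only: z_val_def k if_True nat.distinct if_False)
    have "j = 0 \<or> j = 1" using True by linarith
    then show ?thesis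
    proof (cases "CHAR('a) = 2")
      case char: True
      have "relation_class (single j (z_val l j)) = hk_elt n (Gamma l)"
        using \<open>j = 0 \<or> j = 1\<close>
      proof
        assume "j = 0"
        then show ?thesis unfolding z unfolding hk_elt_Gamma k by (simp only:)
      next
        assume "j = 1"
        then show ?thesis unfolding z unfolding hk_elt_Gamma k relation_class_g_swap by (simp only:)
      qed
      then show ?thesis using char True by (simp only: simp_thms if_True)
    next
      case False
      have "scalar 1 \<otimes>\<^bsub>A\<^esub> D.g j [^]\<^bsub>A\<^esub> Suc k = D.g j [^]\<^bsub>A\<^esub> Suc k" unfolding scalar_1 by (rule A.l_one[OF g])
      then show ?thesis
        using False relation_class_g[OF _ True, of 1 k] unfolding z CHAR_eq_2_iff by (simp only: simp_thms if_False)
    qed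
  qed
qed

section \<open>Listed and unlisted products of basis elements\<close>

lemma hk_elt_closed:
  assumes "x \<in> hk_basis n CHAR('a)" shows "hk_elt n x \<in> (carrier (HK n (hk_deg x)) :: 'a cochain set set)"
proof (cases x)
  case (Z l)
  show ?thesis unfolding Z hk_deg.simps hk_elt_Z by (rule central_class_closed[OF z_val_diagonal z_val_intertwining])
next
  case (Pi i)
  then have i: "i < n" using assms n_ge_4 by (auto simp: hk_basis_def split: if_splits)
  show ?thesis unfolding Pi hk_deg.simps hk_elt_Pi[OF i] by (rule central_class_closed[OF Pi_diagonal[OF i] single_pi_intertwining])
next
  case (Zeta l)
  show ?thesis unfolding Zeta hk_deg.simps One_nat_def hk_elt_Zeta arrow_class_def by (rule HK_carrierI[OF zeta_cocycle])
next
  case (Rho l)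
  then have char: "CHAR('a) = 2" using assms by (auto simp: hk_basis_def split: if_splits)
  show ?thesis unfolding Rho hk_deg.simps One_nat_def hk_elt_Rho[OF char] arrow_class_def by (rule HK_carrierI[OF zero_cocycle])
next
  case (H j)
  then have j: "j < n" using assms n_ge_4 by (auto simp: hk_basis_def split: if_splits)
  show ?thesis unfolding H hk_deg.simps hk_elt_H by (rule relation_class_closed[OF H_diagonal[OF j]])
next
  case (Gamma l)
  then have l: "l > 0" using assms by (auto simp: hk_basis_def split: if_splits)
  show ?thesis unfolding Gamma hk_deg.simps hk_elt_Gamma by (rule relation_class_closed[OF Gamma_diagonal[OF l]])
qed

lemma hk_basis_cases:
  assumes "x \<in> hk_basis n CHAR('a)"
  obtains l where "x = Z l" | i where "x = Pi i" "i < n" "odd n \<longrightarrow> 2 \<le> i" | l where "x = Zeta l"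
  | l where "x = Rho l" "CHAR('a) = 2" | j where "x = H j" "j < n" | l where "x = Gamma l" "l > 0" "CHAR('a) = 2"
  using assms n_ge_4 by (cases x) (auto simp: hk_basis_def split: if_splits)

lemma unit_class: "(cup n 0 p (hk_elt n (Z 0)) X :: 'a cochain set) = X" if "X \<in> carrier (HK n p)"
  using cup_unit[OF that] by (simp add: z_elt_def)

lemma listed_product_value:
  assumes "listed_product n x y v" "x \<in> hk_basis n CHAR('a)" "y \<in> hk_basis n CHAR('a)"
  shows "hk_cup n x y = (v :: 'a cochain set)"
  using assms
proof (induction rule: listed_product.induct)
  case (unit y)
  then show ?case using unit_class[OF hk_elt_closed] by (simp add: hk_cup_def del: hk_elt.simps)
next
  case (Z_Z l1 l2)
  then show ?case by (simp only: hk_cup_Z_Z hk_elt_Z)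
next
  case (Z_Z_even l1 l2)
  then show ?case by (simp only: hk_cup_Z_Z central_class_def z_val_even)
next
  case (Z_Zeta l1 l2)
  then show ?case by (simp only: hk_cup_Z_Zeta hk_elt_Zeta)
next
  case (Z_Rho l1 l2)
  \<comment> \<open>Both sides are the neutral element, because each rho is a coboundary in
    characteristic 2.\<close>
  then show ?case
    using hk_cup_central_Rho[OF z_val_diagonal z_val_intertwining, of l1 l2] hk_elt_Rho[of "l1 + l2"] arrow_class_zero
    by (simp del: hk_elt.simps add: hk_cup_def hk_elt_Z)
next
  case (Z_H l i)
  then have "i < 2" "i < n" "l > 0" by auto
  then show ?case using Z_H(2) unfolding hk_cup_Z_H[OF \<open>i < n\<close>] relation_class_z[OF \<open>l > 0\<close> \<open>i < n\<close>] by (simp only: simp_thms if_True)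
next
  case (Z_Gamma l1 l2)
  \<comment> \<open>The exponents of gamma start at 1 in the basis; g_0 to the power 0 would be the
    unit of A and not an element of e_0 A e_0.\<close>
  then have "l2 > 0" by (auto simp: hk_basis_def split: if_splits)
  then show ?case by (rule hk_cup_Z_Gamma)
next
  case (Pi_H i j)
  have i: "i < n" "odd n \<longrightarrow> 2 \<le> i" using Pi_H(2,4) by (auto elim: hk_basis_cases)
  have "hk_cup n (Pi i) (H i) = relation_class (single i (pi_val i))"
    using hk_cup_Pi_H[OF i(1) i(1)] by (simp only: simp_thms if_True)
  also have "\<dots> = hk_elt n (Gamma (m_D n))"
    using relation_class_pi[OF i] Pi_H(2,3) by (simp only: simp_thms if_True)
  finally show ?case unfolding Pi_H(1) .
qed

text \<open>Graded commutativity turns one order of the factors into a power of the other, and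
  powers of the neutral element are neutral.\<close>

lemma trivial_product_commute:
  assumes "x \<in> hk_basis n CHAR('a)" "y \<in> hk_basis n CHAR('a)" "(hk_cup n x y :: 'a cochain set) = \<one>\<^bsub>HK n (hk_deg x + hk_deg y)\<^esub>"
  shows "(hk_cup n y x :: 'a cochain set) = \<one>\<^bsub>HK n (hk_deg y + hk_deg x)\<^esub>"
proof -
  interpret H: group "HK n (hk_deg y + hk_deg x) :: 'a cochain set monoid" by (rule HK_group)
  show ?thesis
    using cup_graded_commutative[OF hk_elt_closed[OF assms(2)] hk_elt_closed[OF assms(1)]] assms(3)
    by (simp add: hk_cup_def add.commute[of "hk_deg x"] del: hk_elt.simps)
qed

text \<open>The bounds needed to compare the ranges of the table with the nilpotency exponent: u
  equals m for even n and m + 1 for odd n.\<close>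

lemma u_D_m_D: "2 * u_D n \<ge> n - 2" "u_D n \<ge> 1" "even n \<Longrightarrow> u_D n = m_D n \<and> 2 * m_D n = n - 2"
    "odd n \<Longrightarrow> 2 * u_D n > n - 2" "2 * m_D n + 2 > n - 2"
  using n_ge_4 unfolding u_D_def m_D_def by presburger+

lemma trivial_product_deg_0:
  assumes x: "x \<in> hk_basis n CHAR('a)" and y: "y \<in> hk_basis n CHAR('a)" and deg: "hk_deg x = 0"
    and unlisted: "\<nexists>v :: 'a cochain set. listed_product n x y v \<or> listed_product n y x v"
  shows "(hk_cup n x y :: 'a cochain set) = \<one>\<^bsub>HK n (hk_deg x + hk_deg y)\<^esub>"
  using x
proof (cases rule: hk_basis_cases)
  case (1 k)
  have k: "k > 0" using unlisted unit[of n y] 1 by (cases k) auto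
  from y show ?thesis
  proof (cases rule: hk_basis_cases)
    case y: (1 l)
    \<comment> \<open>For even n the two failing conditions together exclude k + l \<le> m, since u
      = m; for odd n already k + l \<ge> u gives 2(k + l) > n - 2.\<close>
    have "\<not> k + l \<le> u_D n - 1" "\<not> (even n \<and> k + l = m_D n)"
      using unlisted Z_Z[of k l n] Z_Z_even[of n k l] unfolding 1 y by blast+
    then have "2 * (k + l) > n - 2" using u_D_m_D by (cases "even n") auto
    then show ?thesis
      unfolding 1 y hk_cup_Z_Z hk_deg.simps add_0 by (intro central_class_eq_one z_val_zero)
  next
    case y: (2 i)
    show ?thesis unfolding 1 y(1) hk_deg.simps add_0 by (rule hk_cup_Z_Pi[OF k y(2)])
  next
    case y: (3 l)
    have "\<not> k + l \<le> u_D n - 1" using unlisted Z_Zeta[of k l n] unfolding 1 y by blast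
    then have "u_D n \<le> k + l" by simp
    then have l: "2 * (k + l) \<ge> n - 2" by (intro le_trans[OF u_D_m_D(1)] mult_le_mono2)
    show ?thesis
      unfolding 1 y hk_cup_Z_Zeta hk_deg.simps add_0 One_nat_def by (intro arrow_class_eq_one zeta_val_zero[OF _ l])
  next
    case y: (4 l)
    show ?thesis
      unfolding 1 y(1) hk_cup_def hk_elt_Z hk_deg.simps add_0 One_nat_def
      by (rule hk_cup_central_Rho[OF z_val_diagonal z_val_intertwining y(2)])
  next
    case y: (5 j)
    have no: "\<not> (CHAR('a) = 2 \<and> j < 2)" using unlisted Z_H[of k j n, where 'a = 'a] k unfolding 1 y(1) by fastforce
    show ?thesis unfolding 1 y(1) hk_cup_Z_H[OF y(2)] relation_class_z[OF k y(2)] if_not_P[OF no] hk_deg.simps add_0 ..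
  next
    case y: (6 l)
    have "\<not> k + l \<le> m_D n" using unlisted Z_Gamma[of k l n, where 'a = 'a] y unfolding 1 y(1) by blast
    \<comment> \<open>As k + l \<ge> m + 1, the estimate 2m + 2 > n - 2 applies, and g_0^{k+l}
      vanishes.\<close>
    then have "2 * (k + l) > n - 2" using u_D_m_D(5) by presburger
    then have "D.g 0 [^]\<^bsub>A\<^esub> (k + l) = \<zero>\<^bsub>A\<^esub>" by (intro D.g_pow_zero) simp_all
    then show ?thesis
      unfolding 1 y(1) hk_cup_Z_Gamma[OF y(2)] hk_deg.simps add_0 hk_elt_Gamma by (intro relation_class_eq_one) simp
  qed
next
  case (2 i)
  from y show ?thesis
  proof (cases rule: hk_basis_cases)
    case l: (1 l)
    have "l > 0" using unlisted unit[of n x] l by (cases l) auto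
    then have "(hk_cup n y x :: 'a cochain set) = \<one>\<^bsub>HK n (hk_deg y + hk_deg x)\<^esub>" unfolding 2(1) l hk_deg.simps add_0 by (rule hk_cup_Z_Pi[OF _ 2(2)])
    then show ?thesis by (rule trivial_product_commute[OF y x])
  next
    case j: (2 j)
    show ?thesis unfolding 2(1) j(1) hk_deg.simps add_0 by (rule hk_cup_Pi_Pi[OF 2(2) j(2)])
  next
    case l: (3 l)
    show ?thesis unfolding 2(1) l hk_deg.simps add_0 One_nat_def by (rule hk_cup_Pi_Zeta[OF 2(2)])
  next
    case l: (4 l)
    show ?thesis
      unfolding 2(1) l(1) hk_cup_def hk_elt_Pi[OF 2(2)] hk_deg.simps add_0 One_nat_def
      by (rule hk_cup_central_Rho[OF Pi_diagonal[OF 2(2)] single_pi_intertwining l(2)])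
  next
    case j: (5 j)
    have no: "i = j \<Longrightarrow> \<not> (even n \<and> CHAR('a) = 2)" using unlisted Pi_H[of i j n, where 'a = 'a] unfolding 2(1) j(1) by blast
    show ?thesis
    proof (cases "i = j")
      case True
      show ?thesis
        unfolding 2(1) j(1) hk_cup_Pi_H[OF 2(2) j(2)] if_P[OF True] relation_class_pi[OF 2(2,3)] if_not_P[OF no[OF True]] hk_deg.simps add_0 ..
    next
      case False
      show ?thesis unfolding 2(1) j(1) hk_cup_Pi_H[OF 2(2) j(2)] if_not_P[OF False] hk_deg.simps add_0 ..
    qed
  next
    case l: (6 l)
    show ?thesis unfolding 2(1) l(1) hk_deg.simps add_0 by (rule hk_cup_Pi_Gamma[OF 2(2) l(2)])
  qed
qed (use deg in simp_all)

text \<open>The zeta_l vanish on the reversed arrows by definition, and the rho_l may be replaced by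
  0 within their class. So all classes of degree one have representatives supported on the arrows
  a_i.\<close>

lemma arrow_class_cases:
  assumes "x \<in> hk_basis n CHAR('a)" "hk_deg x = Suc 0"
  obtains v where "hk_elt n x = arrow_class v" "arrow_valued v" "cochain1 n v \<in> cocycles n (Suc 0)" "\<forall>i. v (Star i) = \<zero>\<^bsub>A\<^esub>"
  using assms(1)
proof (cases rule: hk_basis_cases)
  case (3 l)
  show ?thesis by (rule that[OF _ zeta_val_block zeta_cocycle]) (rule hk_elt_Zeta[of l, folded 3], simp add: zeta_val_def)
next
  case (4 l)
  show ?thesis by (rule that[OF _ zero_valued zero_cocycle]) (use hk_elt_Rho[OF 4(2)] 4(1) in simp_all)
qed (use assms(2) in simp_all)

lemma trivial_product_unlisted:
  assumes x: "x \<in> hk_basis n CHAR('a)" and y: "y \<in> hk_basis n CHAR('a)"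
    and unlisted: "\<nexists>v :: 'a cochain set. listed_product n x y v \<or> listed_product n y x v"
  shows "(hk_cup n x y :: 'a cochain set) = \<one>\<^bsub>HK n (hk_deg x + hk_deg y)\<^esub>"
proof -
  consider "hk_deg x = 0" | "hk_deg y = 0" | "hk_deg x = Suc 0" "hk_deg y = Suc 0" | "hk_deg x + hk_deg y \<ge> 3"
    by linarith
  then show ?thesis
  proof cases
    case 1
    then show ?thesis using x y unlisted by (intro trivial_product_deg_0)
  next
    case 2
    then have "(hk_cup n y x :: 'a cochain set) = \<one>\<^bsub>HK n (hk_deg y + hk_deg x)\<^esub>" using x y unlisted by (intro trivial_product_deg_0) auto
    then show ?thesis by (rule trivial_product_commute[OF y x])
  next
    case 3
    obtain v where v: "hk_elt n x = arrow_class v" "arrow_valued v" "cochain1 n v \<in> cocycles n (Suc 0)" "\<forall>i. v (Star i) = \<zero>\<^bsub>A\<^esub>"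
      by (rule arrow_class_cases[OF x 3(1)])
    obtain w where w: "hk_elt n y = arrow_class w" "arrow_valued w" "cochain1 n w \<in> cocycles n (Suc 0)" "\<forall>i. w (Star i) = \<zero>\<^bsub>A\<^esub>"
      by (rule arrow_class_cases[OF y 3(2)])
    \<comment> \<open>One of x and bar(x) is a reversed arrow, on which both representatives
      vanish.\<close>
    have "v x \<otimes>\<^bsub>A\<^esub> w (bar x) = \<zero>\<^bsub>A\<^esub>" if "x \<in> arrows n" for x
    proof -
      have "bar x \<in> arrows n" using that by simp
      then have "v x \<in> carrier A" "w (bar x) \<in> carrier A"
        using v(2)[rule_format, OF that] w(2)[rule_format, of "bar x"] blockD(1) by blast+
      then show ?thesis using v(4) w(4) by (cases x) simp_all
    qed
    from cup_arrow_arrow[OF v(2,3) w(2,3) this]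
    show ?thesis unfolding hk_cup_def v(1) w(1) 3 by (simp only: numeral_2_eq_2 add_Suc add_0)
  next
    case 4
    then show ?thesis
      unfolding hk_cup_def by (rule cup_ge_3[OF hk_elt_closed[OF x] hk_elt_closed[OF y]])
  qed
qed

end

theorem proposition6p10:
  fixes n :: nat
  assumes "n \<ge> 4"
  shows
    "(\<forall>x\<in>hk_basis n CHAR('a::field).
        (hk_elt n x :: 'a cochain set) \<in> carrier (HK n (hk_deg x))) \<and>
     (\<forall>p q. \<forall>X\<in>carrier (HK n p). \<forall>Y\<in>carrier (HK n q).
        (cup n p q X Y :: 'a cochain set) =
          cup n q p Y X [^]\<^bsub>HK n (p + q)\<^esub> ((- 1 :: int) ^ (p * q))) \<and>
     (\<forall>p. \<forall>X\<in>carrier (HK n p). (cup n 0 p (hk_elt n (Z 0)) X :: 'a cochain set) = X) \<and>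
     (\<forall>x\<in>hk_basis n CHAR('a). \<forall>y\<in>hk_basis n CHAR('a). \<forall>v :: 'a cochain set.
        listed_product n x y v \<longrightarrow> hk_cup n x y = v) \<and>
     (\<forall>x\<in>hk_basis n CHAR('a). \<forall>y\<in>hk_basis n CHAR('a).
        (\<nexists>v :: 'a cochain set. listed_product n x y v \<or> listed_product n y x v) \<longrightarrow>
          (hk_cup n x y :: 'a cochain set) = \<one>\<^bsub>HK n (hk_deg x + hk_deg y)\<^esub>)"
proof -
  interpret type_D n "TYPE('a)" by unfold_locales (rule assms)
  show ?thesis
    by (intro conjI ballI allI impI hk_elt_closed cup_graded_commutative unit_class listed_product_value
        trivial_product_unlisted)
qed

end
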